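(* In the limit $\lambda=e^{-\varkappa}\to0$: 1. For $z$ in compact subsets of $\mathbb{C}\setminus[-1,1]$ we have the uniform approximation $$\Gamma(z;\lambda)=\Psi_0(z;\varkappa)\left(\mathbf 1+O\left(\frac{M^2}{\varkappa}\right)\right)e^{-\varkappa g(z)\sigma_3};$$ 2. For $z$ in compact subsets of $(-1,0)\cup(0,1)$ we have the uniform approximation $$\Gamma(z_\pm;\lambda)=\begin{cases} \Psi_0(z_\pm;\varkappa)\left(\mathbf 1+O\left(\frac{M^2}{\varkappa}\right)\right)\begin{bmatrix} 1 & 0 \\ \pm ie^{\varkappa(2g(z_\pm)-1)} & 1 \end{bmatrix}e^{-\varkappa g(z_\pm)\sigma_3}, & z\in(-1,0), \\ \Psi_0(z_\pm;\varkappa)\left(\mathbf 1+O\left(\frac{M^2}{\varkappa}\right)\right)\begin{bmatrix} 1 & \mp ie^{-\varkappa(2g(z_\pm)+1)} \\ 0 & 1 \end{bmatrix}e^{-\varkappa g(z_\pm)\sigma_3}, & z\in(0,1), \end{cases}$$ where $\pm$ denotes the upper/lower shore of the real axis in the $z$-plane.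
   Context: $\mathbf 1$ is the $2\times2$ identity; $\sigma_1=\begin{bmatrix}0&1\\1&0\end{bmatrix}$, $\sigma_2=\begin{bmatrix}0&-i\\ i&0\end{bmatrix}$, $\sigma_3=\mathrm{diag}(1,-1)$. Here $b_R=-b_L=1$, and $M$ is a fixed sufficiently large positive constant. $\lambda\in\mathbb C\setminus[-1/2,1/2]$, where $\lambda$ on the upper/lower shore of $[-1/2,1/2]$ is also allowed (boundary values in $\lambda$); $\lambda\to0$ with $\Im\lambda\ge0$ or with $\Im\lambda\le0$. $\varkappa=-\ln\lambda$ with $\arg\lambda\in[0,\pi]$ if $\Im\lambda\ge0$ and $\arg\lambda\in[-\pi,0]$ if $\Im\lambda\le0$. $a=a(\lambda)=\frac{1}{i\pi}\ln\left(\frac{i+\sqrt{4\lambda^2-1}}{2\lambda}\right)$, principal logarithm, $\sqrt{4\lambda^2-1}=2\lambda+O(1)$ as $\lambda\to\infty$ (cut $[-1/2,1/2]$), and $g(z)=a(-z/2)$, analytic for $z\in\overline{\mathbb C}\setminus[-1,1]$. $\Gamma(z;\lambda)$: let $h_\infty(\eta)=e^{a\pi i}\eta^{-a}{}_2F_1(a,a+1;2a+2;\frac1\eta)$, $s_\infty(\eta)=-e^{-a\pi i}\eta^{a+1}{}_2F_1(-a-1,-a;-2a;\frac1\eta)$ for $\Im\eta>0$ with principal branches, extended to $\mathbb C\setminus((-\infty,0]\cup[1,\infty))$ by analytic continuation across $(0,1)$; $\hat\Gamma(\eta)=\begin{bmatrix} h_\infty & s_\infty \\ h_\infty' & s_\infty'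 \end{bmatrix}(\eta)$; $$Q(\lambda)=\begin{bmatrix} -\tan(a\pi) & 0 \\ 0 & 4^{2a+1}e^{a\pi i}\frac{\Gamma(a+3/2)\Gamma(a+1/2)}{\Gamma(a)\Gamma(a+2)} \end{bmatrix}\begin{bmatrix} 1 & e^{a\pi i} \\ -e^{a\pi i} & 1 \end{bmatrix},$$ $$\Gamma(z;\lambda)=\sigma_2Q^{-1}(\lambda)\hat{\Gamma}^{-1}\left(\tfrac12\right)\begin{bmatrix} 1 & \frac{-1}{2z(a+1)} \\ 0 & 1 \end{bmatrix}\hat{\Gamma}\left(\tfrac{z+1}{2z}\right)Q(\lambda)\sigma_2$$ ($\Gamma(\cdot)$ with one argument is Euler's Gamma function). $\Phi(z)=\left(\mathbf 1+\frac{i}{2z}\begin{bmatrix}1&-1\\1&-1\end{bmatrix}\right)\left(\frac{z^2-1}{z^2}\right)^{\sigma_1/4}$, where, with $\beta(z)=\left(\frac{z^2-1}{z^2}\right)^{1/4}$ (principal branch, $\beta(\infty)=1$, cut $[-1,1]$), $\beta^{\sigma_1}=\frac{\beta}{2}\begin{bmatrix}1&1\\1&1\end{bmatrix}+\frac{1}{2\beta}\begin{bmatrix}1&-1\\-1&1\end{bmatrix}$. $\Psi_0(z;\varkappa)=\Phi(z)$ for $\Im\varkappa\le0$ (i.e. $\Im\lambda\ge0$) and $\Psi_0(z;\varkappa)=\sigma_1\Phi(z)\sigma_1$ for $\Im\varkappa\ge0$ (i.e. $\Im\lambda\le0$). *)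

theory Defs
  imports "HOL-Complex_Analysis.Complex_Analysis"
begin

subsection \<open>Shores of the real axis\<close>

datatype side = Upper | Lower

fun half_plane :: "side \<Rightarrow> complex set" where
  "half_plane Upper = {w. Im w > 0}"
| "half_plane Lower = {w. Im w < 0}"

fun closed_half_plane :: "side \<Rightarrow> complex set" where
  "closed_half_plane Upper = {w. Im w \<ge> 0}"
| "closed_half_plane Lower = {w. Im w \<le> 0}"

fun side_sign :: "side \<Rightarrow> complex" where
  "side_sign Upper = 1"
| "side_sign Lower = -1"

definition shore :: "side \<Rightarrow> (complex \<Rightarrow> 'a::t2_space) \<Rightarrow> complex \<Rightarrow> 'a" where
  "shore s f z = Lim (at z within half_plane s) f"


subsection \<open>Two-by-two matrices\<close>

definition mat2 :: "complex \<Rightarrow> complex \<Rightarrow> complex \<Rightarrow> complex \<Rightarrow> complex^2^2" where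
  "mat2 p q r s = vector [vector [p, q], vector [r, s]]"

definition cscale :: "complex \<Rightarrow> complex^2^2 \<Rightarrow> complex^2^2" where
  "cscale c A = (\<chi> i j. c * A $ i $ j)"

definition sigma1 :: "complex^2^2" where "sigma1 = mat2 0 1 1 0"

definition sigma2 :: "complex^2^2" where "sigma2 = mat2 0 (-\<i>) \<i> 0"

text \<open>The matrix exponential of \<open>c \<sigma>\<^sub>3\<close>, where \<open>\<sigma>\<^sub>3 = diag(1, -1)\<close>.\<close>

definition exp_sigma3 :: "complex \<Rightarrow> complex^2^2" where
  "exp_sigma3 c = mat2 (exp c) 0 0 (exp (- c))"


subsection \<open>The spectral parameter\<close>

text \<open>The factor \<open>csqrt (1 - 1 / (4 \<lambda>\<^sup>2))\<close> is cut exactly where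
  \<open>1 - 1 / (4 \<lambda>\<^sup>2) \<le> 0\<close>, that is on \<open>[-1/2, 1/2]\<close>, and tends to 1 at infinity.\<close>

definition sqrt_lam :: "complex \<Rightarrow> complex" where
  "sqrt_lam l = 2 * l * csqrt (1 - 1 / (4 * l^2))"

definition a_fun :: "complex \<Rightarrow> complex" where
  "a_fun l = 1 / (\<i> * of_real pi) * Ln ((\<i> + sqrt_lam l) / (2 * l))"

text \<open>\<open>a_val s l\<close> is meant for \<open>l \<in> closed_half_plane s\<close>; a point of the cut stands
  for the corresponding point of its shore \<open>s\<close>.\<close>

definition a_val :: "side \<Rightarrow> complex \<Rightarrow> complex" where
  "a_val s l = (if l \<in> closed_segment (-1/2) (1/2) then shore s a_fun l else a_fun l)"

definition g_fun :: "complex \<Rightarrow> complex" where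
  "g_fun z = a_fun (- z / 2)"

text \<open>Since \<open>Ln\<close> has imaginary part in \<open>(-\<pi>, \<pi>]\<close>, the double conjugation gives the
  logarithm with argument in \<open>[-\<pi>, 0]\<close> on the closed lower half-plane; the two
  branches differ only for negative \<open>l\<close>.\<close>

fun kappa :: "side \<Rightarrow> complex \<Rightarrow> complex" where
  "kappa Upper l = - Ln l"
| "kappa Lower l = - cnj (Ln (cnj l))"


subsection \<open>Hypergeometric functions\<close>

definition gauss_series :: "complex \<Rightarrow> complex \<Rightarrow> complex \<Rightarrow> complex \<Rightarrow> complex" where
  "gauss_series a b c x =
     (\<Sum>n. pochhammer a n * pochhammer b n / (pochhammer c n * fact n) * x ^ n)"

text \<open>Analytic continuation of \<open>f\<close> from \<open>U\<close> to \<open>D\<close>. In both uses below \<open>D\<close> is open and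
  connected and \<open>U\<close> is a nonempty open subset of \<open>D\<close>, so the continuation is unique on \<open>D\<close>.\<close>

definition analytic_continuation ::
    "complex set \<Rightarrow> complex set \<Rightarrow> (complex \<Rightarrow> complex) \<Rightarrow> complex \<Rightarrow> complex" where
  "analytic_continuation D U f = (SOME F. F holomorphic_on D \<and> (\<forall>x\<in>U. F x = f x))"

definition hyp2F1 :: "complex \<Rightarrow> complex \<Rightarrow> complex \<Rightarrow> complex \<Rightarrow> complex" where
  "hyp2F1 a b c =
     analytic_continuation (- complex_of_real ` {1..}) (ball 0 1) (gauss_series a b c)"

definition eta_domain :: "complex set" where
  "eta_domain = - (complex_of_real ` ({..0} \<union> {1..}))"

definition h_inf :: "complex \<Rightarrow> complex \<Rightarrow> complex" where
  "h_inf a = analytic_continuation eta_domain (half_plane Upper)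
     (\<lambda>\<eta>. exp (a * of_real pi * \<i>) * \<eta> powr (- a) * hyp2F1 a (a + 1) (2 * a + 2) (1 / \<eta>))"

definition s_inf :: "complex \<Rightarrow> complex \<Rightarrow> complex" where
  "s_inf a = analytic_continuation eta_domain (half_plane Upper)
     (\<lambda>\<eta>. - exp (- a * of_real pi * \<i>) * \<eta> powr (a + 1)
            * hyp2F1 (- a - 1) (- a) (- 2 * a) (1 / \<eta>))"


subsection \<open>The matrix function \<open>\<Gamma>(z; \<lambda>)\<close>\<close>

definition Gamma_hat :: "complex \<Rightarrow> complex \<Rightarrow> complex^2^2" where
  "Gamma_hat a \<eta> =
     mat2 (h_inf a \<eta>) (s_inf a \<eta>) (deriv (h_inf a) \<eta>) (deriv (s_inf a) \<eta>)"

definition Q_mat :: "complex \<Rightarrow> complex^2^2" where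
  "Q_mat a =
     mat2 (- tan (a * of_real pi)) 0
          0 (4 powr (2 * a + 1) * exp (a * of_real pi * \<i>)
               * (Gamma (a + 3/2) * Gamma (a + 1/2) / (Gamma a * Gamma (a + 2))))
     ** mat2 1 (exp (a * of_real pi * \<i>)) (- exp (a * of_real pi * \<i>)) 1"

definition Gamma_of_a :: "complex \<Rightarrow> complex \<Rightarrow> complex^2^2" where
  "Gamma_of_a a z =
     sigma2 ** matrix_inv (Q_mat a) ** matrix_inv (Gamma_hat a (1/2))
       ** mat2 1 (- 1 / (2 * z * (a + 1))) 0 1
       ** Gamma_hat a ((z + 1) / (2 * z)) ** Q_mat a ** sigma2"

text \<open>\<open>\<Gamma>(z; \<lambda>)\<close> depends on \<open>\<lambda>\<close> only through \<open>a(\<lambda>)\<close>, so its boundary values in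
  \<open>\<lambda>\<close> are obtained from those of \<open>a\<close>.\<close>

definition Gamma_mat :: "side \<Rightarrow> complex \<Rightarrow> complex \<Rightarrow> complex^2^2" where
  "Gamma_mat s z l = Gamma_of_a (a_val s l) z"


subsection \<open>The outer parametrix\<close>

definition beta :: "complex \<Rightarrow> complex" where
  "beta z = ((z^2 - 1) / z^2) powr (1/4)"

definition beta_sigma1 :: "complex \<Rightarrow> complex^2^2" where
  "beta_sigma1 z =
     cscale (beta z / 2) (mat2 1 1 1 1) + cscale (1 / (2 * beta z)) (mat2 1 (-1) (-1) 1)"

definition Phi :: "complex \<Rightarrow> complex^2^2" where
  "Phi z = (mat 1 + cscale (\<i> / (2 * z)) (mat2 1 (-1) 1 (-1))) ** beta_sigma1 z"

text \<open>\<open>\<Im>\<kappa> \<le> 0\<close> is the closed upper half-plane of \<open>\<lambda>\<close>. On \<open>\<lambda> > 0\<close>, where \<open>\<Im>\<kappa> = 0\<close>, the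
  shore decides.\<close>

fun Psi0 :: "side \<Rightarrow> complex \<Rightarrow> complex^2^2" where
  "Psi0 Upper z = Phi z"
| "Psi0 Lower z = sigma1 ** Phi z ** sigma1"

end

(* Put 1/z = sin phi. A quadratic transformation turns the hypergeometric functions at (z+1)/(2z)
   into exp(i A theta) 2F1(A, -1/2; A + 3/2; exp(2 i theta)) with theta = pi/2 +- phi, the Jost
   solutions of sin(theta) f'' - cos(theta) f' + A (A + 1) sin(theta) f = 0, and the matrix Gamma
   collapses to an expression in one solution, the one vanishing at theta = 0, and its derivative.
   As lambda -> 0 the parameter a moves off along a vertical strip, |Im a| ~ |kappa|/pi, and since
   the coefficients of (1 - t)^(1/2) are absolutely summable, 2F1(A, -1/2; A + 3/2; t) =
   (1 - t)^(1/2) + O(1/|Im A|) uniformly on the closed disc minus a neighbourhood of t = 1. This gives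
   the outer parametrix. Off the cut one of the two Jost solutions is exponentially small; on the
   shores of the cut both have the same size, and the second one is the triangular factor. *)

theory Submission
  imports Defs "HOL-Real_Asymp.Real_Asymp"
begin

subsection \<open>Gauss series and a quadratic transformation\<close>

text \<open>The matrix contains the inverse of its own value at eta = 1/2, that is at theta = pi/2.
  Hence only quotients of the solution by its value and slope at pi/2 survive, and all constants
  enter through exact relations: Gauss's summation theorem shows that \<open>Q_mat\<close> turns
  \<open>h_inf\<close> and \<open>s_inf\<close> into multiples of \<open>cfun\<close> and
  \<open>pfun\<close> by one common constant, which cancels, and the connection coefficients for
  large |Im A| come from the evenness of the solution in theta. Two obstacles shape the rest. The
  series of 2F1(A, -1/2; A + 3/2; t) is controlled on the closed disc, the series of its derivative
  only inside; so derivatives are estimated for Im theta \<noteq> 0 and carried to the real axis by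
  holomorphy. And the Jost solutions live in Im theta \<ge> 0, so the other half-plane is reached by
  reflecting theta; this is why many estimates carry a second \<open>side\<close> besides that of
  lambda.\<close>

definition gauss_fps :: "complex \<Rightarrow> complex \<Rightarrow> complex \<Rightarrow> complex fps" where
  "gauss_fps a b c = Abs_fps (\<lambda>n. pochhammer a n * pochhammer b n / (pochhammer c n * fact n))"

lemma gauss_series_eq_eval_fps: "gauss_series a b c = eval_fps (gauss_fps a b c)"
  by (auto simp: gauss_series_def eval_fps_def gauss_fps_def fun_eq_iff)

lemma gauss_fps_nth_0 [simp]: "fps_nth (gauss_fps a b c) 0 = 1"
  by (simp add: gauss_fps_def)

lemma gauss_series_0 [simp]: "gauss_series a b c 0 = 1"
  by (simp add: gauss_series_eq_eval_fps eval_fps_at_0)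

lemma gauss_fps_Suc:
  assumes "c \<notin> \<int>\<^sub>\<le>\<^sub>0"
  shows "of_nat (Suc n) * (c + of_nat n) * fps_nth (gauss_fps a b c) (Suc n)
    = (a + of_nat n) * (b + of_nat n) * fps_nth (gauss_fps a b c) n"
proof -
  have "c + of_nat n \<noteq> 0" "pochhammer c n \<noteq> 0"
    using assms plus_of_nat_eq_0_imp pochhammer_eq_0_imp_nonpos_Int by blast+
  thus ?thesis
    by (simp add: gauss_fps_def pochhammer_Suc divide_simps del: of_nat_Suc)
qed

lemma gauss_fps_conv_radius:
  assumes "c \<notin> \<int>\<^sub>\<le>\<^sub>0"
  shows "fps_conv_radius (gauss_fps a b c) \<ge> 1"
  unfolding fps_conv_radius_def
proof (rule conv_radius_geI_ex)
  fix r :: real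
  assume r: "0 < r" "ereal r < 1"
  hence r1: "r < 1" by simp
  define g where "g = fps_nth (gauss_fps a b c)"
  have nz: "c + of_nat n \<noteq> 0" for n :: nat
    using assms plus_of_nat_eq_0_imp by blast
  have "(\<lambda>n. r * norm ((a + of_nat n) * (b + of_nat n) / (of_nat (Suc n) * (c + of_nat n)))) \<longlonglongrightarrow> r * norm (1::complex)"
  proof (intro tendsto_intros)
    have *: "(\<lambda>n. (x + of_nat n) / of_nat n) \<longlonglongrightarrow> 1" for x :: complex
    proof -
      have "(\<lambda>n. x * inverse (of_nat n) + 1) \<longlonglongrightarrow> x * 0 + 1"
        by (intro tendsto_intros lim_inverse_n)
      moreover have "\<forall>\<^sub>F n in sequentially. x * inverse (of_nat n) + 1 = (x + of_nat n) / of_nat n"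
        using eventually_gt_at_top[of 0] by eventually_elim (simp add: field_simps)
      ultimately show ?thesis by (simp add: tendsto_cong)
    qed
    have "(\<lambda>n. ((a + of_nat n) / of_nat n) * ((b + of_nat n) / of_nat n) / (((1 + of_nat n) / of_nat n) * ((c + of_nat n) / of_nat n))) \<longlonglongrightarrow> 1 * 1 / (1 * 1)"
      by (intro tendsto_intros *) simp
    moreover have "\<forall>\<^sub>F n in sequentially. ((a + of_nat n) / of_nat n) * ((b + of_nat n) / of_nat n) / (((1 + of_nat n) / of_nat n) * ((c + of_nat n) / of_nat n))
        = (a + of_nat n) * (b + of_nat n) / (of_nat (Suc n) * (c + of_nat n))"
      using eventually_gt_at_top[of 0]
    proof eventually_elim
      case (elim n)
      have "((a + N) / N) * ((b + N) / N) / (((1 + N) / N) * ((c + N) / N)) = (a + N) * (b + N) / ((1 + N) * (c + N))"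
        if "N \<noteq> 0" for N using that by (simp add: divide_simps)
      from this[of "of_nat n"] elim show ?case by simp
    qed
    ultimately show "(\<lambda>n. (a + of_nat n) * (b + of_nat n) / (of_nat (Suc n) * (c + of_nat n))) \<longlonglongrightarrow> 1"
      using Lim_transform_eventually by force
  qed
  hence "\<forall>\<^sub>F n in sequentially. r * norm ((a + of_nat n) * (b + of_nat n) / (of_nat (Suc n) * (c + of_nat n))) < (1 + r) / 2"
    by (rule order_tendstoD) (use r1 in auto)
  then obtain N where N: "\<And>n. n \<ge> N \<Longrightarrow> r * norm ((a + of_nat n) * (b + of_nat n) / (of_nat (Suc n) * (c + of_nat n))) \<le> (1 + r) / 2"
    unfolding eventually_sequentially by (meson less_imp_le)
  have g: "g (Suc n) = ((a + of_nat n) * (b + of_nat n) / (of_nat (Suc n) * (c + of_nat n))) * g n" for n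
    using gauss_fps_Suc[OF assms, of n a b] nz[of n] of_nat_neq_0[of n, where 'a = complex] unfolding g_def
    by (simp add: divide_simps mult_ac del: of_nat_Suc)
  have "summable (\<lambda>n. g n * of_real r ^ n)"
  proof (rule summable_ratio_test)
    show "(1 + r) / 2 < 1" using r1 by simp
    fix n assume n: "n \<ge> N"
    have "norm (g (Suc n) * of_real r ^ Suc n) = r * norm ((a + of_nat n) * (b + of_nat n) / (of_nat (Suc n) * (c + of_nat n))) * norm (g n * of_real r ^ n)"
      unfolding g using r by (simp add: norm_mult norm_divide mult_ac)
    also have "\<dots> \<le> (1 + r) / 2 * norm (g n * of_real r ^ n)"
      by (intro mult_right_mono N n) auto
    finally show "norm (g (Suc n) * of_real r ^ Suc n) \<le> (1 + r) / 2 * norm (g n * of_real r ^ n)" .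
  qed
  thus "\<exists>z. norm z = r \<and> summable (\<lambda>n. fps_nth (gauss_fps a b c) n * z ^ n)"
    using r by (intro exI[of _ "of_real r"]) (auto simp: g_def)
qed

lemma eball_1_subset_gauss:
  assumes "c \<notin> \<int>\<^sub>\<le>\<^sub>0" "norm x < 1"
  shows "ereal (norm x) < fps_conv_radius (gauss_fps a b c)"
  using gauss_fps_conv_radius[OF assms(1), of a b] assms(2)
  by (metis ereal_less(3) less_le_trans)

lemma gauss_series_holomorphic:
  assumes "c \<notin> \<int>\<^sub>\<le>\<^sub>0"
  shows "gauss_series a b c holomorphic_on ball 0 1"
  unfolding gauss_series_eq_eval_fps
  by (rule holomorphic_on_eval_fps) (auto simp: in_eball_iff eball_1_subset_gauss[OF assms])

lemma gauss_has_fps_expansion: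
  assumes "c \<notin> \<int>\<^sub>\<le>\<^sub>0"
  shows "gauss_series a b c has_fps_expansion gauss_fps a b c"
  unfolding gauss_series_eq_eval_fps
  by (rule eval_fps_has_fps_expansion)
    (use eball_1_subset_gauss[OF assms, of 0 a b] in \<open>simp add: zero_ereal_def\<close>)

text \<open>In Taylor coefficients at 0 the equation is the recurrence \<open>gauss_fps_Suc\<close>;
  a holomorphic function on the disc with zero expansion vanishes.\<close>

lemma gauss_ode:
  fixes a b c x :: complex
  assumes c: "c \<notin> \<int>\<^sub>\<le>\<^sub>0" and x: "norm x < 1"
  defines f: "f \<equiv> gauss_series a b c"
  shows "x * (1 - x) * deriv (deriv f) x + (c - (a + b + 1) * x) * deriv f x - a * b * f x = 0"
proof -
  define F where "F = gauss_fps a b c"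
  define L where "L = (\<lambda>x. x * (1 - x) * deriv (deriv f) x + (c - (a + b + 1) * x) * deriv f x - a * b * f x)"
  have ex: "f has_fps_expansion F" unfolding f F_def by (rule gauss_has_fps_expansion[OF c])
  have hol: "f holomorphic_on ball 0 1" unfolding f by (rule gauss_series_holomorphic[OF c])
  have "L has_fps_expansion fps_X * (1 - fps_X) * fps_deriv (fps_deriv F)
     + (fps_const c - fps_const (a + b + 1) * fps_X) * fps_deriv F - fps_const (a * b) * F"
    unfolding L_def by (intro fps_expansion_intros ex)
  also have "fps_X * (1 - fps_X) * fps_deriv (fps_deriv F)
     + (fps_const c - fps_const (a + b + 1) * fps_X) * fps_deriv F - fps_const (a * b) * F = 0"
  proof (rule fps_ext)
    fix n
    have eq: "fps_X * (1 - fps_X) * fps_deriv (fps_deriv F)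
     + (fps_const c - fps_const (a + b + 1) * fps_X) * fps_deriv F - fps_const (a * b) * F
     = fps_X * fps_deriv (fps_deriv F) - fps_X * (fps_X * fps_deriv (fps_deriv F))
     + fps_const c * fps_deriv F - fps_const (a + b + 1) * (fps_X * fps_deriv F) - fps_const (a * b) * F"
    proof -
      have "x * (1 - x) * d2 + (c1 - c2 * x) * d1 - c3 * d0 = x * d2 - x * (x * d2) + c1 * d1 - c2 * (x * d1) - c3 * d0"
        for x d2 d1 d0 c1 c2 c3 :: "complex fps"
        by (simp add: algebra_simps)
      thus ?thesis .
    qed
    have S: "of_nat (Suc n) * (c + of_nat n) * fps_nth F (Suc n) = (a + of_nat n) * (b + of_nat n) * fps_nth F n"
      unfolding F_def by (rule gauss_fps_Suc[OF c])
    have 1: "fps_nth (fps_X * fps_deriv (fps_deriv F)) n = of_nat n * (of_nat n + 1) * fps_nth F (Suc n)"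
      by (cases n) (simp_all add: add.commute)
    have 2: "fps_nth (fps_X * (fps_X * fps_deriv (fps_deriv F))) n = of_nat n * (of_nat n - 1) * fps_nth F n"
    proof (cases n)
      case (Suc m)
      thus ?thesis by (cases m) (simp_all add: add.commute)
    qed simp
    have 3: "fps_nth (fps_X * fps_deriv F) n = of_nat n * fps_nth F n"
      by (cases n) simp_all
    have 4: "fps_nth (fps_deriv F) n = (of_nat n + 1) * fps_nth F (Suc n)"
      by (simp add: add.commute)
    have 5: "N * (N + 1) * y - N * (N - 1) * z + c * ((N + 1) * y) - (a + b + 1) * (N * z) - a * b * z = 0"
      if "(N + 1) * (c + N) * y = (a + N) * (b + N) * z" for N y z :: complex
    proof -
      have "N * (N + 1) * y - N * (N - 1) * z + c * ((N + 1) * y) - (a + b + 1) * (N * z) - a * b * z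
        = (N + 1) * (c + N) * y - (a + N) * (b + N) * z"
        by (simp add: ring_distribs)
      thus ?thesis using that by simp
    qed
    show "fps_nth (fps_X * (1 - fps_X) * fps_deriv (fps_deriv F)
     + (fps_const c - fps_const (a + b + 1) * fps_X) * fps_deriv F - fps_const (a * b) * F) n = fps_nth 0 n"
      unfolding eq fps_sub_nth fps_add_nth fps_mult_left_const_nth 1 2 3 4 fps_zero_nth
      by (rule 5) (use S in \<open>simp add: add.commute\<close>)
  qed
  finally have "L has_fps_expansion 0" .
  moreover have "L holomorphic_on ball 0 1"
    unfolding L_def by (intro holomorphic_intros hol) auto
  ultimately have "L x = 0"
    by (rule has_fps_expansion_0_analytic_continuation[where A = "ball 0 1"]) (use x in auto)
  thus ?thesis by (simp add: L_def)
qed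

lemma gauss_deriv1:
  assumes "c \<notin> \<int>\<^sub>\<le>\<^sub>0" "norm x < 1"
  shows "(gauss_series a b c has_field_derivative deriv (gauss_series a b c) x) (at x)"
  using gauss_series_holomorphic[OF assms(1)] assms(2)
  by (intro holomorphic_derivI[where S = "ball 0 1"]) auto

lemma gauss_deriv2:
  assumes "c \<notin> \<int>\<^sub>\<le>\<^sub>0" "norm x < 1"
  shows "(deriv (gauss_series a b c) has_field_derivative deriv (deriv (gauss_series a b c)) x) (at x)"
  using holomorphic_deriv[OF gauss_series_holomorphic[OF assms(1)]] assms(2)
  by (intro holomorphic_derivI[where S = "ball 0 1"]) auto

section \<open>Uniqueness of the regular solution of the transformed equation\<close>

text \<open>At the singular point Z = 0 the exponents are 0 and -2A - 1. The second is not an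
  integer because Im A \<noteq> 0, so the recurrence never degenerates: the coefficient of index m +
  1 appears with the nonzero factor (m + 1)(2A + m + 2), and the constant term determines the
  series.\<close>

lemma zode_unique_fps:
  fixes U :: "complex fps" and A :: complex
  assumes ode: "fps_X * (1 - fps_X * fps_X) * fps_deriv (fps_deriv U)
     + (fps_const (2 * A + 2) - fps_const (2 * A) * (fps_X * fps_X)) * fps_deriv U + fps_const (2 * A) * (fps_X * U) = 0"
    and U0: "fps_nth U 0 = 0" and A: "Im A \<noteq> 0"
  shows "U = 0"
proof (rule fps_ext)
  have eq: "fps_X * (1 - fps_X * fps_X) * fps_deriv (fps_deriv U)
     + (fps_const (2 * A + 2) - fps_const (2 * A) * (fps_X * fps_X)) * fps_deriv U + fps_const (2 * A) * (fps_X * U)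
    = fps_X * fps_deriv (fps_deriv U) - fps_X * (fps_X * (fps_X * fps_deriv (fps_deriv U)))
     + fps_const (2 * A + 2) * fps_deriv U - fps_const (2 * A) * (fps_X * (fps_X * fps_deriv U)) + fps_const (2 * A) * (fps_X * U)"
  proof -
    have "x * (1 - x * x) * d2 + (c1 - c2 * (x * x)) * d1 + c2 * (x * d0) = x * d2 - x * (x * (x * d2)) + c1 * d1 - c2 * (x * (x * d1)) + c2 * (x * d0)"
      for x d2 d1 d0 c1 c2 :: "complex fps"
      by (simp add: algebra_simps)
    thus ?thesis .
  qed
  note ode' = ode[unfolded eq]
  have nz: "2 * A + of_nat k \<noteq> 0" for k
    using A by (auto simp: complex_eq_iff)
  have nz': "A * 2 + of_nat k \<noteq> 0" for k
    using A by (auto simp: complex_eq_iff)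
  show "fps_nth U n = fps_nth 0 n" for n
  proof (induction n rule: less_induct)
    case (less n)
    show ?case
    proof (cases n)
      case 0
      thus ?thesis using U0 by simp
    next
      case (Suc m)
      have e: "fps_nth (fps_X * fps_deriv (fps_deriv U) - fps_X * (fps_X * (fps_X * fps_deriv (fps_deriv U)))
     + fps_const (2 * A + 2) * fps_deriv U - fps_const (2 * A) * (fps_X * (fps_X * fps_deriv U)) + fps_const (2 * A) * (fps_X * U)) m = 0"
        unfolding ode' by simp
      have l: "fps_nth U k = 0" if "k \<le> m" for k using less[of k] Suc that by auto
      have 1: "fps_nth (fps_X * fps_deriv (fps_deriv U)) m = of_nat m * (of_nat m + 1) * fps_nth U (Suc m)"
        by (cases m) (simp_all add: add.commute)
      have 2: "fps_nth (fps_X * V) m = 0" if "\<And>k. Suc k \<le> m \<Longrightarrow> fps_nth V k = 0" for V :: "complex fps"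
        using that by (cases m) simp_all
      have 3: "fps_nth (fps_X * (fps_X * fps_deriv (fps_deriv U))) k = 0" if "k \<le> m" for k
      proof (cases k)
        case (Suc j)
        thus ?thesis using l[of k] that by (cases j) simp_all
      qed simp
      have 4: "fps_nth (fps_X * fps_deriv U) k = 0" if "k \<le> m" for k
        using l[of k] that by (cases k) simp_all
      have 5: "fps_nth (fps_X * (fps_X * (fps_X * fps_deriv (fps_deriv U)))) m = 0"
        by (rule 2, rule 3) simp
      have 6: "fps_nth (fps_X * (fps_X * fps_deriv U)) m = 0"
        by (rule 2, rule 4) simp
      have 7: "fps_nth (fps_X * U) m = 0"
        by (rule 2, rule l) simp
      have "(of_nat m + 1) * (2 * A + of_nat (m + 2)) * fps_nth U (Suc m) = 0"
        using e unfolding fps_sub_nth fps_add_nth fps_mult_left_const_nth 1 5 6 7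
        by (simp add: algebra_simps)
      moreover have "(of_nat m + 1 :: complex) \<noteq> 0" by (metis of_nat_Suc of_nat_neq_0 add.commute)
      ultimately show ?thesis using nz[of "m+2"] Suc by simp
    qed
  qed
qed

lemma zode_unique:
  fixes f :: "complex \<Rightarrow> complex" and A :: complex
  assumes hol: "f holomorphic_on ball 0 r" and r: "r > 0"
    and ode: "\<And>Z. norm Z < r \<Longrightarrow> Z * (1 - Z * Z) * deriv (deriv f) Z + (2 * A + 2 - 2 * A * (Z * Z)) * deriv f Z + 2 * A * (Z * f Z) = 0"
    and f0: "f 0 = 0" and A: "Im A \<noteq> 0" and x: "norm x < r"
  shows "f x = 0"
proof -
  define U where "U = fps_expansion f 0"
  have "f analytic_on {0}"
    using hol r by (meson analytic_at centre_in_ball open_ball)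
  hence ex: "f has_fps_expansion U"
    unfolding U_def by (rule analytic_at_imp_has_fps_expansion_0)
  define L where "L = (\<lambda>Z. Z * (1 - Z * Z) * deriv (deriv f) Z + (2 * A + 2 - 2 * A * (Z * Z)) * deriv f Z + 2 * A * (Z * f Z))"
  have "L has_fps_expansion fps_X * (1 - fps_X * fps_X) * fps_deriv (fps_deriv U)
     + (fps_const (2 * A + 2) - fps_const (2 * A) * (fps_X * fps_X)) * fps_deriv U + fps_const (2 * A) * (fps_X * U)"
    unfolding L_def by (intro fps_expansion_intros ex)
  moreover have "L has_fps_expansion 0"
  proof -
    have ev: "\<forall>\<^sub>F Z in nhds 0. Z \<in> ball 0 r"
      using r by (intro eventually_nhds_in_open) auto
    have ev2: "\<forall>\<^sub>F Z in nhds 0. L Z = 0"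
      using ev by eventually_elim (use ode in \<open>auto simp: L_def\<close>)
    show ?thesis by (rule iffD2[OF has_fps_expansion_cong[OF ev2 refl]]) (rule has_fps_expansion_0)
  qed
  ultimately have ode': "fps_X * (1 - fps_X * fps_X) * fps_deriv (fps_deriv U)
     + (fps_const (2 * A + 2) - fps_const (2 * A) * (fps_X * fps_X)) * fps_deriv U + fps_const (2 * A) * (fps_X * U) = 0"
    by (rule fps_expansion_unique_complex)
  have "fps_nth U 0 = 0"
    using has_fps_expansion_imp_0_eq_fps_nth_0[OF ex] f0 by simp
  from zode_unique_fps[OF ode' this A] have "U = 0" .
  with ex have "f has_fps_expansion 0" by simp
  thus ?thesis
    by (rule has_fps_expansion_0_analytic_continuation[where A = "ball 0 r"]) (use x r hol in auto)
qed

lemma deriv_twice_eqI: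
  fixes f :: "complex \<Rightarrow> complex"
  assumes "open S" "z \<in> S"
    and 1: "\<And>z. z \<in> S \<Longrightarrow> (f has_field_derivative f1 z) (at z)"
    and 2: "\<And>z. z \<in> S \<Longrightarrow> (f1 has_field_derivative f2 z) (at z)"
  shows "deriv f z = f1 z" "deriv (deriv f) z = f2 z"
proof -
  show "deriv f z = f1 z" using 1[OF assms(2)] by (rule DERIV_imp_deriv)
  have "\<And>z. z \<in> S \<Longrightarrow> deriv f z = f1 z" using 1 by (blast intro: DERIV_imp_deriv)
  hence "(deriv f has_field_derivative f2 z) (at z)"
    using has_field_derivative_transform_within_open[OF 2[OF assms(2)] assms(1,2), of "deriv f"] by simp
  thus "deriv (deriv f) z = f2 z" by (rule DERIV_imp_deriv)
qed

lemma powr_has_field_derivative: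
  fixes z p :: complex
  assumes "z \<notin> \<real>\<^sub>\<le>\<^sub>0"
  shows "((\<lambda>z. z powr p) has_field_derivative p * (z powr p) / z) (at z)"
proof -
  have "((\<lambda>z. z powr p) has_field_derivative (p * z powr (p - 1))) (at z)"
    by (rule has_field_derivative_powr[OF assms])
  moreover have "z \<noteq> 0" using assms by auto
  hence "p * z powr (p - 1) = p * (z powr p) / z"
    by (simp add: powr_diff)
  ultimately show ?thesis by simp
qed

lemma Im_nz_not_nonpos_Ints: "Im c \<noteq> 0 \<Longrightarrow> c \<notin> \<int>\<^sub>\<le>\<^sub>0"
  by (metis Ints_def complex_Im_of_int imageE nonpos_Ints_Int)

section \<open>The function 2F1(A, -1/2; A + 3/2; t)\<close>

text \<open>The target of the quadratic transformation. Its second parameter does not involve A, so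
  its coefficients are those of (1 - t)^(1/2) times factors that are bounded in A and, for each
  fixed index, tend to 1 as |Im A| grows. All large-parameter estimates rest on this.\<close>

definition FA :: "complex \<Rightarrow> complex \<Rightarrow> complex" where
  "FA A = gauss_series A (- 1 / 2) (A + 3 / 2)"

definition FA1 :: "complex \<Rightarrow> complex \<Rightarrow> complex" where "FA1 A = deriv (FA A)"
definition FA2 :: "complex \<Rightarrow> complex \<Rightarrow> complex" where "FA2 A = deriv (FA1 A)"

lemma FA_holomorphic: "Im A \<noteq> 0 \<Longrightarrow> FA A holomorphic_on ball 0 1"
  unfolding FA_def by (intro gauss_series_holomorphic Im_nz_not_nonpos_Ints) auto

lemma FA_has_deriv:
  assumes "Im A \<noteq> 0" "norm t < 1"
  shows "(FA A has_field_derivative FA1 A t) (at t)"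
  unfolding FA_def FA1_def by (rule gauss_deriv1) (use assms Im_nz_not_nonpos_Ints[of "A + 3/2"] in auto)

lemma FA1_has_deriv:
  assumes "Im A \<noteq> 0" "norm t < 1"
  shows "(FA1 A has_field_derivative FA2 A t) (at t)"
  unfolding FA_def FA1_def FA2_def by (rule gauss_deriv2) (use assms Im_nz_not_nonpos_Ints[of "A + 3/2"] in auto)

lemma FA_ode:
  assumes "Im A \<noteq> 0" "norm t < 1"
  shows "t * (1 - t) * FA2 A t + (A + 3 / 2 - (A + 1 / 2) * t) * FA1 A t + A / 2 * FA A t = 0"
  using gauss_ode[of "A + 3/2" t A "-1/2"] assms Im_nz_not_nonpos_Ints[of "A+3/2"]
  by (simp add: FA_def FA1_def FA2_def add.commute)

lemma Re_1_plus_pos: "norm (Z::complex) < 1 \<Longrightarrow> Re (1 + Z) > 0"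
  using complex_Re_le_cmod[of "-Z"] by simp

lemma pos_Re_not_nonpos: "Re z > 0 \<Longrightarrow> z \<notin> \<real>\<^sub>\<le>\<^sub>0"
  by (auto simp: complex_nonpos_Reals_iff)

lemma pfaff_w_deriv:
  fixes Z :: complex
  assumes "1 + Z \<noteq> 0"
  shows "((\<lambda>Z. 4 * Z / (1 + Z)^2) has_field_derivative 4 * (1 - Z) / (1 + Z)^3) (at Z)"
proof -
  have "4 * ((1 + Z)\<^sup>2) - 4 * Z * (2 * (1 + Z)) = 4 * (1 - Z) * (1 + Z)"
    by (simp add: power2_eq_square algebra_simps)
  moreover have "((\<lambda>Z. 4 * Z / (1 + Z)^2) has_field_derivative
      (4 * ((1 + Z)\<^sup>2) - 4 * Z * (2 * (1 + Z))) / ((1 + Z)^2 * (1 + Z)^2)) (at Z)"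
    by (rule derivative_eq_intros refl | use assms in simp)+
  moreover have "4 * (1 - Z) * (1 + Z) / ((1 + Z)^2 * (1 + Z)^2) = 4 * (1 - Z) / (1 + Z)^3"
    using assms by (simp add: divide_simps power2_eq_square power3_eq_cube)
  ultimately show ?thesis by simp
qed

lemma pfaff_w1_deriv:
  fixes Z :: complex
  assumes "1 + Z \<noteq> 0"
  shows "((\<lambda>Z. 4 * (1 - Z) / (1 + Z)^3) has_field_derivative (8 * Z - 16) / (1 + Z)^4) (at Z)"
proof -
  have "((\<lambda>Z. 4 * (1 - Z) / (1 + Z)^3) has_field_derivative
      ((- 4) * ((1 + Z)^3) - 4 * (1 - Z) * (3 * (1 + Z)^2)) / ((1 + Z)^3 * (1 + Z)^3)) (at Z)"
    by (rule derivative_eq_intros refl | use assms in simp)+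
  moreover have "((- 4) * ((1 + Z)^3) - 4 * (1 - Z) * (3 * (1 + Z)^2)) = (8 * Z - 16) * (1 + Z)^2"
    by (simp add: power2_eq_square power3_eq_cube algebra_simps)
  moreover have "(8 * Z - 16) * (1 + Z)^2 / ((1 + Z)^3 * (1 + Z)^3) = (8 * Z - 16) / (1 + Z)^4"
    using assms by (simp add: divide_simps power2_eq_square power3_eq_cube power4_eq_xxxx)
  ultimately show ?thesis by simp
qed

text \<open>Both (1 + Z)^(-2A) 2F1(A, A + 1; 2A + 2; 4Z/(1 + Z)^2) and \<open>FA A (Z * Z)\<close>
  solve the equation of \<open>zode_unique\<close> and have the value 1 at Z = 0, so their
  difference vanishes.\<close>

lemma quadratic_transformation_local:
  assumes A: "Im A \<noteq> 0" and Z: "norm Z < 1 / 10"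
  shows "gauss_series A (A + 1) (2 * A + 2) (4 * Z / (1 + Z)^2) = (1 + Z) powr (2 * A) * FA A (Z * Z)"
proof -
  define G where "G = gauss_series A (A + 1) (2 * A + 2)"
  define w where "w = (\<lambda>Z::complex. 4 * Z / (1 + Z)^2)"
  define E where "E = (\<lambda>Z::complex. (1 + Z) powr (- 2 * A))"
  define G1 where "G1 = deriv G"
  define G2 where "G2 = deriv G1"
  define w1 where "w1 = (\<lambda>Z::complex. 4 * (1 - Z) / (1 + Z)^3)"
  define w2 where "w2 = (\<lambda>Z::complex. (8 * Z - 16) / (1 + Z)^4)"
  have c: "2 * A + 2 \<notin> \<int>\<^sub>\<le>\<^sub>0" by (rule Im_nz_not_nonpos_Ints) (use A in auto)
  \<comment> \<open>The radius 1/10 keeps the argument of the Gauss series in the unit disc: (4/10)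
    / (9/10)^2 < 1.\<close>
  have w: "norm (w Z) < 1" if "norm Z < 1/10" for Z
  proof -
    have "norm (1 + Z) \<ge> 9/10"
      using norm_triangle_ineq2[of 1 "-Z"] that by simp
    hence "norm (1 + Z) ^ 2 \<ge> (9/10)^2" by (intro power_mono) auto
    thus ?thesis using that unfolding w_def
      by (simp add: norm_divide norm_mult norm_power divide_simps power2_eq_square)
  qed
  have s: "1 + Z \<noteq> 0" "1 + Z \<notin> \<real>\<^sub>\<le>\<^sub>0" if "norm Z < 1/10" for Z :: complex
    using Re_1_plus_pos[of Z] that by (auto intro!: pos_Re_not_nonpos simp: complex_eq_iff)
  have dG: "(G has_field_derivative G1 x) (at x)" "(G1 has_field_derivative G2 x) (at x)" if "norm x < 1" for x
    using gauss_deriv1[OF c that] gauss_deriv2[OF c that] by (auto simp: G_def G1_def G2_def)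
  have dw: "(w has_field_derivative w1 Z) (at Z)" "(w1 has_field_derivative w2 Z) (at Z)" if "norm Z < 1/10" for Z
    using pfaff_w_deriv pfaff_w1_deriv s(1)[OF that] by (auto simp: w_def w1_def w2_def)
  have dE: "(E has_field_derivative - 2 * A * E Z / (1 + Z)) (at Z)" if "norm Z < 1/10" for Z
  proof -
    have "((\<lambda>Z. (1 + Z) powr (- 2 * A)) has_field_derivative (- 2 * A * (1 + Z) powr (- 2 * A) / (1 + Z)) * 1) (at Z)"
      by (rule DERIV_chain2[where f = "\<lambda>z. z powr (- 2 * A)"], rule powr_has_field_derivative[OF s(2)[OF that]])
        (auto intro!: derivative_eq_intros)
    thus ?thesis by (simp add: E_def)
  qed
  define u where "u = (\<lambda>Z. E Z * G (w Z))"
  define m where "m = (\<lambda>Z. - 2 * A / (1 + Z))"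
  define K0 where "K0 = (\<lambda>Z. (4 * A^2 + 2 * A) / (1 + Z)^2)"
  define K1 where "K1 = (\<lambda>Z. 2 * m Z * w1 Z + w2 Z)"
  define u1 where "u1 = (\<lambda>Z. E Z * (m Z * G (w Z) + w1 Z * G1 (w Z)))"
  define u2 where "u2 = (\<lambda>Z. E Z * (K0 Z * G (w Z) + K1 Z * G1 (w Z) + w1 Z * w1 Z * G2 (w Z)))"
  have dGw: "((\<lambda>Z. G (w Z)) has_field_derivative G1 (w Z) * w1 Z) (at Z)"
    "((\<lambda>Z. G1 (w Z)) has_field_derivative G2 (w Z) * w1 Z) (at Z)" if "norm Z < 1/10" for Z
    using dG[OF w[OF that]] dw(1)[OF that] by (auto intro: DERIV_chain2)
  have dE': "(E has_field_derivative m Z * E Z) (at Z)" if "norm Z < 1/10" for Z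
    using dE[OF that] by (simp add: m_def)
  have dm: "(m has_field_derivative 2 * A / (1 + Z)^2) (at Z)" if "norm Z < 1/10" for Z
    unfolding m_def
    by (rule derivative_eq_intros refl | use s(1)[OF that] in \<open>simp add: power2_eq_square\<close>)+
  have du: "(u has_field_derivative u1 Z) (at Z)" if "norm Z < 1/10" for Z
  proof -
    have "(u has_field_derivative m Z * E Z * G (w Z) + G1 (w Z) * w1 Z * E Z) (at Z)"
      unfolding u_def by (rule DERIV_mult dE' dGw that)+
    moreover have "m Z * E Z * G (w Z) + G1 (w Z) * w1 Z * E Z = u1 Z"
      unfolding u1_def by (simp add: algebra_simps)
    ultimately show ?thesis by simp
  qed
  have du1: "(u1 has_field_derivative u2 Z) (at Z)" if "norm Z < 1/10" for Z
  proof -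
    have "(u1 has_field_derivative m Z * E Z * (m Z * G (w Z) + w1 Z * G1 (w Z))
       + ((2 * A / (1 + Z)^2 * G (w Z) + G1 (w Z) * w1 Z * m Z) + (w2 Z * G1 (w Z) + G2 (w Z) * w1 Z * w1 Z)) * E Z) (at Z)"
      unfolding u1_def by (rule DERIV_mult DERIV_add dE' dm dw dGw that)+
    moreover have K0: "K0 Z = m Z * m Z + 2 * A / (1 + Z)^2"
      using s(1)[OF that] unfolding K0_def m_def by (simp add: add_divide_distrib power2_eq_square)
    have "e * m * (m * g + w * g1) + ((k * g + g1 * w * m) + (w' * g1 + g2 * w * w)) * e
        = e * ((m * m + k) * g + (2 * m * w + w') * g1 + w * w * g2)" for e m g w g1 k w' g2 :: complex
      by (simp add: algebra_simps)
    from this[of "E Z" "m Z" "G (w Z)" "w1 Z" "G1 (w Z)" "2 * A / (1 + Z)^2" "w2 Z" "G2 (w Z)"]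
    have "m Z * E Z * (m Z * G (w Z) + w1 Z * G1 (w Z))
       + ((2 * A / (1 + Z)^2 * G (w Z) + G1 (w Z) * w1 Z * m Z) + (w2 Z * G1 (w Z) + G2 (w Z) * w1 Z * w1 Z)) * E Z = u2 Z"
      unfolding u2_def K0 K1_def by (simp only: mult.commute[of "m Z" "E Z"])
    ultimately show ?thesis by simp
  qed
  have ode_u: "Z * (1 - Z * Z) * u2 Z + (2 * A + 2 - 2 * A * (Z * Z)) * u1 Z + 2 * A * (Z * u Z) = 0"
    if Z: "norm Z < 1/10" for Z
  proof -
    have nz: "1 + Z \<noteq> 0" by (rule s(1)[OF Z])
    have h: "w Z * (1 - w Z) * G2 (w Z) = A * (A + 1) * G (w Z) - (2 * A + 2) * (1 - w Z) * G1 (w Z)"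
      using gauss_ode[OF c w[OF Z], of A "A + 1"] unfolding G_def G1_def G2_def by (simp add: algebra_simps)
    \<comment> \<open>\<open>l\<close> turns the transformed leading coefficient into l w (1 - w),
      so that the hypergeometric equation eliminates \<open>G2\<close>. By \<open>i0\<close> and
      \<open>i1\<close> what then remains in front of \<open>G\<close> and \<open>G1\<close> is
      identically zero.\<close>
    define l where "l = 4 * (1 - Z) / (1 + Z)"
    have l: "Z * (1 - Z * Z) * (w1 Z * w1 Z) = l * (w Z * (1 - w Z))"
    proof -
      have "1 - w Z = (1 - Z)^2 / (1 + Z)^2"
        using nz unfolding w_def by (simp add: divide_simps) (simp add: power2_eq_square algebra_simps)
      moreover have "Z * ((1 - Z) * s) * (4 * (1 - Z) / s^3 * (4 * (1 - Z) / s^3)) = 4 * (1 - Z) / s * (4 * Z / s^2 * ((1 - Z)^2 / s^2))"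
        if "s \<noteq> 0" for s
        using that by (simp add: divide_simps power2_eq_square power3_eq_cube)
      from this[OF nz] have "Z * (1 - Z * Z) * (4 * (1 - Z) / (1 + Z)^3 * (4 * (1 - Z) / (1 + Z)^3))
          = 4 * (1 - Z) / (1 + Z) * (4 * Z / (1 + Z)^2 * ((1 - Z)^2 / (1 + Z)^2))"
        by (simp add: algebra_simps)
      ultimately show ?thesis unfolding w1_def l_def by (simp only: w_def)
    qed
    define p where "p = Z * (1 - Z * Z)"
    define q where "q = 2 * A + 2 - 2 * A * (Z * Z)"
    have i0: "p * K0 Z + q * m Z + 2 * A * Z + l * (A * (A + 1)) = 0"
      using nz unfolding l_def p_def q_def K0_def m_def
      by (simp add: divide_simps) (simp add: power2_eq_square algebra_simps)
    have i1: "p * K1 Z + q * w1 Z - l * ((2 * A + 2) * (1 - w Z)) = 0"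
    proof -
      have om: "1 - w Z = (1 - Z)^2 / (1 + Z)^2"
        using nz unfolding w_def by (simp add: divide_simps) (simp add: power2_eq_square algebra_simps)
      have "(Z * ((1 - Z) * s)) * (2 * (- 2 * A / s) * (4 * (1 - Z) / s^3) + (8 * Z - 16) / s^4)
          = Z * (1 - Z) * (- 16 * A * (1 - Z) + 8 * Z - 16) / s^3"
        if "s \<noteq> 0" for s
      proof -
        have "2 * (- 2 * A / s) * (4 * (1 - Z) / s^3) + (8 * Z - 16) / s^4 = (- 16 * A * (1 - Z) + 8 * Z - 16) / s^4"
        proof -
          have "2 * (- 2 * A / s) * (4 * (1 - Z) / s^3) = (- 16 * A * (1 - Z)) / s^4"
            by (simp add: power4_eq_xxxx power3_eq_cube mult_ac)
          thus ?thesis by (simp only: add_divide_distrib diff_divide_distrib add_diff_eq)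
        qed
        thus ?thesis using that by (simp add: power4_eq_xxxx power3_eq_cube mult_ac)
      qed
      from this[OF nz] have 1: "p * K1 Z = Z * (1 - Z) * (- 16 * A * (1 - Z) + 8 * Z - 16) / (1 + Z)^3"
        unfolding p_def K1_def m_def w1_def w2_def by (simp add: algebra_simps)
      have 2: "l * ((2 * A + 2) * (1 - w Z)) = 4 * (1 - Z) * (2 * A + 2) * (1 - Z)^2 / (1 + Z)^3"
        unfolding om l_def by (simp add: power2_eq_square power3_eq_cube mult_ac)
      have 3: "Z * (1 - Z) * (- 16 * A * (1 - Z) + 8 * Z - 16) + q * (4 * (1 - Z)) - 4 * (1 - Z) * (2 * A + 2) * (1 - Z)^2 = 0"
        unfolding q_def by (simp add: power2_eq_square algebra_simps)
      have "p * K1 Z + q * w1 Z - l * ((2 * A + 2) * (1 - w Z))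
        = (Z * (1 - Z) * (- 16 * A * (1 - Z) + 8 * Z - 16) + q * (4 * (1 - Z)) - 4 * (1 - Z) * (2 * A + 2) * (1 - Z)^2) / (1 + Z)^3"
        unfolding 1 2 w1_def by (simp only: add_divide_distrib diff_divide_distrib times_divide_eq_right)
      thus ?thesis unfolding 3 by simp
    qed
    have "p * (e * (k0 * g + k1 * g1 + w * w * g2)) + q * (e * (m * g + w * g1)) + 2 * A * (Z * (e * g))
       = e * (g * (p * k0 + q * m + 2 * A * Z + l * a) + g1 * (p * k1 + q * w - l * b))"
      if "p * (w * w) = l * k" "k * g2 = a * g - b * g1" for e k0 g k1 g1 w g2 m a b k
    proof -
      have "p * (w * w) * g2 = l * (a * g - b * g1)" unfolding that(2)[symmetric] that(1) by simp
      moreover have "p * (e * (k0 * g + k1 * g1 + w * w * g2)) + q * (e * (m * g + w * g1)) + 2 * A * (Z * (e * g))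
        = e * (g * (p * k0 + q * m + 2 * A * Z) + g1 * (p * k1 + q * w) + p * (w * w) * g2)"
        by (simp add: algebra_simps)
      ultimately have "p * (e * (k0 * g + k1 * g1 + w * w * g2)) + q * (e * (m * g + w * g1)) + 2 * A * (Z * (e * g))
        = e * (g * (p * k0 + q * m + 2 * A * Z) + g1 * (p * k1 + q * w) + l * (a * g - b * g1))" by simp
      also have "\<dots> = e * (g * (p * k0 + q * m + 2 * A * Z + l * a) + g1 * (p * k1 + q * w - l * b))"
        by (simp add: algebra_simps)
      finally show ?thesis .
    qed
    from this[OF l[folded p_def] h, of "E Z" "K0 Z" "K1 Z" "m Z"]
    show ?thesis unfolding u_def u1_def u2_def i0 i1 p_def[symmetric] q_def[symmetric] by simp
  qed
  define v where "v = (\<lambda>Z. FA A (Z * Z))"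
  define v1 where "v1 = (\<lambda>Z. 2 * Z * FA1 A (Z * Z))"
  define v2 where "v2 = (\<lambda>Z. 2 * FA1 A (Z * Z) + 4 * (Z * Z) * FA2 A (Z * Z))"
  have ZZ: "norm (Z * Z) < 1" if "norm Z < 1/10" for Z :: complex
  proof -
    have "norm Z * norm Z \<le> (1/10) * (1/10)" using that by (intro mult_mono) auto
    thus ?thesis by (simp add: norm_mult)
  qed
  have dFZ: "((\<lambda>Z. FA A (Z * Z)) has_field_derivative FA1 A (Z * Z) * (2 * Z)) (at Z)"
    "((\<lambda>Z. FA1 A (Z * Z)) has_field_derivative FA2 A (Z * Z) * (2 * Z)) (at Z)" if "norm Z < 1/10" for Z
  proof -
    have "((\<lambda>Z::complex. Z * Z) has_field_derivative (2 * Z)) (at Z)"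
      by (auto intro!: derivative_eq_intros)
    thus "((\<lambda>Z. FA A (Z * Z)) has_field_derivative FA1 A (Z * Z) * (2 * Z)) (at Z)"
      "((\<lambda>Z. FA1 A (Z * Z)) has_field_derivative FA2 A (Z * Z) * (2 * Z)) (at Z)"
      using FA_has_deriv[OF A ZZ[OF that]] FA1_has_deriv[OF A ZZ[OF that]] by (auto intro: DERIV_chain2)
  qed
  have dv: "(v has_field_derivative v1 Z) (at Z)" "(v1 has_field_derivative v2 Z) (at Z)" if "norm Z < 1/10" for Z
  proof -
    show "(v has_field_derivative v1 Z) (at Z)"
      using dFZ(1)[OF that] by (simp add: v_def v1_def mult_ac)
    have "(v1 has_field_derivative 2 * FA1 A (Z * Z) + FA2 A (Z * Z) * (2 * Z) * (2 * Z)) (at Z)"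
      unfolding v1_def by (rule DERIV_mult dFZ(2) that DERIV_cmult_Id)+
    thus "(v1 has_field_derivative v2 Z) (at Z)" by (simp add: v2_def mult_ac)
  qed
  have ode_v: "Z * (1 - Z * Z) * v2 Z + (2 * A + 2 - 2 * A * (Z * Z)) * v1 Z + 2 * A * (Z * v Z) = 0"
    if Z: "norm Z < 1/10" for Z
  proof -
    have "Z * (1 - Z * Z) * v2 Z + (2 * A + 2 - 2 * A * (Z * Z)) * v1 Z + 2 * A * (Z * v Z)
      = 4 * Z * ((Z * Z) * (1 - Z * Z) * FA2 A (Z * Z) + (A + 3 / 2 - (A + 1 / 2) * (Z * Z)) * FA1 A (Z * Z) + A / 2 * FA A (Z * Z))"
      unfolding v_def v1_def v2_def by (simp add: algebra_simps)
    thus ?thesis unfolding FA_ode[OF A ZZ[OF Z]] by simp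
  qed
  define f where "f = (\<lambda>Z. u Z - v Z)"
  have df: "(f has_field_derivative u1 Z - v1 Z) (at Z)" "((\<lambda>Z. u1 Z - v1 Z) has_field_derivative u2 Z - v2 Z) (at Z)"
    if "Z \<in> ball 0 (1/10)" for Z
    using du[of Z] du1[of Z] dv[of Z] that unfolding f_def by (auto intro!: DERIV_diff)
  have "f Z = 0"
  proof (rule zode_unique[where f = f and x = Z and r = "1/10" and A = A])
    show "f holomorphic_on ball 0 (1/10)"
      using df(1) unfolding holomorphic_on_def field_differentiable_def
      by (meson has_field_derivative_at_within)
    show "f 0 = 0" by (simp add: f_def u_def v_def E_def w_def G_def FA_def)
  next
    fix Z :: complex assume Z: "norm Z < 1/10"
    hence "Z \<in> ball 0 (1/10)" by simp
    have d: "deriv f Z = u1 Z - v1 Z" "deriv (deriv f) Z = u2 Z - v2 Z"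
      by (rule deriv_twice_eqI[where S = "ball 0 (1/10)" and f = f], rule open_ball, fact, erule df, erule df)+
    have "Z * (1 - Z * Z) * (u2 Z - v2 Z) + (2 * A + 2 - 2 * A * (Z * Z)) * (u1 Z - v1 Z) + 2 * A * (Z * f Z)
      = (Z * (1 - Z * Z) * u2 Z + (2 * A + 2 - 2 * A * (Z * Z)) * u1 Z + 2 * A * (Z * u Z))
       - (Z * (1 - Z * Z) * v2 Z + (2 * A + 2 - 2 * A * (Z * Z)) * v1 Z + 2 * A * (Z * v Z))"
      unfolding f_def by (simp add: algebra_simps)
    thus "Z * (1 - Z * Z) * deriv (deriv f) Z + (2 * A + 2 - 2 * A * (Z * Z)) * deriv f Z + 2 * A * (Z * f Z) = 0"
      unfolding d ode_u[OF Z] ode_v[OF Z] by simp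
  qed (use A Z in auto)
  hence "u Z = v Z" by (simp add: f_def)
  hence "(1 + Z) powr (2 * A) * ((1 + Z) powr (- 2 * A) * G (w Z)) = (1 + Z) powr (2 * A) * FA A (Z * Z)"
    by (simp add: u_def v_def E_def)
  moreover have "(1 + Z) powr (2 * A) * (1 + Z) powr (- 2 * A) = 1"
    using s(1)[OF Z] by (simp add: powr_def exp_add[symmetric])
  ultimately show ?thesis unfolding G_def w_def by (metis mult.assoc mult_1)
qed

section \<open>Continuation of the transformation to the cut plane\<close>

text \<open>\<open>analytic_continuation\<close> chooses some extension. By the identity theorem
  there is only one, so exhibiting a holomorphic extension F computes it.\<close>

lemma analytic_continuation_eqI:
  assumes F: "F holomorphic_on D" and D: "open D" "connected D" and U: "open U" "U \<noteq> {}" "U \<subseteq> D"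
    and eq: "\<And>x. x \<in> U \<Longrightarrow> F x = f x" and x: "x \<in> D"
  shows "analytic_continuation D U f x = F x"
proof -
  define G where "G = analytic_continuation D U f"
  have G: "G holomorphic_on D \<and> (\<forall>x\<in>U. G x = f x)"
    unfolding G_def analytic_continuation_def by (rule someI[of _ F]) (use F eq in auto)
  have "G x = F x"
    by (rule analytic_continuation_open[OF U(1) D(1) U(2) D(2) U(3)]) (use G F eq x in auto)
  thus ?thesis by (simp add: G_def)
qed

text \<open>The inverse of Z |-> 4Z/(1 + Z)^2, a rotated Koebe function, which maps the unit disc
  onto the plane cut along [1, \<infinity>).\<close>

definition zsq :: "complex \<Rightarrow> complex" where
  "zsq x = (1 - csqrt (1 - x)) / (1 + csqrt (1 - x))"

lemma cayley_norm_less_1: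
  assumes "Re w > 0"
  shows "norm ((1 - w) / (1 + w)) < 1"
proof -
  have "norm (1 - w) ^ 2 < norm (1 + w) ^ 2"
    unfolding cmod_power2 using assms by (simp add: power2_eq_square algebra_simps)
  hence "norm (1 - w) < norm (1 + w)" by (rule power_less_imp_less_base) auto
  moreover have "1 + w \<noteq> 0" using assms by (auto simp: complex_eq_iff)
  ultimately show ?thesis by (simp add: norm_divide divide_simps)
qed

lemma cut_plane_csqrt:
  assumes "x \<notin> complex_of_real ` {1..}"
  shows "1 - x \<notin> \<real>\<^sub>\<le>\<^sub>0" "Re (csqrt (1 - x)) > 0"
proof -
  show *: "1 - x \<notin> \<real>\<^sub>\<le>\<^sub>0"
  proof
    assume "1 - x \<in> \<real>\<^sub>\<le>\<^sub>0"
    hence "Re x \<ge> 1" "Im x = 0" by (auto simp: complex_nonpos_Reals_iff)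
    hence "x = of_real (Re x)" "Re x \<in> {1..}" by (auto simp: complex_eq_iff)
    with assms show False by blast
  qed
  hence "1 - x \<noteq> 0" by auto
  have "\<not> (Re (csqrt (1 - x)) \<le> 0)"
  proof
    assume "Re (csqrt (1 - x)) \<le> 0"
    hence r: "Re (csqrt (1 - x)) = 0" using csqrt_principal[of "1 - x"] by auto
    have "1 - x = csqrt (1 - x) ^ 2" by simp
    also have "\<dots> = of_real (- ((Im (csqrt (1-x)))^2))"
      using r by (simp add: complex_eq_iff power2_eq_square)
    finally have "1 - x \<in> \<real>\<^sub>\<le>\<^sub>0"
      by (metis nonpos_Reals_of_real_iff neg_le_0_iff_le zero_le_power2)
    with * show False ..
  qed
  thus "Re (csqrt (1 - x)) > 0" by simp
qed

lemma zsq_norm: "x \<notin> complex_of_real ` {1..} \<Longrightarrow> norm (zsq x) < 1"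
  unfolding zsq_def by (intro cayley_norm_less_1 cut_plane_csqrt)

lemma zsq_inverse:
  assumes "x \<notin> complex_of_real ` {1..}"
  shows "4 * zsq x / (1 + zsq x)^2 = x"
proof -
  define w where "w = csqrt (1 - x)"
  have "1 + w \<noteq> 0"
  proof
    assume "1 + w = 0"
    hence "Re (1 + w) = 0" by (simp only: zero_complex.sel)
    with cut_plane_csqrt(2)[OF assms] show False unfolding w_def by (simp only: plus_complex.sel one_complex.sel)
  qed
  hence "1 + (1 - w) / (1 + w) = 2 / (1 + w)" by (simp add: divide_simps)
  hence "4 * ((1 - w) / (1 + w)) / (1 + (1 - w) / (1 + w))^2 = (1 - w) * (1 + w)"
    using \<open>1 + w \<noteq> 0\<close> by (simp add: power2_eq_square)
  also have "\<dots> = 1 - w^2" by (simp add: power2_eq_square algebra_simps)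
  finally have "4 * ((1 - w) / (1 + w)) / (1 + (1 - w) / (1 + w))^2 = 1 - w^2" .
  thus ?thesis by (simp add: zsq_def w_def)
qed

lemma open_cut_plane: "open (- complex_of_real ` {1..})"
  by (intro open_Compl closed_slot_right)

lemma zsq_holomorphic: "zsq holomorphic_on - complex_of_real ` {1..}"
proof -
  have "1 + csqrt (1 - x) \<noteq> 0" if "x \<notin> complex_of_real ` {1..}" for x
  proof
    assume "1 + csqrt (1 - x) = 0"
    hence "Re (1 + csqrt (1 - x)) = 0" by (simp only: zero_complex.sel)
    with cut_plane_csqrt(2)[OF that] show False by (simp only: plus_complex.sel one_complex.sel)
  qed
  thus ?thesis
    unfolding zsq_def using cut_plane_csqrt(1) by (intro holomorphic_intros) auto
qed

lemma connected_cut_plane: "connected (- complex_of_real ` {1..})"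
proof (rule starlike_imp_connected)
  show "starlike (- complex_of_real ` {1..})"
    unfolding starlike_def
  proof (intro bexI[of _ 0] ballI subsetI)
    fix x y assume x: "x \<in> - complex_of_real ` {1..}" and y: "y \<in> closed_segment 0 x"
    then obtain u where u: "0 \<le> u" "u \<le> 1" "y = of_real u * x"
      by (auto simp: in_segment scaleR_conv_of_real)
    show "y \<in> - complex_of_real ` {1..}"
    proof
      assume "y \<in> complex_of_real ` {1..}"
      then obtain r where r: "r \<ge> 1" "y = of_real r" by auto
      hence "u \<noteq> 0" using u by auto
      hence "x = of_real (r / u)" using u(3) r(2) by (simp add: field_simps)
      moreover have "r / u \<ge> 1" using r u \<open>u \<noteq> 0\<close> by (simp add: divide_simps)
      ultimately show False using x by (metis ComplD atLeast_iff imageI)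
    qed
  qed auto
qed

definition Vfun :: "complex \<Rightarrow> complex \<Rightarrow> complex" where
  "Vfun A x = (1 + zsq x) powr (2 * A) * FA A (zsq x * zsq x)"

lemma Vfun_holomorphic:
  assumes "Im A \<noteq> 0"
  shows "Vfun A holomorphic_on - complex_of_real ` {1..}"
proof -
  have 1: "norm (zsq x * zsq x) < 1" if "x \<notin> complex_of_real ` {1..}" for x
    using zsq_norm[OF that] mult_strict_mono[of "norm (zsq x)" 1 "norm (zsq x)" 1] by (simp add: norm_mult)
  have "(\<lambda>x. FA A (zsq x * zsq x)) holomorphic_on - complex_of_real ` {1..}"
    by (rule holomorphic_on_compose_gen[unfolded o_def, OF _ FA_holomorphic[OF assms]])
      (use 1 in \<open>auto intro!: holomorphic_intros zsq_holomorphic\<close>)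
  thus ?thesis unfolding Vfun_def
    by (intro holomorphic_intros zsq_holomorphic) (use Re_1_plus_pos pos_Re_not_nonpos zsq_norm in auto)
qed

text \<open>\<open>quadratic_transformation_local\<close> gives equality where |zsq x| < 1/10, an
  open set around 0; the identity theorem carries it to the disc.\<close>

lemma Vfun_eq_gauss:
  assumes A: "Im A \<noteq> 0" and x: "norm x < 1"
  shows "Vfun A x = gauss_series A (A + 1) (2 * A + 2) x"
proof -
  have D: "ball 0 1 \<subseteq> - complex_of_real ` {1..}"
    using complex_Re_le_cmod by (force simp: dist_norm)
  have c: "2 * A + 2 \<notin> \<int>\<^sub>\<le>\<^sub>0" by (rule Im_nz_not_nonpos_Ints) (use A in auto)
  have cont: "continuous_on (- complex_of_real ` {1..}) zsq"
    by (intro holomorphic_on_imp_continuous_on zsq_holomorphic)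
  define S where "S = (- complex_of_real ` {1..}) \<inter> zsq -` ball 0 (1/10) \<inter> ball 0 1"
  have S: "open S" unfolding S_def
    by (intro open_Int continuous_open_preimage[OF cont open_cut_plane]) auto
  have "0 \<in> S" unfolding S_def by (auto simp: zsq_def)
  show ?thesis
  proof (rule analytic_continuation_open[where f = "Vfun A" and g = "gauss_series A (A + 1) (2 * A + 2)" and z = x, OF S open_ball _ connected_ball])
    show "S \<noteq> {}" using \<open>0 \<in> S\<close> by auto
    show "S \<subseteq> ball 0 1" by (auto simp: S_def)
    show "Vfun A holomorphic_on ball 0 1" by (rule holomorphic_on_subset[OF Vfun_holomorphic[OF A] D])
    show "gauss_series A (A + 1) (2 * A + 2) holomorphic_on ball 0 1" by (rule gauss_series_holomorphic[OF c])
    show "x \<in> ball 0 1" using x by simp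
    fix z assume z: "z \<in> S"
    hence "z \<notin> complex_of_real ` {1..}" "norm (zsq z) < 1/10" by (auto simp: S_def)
    from quadratic_transformation_local[OF A this(2)] zsq_inverse[OF this(1)]
    show "Vfun A z = gauss_series A (A + 1) (2 * A + 2) z" by (simp add: Vfun_def)
  qed
qed

lemma hyp2F1_eq_Vfun:
  assumes A: "Im A \<noteq> 0" and x: "x \<notin> complex_of_real ` {1..}"
  shows "hyp2F1 A (A + 1) (2 * A + 2) x = Vfun A x"
  unfolding hyp2F1_def
proof (rule analytic_continuation_eqI[OF Vfun_holomorphic[OF A] open_cut_plane connected_cut_plane open_ball])
  show "ball 0 1 \<subseteq> - complex_of_real ` {1..}"
    using complex_Re_le_cmod by (force simp: dist_norm)
qed (use x Vfun_eq_gauss[OF A] in auto)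

lemma csqrt_square_pos: "Re w > 0 \<Longrightarrow> csqrt (w^2) = w"
  by (rule csqrt_unique) auto

lemma exp_cos_half:
  fixes \<theta> :: complex
  shows "1 + exp (- \<i> * \<theta>) = 2 * exp (- \<i> * \<theta> / 2) * cos (\<theta> / 2)"
proof -
  have "exp (- \<i> * \<theta>) = exp (- \<i> * \<theta> / 2) * exp (- \<i> * \<theta> / 2)"
    by (simp add: exp_add[symmetric])
  moreover have "exp (- \<i> * \<theta> / 2) * exp (\<i> * \<theta> / 2) = 1"
    by (simp add: exp_add[symmetric])
  ultimately show ?thesis unfolding cos_exp_eq by (simp add: algebra_simps)
qed

text \<open>Put Z = exp(-i theta), which lies in the unit disc as Im theta < 0. From 1 + Z = 2
  exp(-i theta/2) cos(theta/2) follows 1/eta = 4Z/(1 + Z)^2, hence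
  \<open>zsq (1 / \<eta>) = Z\<close>. The restriction 0 < Re theta < pi fixes the branches: Re
  cos(theta/2) > 0, so \<open>Ln \<eta>\<close> and \<open>Ln (1 + Z)\<close> are expressed by
  \<open>Ln c\<close> without a multiple of 2 pi i.\<close>

lemma hyp2F1_theta:
  fixes \<theta> A :: complex
  assumes A: "Im A \<noteq> 0" and re: "0 < Re \<theta>" "Re \<theta> < pi" and im: "Im \<theta> < 0"
  defines "\<eta> \<equiv> (1 + cos \<theta>) / 2"
  shows "\<eta> powr (- A) * hyp2F1 A (A + 1) (2 * A + 2) (1 / \<eta>)
     = 4 powr A * (exp (- \<i> * A * \<theta>) * FA A (exp (- 2 * \<i> * \<theta>)))"
proof -
  define Z where "Z = exp (- \<i> * \<theta>)"
  define c where "c = cos (\<theta> / 2)"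
  have c2: "\<eta> = c^2"
    using cos_double_cos[of "\<theta>/2"] by (simp add: \<eta>_def c_def)
  have Zn: "norm Z < 1" using im by (simp add: Z_def)
  have Z0: "Z \<noteq> 0" by (simp add: Z_def)
  have cpos: "Re c > 0"
    using re cos_gt_zero_pi[of "Re \<theta> / 2"] by (simp add: c_def Re_cos zero_less_mult_iff add_pos_pos)
  hence cnz: "c \<noteq> 0" by auto
  have Zc: "1 + Z = 2 * exp (- \<i> * \<theta> / 2) * c"
    unfolding Z_def c_def by (rule exp_cos_half)
  have ZZ: "Z = exp (- \<i> * \<theta> / 2) ^ 2" by (simp add: Z_def exp_double[symmetric])
  have eta: "1 / \<eta> = 4 * Z / (1 + Z)^2"
    unfolding Zc c2 by (simp add: ZZ power_mult_distrib)
  have nz: "1 + Z \<noteq> 0" using Zc cnz by simp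
  have r: "1 - 1 / \<eta> = ((1 - Z) / (1 + Z))^2"
    unfolding eta using nz by (simp add: divide_simps) (simp add: power2_eq_square algebra_simps)
  have rpos: "Re ((1 - Z) / (1 + Z)) > 0"
  proof -
    have "Re ((1 - Z) * cnj (1 + Z)) = 1 - norm Z ^ 2"
      unfolding cmod_power2 by (simp add: power2_eq_square algebra_simps)
    also have "\<dots> > 0" using Zn by (simp add: abs_square_less_1)
    finally show ?thesis unfolding Re_complex_div_gt_0 by simp
  qed
  have cs: "csqrt (1 - 1 / \<eta>) = (1 - Z) / (1 + Z)"
    unfolding r by (rule csqrt_square_pos[OF rpos])
  have z: "zsq (1 / \<eta>) = Z"
  proof -
    have "1 - (1 - Z) / (1 + Z) = 2 * Z / (1 + Z)" "1 + (1 - Z) / (1 + Z) = 2 / (1 + Z)"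
      using nz by (simp_all add: divide_simps)
    thus ?thesis unfolding zsq_def cs using nz by simp
  qed
  have x: "1 / \<eta> \<notin> complex_of_real ` {1..}"
  proof
    assume "1 / \<eta> \<in> complex_of_real ` {1..}"
    then obtain t where t: "t \<ge> 1" "1 / \<eta> = of_real t" by auto
    have "csqrt (of_real (1 - t)) = (1 - Z) / (1 + Z)" using cs t by simp
    moreover have "Re (csqrt (of_real (1 - t))) = 0" using t by simp
    ultimately show False using rpos by simp
  qed
  have L1: "Ln \<eta> = 2 * Ln c"
  proof (rule Ln_unique)
    show "exp (2 * Ln c) = \<eta>" using cnz by (simp add: exp_double c2)
    have "\<bar>Im (Ln c)\<bar> < pi / 2" using Re_Ln_pos_lt[OF cnz] cpos by simp
    thus "- pi < Im (2 * Ln c)" "Im (2 * Ln c) \<le> pi" by auto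
  qed
  have L2: "Ln (1 + Z) = ln 2 - \<i> * \<theta> / 2 + Ln c"
  proof (rule Ln_unique)
    show "exp (ln 2 - \<i> * \<theta> / 2 + Ln c) = 1 + Z"
    proof -
      have "exp (ln 2 + (- \<i> * \<theta> / 2) + Ln c) = 2 * exp (- \<i> * \<theta> / 2) * c"
        unfolding exp_add using cnz by simp
      thus ?thesis unfolding Zc by simp
    qed
    have "\<bar>Im (Ln c)\<bar> < pi / 2" using Re_Ln_pos_lt[OF cnz] cpos by simp
    moreover have "Im (ln 2 :: complex) = 0" by (metis Im_complex_of_real Ln_of_real of_real_numeral zero_less_numeral)
    ultimately show "- pi < Im (ln 2 - \<i> * \<theta> / 2 + Ln c)" "Im (ln 2 - \<i> * \<theta> / 2 + Ln c) \<le> pi"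
      using re by auto
  qed
  have l4: "Ln 4 = 2 * ln (2::complex)"
  proof -
    have "ln (4::real) = 2 * ln 2" using ln_realpow[of 2 2] by simp
    hence "complex_of_real (ln 4) = 2 * complex_of_real (ln 2)" by (simp del: Ln_of_real)
    thus ?thesis by (simp add: Ln_of_real[symmetric] del: Ln_of_real)
  qed
  have "\<eta> powr (- A) * (1 + Z) powr (2 * A) = exp (- A * (2 * Ln c) + 2 * A * (ln 2 - \<i> * \<theta> / 2 + Ln c))"
  proof -
    have "\<eta> \<noteq> 0" using cnz by (simp add: c2)
    thus ?thesis unfolding powr_def L1 L2 exp_add using nz by simp
  qed
  also have "\<dots> = 4 powr A * exp (- \<i> * A * \<theta>)"
    by (simp add: powr_def l4 exp_add[symmetric] algebra_simps)
  finally have *: "\<eta> powr (- A) * (1 + Z) powr (2 * A) = 4 powr A * exp (- \<i> * A * \<theta>)" .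
  have ZZ': "Z * Z = exp (- 2 * \<i> * \<theta>)" by (simp add: Z_def exp_add[symmetric] mult.assoc)
  show ?thesis unfolding hyp2F1_eq_Vfun[OF A x] Vfun_def z ZZ' mult.assoc[symmetric] * ..
qed

subsection \<open>Large imaginary parameter\<close>

definition sqrt_coeff :: "nat \<Rightarrow> real" where
  "sqrt_coeff n = pochhammer (- 1 / 2) n / fact n"

lemma sqrt_coeff_0 [simp]: "sqrt_coeff 0 = 1"
  by (simp add: sqrt_coeff_def)

lemma sqrt_coeff_Suc: "(real n + 1) * sqrt_coeff (Suc n) = (real n - 1 / 2) * sqrt_coeff n"
proof -
  have "fact (Suc n) = (real n + 1) * fact n" by (simp add: add.commute)
  moreover have "real n + 1 \<noteq> 0" by linarith
  ultimately show ?thesis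
    unfolding sqrt_coeff_def pochhammer_Suc by (simp add: add.commute)
qed

lemma sqrt_coeff_Suc_eq: "(real n + 1) * sqrt_coeff (Suc n) = - (pochhammer (1 / 2) n / fact n) / 2"
proof -
  have "fact (Suc n) = (real n + 1) * fact n" by (simp add: add.commute)
  moreover have "real n + 1 \<noteq> 0" by linarith
  moreover have "m * ((- 1 / 2) * p / (m * f)) = - (p / f) / 2" if "m \<noteq> 0" for m p f :: real
    using that by simp
  moreover have "- 1 / 2 + 1 = (1 / 2 :: real)" by simp
  ultimately show ?thesis
    unfolding sqrt_coeff_def pochhammer_rec by (simp only:)
qed

lemma sqrt_coeff_Suc_neg: "sqrt_coeff (Suc n) \<le> 0"
proof -
  have "(real n + 1) * sqrt_coeff (Suc n) \<le> 0"
    unfolding sqrt_coeff_Suc_eq by (simp add: pochhammer_nonneg)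
  thus ?thesis by (simp add: mult_le_0_iff)
qed

lemma sqrt_coeff_diff: "sqrt_coeff (Suc n) - sqrt_coeff n = - (3 / 2) * sqrt_coeff n / (real n + 1)"
proof -
  have "real n + 1 \<noteq> 0" by linarith
  hence "sqrt_coeff (Suc n) = (real n - 1 / 2) * sqrt_coeff n / (real n + 1)"
    using sqrt_coeff_Suc[of n] by (metis nonzero_mult_div_cancel_left)
  thus ?thesis using \<open>real n + 1 \<noteq> 0\<close> by (simp add: divide_simps) (simp add: algebra_simps)
qed

text \<open>Dividing (1 - t)^(1/2) by 1 - t sums the coefficients, so the partial sums are the
  coefficients of (1 - t)^(-1/2). Their nonnegativity bounds the absolute sum below.\<close>

lemma sum_sqrt_coeff: "(\<Sum>k\<le>n. sqrt_coeff k) = pochhammer (1 / 2) n / fact n"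
proof (induction n)
  case (Suc n)
  have nz: "real n + 1 \<noteq> 0" by linarith
  have f: "fact (Suc n) = (real n + 1) * fact n" by (simp add: add.commute)
  have "sqrt_coeff (Suc n) = - (pochhammer (1 / 2) n / fact n) / 2 / (real n + 1)"
    using sqrt_coeff_Suc_eq[of n] nz by (metis nonzero_mult_div_cancel_left)
  thus ?case using nz unfolding sum.atMost_Suc Suc.IH f pochhammer_Suc
    by (simp add: divide_simps) (simp add: algebra_simps)
qed simp

text \<open>All coefficients but the first are nonpositive, so the absolute sum is 2 minus a partial
  sum, and partial sums are nonnegative.\<close>

lemma sum_abs_sqrt_coeff: "(\<Sum>k<n. \<bar>sqrt_coeff k\<bar>) \<le> 2"
proof (cases n)
  case (Suc m)
  have "\<bar>sqrt_coeff k\<bar> = (if k = 0 then 2 else 0) - sqrt_coeff k" for k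
    using sqrt_coeff_Suc_neg[of "k - 1"] by (cases k) auto
  hence "(\<Sum>k\<le>m. \<bar>sqrt_coeff k\<bar>) = (\<Sum>k\<le>m. (if k = 0 then 2 else 0)) - (\<Sum>k\<le>m. sqrt_coeff k)"
    by (simp add: sum_subtractf)
  also have "(\<Sum>k\<le>m. (if k = 0 then 2 else 0)) = (2::real)" by simp
  also have "2 - (\<Sum>k\<le>m. sqrt_coeff k) \<le> 2"
    unfolding sum_sqrt_coeff by (simp add: pochhammer_nonneg)
  finally show ?thesis by (simp add: Suc lessThan_Suc_atMost)
qed simp

lemma summable_sqrt_coeff: "summable (\<lambda>n. \<bar>sqrt_coeff n\<bar>)"
  by (rule summableI_nonneg_bounded[of _ 2]) (auto intro: sum_abs_sqrt_coeff)

lemma suminf_sqrt_coeff: "(\<Sum>n. \<bar>sqrt_coeff n\<bar>) \<le> 2"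
  by (rule suminf_le_const[OF summable_sqrt_coeff sum_abs_sqrt_coeff])

text \<open>A Wallis-type bound of order n^(-1/2), squared so that the induction stays
  rational.\<close>

lemma pochhammer_half_bound: "(pochhammer (1 / 2) n / fact n)\<^sup>2 \<le> 1 / (2 * real n + 1)"
proof (induction n)
  case (Suc n)
  have f: "fact (Suc n) = (real n + 1) * fact n" by (simp add: add.commute)
  have "pochhammer (1 / 2) (Suc n) / fact (Suc n) = (pochhammer (1 / 2) n / fact n) * ((2 * real n + 1) / (2 * real n + 2))"
    unfolding f pochhammer_Suc by (simp add: divide_simps add.commute)
  hence "(pochhammer (1 / 2) (Suc n) / fact (Suc n))\<^sup>2 = (pochhammer (1 / 2) n / fact n)\<^sup>2 * ((2 * real n + 1) / (2 * real n + 2))\<^sup>2"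
    by (simp only: power_mult_distrib)
  also have "\<dots> \<le> 1 / (2 * real n + 1) * ((2 * real n + 1) / (2 * real n + 2))\<^sup>2"
    by (intro mult_right_mono Suc.IH) auto
  also have "\<dots> = (2 * real n + 1) / (2 * real n + 2)\<^sup>2"
    by (simp add: power2_eq_square)
  also have "\<dots> \<le> 1 / (2 * real (Suc n) + 1)"
    by (simp add: divide_simps) (simp add: power2_eq_square algebra_simps)
  finally show ?case .
qed simp

lemma pochhammer_half_tendsto_0: "(\<lambda>n. pochhammer (1 / 2) n / fact n :: real) \<longlonglongrightarrow> 0"
proof -
  have "(\<lambda>n. (pochhammer (1 / 2) n / fact n :: real)\<^sup>2) \<longlonglongrightarrow> 0"
  proof (rule tendsto_sandwich[of "\<lambda>_. 0" _ _ "\<lambda>n. 1 / (2 * real n + 1)"])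
    show "(\<lambda>n. 1 / (2 * real n + 1)) \<longlonglongrightarrow> 0" by real_asymp
  qed (auto intro: pochhammer_half_bound always_eventually)
  hence "(\<lambda>n. sqrt ((pochhammer (1 / 2) n / fact n :: real)\<^sup>2)) \<longlonglongrightarrow> sqrt 0"
    by (rule tendsto_real_sqrt)
  hence "(\<lambda>n. \<bar>pochhammer (1 / 2) n / fact n :: real\<bar>) \<longlonglongrightarrow> 0"
    by (simp only: real_sqrt_abs real_sqrt_zero)
  thus ?thesis by (rule tendsto_rabs_zero_cancel)
qed

text \<open>Stronger information than absolute summability: it removes the boundary term of the
  telescoping sum in \<open>GA_eq\<close>.\<close>

lemma n_sqrt_coeff_tendsto_0: "(\<lambda>n. real n * sqrt_coeff n) \<longlonglongrightarrow> 0"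
proof (rule LIMSEQ_imp_Suc)
  have "(\<lambda>n. - (pochhammer (1 / 2) n / fact n) / 2 :: real) \<longlonglongrightarrow> - 0 / 2"
    by (intro tendsto_intros pochhammer_half_tendsto_0) simp
  thus "(\<lambda>n. real (Suc n) * sqrt_coeff (Suc n)) \<longlonglongrightarrow> 0"
    using sqrt_coeff_Suc_eq by (simp add: add.commute)
qed

lemma csqrt_series:
  fixes t :: complex
  assumes "norm t < 1"
  shows "(\<lambda>n. of_real (sqrt_coeff n) * t ^ n) sums csqrt (1 - t)"
proof -
  have "(\<lambda>n. ((1 / 2) gchoose n) * (- t) ^ n) sums (1 + (- t)) powr (1 / 2)"
    by (rule gen_binomial_complex) (use assms in auto)
  moreover have "((1 / 2) gchoose n) * (- t) ^ n = of_real (sqrt_coeff n) * t ^ n" for n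
  proof -
    have "complex_of_real (sqrt_coeff n) = pochhammer (- (1 / 2)) n / fact n"
      unfolding sqrt_coeff_def by (simp add: pochhammer_of_real[symmetric])
    moreover have "(- 1) ^ n * (- 1 :: complex) ^ n = 1" by (simp add: power_mult_distrib[symmetric])
    moreover have "((1 / 2) gchoose n) * (- t) ^ n = ((- 1) ^ n * (- 1 :: complex) ^ n) * (pochhammer (- (1 / 2)) n / fact n) * t ^ n"
      unfolding gbinomial_pochhammer power_minus[of t] by (simp only: times_divide_eq_left times_divide_eq_right mult_ac)
    ultimately show ?thesis by simp
  qed
  moreover have "(1 + (- t)) powr (1 / 2) = csqrt (1 - t)"
  proof -
    have "1 - t \<noteq> 0" using assms by auto
    thus ?thesis by (simp add: csqrt_conv_powr)
  qed
  ultimately show ?thesis by simp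
qed

text \<open>A strip that contains, for small \<open>\<lambda>\<close>, both \<open>a\<close> and \<open>- a - 1\<close>.\<close>

definition adm :: "complex \<Rightarrow> bool" where
  "adm A \<longleftrightarrow> - 3 / 2 \<le> Re A \<and> Re A \<le> 1 / 2 \<and> 3 \<le> \<bar>Im A\<bar>"

lemma admD: "adm A \<Longrightarrow> - 3 / 2 \<le> Re A" "adm A \<Longrightarrow> Re A \<le> 1 / 2" "adm A \<Longrightarrow> 3 \<le> \<bar>Im A\<bar>" "adm A \<Longrightarrow> Im A \<noteq> 0"
  by (auto simp: adm_def)

lemma adm_reflect: "adm A \<Longrightarrow> adm (- A - 1)"
  by (auto simp: adm_def)

section \<open>Uniform bounds for the Pochhammer quotient\<close>

text \<open>The second parameter stays free because \<open>GA_eq\<close> runs through c = A + 3/2 +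
  N; the estimates of \<open>FA\<close> use N = 0.\<close>

definition poch_ratio :: "complex \<Rightarrow> complex \<Rightarrow> nat \<Rightarrow> complex" where
  "poch_ratio A c n = pochhammer A n / pochhammer c n"

lemma poch_ratio_0 [simp]: "poch_ratio A c 0 = 1"
  by (simp add: poch_ratio_def)

lemma poch_ratio_Suc: "poch_ratio A c (Suc n) = poch_ratio A c n * ((A + of_nat n) / (c + of_nat n))"
  by (simp add: poch_ratio_def pochhammer_Suc)

lemma norm_ge_Re_of_nat:
  assumes "adm A" "0 \<le> s"
  shows "real n \<le> norm (A + 3 / 2 + of_real s + of_nat n)"
    "\<bar>Im A\<bar> \<le> norm (A + 3 / 2 + of_real s + of_nat n)"
    "A + 3 / 2 + of_real s + of_nat n \<noteq> 0"
proof -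
  show "real n \<le> norm (A + 3 / 2 + of_real s + of_nat n)"
    using complex_Re_le_cmod[of "A + 3 / 2 + of_real s + of_nat n"] admD(1)[OF assms(1)] assms(2) by simp
  show *: "\<bar>Im A\<bar> \<le> norm (A + 3 / 2 + of_real s + of_nat n)"
    using abs_Im_le_cmod[of "A + 3 / 2 + of_real s + of_nat n"] by simp
  show "A + 3 / 2 + of_real s + of_nat n \<noteq> 0"
    using * admD(3)[OF assms(1)] by auto
qed

lemma norm_shift_le:
  assumes "0 \<le> d" "0 \<le> 2 * Re z + d"
  shows "norm z \<le> norm (z + of_real d)"
proof -
  have "(Re z + d)\<^sup>2 - (Re z)\<^sup>2 = d * (2 * Re z + d)" by (simp add: power2_eq_square algebra_simps)
  also have "\<dots> \<ge> 0" using assms by simp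
  finally have "(Re z)\<^sup>2 \<le> (Re z + d)\<^sup>2" by simp
  thus ?thesis unfolding cmod_def by simp
qed

text \<open>For k \<ge> 1 the number A + k has real part at least -1/2, so adding 3/2 + s does not
  decrease its modulus and the factor (A + k)/(c + k) is at most 1. The factor with k = 0 may exceed
  1, since Re A may be as small as -3/2, and is kept in the bound.\<close>

lemma poch_ratio_bound_Suc:
  assumes A: "adm A" and s: "0 \<le> s"
  shows "norm (poch_ratio A (A + 3 / 2 + of_real s) (Suc n)) \<le> norm A / norm (A + 3 / 2 + of_real s)"
proof (induction n)
  case 0
  show ?case by (simp add: poch_ratio_Suc norm_divide)
next
  case (Suc n)
  have "norm (A + of_nat (Suc n)) \<le> norm (A + of_nat (Suc n) + of_real (3 / 2 + s))"
    using admD(1)[OF A] s by (intro norm_shift_le) auto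
  also have "A + of_nat (Suc n) + of_real (3 / 2 + s) = A + 3 / 2 + of_real s + of_nat (Suc n)" by simp
  finally have "norm ((A + of_nat (Suc n)) / (A + 3 / 2 + of_real s + of_nat (Suc n))) \<le> 1"
    by (simp add: norm_divide divide_le_eq_1)
  hence "norm (poch_ratio A (A + 3 / 2 + of_real s) (Suc n)) * norm ((A + of_nat (Suc n)) / (A + 3 / 2 + of_real s + of_nat (Suc n)))
     \<le> norm A / norm (A + 3 / 2 + of_real s) * 1"
    by (intro mult_mono Suc.IH) auto
  thus ?case by (subst poch_ratio_Suc) (simp only: norm_mult mult_1_right)
qed

lemma poch_ratio_bound:
  assumes A: "adm A" and s: "0 \<le> s"
  shows "norm (poch_ratio A (A + 3 / 2 + of_real s) n) \<le> 2"
proof (cases n)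
  case (Suc m)
  have 1: "norm A \<le> norm (A + 3 / 2) + 3 / 2"
    using norm_triangle_ineq4[of "A + 3/2" "3/2"] by simp
  have 2: "norm (A + 3 / 2) \<le> norm (A + 3 / 2 + of_real s)"
    by (rule norm_shift_le) (use admD(1)[OF A] s in auto)
  have 3: "3 \<le> norm (A + 3 / 2 + of_real s)"
    using norm_ge_Re_of_nat(2)[OF A s, of 0] admD(3)[OF A] by simp
  \<comment> \<open>The denominator is at least 3 and at least |A| - 3/2, so the quotient is at most
    1 + (3/2)/3.\<close>
  hence "norm A / norm (A + 3 / 2 + of_real s) \<le> 2"
    using 1 2 by (simp add: divide_le_eq)
  thus ?thesis using poch_ratio_bound_Suc[OF A s, of m] Suc by simp
qed simp

definition rho :: "complex \<Rightarrow> nat \<Rightarrow> complex" where "rho A = poch_ratio A (A + 3 / 2)"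

lemma rho_bound: "adm A \<Longrightarrow> norm (rho A n) \<le> 2"
  using poch_ratio_bound[of A 0 n] by (simp add: rho_def)

lemma rho_diff:
  assumes "adm A"
  shows "norm (rho A (Suc n) - rho A n) \<le> 3 / norm (A + 3 / 2 + of_nat n)"
proof -
  have nz: "A + 3 / 2 + of_nat n \<noteq> 0" using norm_ge_Re_of_nat(3)[OF assms, of 0 n] by simp
  have "rho A (Suc n) - rho A n = rho A n * (- (3 / 2) / (A + 3 / 2 + of_nat n))"
    unfolding rho_def poch_ratio_Suc using nz by (simp add: divide_simps) (simp add: algebra_simps)
  also have "norm \<dots> = norm (rho A n) * (3 / 2) / norm (A + 3 / 2 + of_nat n)"
    by (simp only: norm_mult norm_divide norm_minus_cancel) simp
  also have "\<dots> \<le> 2 * (3 / 2) / norm (A + 3 / 2 + of_nat n)"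
    by (intro divide_right_mono mult_right_mono rho_bound assms) auto
  finally show ?thesis by simp
qed

lemma rho_diff_Im:
  assumes "adm A"
  shows "norm (rho A (Suc n) - rho A n) \<le> 3 / \<bar>Im A\<bar>"
proof -
  have "\<bar>Im A\<bar> \<le> norm (A + 3 / 2 + of_nat n)" using norm_ge_Re_of_nat(2)[OF assms, of 0 n] by simp
  hence "3 / norm (A + 3 / 2 + of_nat n) \<le> 3 / \<bar>Im A\<bar>"
    using admD(3)[OF assms] by (intro divide_left_mono) (auto intro!: mult_pos_pos)
  with rho_diff[OF assms, of n] show ?thesis by linarith
qed

lemma rho_diff_nat: "adm A \<Longrightarrow> real n * norm (rho A (Suc n) - rho A n) \<le> 3"
proof -
  assume A: "adm A"
  define x where "x = norm (A + 3 / 2 + of_nat n)"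
  have x: "real n \<le> x" "x > 0" "norm (rho A (Suc n) - rho A n) \<le> 3 / x"
    using rho_diff[OF A, of n] norm_ge_Re_of_nat[OF A, of 0 n] by (auto simp: x_def)
  have "real n * norm (rho A (Suc n) - rho A n) \<le> x * (3 / x)"
    using x by (intro mult_mono) auto
  thus ?thesis using x(2) by simp
qed

text \<open>Summing the increments loses a factor n. It is repaid in \<open>FA_estimate\<close> by
  the factor 1/(n + 1) of \<open>sqrt_coeff_diff\<close>.\<close>

lemma rho_minus_1:
  assumes "adm A"
  shows "norm (rho A n - 1) \<le> real n * (3 / \<bar>Im A\<bar>)"
proof (induction n)
  case (Suc n)
  have "norm (rho A (Suc n) - 1) \<le> norm (rho A (Suc n) - rho A n) + norm (rho A n - 1)"
    using norm_triangle_ineq[of "rho A (Suc n) - rho A n" "rho A n - 1"] by simp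
  also have "\<dots> \<le> 3 / \<bar>Im A\<bar> + real n * (3 / \<bar>Im A\<bar>)"
    by (intro add_mono Suc.IH rho_diff_Im assms)
  also have "\<dots> = real (Suc n) * (3 / \<bar>Im A\<bar>)"
    by (simp add: distrib_right add_divide_distrib)
  finally show ?case .
qed (simp add: rho_def)

lemma FA_coeff: "fps_nth (gauss_fps A (- 1 / 2) (A + 3 / 2)) n = rho A n * of_real (sqrt_coeff n)"
  unfolding gauss_fps_def rho_def poch_ratio_def sqrt_coeff_def by (simp add: pochhammer_of_real[symmetric])

lemma FA_coeff_bound: "adm A \<Longrightarrow> norm (rho A n * of_real (sqrt_coeff n)) \<le> 2 * \<bar>sqrt_coeff n\<bar>"
  unfolding norm_mult by (auto intro!: mult_mono rho_bound)

lemma FA_term_bound: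
  assumes "adm A" "norm t \<le> 1"
  shows "norm (rho A n * of_real (sqrt_coeff n) * t ^ n) \<le> 2 * \<bar>sqrt_coeff n\<bar>"
proof -
  have "norm (rho A n * of_real (sqrt_coeff n)) * norm (t ^ n) \<le> 2 * \<bar>sqrt_coeff n\<bar> * 1"
    using assms by (intro mult_mono FA_coeff_bound) (auto simp: norm_power power_le_one)
  thus ?thesis by (simp add: norm_mult)
qed

lemma FA_sums:
  assumes "adm A" "norm t \<le> 1"
  shows "(\<lambda>n. rho A n * of_real (sqrt_coeff n) * t ^ n) sums FA A t"
proof -
  have "summable (\<lambda>n. rho A n * of_real (sqrt_coeff n) * t ^ n)"
    by (rule summable_comparison_test'[OF summable_mult[OF summable_sqrt_coeff, of 2]])
      (rule FA_term_bound[OF assms])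
  moreover have "FA A t = (\<Sum>n. rho A n * of_real (sqrt_coeff n) * t ^ n)"
    unfolding FA_def gauss_series_eq_eval_fps eval_fps_def FA_coeff ..
  ultimately show ?thesis by (simp add: summable_sums)
qed

text \<open>\<open>gauss_series\<close> is a plain infinite sum, so \<open>FA\<close> also has
  values on the unit circle; the Weierstrass test applies on the whole closed disc because
  \<open>rho\<close> is bounded by 2 and the coefficients of (1 - t)^(1/2) are absolutely
  summable.\<close>

lemma FA_continuous:
  assumes "adm A"
  shows "continuous_on (cball 0 1) (FA A)"
proof -
  have "uniform_limit (cball 0 1) (\<lambda>n t. \<Sum>i<n. rho A i * of_real (sqrt_coeff i) * t ^ i)
     (\<lambda>t. \<Sum>i. rho A i * of_real (sqrt_coeff i) * t ^ i) sequentially"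
    by (rule Weierstrass_m_test[OF _ summable_mult[OF summable_sqrt_coeff, of 2]])
      (rule FA_term_bound[OF assms], simp)
  hence "continuous_on (cball 0 1) (\<lambda>t. \<Sum>i. rho A i * of_real (sqrt_coeff i) * t ^ i)"
    by (rule uniform_limit_theorem[rotated]) (auto intro!: always_eventually continuous_intros)
  moreover have "FA A = (\<lambda>t. \<Sum>n. rho A n * of_real (sqrt_coeff n) * t ^ n)"
    unfolding FA_def gauss_series_eq_eval_fps eval_fps_def FA_coeff ..
  ultimately show ?thesis by simp
qed

text \<open>Abel summation: multiplication by 1 - t replaces the coefficients by their increments.
  It gains decay in n at the price of a factor that degenerates at t = 1.\<close>

lemma one_minus_times_power_series:
  fixes f :: "nat \<Rightarrow> complex"
  assumes S: "(\<lambda>n. f n * t ^ n) sums S" and t: "norm t \<le> 1"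
    and g: "summable g" "\<And>n. norm (f (Suc n) - f n) \<le> g n"
  shows "norm ((1 - t) * S) \<le> norm (f 0) + suminf g"
proof -
  have 1: "(\<lambda>n. f (Suc n) * t ^ Suc n) sums (S - f 0)"
    using S by (subst sums_Suc_iff) simp
  have 2: "(\<lambda>n. f n * t ^ Suc n) sums (t * S)"
    using sums_mult[OF S, of t] by (simp add: mult_ac)
  have 3: "(\<lambda>n. (f (Suc n) - f n) * t ^ Suc n) sums (S - f 0 - t * S)"
    using sums_diff[OF 1 2] by (simp add: left_diff_distrib)
  have le: "norm ((f (Suc n) - f n) * t ^ Suc n) \<le> g n" for n
  proof -
    have "norm (f (Suc n) - f n) * norm (t ^ Suc n) \<le> g n * 1"
      using t order_trans[OF norm_ge_zero g(2)] power_le_one[of "norm t" "Suc n"]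
      by (intro mult_mono g) (simp_all add: norm_power del: power_Suc)
    thus ?thesis by (simp add: norm_mult)
  qed
  have "norm (S - f 0 - t * S) \<le> suminf g"
    unfolding sums_unique[OF 3] by (rule norm_suminf_le[OF le g(1)])
  moreover have "(1 - t) * S = f 0 + (S - f 0 - t * S)" by (simp add: algebra_simps)
  ultimately show ?thesis using norm_triangle_ineq[of "f 0" "S - f 0 - t * S"] by simp
qed

lemma suminf_mult_sqrt_coeff: "c \<ge> 0 \<Longrightarrow> (\<Sum>n. c * \<bar>sqrt_coeff n\<bar>) \<le> c * 2"
  using suminf_sqrt_coeff by (simp add: suminf_mult[OF summable_sqrt_coeff] mult_left_mono)

text \<open>With c_n = \<open>sqrt_coeff n\<close>, the increments of (rho_n - 1) c_n are at most
  (9/2 + 3) |c_n| / |Im A|: the first part is the bound (n + 1) 3/|Im A| times the increment (3/2)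
  |c_n|/(n + 1) of c_n, the second the increment of rho. The |c_n| sum to at most 2, which gives 15
  / |Im A|.\<close>

lemma FA_estimate:
  assumes A: "adm A" and t: "norm t < 1"
  shows "norm (FA A t - csqrt (1 - t)) * norm (1 - t) \<le> 15 / \<bar>Im A\<bar>"
proof -
  define T where "T = \<bar>Im A\<bar>"
  have T: "T \<ge> 3" using admD(3)[OF A] by (simp add: T_def)
  define f where "f = (\<lambda>n. (rho A n - 1) * of_real (sqrt_coeff n))"
  have S: "(\<lambda>n. f n * t ^ n) sums (FA A t - csqrt (1 - t))"
    using sums_diff[OF FA_sums[OF A less_imp_le[OF t]] csqrt_series[OF t]]
    by (simp add: f_def algebra_simps)
  have le: "norm (f (Suc n) - f n) \<le> 15 / (2 * T) * \<bar>sqrt_coeff n\<bar>" for n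
  proof -
    have "f (Suc n) - f n = (rho A (Suc n) - 1) * of_real (sqrt_coeff (Suc n) - sqrt_coeff n)
        + (rho A (Suc n) - rho A n) * of_real (sqrt_coeff n)"
      by (simp add: f_def algebra_simps)
    hence "norm (f (Suc n) - f n) \<le> norm (rho A (Suc n) - 1) * \<bar>sqrt_coeff (Suc n) - sqrt_coeff n\<bar>
        + norm (rho A (Suc n) - rho A n) * \<bar>sqrt_coeff n\<bar>"
      by (metis norm_triangle_ineq norm_mult norm_of_real)
    also have "\<dots> \<le> real (Suc n) * (3 / T) * \<bar>sqrt_coeff (Suc n) - sqrt_coeff n\<bar> + 3 / T * \<bar>sqrt_coeff n\<bar>"
      unfolding T_def by (intro add_mono mult_right_mono rho_minus_1 rho_diff_Im A) auto
    also have "\<bar>sqrt_coeff (Suc n) - sqrt_coeff n\<bar> = (3 / 2) * \<bar>sqrt_coeff n\<bar> / (real n + 1)"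
      unfolding sqrt_coeff_diff by (simp add: abs_mult)
    also have "real (Suc n) * (3 / T) * ((3 / 2) * \<bar>sqrt_coeff n\<bar> / (real n + 1)) = 9 / (2 * T) * \<bar>sqrt_coeff n\<bar>"
    proof -
      have "m * (3 / T) * ((3 / 2) * x / m) = 9 / (2 * T) * x" if "m > 0" for m x :: real
        using that T by (simp add: field_simps)
      from this[of "real (Suc n)"] show ?thesis by (simp add: add.commute)
    qed
    also have "9 / (2 * T) * \<bar>sqrt_coeff n\<bar> + 3 / T * \<bar>sqrt_coeff n\<bar> = 15 / (2 * T) * \<bar>sqrt_coeff n\<bar>"
      using T by (simp add: field_simps)
    finally show ?thesis .
  qed
  have "norm ((1 - t) * (FA A t - csqrt (1 - t))) \<le> norm (f 0) + (\<Sum>n. 15 / (2 * T) * \<bar>sqrt_coeff n\<bar>)"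
    by (rule one_minus_times_power_series[OF S _ summable_mult[OF summable_sqrt_coeff] le]) (use t in auto)
  also have "\<dots> \<le> 0 + 15 / (2 * T) * 2"
    using T by (intro add_mono suminf_mult_sqrt_coeff) (auto simp: f_def rho_def)
  finally show ?thesis by (simp add: norm_mult T_def mult.commute)
qed

lemma FA1_sums:
  assumes A: "adm A" and t: "norm t < 1"
  shows "(\<lambda>n. of_nat n * (rho A n * of_real (sqrt_coeff n)) * t ^ n) sums (t * FA1 A t)"
proof -
  define F where "F = gauss_fps A (- 1 / 2) (A + 3 / 2)"
  have c: "A + 3 / 2 \<notin> \<int>\<^sub>\<le>\<^sub>0" by (rule Im_nz_not_nonpos_Ints) (use admD[OF A] in auto)
  have r: "ereal (norm t) < fps_conv_radius F"
    unfolding F_def by (rule eball_1_subset_gauss[OF c t])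
  have "FA1 A t = eval_fps (fps_deriv F) t"
    unfolding FA1_def FA_def gauss_series_eq_eval_fps F_def[symmetric] by (rule eval_fps_deriv[OF r, symmetric])
  moreover have "(\<lambda>n. fps_nth (fps_deriv F) n * t ^ n) sums eval_fps (fps_deriv F) t"
    by (rule sums_eval_fps) (use r fps_conv_radius_deriv[of F] in \<open>auto intro: less_le_trans\<close>)
  ultimately have "(\<lambda>n. t * (fps_nth (fps_deriv F) n * t ^ n)) sums (t * FA1 A t)"
    by (simp add: sums_mult)
  hence "(\<lambda>n. of_nat (Suc n) * (rho A (Suc n) * of_real (sqrt_coeff (Suc n))) * t ^ Suc n) sums (t * FA1 A t)"
    unfolding F_def fps_deriv_nth Suc_eq_plus1[symmetric] FA_coeff by (simp only: power_Suc mult_ac)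
  thus ?thesis by (subst (asm) sums_Suc_iff) simp
qed

text \<open>The relation (n + 1) c_(n+1) = (n - 1/2) c_n turns the increments of n rho_n c_n into
  c_n (n (rho_(n+1) - rho_n) - rho_(n+1)/2), at most (3 + 1) |c_n|. The bound does not improve with
  A; smallness comes later, since in \<open>jost1\<close> this term stands beside one with the
  factor A.\<close>

lemma FA1_estimate:
  assumes A: "adm A" and t: "norm t < 1"
  shows "norm (t * FA1 A t) * norm (1 - t) \<le> 8"
proof -
  define f where "f = (\<lambda>n. of_nat n * (rho A n * of_real (sqrt_coeff n)))"
  have le: "norm (f (Suc n) - f n) \<le> 4 * \<bar>sqrt_coeff n\<bar>" for n
  proof -
    have "complex_of_real ((real n + 1) * sqrt_coeff (Suc n)) = of_real ((real n - 1 / 2) * sqrt_coeff n)"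
      unfolding sqrt_coeff_Suc ..
    hence "(of_nat n + 1) * complex_of_real (sqrt_coeff (Suc n)) = (of_nat n - 1 / 2) * of_real (sqrt_coeff n)"
      by simp
    moreover have "f (Suc n) = rho A (Suc n) * ((of_nat n + 1) * of_real (sqrt_coeff (Suc n)))"
      by (simp add: f_def mult_ac add.commute)
    ultimately have "f (Suc n) = rho A (Suc n) * ((of_nat n - 1 / 2) * of_real (sqrt_coeff n))"
      by (simp only:)
    hence "f (Suc n) - f n = of_real (sqrt_coeff n) * (of_nat n * (rho A (Suc n) - rho A n) - rho A (Suc n) / 2)"
      by (simp add: f_def algebra_simps)
    hence "norm (f (Suc n) - f n) = \<bar>sqrt_coeff n\<bar> * norm (of_nat n * (rho A (Suc n) - rho A n) - rho A (Suc n) / 2)"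
      by (simp add: norm_mult)
    also have "norm (of_nat n * (rho A (Suc n) - rho A n) - rho A (Suc n) / 2)
        \<le> real n * norm (rho A (Suc n) - rho A n) + norm (rho A (Suc n)) / 2"
      by (rule order_trans[OF norm_triangle_ineq4]) (simp add: norm_mult)
    also have "\<dots> \<le> 3 + 2 / 2"
      by (intro add_mono rho_diff_nat divide_right_mono rho_bound A) auto
    finally show ?thesis by (simp add: mult_ac mult_right_mono)
  qed
  have "norm ((1 - t) * (t * FA1 A t)) \<le> norm (f 0) + (\<Sum>n. 4 * \<bar>sqrt_coeff n\<bar>)"
  proof (rule one_minus_times_power_series[OF _ _ summable_mult[OF summable_sqrt_coeff] le])
    show "(\<lambda>n. f n * t ^ n) sums (t * FA1 A t)" unfolding f_def by (rule FA1_sums[OF A t])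
  qed (use t in auto)
  also have "\<dots> \<le> 0 + 4 * 2"
    by (intro add_mono suminf_mult_sqrt_coeff) (auto simp: f_def)
  finally show ?thesis by (simp only: norm_mult mult_ac)
qed

text \<open>Comparison with the series of (1 - t)^(-1/2). The bound 8/(1 - t) of
  \<open>FA1_estimate\<close> would not give the limit in \<open>tendsto_jost1_0\<close>, where the
  derivative is multiplied by a quantity of exact order 1 - t.\<close>

lemma FA1_estimate_real:
  assumes A: "adm A" and t: "0 \<le> t" "t < 1"
  shows "norm (of_real t * FA1 A (of_real t)) \<le> t / sqrt (1 - t)"
proof -
  have tn: "norm (complex_of_real t) < 1" using t by simp
  have "(\<lambda>n. ((- 1 / 2) gchoose n) * (- t) ^ n) sums (1 + (- t)) powr (- 1 / 2)"
    by (rule gen_binomial_real) (use t in auto)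
  moreover have "((- 1 / 2) gchoose n) * (- t) ^ n = pochhammer (1 / 2) n / fact n * t ^ n" for n
  proof -
    have "(- 1) ^ n * (- 1 :: real) ^ n = 1" by (simp add: power_mult_distrib[symmetric])
    moreover have "((- 1 / 2) gchoose n) * (- t) ^ n = ((- 1) ^ n * (- 1 :: real) ^ n) * (pochhammer (- (- 1 / 2)) n / fact n) * t ^ n"
      unfolding gbinomial_pochhammer power_minus[of t] by (simp only: times_divide_eq_left times_divide_eq_right mult_ac)
    ultimately show ?thesis by simp
  qed
  moreover have "(1 + (- t)) powr (- 1 / 2) = 1 / sqrt (1 - t)"
    using t by (simp add: powr_minus_divide powr_half_sqrt)
  ultimately have "(\<lambda>n. pochhammer (1 / 2) n / fact n * t ^ n) sums (1 / sqrt (1 - t))" by simp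
  hence "(\<lambda>n. t * (pochhammer (1 / 2) n / fact n * t ^ n)) sums (t * (1 / sqrt (1 - t)))" by (rule sums_mult)
  moreover have "t * (pochhammer (1 / 2) n / fact n * t ^ n) = 2 * (real (Suc n) * \<bar>sqrt_coeff (Suc n)\<bar>) * t ^ Suc n" for n
  proof -
    have "real (Suc n) * \<bar>sqrt_coeff (Suc n)\<bar> = - ((real n + 1) * sqrt_coeff (Suc n))"
      using sqrt_coeff_Suc_neg[of n] by simp
    thus ?thesis unfolding sqrt_coeff_Suc_eq by simp
  qed
  ultimately have "(\<lambda>n. 2 * (real (Suc n) * \<bar>sqrt_coeff (Suc n)\<bar>) * t ^ Suc n) sums (t / sqrt (1 - t))"
    by (simp only: times_divide_eq_right mult_1_right)
  hence s: "(\<lambda>n. 2 * (real n * \<bar>sqrt_coeff n\<bar>) * t ^ n) sums (t / sqrt (1 - t))"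
    by (subst (asm) sums_Suc_iff) simp
  show ?thesis
    unfolding sums_unique[OF FA1_sums[OF A tn]] sums_unique[OF s]
  proof (rule norm_suminf_le[OF _ sums_summable[OF s]])
    fix n
    have "norm (rho A n) * (real n * \<bar>sqrt_coeff n\<bar> * t ^ n) \<le> 2 * (real n * \<bar>sqrt_coeff n\<bar> * t ^ n)"
      using t by (intro mult_right_mono rho_bound A) auto
    thus "norm (of_nat n * (rho A n * of_real (sqrt_coeff n)) * of_real t ^ n) \<le> 2 * (real n * \<bar>sqrt_coeff n\<bar>) * t ^ n"
      using t by (simp add: norm_mult norm_power mult_ac)
  qed
qed

section \<open>Gauss's summation theorem for the value at t = 1\<close>

definition GA :: "complex \<Rightarrow> complex" where "GA A = FA A 1"

text \<open>The contiguous relation between c and c + 1 at t = 1, term by term: the combination is a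
  total difference in n, so it sums to zero once n times the n-th term tends to 0.\<close>

lemma gauss_contiguous_term:
  fixes A c :: complex
  assumes nz: "c \<noteq> 0" "c + of_nat n \<noteq> 0"
  shows "(c - A) * (c + 1 / 2) * (poch_ratio A (c + 1) n * of_real (sqrt_coeff n))
       - c * (c - A + 1 / 2) * (poch_ratio A c n * of_real (sqrt_coeff n))
     = c * (of_nat (Suc n) * (poch_ratio A c (Suc n) * of_real (sqrt_coeff (Suc n)))
        - of_nat n * (poch_ratio A c n * of_real (sqrt_coeff n)))"
proof -
  define r s where "r = poch_ratio A c n" and "s = complex_of_real (sqrt_coeff n)"
  define N where "N = complex_of_nat n"
  have "pochhammer c (Suc n) = c * pochhammer (c + 1) n" by (rule pochhammer_rec)
  hence "pochhammer (c + 1) n = pochhammer c n * (c + N) / c"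
    using nz by (simp add: pochhammer_Suc N_def field_simps)
  hence 1: "poch_ratio A (c + 1) n = r * c / (c + N)"
    using nz by (simp add: poch_ratio_def r_def)
  have 2: "poch_ratio A c (Suc n) = r * (A + N) / (c + N)"
    by (simp add: poch_ratio_Suc r_def N_def)
  have "complex_of_real ((real n + 1) * sqrt_coeff (Suc n)) = of_real ((real n - 1 / 2) * sqrt_coeff n)"
    unfolding sqrt_coeff_Suc ..
  hence 3: "of_nat (Suc n) * complex_of_real (sqrt_coeff (Suc n)) = (N - 1 / 2) * s"
    by (simp add: N_def s_def add.commute)
  have nz': "c + N \<noteq> 0" using nz by (simp add: N_def)
  have "(c - A) * (c + 1 / 2) * (r * c / (c + N) * s) - c * (c - A + 1 / 2) * (r * s)
      = c * r * s / (c + N) * ((c - A) * (c + 1 / 2) - (c - A + 1 / 2) * (c + N))"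
  proof -
    have "X * (r * c / D * s) - c * Y * (r * s) = c * r * s / D * (X - Y * D)" if "D \<noteq> 0" for X Y D
      using that by (simp add: divide_simps) (simp add: algebra_simps)
    from this[OF nz'] show ?thesis .
  qed
  also have "(c - A) * (c + 1 / 2) - (c - A + 1 / 2) * (c + N) = (A + N) * (N - 1 / 2) - N * (c + N)"
    by (simp add: diff_divide_distrib add_divide_distrib algebra_simps)
  also have "c * r * s / (c + N) * ((A + N) * (N - 1 / 2) - N * (c + N))
      = c * (r * (A + N) / (c + N) * ((N - 1 / 2) * s) - N * (r * s))"
  proof -
    have "c * r * s / D * (X * Y - N * D) = c * (r * X / D * (Y * s) - N * (r * s))" if "D \<noteq> 0" for X Y D
    proof -
      define i where "i = 1 / D"
      have i: "x / D = x * i" for x by (simp add: i_def)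
      have "D * i = 1" using that by (simp add: i_def)
      moreover have "c * r * s * i * (X * Y - N * D) = c * (r * X * i * (Y * s)) - c * (N * (r * s)) * (D * i)"
        by (simp add: right_diff_distrib mult_ac)
      ultimately show ?thesis unfolding i by (simp add: right_diff_distrib)
    qed
    from this[OF nz'] show ?thesis .
  qed
  finally show ?thesis
    unfolding 1 2 3[symmetric] r_def[symmetric] s_def[symmetric] N_def[symmetric] by (simp only: mult_ac)
qed

text \<open>Gauss's formula Gamma(c) Gamma(c - a - b) / (Gamma(c - a) Gamma(c - b)) with b = -1/2
  and c = A + 3/2. The contiguous relation moves c to c + N, where the sum tends to 1, and the
  product of the factors met on the way is evaluated by Euler's limit for the Gamma
  function.\<close>

lemma GA_eq:
  assumes A: "adm A"
  shows "GA A = Gamma (A + 3 / 2) * Gamma 2 / (Gamma (3 / 2) * Gamma (A + 2))"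
proof -
  define c where "c = (\<lambda>N::nat. A + 3 / 2 + complex_of_real (real N))"
  define t where "t = (\<lambda>N n. poch_ratio A (c N) n * complex_of_real (sqrt_coeff n))"
  define F where "F = (\<lambda>N. \<Sum>n. t N n)"
  have tb: "norm (t N n) \<le> 2 * \<bar>sqrt_coeff n\<bar>" for N n
    unfolding t_def c_def norm_mult
    by (rule order_trans[OF mult_right_mono[OF poch_ratio_bound[OF A]]]) auto
  have ts: "t N sums F N" for N
    unfolding F_def
    by (intro summable_sums summable_comparison_test'[OF summable_mult[OF summable_sqrt_coeff, of 2]] tb)
  have F0: "F 0 = GA A"
    using FA_sums[OF A, of 1] ts[of 0] by (simp add: GA_def t_def c_def rho_def sums_iff)
  have cnz: "c N + of_nat n \<noteq> 0" for N n
    using norm_ge_Re_of_nat(3)[OF A, of "real N" n] by (simp add: c_def)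
  have rec: "(3 / 2 + of_nat N) * (A + 2 + of_nat N) * F (Suc N) = (A + 3 / 2 + of_nat N) * (2 + of_nat N) * F N" for N
  proof -
    have cs: "c (Suc N) = c N + 1" by (simp add: c_def)
    have lim: "(\<lambda>n. of_nat n * t N n) \<longlonglongrightarrow> 0"
    proof (rule Lim_null_comparison[where g = "\<lambda>n. 2 * \<bar>real n * sqrt_coeff n\<bar>"])
      show "\<forall>\<^sub>F n in sequentially. norm (of_nat n * t N n) \<le> 2 * \<bar>real n * sqrt_coeff n\<bar>"
        using mult_left_mono[OF tb, of "real n" for n] by (intro always_eventually allI) (simp add: norm_mult abs_mult mult_ac)
      show "(\<lambda>n. 2 * \<bar>real n * sqrt_coeff n\<bar>) \<longlonglongrightarrow> 0"
        using tendsto_mult_right_zero[OF tendsto_rabs_zero[OF n_sqrt_coeff_tendsto_0], of 2] by simp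
    qed
    have 1: "(\<lambda>n. c N * (of_nat (Suc n) * t N (Suc n) - of_nat n * t N n)) sums (c N * (0 - of_nat 0 * t N 0))"
      by (intro sums_mult telescope_sums lim)
    have 2: "(\<lambda>n. (c N - A) * (c N + 1 / 2) * t (Suc N) n - c N * (c N - A + 1 / 2) * t N n) sums
       ((c N - A) * (c N + 1 / 2) * F (Suc N) - c N * (c N - A + 1 / 2) * F N)"
      by (intro sums_diff sums_mult ts)
    have "(\<lambda>n. (c N - A) * (c N + 1 / 2) * t (Suc N) n - c N * (c N - A + 1 / 2) * t N n)
        = (\<lambda>n. c N * (of_nat (Suc n) * t N (Suc n) - of_nat n * t N n))"
      unfolding t_def cs using gauss_contiguous_term[of "c N"] cnz[of N] cnz[of N 0] by auto
    with 1 2 have "(c N - A) * (c N + 1 / 2) * F (Suc N) - c N * (c N - A + 1 / 2) * F N = 0"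
      using sums_unique2 by force
    moreover have "c N - A = 3 / 2 + of_nat N" "c N + 1 / 2 = A + 2 + of_nat N" "c N - A + 1 / 2 = 2 + of_nat N"
      by (simp_all add: c_def)
    ultimately show ?thesis by (simp add: c_def add_ac)
  qed
  have prod: "pochhammer (3 / 2) N * pochhammer (A + 2) N * F N = pochhammer (A + 3 / 2) N * pochhammer 2 N * F 0" for N
  proof (induction N)
    case (Suc N)
    have "pochhammer (3 / 2) (Suc N) * pochhammer (A + 2) (Suc N) * F (Suc N)
      = pochhammer (3 / 2) N * pochhammer (A + 2) N * ((3 / 2 + of_nat N) * (A + 2 + of_nat N) * F (Suc N))"
      unfolding pochhammer_Suc by (simp only: mult_ac)
    also have "\<dots> = (pochhammer (3 / 2) N * pochhammer (A + 2) N * F N) * ((A + 3 / 2 + of_nat N) * (2 + of_nat N))"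
      unfolding rec by (simp only: mult_ac)
    also have "\<dots> = pochhammer (A + 3 / 2) (Suc N) * pochhammer 2 (Suc N) * F 0"
      unfolding Suc.IH pochhammer_Suc by (simp only: mult_ac)
    finally show ?case .
  qed simp
  \<comment> \<open>The term n = 0 is 1; the others are together O(1/N), by
    \<open>poch_ratio_bound_Suc\<close> and |c N| \<ge> N.\<close>
  have F1: "F \<longlonglongrightarrow> 1"
  proof (rule LIM_zero_cancel, rule Lim_null_comparison[where g = "\<lambda>N. norm A * 2 / real N"])
    show "(\<lambda>N. norm A * 2 / real N) \<longlonglongrightarrow> 0" by real_asymp
    have "norm (F N - 1) \<le> norm A * 2 / real N" if "N > 0" for N
    proof -
      have cN: "real N \<le> norm (c N)" "norm (c N) > 0"
        using complex_Re_le_cmod[of "c N"] admD(1)[OF A] that by (auto simp: c_def)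
      have "(\<lambda>n. t N (Suc n)) sums (F N - 1)"
        using ts[of N] by (subst sums_Suc_iff) (simp add: t_def)
      moreover have b: "norm (t N (Suc n)) \<le> norm A / real N * \<bar>sqrt_coeff (Suc n)\<bar>" for n
      proof -
        have "norm (poch_ratio A (c N) (Suc n)) \<le> norm A / norm (c N)"
          unfolding c_def by (rule poch_ratio_bound_Suc[OF A]) simp
        also have "\<dots> \<le> norm A / real N" using cN that by (intro divide_left_mono) auto
        finally show ?thesis unfolding t_def norm_mult norm_of_real by (rule mult_right_mono) simp
      qed
      have S: "summable (\<lambda>n. \<bar>sqrt_coeff (Suc n)\<bar>)"
        using summable_sqrt_coeff by (subst summable_Suc_iff)
      ultimately have "norm (F N - 1) \<le> (\<Sum>n. norm A / real N * \<bar>sqrt_coeff (Suc n)\<bar>)"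
        unfolding sums_iff using norm_suminf_le[OF b summable_mult[OF S]] by metis
      also have "\<dots> = norm A / real N * (\<Sum>n. \<bar>sqrt_coeff (Suc n)\<bar>)" by (rule suminf_mult[OF S])
      also have "\<dots> \<le> norm A / real N * 2"
        using suminf_split_head[OF summable_sqrt_coeff] suminf_sqrt_coeff by (intro mult_left_mono) auto
      finally show ?thesis by simp
    qed
    thus "\<forall>\<^sub>F N in sequentially. norm (F N - 1) \<le> norm A * 2 / real N"
      using eventually_gt_at_top[of 0] by (rule eventually_mono[rotated])
  qed
  have np: "A + 3 / 2 \<notin> \<int>\<^sub>\<le>\<^sub>0" "A + 2 \<notin> \<int>\<^sub>\<le>\<^sub>0"
    using admD(4)[OF A] by (auto intro!: Im_nz_not_nonpos_Ints)
  have np2: "(3 / 2 :: complex) \<notin> \<int>\<^sub>\<le>\<^sub>0" "(2 :: complex) \<notin> \<int>\<^sub>\<le>\<^sub>0"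
    by (auto elim!: nonpos_Ints_cases simp: complex_eq_iff)
  have "(\<lambda>N. Gamma_series' (A + 3 / 2) N * Gamma_series' 2 N / (Gamma_series' (3 / 2) N * Gamma_series' (A + 2) N) * F N)
     \<longlonglongrightarrow> Gamma (A + 3 / 2) * Gamma 2 / (Gamma (3 / 2) * Gamma (A + 2)) * 1"
    using np np2 by (intro tendsto_intros Gamma_series'_LIMSEQ F1) (auto simp: Gamma_eq_zero_iff)
  moreover have "\<forall>\<^sub>F N in sequentially. Gamma_series' (A + 3 / 2) N * Gamma_series' 2 N / (Gamma_series' (3 / 2) N * Gamma_series' (A + 2) N) * F N = F 0"
    using eventually_gt_at_top[of 0]
  proof eventually_elim
    case (elim N)
    define f e where "f = (fact (N - 1) :: complex)" and "e = (\<lambda>z. exp (z * complex_of_real (ln (of_nat N))))"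
    \<comment> \<open>The powers of N in Euler's limit cancel because (A + 3/2) + 2 = 3/2 + (A +
      2).\<close>
    have e: "e (A + 3 / 2) * e 2 = e (3 / 2) * e (A + 2)"
      unfolding e_def exp_add[symmetric] distrib_right[symmetric] by simp
    have nz: "f \<noteq> 0" "e z \<noteq> 0" for z by (auto simp: f_def e_def)
    have p: "pochhammer (3 / 2 :: complex) N \<noteq> 0" "pochhammer (A + 2) N \<noteq> 0" "pochhammer (A + 3 / 2) N \<noteq> 0" "pochhammer (2::complex) N \<noteq> 0"
      using np np2 pochhammer_eq_0_imp_nonpos_Int by blast+
    have "Gamma_series' (A + 3 / 2) N * Gamma_series' 2 N / (Gamma_series' (3 / 2) N * Gamma_series' (A + 2) N)
       = (e (A + 3 / 2) * e 2) / (e (3 / 2) * e (A + 2)) * (pochhammer (3 / 2) N * pochhammer (A + 2) N / (pochhammer (A + 3 / 2) N * pochhammer 2 N))"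
    proof -
      have gs: "Gamma_series' z N = f * e z / pochhammer z N" for z
        unfolding Gamma_series'_def f_def e_def ..
      have "(f * e1 / p1) * (f * e2 / p2) / ((f * e3 / p3) * (f * e4 / p4)) = (e1 * e2) / (e3 * e4) * (p3 * p4 / (p1 * p2))"
        if "p1 \<noteq> 0" "p2 \<noteq> 0" "p3 \<noteq> 0" "p4 \<noteq> 0" "e3 \<noteq> 0" "e4 \<noteq> 0" for e1 e2 e3 e4 p1 p2 p3 p4 :: complex
      proof -
        have 1: "(f * e1 / p1) * (f * e2 / p2) = (f * f) * (e1 * e2) / (p1 * p2)" by (simp add: mult_ac)
        have 2: "(f * e3 / p3) * (f * e4 / p4) = (f * f) * (e3 * e4) / (p3 * p4)" by (simp add: mult_ac)
        have "(k * x / y) / (k * v / w) = x / v * (w / y)" if "k \<noteq> 0" for k x y v w :: complex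
          using that by simp
        from this[of "f * f" "e1 * e2" "p1 * p2" "e3 * e4" "p3 * p4"] nz(1)
        show ?thesis unfolding 1 2 by simp
      qed
      from this[OF p(3,4,1,2) nz(2) nz(2)] show ?thesis unfolding gs .
    qed
    also have "\<dots> = pochhammer (3 / 2) N * pochhammer (A + 2) N / (pochhammer (A + 3 / 2) N * pochhammer 2 N)"
      unfolding e using nz by simp
    also have "\<dots> * F N = F 0"
    proof -
      have "x / y * v = w" if "x * v = y * w" "y \<noteq> 0" for x y v w :: complex
        using that by simp
      from this[OF prod[of N]] p show ?thesis by simp
    qed
    finally show ?case .
  qed
  ultimately have "(\<lambda>_::nat. F 0) \<longlonglongrightarrow> Gamma (A + 3 / 2) * Gamma 2 / (Gamma (3 / 2) * Gamma (A + 2)) * 1"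
    by (rule Lim_transform_eventually)
  from LIMSEQ_unique[OF tendsto_const this] show ?thesis unfolding F0 by simp
qed

lemma GA_nonzero:
  assumes A: "adm A"
  shows "GA A \<noteq> 0"
proof -
  have np: "A + 3 / 2 \<notin> \<int>\<^sub>\<le>\<^sub>0" "A + 2 \<notin> \<int>\<^sub>\<le>\<^sub>0"
    using admD(4)[OF A] by (auto intro!: Im_nz_not_nonpos_Ints)
  have np2: "(3 / 2 :: complex) \<notin> \<int>\<^sub>\<le>\<^sub>0" "(2 :: complex) \<notin> \<int>\<^sub>\<le>\<^sub>0"
    by (auto elim!: nonpos_Ints_cases simp: complex_eq_iff)
  show ?thesis unfolding GA_eq[OF A] using np np2 by (simp add: Gamma_eq_zero_iff)
qed

text \<open>The Gamma quotient is the one in \<open>Q_mat\<close>. \<open>GA_eq\<close> at -a - 1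
  produces Gamma(1/2 - a) and Gamma(1 - a), and the reflection formula turns the products with their
  partners into pi/cos(a pi) and pi/sin(a pi).\<close>

lemma GA_reflect:
  assumes A: "adm a"
  shows "Gamma (a + 3 / 2) * Gamma (a + 1 / 2) / (Gamma a * Gamma (a + 2)) * GA (- a - 1) = tan (a * of_real pi) * GA a"
proof -
  define p where "p = a * complex_of_real pi"
  have sin: "sin (of_real pi * (a + 1 / 2)) = cos p"
    using sin_add[of p "of_real pi / 2"] by (simp add: p_def algebra_simps)
  have sin': "sin (of_real pi * a) = sin p" by (simp add: p_def mult.commute)
  have r1: "Gamma (a + 1 / 2) * Gamma (1 / 2 - a) = of_real pi / cos p"
    using Gamma_reflection_complex[of "a + 1/2"] unfolding sin by (simp add: algebra_simps)
  have r2: "Gamma a * Gamma (1 - a) = of_real pi / sin p"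
    using Gamma_reflection_complex[of a] unfolding sin' .
  have im: "Im (- a - 1 + 3 / 2) \<noteq> 0" using admD(4)[OF A] by simp
  have e: "- a - 1 + 3 / 2 = 1 / 2 - a" "- a - 1 + 2 = 1 - a" by simp_all
  have "Gamma (a + 3 / 2) * Gamma (a + 1 / 2) / (Gamma a * Gamma (a + 2)) * GA (- a - 1)
      = (Gamma (a + 1 / 2) * Gamma (1 / 2 - a)) / (Gamma a * Gamma (1 - a)) * (Gamma (a + 3 / 2) * Gamma 2 / (Gamma (3 / 2) * Gamma (a + 2)))"
    unfolding GA_eq[OF adm_reflect[OF A]] e by (simp add: field_simps)
  also have "\<dots> = tan p * GA a"
    unfolding r1 r2 GA_eq[OF A] tan_def by simp
  finally show ?thesis by (simp add: p_def)
qed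

subsection \<open>Jost solutions and the solution vanishing at the origin\<close>

definition jost :: "complex \<Rightarrow> complex \<Rightarrow> complex" where
  "jost A \<theta> = exp (\<i> * A * \<theta>) * FA A (exp (2 * \<i> * \<theta>))"

definition jost1 :: "complex \<Rightarrow> complex \<Rightarrow> complex" where
  "jost1 A \<theta> = exp (\<i> * A * \<theta>) * (\<i> * A * FA A (exp (2 * \<i> * \<theta>)) + 2 * \<i> * (exp (2 * \<i> * \<theta>) * FA1 A (exp (2 * \<i> * \<theta>))))"

definition jost2 :: "complex \<Rightarrow> complex \<Rightarrow> complex" where
  "jost2 A \<theta> = exp (\<i> * A * \<theta>) * (- (A * A) * FA A (exp (2 * \<i> * \<theta>))
      - 4 * (A + 1) * exp (2 * \<i> * \<theta>) * FA1 A (exp (2 * \<i> * \<theta>))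
      - 4 * exp (2 * \<i> * \<theta>) * exp (2 * \<i> * \<theta>) * FA2 A (exp (2 * \<i> * \<theta>)))"

lemma norm_exp_upper: "Im \<theta> > 0 \<Longrightarrow> norm (exp (2 * \<i> * \<theta>)) < 1"
  by simp

lemma norm_exp_upper': "Im \<theta> \<ge> 0 \<Longrightarrow> norm (exp (2 * \<i> * \<theta>)) \<le> 1"
  by simp

lemma exp_linear_deriv: "((\<lambda>z. exp (c * z)) has_field_derivative c * exp (c * z)) (at (z::complex))"
  by (auto intro!: derivative_eq_intros)

lemma jost_has_deriv:
  assumes A: "Im A \<noteq> 0" and \<theta>: "Im \<theta> > 0"
  shows "(jost A has_field_derivative jost1 A \<theta>) (at \<theta>)"
    "(jost1 A has_field_derivative jost2 A \<theta>) (at \<theta>)"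
proof -
  define e where "e = (\<lambda>\<theta>. exp (\<i> * A * \<theta>))"
  define t where "t = (\<lambda>\<theta>. exp (2 * \<i> * \<theta>))"
  have dt: "(t has_field_derivative 2 * \<i> * t \<theta>) (at \<theta>)"
    unfolding t_def by (rule exp_linear_deriv)
  have de: "(e has_field_derivative \<i> * A * e \<theta>) (at \<theta>)"
    unfolding e_def by (rule exp_linear_deriv)
  have tn: "norm (t \<theta>) < 1" unfolding t_def by (rule norm_exp_upper[OF \<theta>])
  have dF: "((\<lambda>\<theta>. FA A (t \<theta>)) has_field_derivative FA1 A (t \<theta>) * (2 * \<i> * t \<theta>)) (at \<theta>)"
    by (rule DERIV_chain2[OF FA_has_deriv[OF A tn] dt])
  have dF1: "((\<lambda>\<theta>. FA1 A (t \<theta>)) has_field_derivative FA2 A (t \<theta>) * (2 * \<i> * t \<theta>)) (at \<theta>)"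
    by (rule DERIV_chain2[OF FA1_has_deriv[OF A tn] dt])
  have "((\<lambda>\<theta>. e \<theta> * FA A (t \<theta>)) has_field_derivative
      \<i> * A * e \<theta> * FA A (t \<theta>) + FA1 A (t \<theta>) * (2 * \<i> * t \<theta>) * e \<theta>) (at \<theta>)"
    by (rule DERIV_mult[OF de dF])
  moreover have "\<i> * A * e \<theta> * FA A (t \<theta>) + FA1 A (t \<theta>) * (2 * \<i> * t \<theta>) * e \<theta> = jost1 A \<theta>"
    unfolding jost1_def e_def t_def by (simp add: algebra_simps)
  ultimately show "(jost A has_field_derivative jost1 A \<theta>) (at \<theta>)"
    unfolding jost_def[abs_def] e_def t_def by simp
  have "((\<lambda>\<theta>. e \<theta> * (\<i> * A * FA A (t \<theta>) + 2 * \<i> * (t \<theta> * FA1 A (t \<theta>)))) has_field_derivative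
      \<i> * A * e \<theta> * (\<i> * A * FA A (t \<theta>) + 2 * \<i> * (t \<theta> * FA1 A (t \<theta>)))
     + (\<i> * A * (FA1 A (t \<theta>) * (2 * \<i> * t \<theta>)) + 2 * \<i> * (2 * \<i> * t \<theta> * FA1 A (t \<theta>) + FA2 A (t \<theta>) * (2 * \<i> * t \<theta>) * t \<theta>)) * e \<theta>) (at \<theta>)"
    by (rule DERIV_mult[OF de] DERIV_add DERIV_cmult dF dF1 DERIV_mult[OF dt])+
  moreover have "\<i> * A * e * (\<i> * A * f + 2 * \<i> * (t * f1))
     + (\<i> * A * (f1 * (2 * \<i> * t)) + 2 * \<i> * (2 * \<i> * t * f1 + f2 * (2 * \<i> * t) * t)) * e
     = e * (- (A * A) * f - 4 * (A + 1) * t * f1 - 4 * t * t * f2)" for e t f f1 f2 :: complex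
    by (simp add: algebra_simps)
  ultimately show "(jost1 A has_field_derivative jost2 A \<theta>) (at \<theta>)"
    unfolding jost1_def[abs_def] jost2_def e_def t_def by metis
qed

lemma jost_ode:
  assumes A: "Im A \<noteq> 0" and \<theta>: "Im \<theta> > 0"
  shows "sin \<theta> * jost2 A \<theta> - cos \<theta> * jost1 A \<theta> + A * (A + 1) * sin \<theta> * jost A \<theta> = 0"
proof -
  define E where "E = exp (\<i> * \<theta>)"
  define t where "t = exp (2 * \<i> * \<theta>)"
  have E0: "E \<noteq> 0" by (simp add: E_def)
  have tE: "t = E * E" by (simp add: t_def E_def exp_add[symmetric] mult.assoc)
  have Ei: "exp (- (\<i> * \<theta>)) = 1 / E" by (simp add: E_def exp_minus field_simps)
  have s: "sin \<theta> = (t - 1) / (2 * \<i> * E)"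
    unfolding sin_exp_eq tE using E0 by (simp add: Ei E_def[symmetric] field_simps)
  have c: "cos \<theta> = \<i> * (t + 1) / (2 * \<i> * E)"
    unfolding cos_exp_eq tE using E0 by (simp add: Ei E_def[symmetric] field_simps)
  have tn: "norm t < 1" unfolding t_def by (rule norm_exp_upper[OF \<theta>])
  define e f f1 f2 where "e = exp (\<i> * A * \<theta>)" and "f = FA A t" and "f1 = FA1 A t" and "f2 = FA2 A t"
  have ode: "t * (1 - t) * f2 + (A + 3 / 2 - (A + 1 / 2) * t) * f1 + A / 2 * f = 0"
    unfolding f_def f1_def f2_def by (rule FA_ode[OF A tn])
  have "(t - 1) * (e * (- (A * A) * f - 4 * (A + 1) * t * f1 - 4 * t * t * f2))
     - \<i> * (t + 1) * (e * (\<i> * A * f + 2 * \<i> * (t * f1))) + A * (A + 1) * (t - 1) * (e * f)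
     = 4 * t * e * (t * (1 - t) * f2 + (A + 3 / 2 - (A + 1 / 2) * t) * f1 + A / 2 * f)"
    by (simp add: algebra_simps)
  hence "((t - 1) * (e * (- (A * A) * f - 4 * (A + 1) * t * f1 - 4 * t * t * f2))
     - \<i> * (t + 1) * (e * (\<i> * A * f + 2 * \<i> * (t * f1))) + A * (A + 1) * (t - 1) * (e * f)) / (2 * \<i> * E) = 0"
    unfolding ode by simp
  moreover have "(a / k) * x - (b / k) * y + m * (a / k) * z = (a * x - b * y + m * a * z) / k" for a b k x y z m :: complex
    by (simp add: add_divide_distrib diff_divide_distrib mult_ac)
  ultimately show ?thesis
    unfolding jost_def jost1_def jost2_def s c t_def[symmetric] e_def[symmetric] f_def[symmetric] f1_def[symmetric] f2_def[symmetric]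
    by (simp only:)
qed

text \<open>The Jost solutions for A and -A - 1 belong to the same equation, which involves A only
  through A (A + 1). At theta = 0 its exponents are 0 and 2, so the difference of the two, each
  normalised to 1 at 0, should be the solution of exponent 2, which is even and free of logarithms.
  \<open>nf_eq_rec_near_0\<close> establishes this.\<close>

definition nf :: "complex \<Rightarrow> complex \<Rightarrow> complex" where
  "nf A \<theta> = jost (- A - 1) \<theta> / GA (- A - 1) - jost A \<theta> / GA A"
definition nf1 :: "complex \<Rightarrow> complex \<Rightarrow> complex" where
  "nf1 A \<theta> = jost1 (- A - 1) \<theta> / GA (- A - 1) - jost1 A \<theta> / GA A"
definition nf2 :: "complex \<Rightarrow> complex \<Rightarrow> complex" where
  "nf2 A \<theta> = jost2 (- A - 1) \<theta> / GA (- A - 1) - jost2 A \<theta> / GA A"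

lemma nf_has_deriv:
  assumes A: "adm A" and \<theta>: "Im \<theta> > 0"
  shows "(nf A has_field_derivative nf1 A \<theta>) (at \<theta>)"
    "(nf1 A has_field_derivative nf2 A \<theta>) (at \<theta>)"
  unfolding nf_def[abs_def] nf1_def[abs_def] nf2_def
  by (rule DERIV_diff DERIV_cdivide jost_has_deriv admD(4)[OF A] admD(4)[OF adm_reflect[OF A]] \<theta>)+

lemma nf_ode:
  assumes A: "adm A" and \<theta>: "Im \<theta> > 0"
  shows "sin \<theta> * nf2 A \<theta> - cos \<theta> * nf1 A \<theta> + A * (A + 1) * sin \<theta> * nf A \<theta> = 0"
proof -
  define B where "B = - A - 1"
  have B: "sin \<theta> * jost2 B \<theta> - cos \<theta> * jost1 B \<theta> + A * (A + 1) * sin \<theta> * jost B \<theta> = 0"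
    using jost_ode[OF admD(4)[OF adm_reflect[OF A]] \<theta>] unfolding B_def by (simp add: algebra_simps)
  note A' = jost_ode[OF admD(4)[OF A] \<theta>]
  have "s * (x2 / g - y2 / h) - c * (x1 / g - y1 / h) + m * s * (x / g - y / h)
     = (s * x2 - c * x1 + m * s * x) / g - (s * y2 - c * y1 + m * s * y) / h" for s c m x x1 x2 y y1 y2 g h :: complex
    by (simp add: add_divide_distrib diff_divide_distrib right_diff_distrib)
  from this[of "sin \<theta>" "jost2 B \<theta>" "GA B" "jost2 A \<theta>" "GA A" "cos \<theta>" "jost1 B \<theta>" "jost1 A \<theta>" "A * (A + 1)" "jost B \<theta>" "jost A \<theta>"]
  show ?thesis unfolding nf_def nf1_def nf2_def B_def[symmetric] A' B by simp
qed

lemma nf_continuous: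
  assumes A: "adm A"
  shows "continuous_on {\<theta>. Im \<theta> \<ge> 0} (nf A)"
proof -
  have "continuous_on {\<theta>. Im \<theta> \<ge> 0} (\<lambda>\<theta>. FA B (exp (2 * \<i> * \<theta>)))" if "adm B" for B
    by (rule continuous_on_compose2[OF FA_continuous[OF that]]) (auto intro!: continuous_intros)
  thus ?thesis unfolding nf_def jost_def
    using A adm_reflect[OF A] GA_nonzero by (intro continuous_intros) auto
qed

text \<open>The solution of the \<open>\<theta>\<close>-equation that vanishes at \<open>\<theta> = 0\<close>, even in \<open>\<theta>\<close>.\<close>

definition rec_G :: "complex \<Rightarrow> complex \<Rightarrow> complex" where "rec_G A = gauss_series (- A) (A + 1) 2"
definition rec_y :: "complex \<Rightarrow> complex" where "rec_y \<theta> = sin (\<theta> / 2) * sin (\<theta> / 2)"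
definition rec :: "complex \<Rightarrow> complex \<Rightarrow> complex" where "rec A \<theta> = rec_y \<theta> * rec_G A (rec_y \<theta>)"
definition rec1 :: "complex \<Rightarrow> complex \<Rightarrow> complex" where
  "rec1 A \<theta> = (rec_G A (rec_y \<theta>) + rec_y \<theta> * deriv (rec_G A) (rec_y \<theta>)) * (sin \<theta> / 2)"
definition rec2 :: "complex \<Rightarrow> complex \<Rightarrow> complex" where
  "rec2 A \<theta> = (2 * deriv (rec_G A) (rec_y \<theta>) + rec_y \<theta> * deriv (deriv (rec_G A)) (rec_y \<theta>)) * (sin \<theta> / 2) * (sin \<theta> / 2)
     + (rec_G A (rec_y \<theta>) + rec_y \<theta> * deriv (rec_G A) (rec_y \<theta>)) * (cos \<theta> / 2)"

lemma two_not_nonpos_Int: "(2 :: complex) \<notin> \<int>\<^sub>\<le>\<^sub>0"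
  by (auto elim!: nonpos_Ints_cases simp: complex_eq_iff)

lemma rec_has_deriv:
  assumes y: "norm (rec_y \<theta>) < 1"
  shows "(rec A has_field_derivative rec1 A \<theta>) (at \<theta>)"
    "(rec1 A has_field_derivative rec2 A \<theta>) (at \<theta>)"
proof -
  have dy: "(rec_y has_field_derivative sin \<theta> / 2) (at \<theta>)"
  proof -
    have "((\<lambda>\<theta>. sin (\<theta> / 2) * sin (\<theta> / 2)) has_field_derivative cos (\<theta> / 2) * (1 / 2) * sin (\<theta> / 2) + cos (\<theta> / 2) * (1 / 2) * sin (\<theta> / 2)) (at \<theta>)"
      by (auto intro!: derivative_eq_intros)
    moreover have "cos (\<theta> / 2) * (1 / 2) * sin (\<theta> / 2) + cos (\<theta> / 2) * (1 / 2) * sin (\<theta> / 2) = sin \<theta> / 2"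
      using sin_double[of "\<theta> / 2"] by simp
    ultimately show ?thesis unfolding rec_y_def[abs_def] by (simp only:)
  qed
  have dG: "((\<lambda>\<theta>. rec_G A (rec_y \<theta>)) has_field_derivative deriv (rec_G A) (rec_y \<theta>) * (sin \<theta> / 2)) (at \<theta>)"
    unfolding rec_G_def by (rule DERIV_chain2[OF gauss_deriv1[OF two_not_nonpos_Int y] dy])
  have dG1: "((\<lambda>\<theta>. deriv (rec_G A) (rec_y \<theta>)) has_field_derivative deriv (deriv (rec_G A)) (rec_y \<theta>) * (sin \<theta> / 2)) (at \<theta>)"
    unfolding rec_G_def by (rule DERIV_chain2[OF gauss_deriv2[OF two_not_nonpos_Int y] dy])
  have ds: "((\<lambda>\<theta>. sin \<theta> / 2) has_field_derivative cos \<theta> / 2) (at \<theta>)"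
    by (auto intro!: derivative_eq_intros)
  have "(rec A has_field_derivative sin \<theta> / 2 * rec_G A (rec_y \<theta>) + deriv (rec_G A) (rec_y \<theta>) * (sin \<theta> / 2) * rec_y \<theta>) (at \<theta>)"
    unfolding rec_def[abs_def] by (rule DERIV_mult[OF dy dG])
  thus "(rec A has_field_derivative rec1 A \<theta>) (at \<theta>)"
    unfolding rec1_def by (simp add: algebra_simps)
  have "(rec1 A has_field_derivative (deriv (rec_G A) (rec_y \<theta>) * (sin \<theta> / 2)
     + (sin \<theta> / 2 * deriv (rec_G A) (rec_y \<theta>) + deriv (deriv (rec_G A)) (rec_y \<theta>) * (sin \<theta> / 2) * rec_y \<theta>)) * (sin \<theta> / 2)
     + cos \<theta> / 2 * (rec_G A (rec_y \<theta>) + rec_y \<theta> * deriv (rec_G A) (rec_y \<theta>))) (at \<theta>)"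
    unfolding rec1_def[abs_def] by (rule DERIV_mult[OF DERIV_add[OF dG DERIV_mult[OF dy dG1]] ds])
  moreover have "(g1 * s + (s * g1 + g2 * s * y)) * s + c * (g + y * g1) = (2 * g1 + y * g2) * s * s + (g + y * g1) * c" for g g1 g2 s c y :: complex
    by (simp add: algebra_simps)
  ultimately show "(rec1 A has_field_derivative rec2 A \<theta>) (at \<theta>)"
    unfolding rec2_def by (simp only:)
qed

lemma rec_ode:
  assumes y: "norm (rec_y \<theta>) < 1"
  shows "sin \<theta> * rec2 A \<theta> - cos \<theta> * rec1 A \<theta> + A * (A + 1) * sin \<theta> * rec A \<theta> = 0"
proof -
  define g g1 g2 where "g = rec_G A (rec_y \<theta>)" and "g1 = deriv (rec_G A) (rec_y \<theta>)" and "g2 = deriv (deriv (rec_G A)) (rec_y \<theta>)"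
  define s c u where "s = sin \<theta>" and "c = cos \<theta>" and "u = rec_y \<theta>"
  have ode: "u * (1 - u) * g2 + (2 - 2 * u) * g1 + A * (A + 1) * g = 0"
    using gauss_ode[OF two_not_nonpos_Int y, of "- A" "A + 1"]
    unfolding g_def g1_def g2_def rec_G_def u_def by (simp add: algebra_simps)
  have s2: "s * s / 4 = u * (1 - u)"
  proof -
    have "1 - u = cos (\<theta> / 2) * cos (\<theta> / 2)"
      using sin_cos_squared_add[of "\<theta> / 2"] unfolding u_def rec_y_def power2_eq_square by (simp add: algebra_simps)
    moreover have "s = 2 * sin (\<theta> / 2) * cos (\<theta> / 2)" using sin_double[of "\<theta> / 2"] by (simp add: s_def)
    ultimately show ?thesis unfolding u_def rec_y_def by simp
  qed
  have "s * ((2 * g1 + u * g2) * (s / 2) * (s / 2) + (g + u * g1) * (c / 2)) - c * ((g + u * g1) * (s / 2)) + A * (A + 1) * s * (u * g)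
    = s * ((2 * g1 + u * g2) * (s * s / 4) + A * (A + 1) * (u * g))"
    by (simp add: algebra_simps)
  also have "\<dots> = s * u * (u * (1 - u) * g2 + (2 - 2 * u) * g1 + A * (A + 1) * g)"
    unfolding s2 by (simp add: algebra_simps)
  also have "\<dots> = 0" unfolding ode by simp
  finally show ?thesis
    unfolding rec_def rec1_def rec2_def g_def g1_def g2_def s_def c_def u_def .
qed

lemma rec_even: "rec A (- \<theta>) = rec A \<theta>"
  by (simp add: rec_def rec_y_def)

lemma norm_rec_y: "norm (rec_y \<theta>) = (cosh (Im \<theta>) - cos (Re \<theta>)) / 2"
proof -
  have "norm (rec_y \<theta>) = norm (sin (\<theta> / 2)) ^ 2"
    by (simp add: rec_y_def norm_mult power2_eq_square)
  also have "\<dots> = (cosh (Im \<theta>) - cos (Re \<theta>)) / 2"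
    unfolding norm_sin_squared by (simp add: cosh_def exp_minus field_simps)
  finally show ?thesis .
qed

lemma sin_upper_nonzero:
  assumes "Im (\<theta>::complex) > 0"
  shows "sin \<theta> \<noteq> 0"
proof
  assume "sin \<theta> = 0"
  then obtain n :: int where "\<theta> = of_real (n * pi)" unfolding sin_eq_0 by blast
  with assms show False by (metis Im_complex_of_real less_irrefl)
qed

lemma tendsto_jost_0:
  assumes B: "adm B"
  shows "((\<lambda>y. FA B (exp (2 * \<i> * (\<i> * of_real y)))) \<longlongrightarrow> GA B) (at_right 0)"
    "((\<lambda>y. jost B (\<i> * of_real y)) \<longlongrightarrow> GA B) (at_right 0)"
proof -
  have lim: "((\<lambda>y::real. exp (2 * \<i> * (\<i> * complex_of_real y))) \<longlongrightarrow> exp (2 * \<i> * (\<i> * complex_of_real 0))) (at_right 0)"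
    by (intro tendsto_intros)
  have "((\<lambda>y::real. FA B (exp (2 * \<i> * (\<i> * of_real y)))) \<longlongrightarrow> FA B (exp (2 * \<i> * (\<i> * complex_of_real 0)))) (at_right 0)"
    by (rule continuous_on_tendsto_compose[OF FA_continuous[OF B] lim])
      (auto simp: eventually_at_right_less intro!: eventually_at_rightI[of 0 1])
  thus 1: "((\<lambda>y. FA B (exp (2 * \<i> * (\<i> * of_real y)))) \<longlongrightarrow> GA B) (at_right 0)"
    by (simp add: GA_def)
  have "((\<lambda>y. exp (\<i> * B * (\<i> * of_real y)) * FA B (exp (2 * \<i> * (\<i> * of_real y)))) \<longlongrightarrow> exp (\<i> * B * (\<i> * of_real 0)) * GA B) (at_right 0)"
    by (intro tendsto_intros 1)
  thus "((\<lambda>y. jost B (\<i> * of_real y)) \<longlongrightarrow> GA B) (at_right 0)"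
    unfolding jost_def by simp
qed

lemma tan_imaginary:
  "sin (\<i> * complex_of_real y) / cos (\<i> * complex_of_real y) = \<i> * of_real (tanh y)"
proof -
  have "\<i> * (a / 2) / (b / 2) = \<i> * (a / b)" for a b :: complex by simp
  moreover have "complex_of_real (tanh y) = (exp (of_real y) - inverse (exp (of_real y))) / (exp (of_real y) + inverse (exp (of_real y)))"
    unfolding tanh_altdef by (simp add: exp_of_real[symmetric] exp_minus)
  ultimately show ?thesis unfolding sin_i_times cos_i_times by (simp only:)
qed

text \<open>With theta = i y the factor i tanh(y/2) is tan(theta/2). It arises because
  \<open>rec A \<theta> / sin \<theta>\<close> is tan(theta/2)/2 times a value of
  \<open>rec_G\<close>, and it compensates the possible growth of \<open>FA1\<close> at t =
  1.\<close>

lemma tendsto_jost1_0: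
  assumes B: "adm B"
  shows "((\<lambda>y. jost1 B (\<i> * of_real y) * (\<i> * of_real (tanh (y / 2)))) \<longlongrightarrow> 0) (at_right 0)"
proof -
  define t where "t = (\<lambda>y::real. exp (2 * \<i> * (\<i> * complex_of_real y)))"
  have t: "t y = of_real (exp (- 2 * y))" for y
  proof -
    have "2 * \<i> * (\<i> * complex_of_real y) = of_real (- 2 * y)" by (simp add: complex_eq_iff)
    thus ?thesis unfolding t_def by (simp only: exp_of_real)
  qed
  have 1: "((\<lambda>y. t y * FA1 B (t y) * (\<i> * of_real (tanh (y / 2)))) \<longlongrightarrow> 0) (at_right 0)"
  proof (rule Lim_null_comparison[where g = "\<lambda>y. exp (- 2 * y) / sqrt (1 - exp (- 2 * y)) * ((exp y - 1) / (exp y + 1))"])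
    show "((\<lambda>y. exp (- 2 * y) / sqrt (1 - exp (- 2 * y)) * ((exp y - 1) / (exp y + 1))) \<longlongrightarrow> 0) (at_right 0)"
      for y :: real by real_asymp
    show "\<forall>\<^sub>F y in at_right 0. norm (t y * FA1 B (t y) * (\<i> * of_real (tanh (y / 2))))
        \<le> exp (- 2 * y) / sqrt (1 - exp (- 2 * y)) * ((exp y - 1) / (exp y + 1))"
    proof (rule eventually_at_rightI[of 0 1])
      fix y :: real assume y: "y \<in> {0<..<1}"
      have "tanh (y / 2) = (exp y - 1) / (exp y + 1)"
      proof -
        have "exp y = exp (y / 2) * exp (y / 2)" by (simp add: exp_add[symmetric])
        moreover have "(e - 1 / e) / (e + 1 / e) = (e * e - 1) / (e * e + 1)" if "e > 0" for e :: real
          using that by (simp add: divide_simps add_pos_pos) 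
        ultimately show ?thesis
          unfolding tanh_altdef exp_minus inverse_eq_divide by simp
      qed
      moreover have "norm (t y * FA1 B (t y)) \<le> exp (- 2 * y) / sqrt (1 - exp (- 2 * y))"
        unfolding t by (rule FA1_estimate_real[OF B]) (use y in auto)
      moreover have "(exp y - 1) / (exp y + 1) \<ge> 0" using y by simp
      ultimately show "norm (t y * FA1 B (t y) * (\<i> * of_real (tanh (y / 2)))) \<le> exp (- 2 * y) / sqrt (1 - exp (- 2 * y)) * ((exp y - 1) / (exp y + 1))"
        by (simp only: norm_mult norm_of_real norm_ii mult_1 abs_of_nonneg mult_right_mono)
    qed simp
  qed
  have tF: "((\<lambda>y. FA B (t y)) \<longlongrightarrow> GA B) (at_right 0)"
    unfolding t_def by (rule tendsto_jost_0(1)[OF B])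
  have "((\<lambda>y. exp (\<i> * B * (\<i> * of_real y)) * (\<i> * B * FA B (t y) * (\<i> * of_real (tanh (y / 2)))
        + 2 * \<i> * (t y * FA1 B (t y) * (\<i> * of_real (tanh (y / 2))))))
     \<longlongrightarrow> exp (\<i> * B * (\<i> * of_real 0)) * (\<i> * B * GA B * (\<i> * of_real (tanh (0 / 2))) + 2 * \<i> * 0)) (at_right 0)"
    by (intro tendsto_intros 1 tF) auto
  moreover have "jost1 B (\<i> * of_real y) * (\<i> * of_real (tanh (y / 2))) = exp (\<i> * B * (\<i> * of_real y)) * (\<i> * B * FA B (t y) * (\<i> * of_real (tanh (y / 2)))
        + 2 * \<i> * (t y * FA1 B (t y) * (\<i> * of_real (tanh (y / 2)))))" for y
  proof -
    have ty: "exp (2 * \<i> * (\<i> * of_real y)) = t y" unfolding t_def ..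
    show ?thesis unfolding jost1_def ty by (simp only: distrib_left distrib_right mult.assoc)
  qed
  ultimately show ?thesis by simp
qed

text \<open>The Wronskian of two solutions is a constant multiple of sin theta. Along the imaginary
  axis this constant is seen to be 0, so \<open>nf A\<close> and \<open>rec A\<close> are
  proportional. A half-disc is used because \<open>nf\<close> satisfies the equation for Im theta >
  0; it is convex, so a vanishing derivative gives a constant.\<close>

lemma nf_eq_rec_near_0:
  assumes A: "adm A"
  obtains k d where "d > 0" "\<And>\<theta>. Im \<theta> > 0 \<Longrightarrow> norm \<theta> < d \<Longrightarrow> nf A \<theta> = k * rec A \<theta>"
proof -
  have cy: "isCont rec_y 0" unfolding rec_y_def[abs_def] by (intro continuous_intros) auto
  have G: "isCont (rec_G A) 0"
    unfolding rec_G_def by (rule DERIV_isCont[OF gauss_deriv1[OF two_not_nonpos_Int]]) simp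
  have G1: "isCont (deriv (rec_G A)) 0"
    unfolding rec_G_def by (rule DERIV_isCont[OF gauss_deriv2[OF two_not_nonpos_Int]]) simp
  have y0: "rec_y 0 = 0" by (simp add: rec_y_def)
  have cy': "(rec_y \<longlongrightarrow> rec_y 0) (nhds 0)"
    using cy unfolding isCont_def tendsto_at_iff_tendsto_nhds .
  have "isCont (rec_G A) (rec_y 0)" using G y0 by simp
  hence "((\<lambda>\<theta>. rec_G A (rec_y \<theta>)) \<longlongrightarrow> rec_G A (rec_y 0)) (nhds 0)"
    using cy' by (rule isCont_tendsto_compose)
  hence "\<forall>\<^sub>F \<theta> in nhds 0. rec_G A (rec_y \<theta>) \<noteq> 0"
    by (rule tendsto_imp_eventually_ne) (simp add: y0 rec_G_def)
  moreover have "\<forall>\<^sub>F \<theta> in nhds 0. norm (rec_y \<theta>) < 1"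
  proof (rule order_tendstoD(2))
    show "((\<lambda>\<theta>. norm (rec_y \<theta>)) \<longlongrightarrow> norm (rec_y 0)) (nhds 0)"
      by (rule tendsto_norm[OF cy'])
  qed (simp add: y0)
  ultimately have "\<forall>\<^sub>F \<theta> in nhds 0. rec_G A (rec_y \<theta>) \<noteq> 0 \<and> norm (rec_y \<theta>) < 1"
    by (rule eventually_conj)
  then obtain d where d: "d > 0" "\<And>\<theta>. norm \<theta> < d \<Longrightarrow> rec_G A (rec_y \<theta>) \<noteq> 0 \<and> norm (rec_y \<theta>) < 1"
    unfolding eventually_nhds_metric by (auto simp: dist_norm)
  define H where "H = ball 0 d \<inter> {\<theta>::complex. 0 < Im \<theta>}"
  have H: "convex H" unfolding H_def by (intro convex_Int convex_ball convex_halfspace_Im_gt)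
  have Hd: "Im \<theta> > 0" "norm (rec_y \<theta>) < 1" "sin \<theta> \<noteq> 0" "rec A \<theta> \<noteq> 0" if "\<theta> \<in> H" for \<theta>
  proof -
    show i: "Im \<theta> > 0" using that by (simp add: H_def)
    show "norm (rec_y \<theta>) < 1" "sin \<theta> \<noteq> 0" using d(2)[of \<theta>] that sin_upper_nonzero[OF i] by (auto simp: H_def)
    have "sin (\<theta> / 2) \<noteq> 0" by (rule sin_upper_nonzero) (use i in simp)
    thus "rec A \<theta> \<noteq> 0" using d(2)[of \<theta>] that by (auto simp: rec_def rec_y_def H_def)
  qed
  define W where "W = (\<lambda>\<theta>. (nf A \<theta> * rec1 A \<theta> - nf1 A \<theta> * rec A \<theta>) / sin \<theta>)"
  have dW: "(W has_field_derivative 0) (at \<theta> within H)" if "\<theta> \<in> H" for \<theta>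
  proof -
    note h = Hd[OF that]
    note n = nf_has_deriv[OF A h(1)]
    note r = rec_has_deriv[OF h(2), of A]
    have "(W has_field_derivative
       (((nf1 A \<theta> * rec1 A \<theta> + rec2 A \<theta> * nf A \<theta>) - (nf2 A \<theta> * rec A \<theta> + rec1 A \<theta> * nf1 A \<theta>)) * sin \<theta>
        - (nf A \<theta> * rec1 A \<theta> - nf1 A \<theta> * rec A \<theta>) * cos \<theta>) / (sin \<theta> * sin \<theta>)) (at \<theta>)"
      unfolding W_def by (intro DERIV_divide DERIV_diff DERIV_mult n r DERIV_sin h(3))
    moreover have "((nf1 A \<theta> * rec1 A \<theta> + rec2 A \<theta> * nf A \<theta>) - (nf2 A \<theta> * rec A \<theta> + rec1 A \<theta> * nf1 A \<theta>)) * sin \<theta>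
        - (nf A \<theta> * rec1 A \<theta> - nf1 A \<theta> * rec A \<theta>) * cos \<theta>
        = nf A \<theta> * (sin \<theta> * rec2 A \<theta> - cos \<theta> * rec1 A \<theta> + A * (A + 1) * sin \<theta> * rec A \<theta>)
        - rec A \<theta> * (sin \<theta> * nf2 A \<theta> - cos \<theta> * nf1 A \<theta> + A * (A + 1) * sin \<theta> * nf A \<theta>)"
      by (simp add: algebra_simps)
    ultimately have "(W has_field_derivative 0) (at \<theta>)"
      unfolding rec_ode[OF h(2)] nf_ode[OF A h(1)] by simp
    thus ?thesis by (rule has_field_derivative_at_within)
  qed
  obtain c where c: "\<And>\<theta>. \<theta> \<in> H \<Longrightarrow> W \<theta> = c"
    using has_field_derivative_zero_constant[OF H dW] by blast
  have "((\<lambda>y. W (\<i> * of_real y)) \<longlongrightarrow> 0) (at_right 0)"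
  proof -
    have ty: "((\<lambda>y::real. rec_y (\<i> * of_real y)) \<longlongrightarrow> 0) (at_right 0)"
    proof -
      have "((\<lambda>y::real. rec_y (\<i> * of_real y)) \<longlongrightarrow> rec_y (\<i> * of_real 0)) (at_right 0)"
        unfolding rec_y_def by (intro tendsto_intros) auto
      thus ?thesis by (simp add: y0)
    qed
    have tG: "((\<lambda>y::real. rec_G A (rec_y (\<i> * of_real y))) \<longlongrightarrow> 1) (at_right 0)"
      using isCont_tendsto_compose[OF G ty] by (simp add: rec_G_def)
    have tG1: "((\<lambda>y::real. deriv (rec_G A) (rec_y (\<i> * of_real y))) \<longlongrightarrow> deriv (rec_G A) 0) (at_right 0)"
      by (rule isCont_tendsto_compose[OF G1 ty])
    have tn: "((\<lambda>y::real. nf A (\<i> * of_real y)) \<longlongrightarrow> 0) (at_right 0)"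
    proof -
      have "((\<lambda>y::real. nf A (\<i> * of_real y)) \<longlongrightarrow> GA (- A - 1) / GA (- A - 1) - GA A / GA A) (at_right 0)"
        unfolding nf_def using GA_nonzero[OF A] GA_nonzero[OF adm_reflect[OF A]]
        by (intro tendsto_intros tendsto_jost_0 A adm_reflect) auto
      thus ?thesis using GA_nonzero[OF A] GA_nonzero[OF adm_reflect[OF A]] by simp
    qed
    have tn1: "((\<lambda>y::real. nf1 A (\<i> * of_real y) * (\<i> * of_real (tanh (y / 2)))) \<longlongrightarrow> 0) (at_right 0)"
    proof -
      have "((\<lambda>y::real. jost1 (- A - 1) (\<i> * of_real y) * (\<i> * of_real (tanh (y / 2))) / GA (- A - 1)
           - jost1 A (\<i> * of_real y) * (\<i> * of_real (tanh (y / 2))) / GA A) \<longlongrightarrow> 0 / GA (- A - 1) - 0 / GA A) (at_right 0)"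
        using GA_nonzero[OF A] GA_nonzero[OF adm_reflect[OF A]]
        by (intro tendsto_intros tendsto_jost1_0 A adm_reflect) auto
      moreover have "nf1 A (\<i> * of_real y) * (\<i> * of_real (tanh (y / 2))) = jost1 (- A - 1) (\<i> * of_real y) * (\<i> * of_real (tanh (y / 2))) / GA (- A - 1)
           - jost1 A (\<i> * of_real y) * (\<i> * of_real (tanh (y / 2))) / GA A" for y
        unfolding nf1_def left_diff_distrib by (simp only: times_divide_eq_left)
      ultimately show ?thesis by simp
    qed
    \<comment> \<open>This is W after the quotients of \<open>rec1\<close> and \<open>rec\<close> by
      sin theta have been simplified, so that every factor has a limit.\<close>
    have "((\<lambda>y::real. nf A (\<i> * of_real y) * ((rec_G A (rec_y (\<i> * of_real y)) + rec_y (\<i> * of_real y) * deriv (rec_G A) (rec_y (\<i> * of_real y))) / 2)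
        - nf1 A (\<i> * of_real y) * (\<i> * of_real (tanh (y / 2))) * (rec_G A (rec_y (\<i> * of_real y)) / 2))
        \<longlongrightarrow> 0 * ((1 + 0 * deriv (rec_G A) 0) / 2) - 0 * (1 / 2)) (at_right 0)"
      by (intro tendsto_intros tn ty tG tG1 tn1) auto
    hence "((\<lambda>y::real. nf A (\<i> * of_real y) * ((rec_G A (rec_y (\<i> * of_real y)) + rec_y (\<i> * of_real y) * deriv (rec_G A) (rec_y (\<i> * of_real y))) / 2)
        - nf1 A (\<i> * of_real y) * (\<i> * of_real (tanh (y / 2))) * (rec_G A (rec_y (\<i> * of_real y)) / 2)) \<longlongrightarrow> 0) (at_right 0)"
      by simp
    moreover have "\<forall>\<^sub>F y::real in at_right 0. nf A (\<i> * of_real y) * ((rec_G A (rec_y (\<i> * of_real y)) + rec_y (\<i> * of_real y) * deriv (rec_G A) (rec_y (\<i> * of_real y))) / 2)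
        - nf1 A (\<i> * of_real y) * (\<i> * of_real (tanh (y / 2))) * (rec_G A (rec_y (\<i> * of_real y)) / 2) = W (\<i> * of_real y)"
    proof (rule eventually_at_rightI[of 0 1])
      fix y :: real assume y: "y \<in> {0<..<1}"
      define \<theta> where "\<theta> = \<i> * complex_of_real y"
      define s c where "s = sin (\<theta> / 2)" and "c = cos (\<theta> / 2)"
      have s: "s \<noteq> 0" unfolding s_def by (rule sin_upper_nonzero) (use y in \<open>simp add: \<theta>_def\<close>)
      have S: "sin \<theta> = 2 * s * c" using sin_double[of "\<theta> / 2"] by (simp add: s_def c_def)
      have "sin \<theta> \<noteq> 0" by (rule sin_upper_nonzero) (use y in \<open>simp add: \<theta>_def\<close>)
      hence c: "c \<noteq> 0" using S by auto
      have T: "\<i> * of_real (tanh (y / 2)) = s / c"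
        using tan_imaginary[of "y / 2"] by (simp add: s_def c_def \<theta>_def)
      have "n * ((g + s * s * g1) / 2) - n1 * (s / c) * (g / 2) = (n * ((g + s * s * g1) * (2 * s * c / 2)) - n1 * (s * s * g)) / (2 * s * c)"
        for n n1 g g1 using s c by (simp add: divide_simps) (simp add: algebra_simps)
      thus "nf A (\<i> * of_real y) * ((rec_G A (rec_y (\<i> * of_real y)) + rec_y (\<i> * of_real y) * deriv (rec_G A) (rec_y (\<i> * of_real y))) / 2)
        - nf1 A (\<i> * of_real y) * (\<i> * of_real (tanh (y / 2))) * (rec_G A (rec_y (\<i> * of_real y)) / 2) = W (\<i> * of_real y)"
        unfolding T W_def rec_def rec1_def \<theta>_def[symmetric] S rec_y_def s_def[symmetric] .
    qed simp
    ultimately show ?thesis by (rule Lim_transform_eventually)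
  qed
  moreover have "\<forall>\<^sub>F y::real in at_right 0. W (\<i> * of_real y) = c"
    by (rule eventually_at_rightI[of 0 d]) (use d(1) in \<open>auto intro!: c simp: H_def norm_mult\<close>)
  ultimately have "((\<lambda>_::real. c) \<longlongrightarrow> 0) (at_right 0)" by (rule Lim_transform_eventually)
  hence c0: "c = 0" by (simp add: tendsto_const_iff)
  have "((\<lambda>\<theta>. nf A \<theta> / rec A \<theta>) has_field_derivative 0) (at \<theta> within H)" if "\<theta> \<in> H" for \<theta>
  proof -
    note h = Hd[OF that]
    have "((\<lambda>\<theta>. nf A \<theta> / rec A \<theta>) has_field_derivative (nf1 A \<theta> * rec A \<theta> - nf A \<theta> * rec1 A \<theta>) / (rec A \<theta> * rec A \<theta>)) (at \<theta>)"
      by (intro DERIV_divide nf_has_deriv(1)[OF A h(1)] rec_has_deriv(1)[OF h(2)] h(4))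
    moreover have "nf1 A \<theta> * rec A \<theta> - nf A \<theta> * rec1 A \<theta> = 0"
      using c[OF that] h(3) by (simp add: c0 W_def)
    ultimately show ?thesis by (auto intro: has_field_derivative_at_within)
  qed
  then obtain k where k: "\<And>\<theta>. \<theta> \<in> H \<Longrightarrow> nf A \<theta> / rec A \<theta> = k"
    using has_field_derivative_zero_constant[OF H, of "\<lambda>\<theta>. nf A \<theta> / rec A \<theta>"] by blast
  show thesis
  proof (rule that[OF d(1)])
    fix \<theta> :: complex assume "Im \<theta> > 0" "norm \<theta> < d"
    hence "\<theta> \<in> H" by (simp add: H_def)
    from k[OF this] Hd(4)[OF this] show "nf A \<theta> = k * rec A \<theta>" by (simp add: field_simps)
  qed
qed

text \<open>The series in \<open>rec\<close> converges where |sin(theta/2)| < 1. By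
  \<open>norm_rec_y\<close> this includes a thin rectangle around any compact part of (-pi, pi), to
  which the identity theorem carries the equality from the half-disc at 0.\<close>

lemma nf_eq_rec_near_real_axis:
  assumes A: "adm A" and d: "d > 0" and k: "\<And>\<theta>. Im \<theta> > 0 \<Longrightarrow> norm \<theta> < d \<Longrightarrow> nf A \<theta> = k * rec A \<theta>"
    and u: "0 < u" "u < pi"
  obtains v where "v > 0" "\<And>\<theta>. \<bar>Re \<theta>\<bar> < u \<Longrightarrow> \<bar>Im \<theta>\<bar> < v \<Longrightarrow> norm (rec_y \<theta>) < 1"
    "\<And>\<theta>. \<bar>Re \<theta>\<bar> < u \<Longrightarrow> \<bar>Im \<theta>\<bar> < v \<Longrightarrow> Im \<theta> > 0 \<Longrightarrow> nf A \<theta> = k * rec A \<theta>"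
proof -
  have cu: "cos u > - 1"
    using cos_monotone_0_pi[of u pi] u by simp
  have "isCont (cosh :: real \<Rightarrow> real) 0" by (intro continuous_intros)
  hence "(cosh \<longlongrightarrow> (cosh 0 :: real)) (nhds 0)"
    unfolding isCont_def tendsto_at_iff_tendsto_nhds .
  hence "\<forall>\<^sub>F y in nhds (0::real). cosh y < 2 + cos u"
    by (rule order_tendstoD(2)) (use cu in simp)
  then obtain v where v: "v > 0" "\<And>y. \<bar>y\<bar> < v \<Longrightarrow> cosh y < 2 + cos u"
    unfolding eventually_nhds_metric by (auto simp: dist_real_def)
  have y: "norm (rec_y \<theta>) < 1" if "\<bar>Re \<theta>\<bar> < u" "\<bar>Im \<theta>\<bar> < v" for \<theta>
  proof -
    have "cos u \<le> cos \<bar>Re \<theta>\<bar>" using that u by (intro cos_monotone_0_pi_le) auto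
    thus ?thesis unfolding norm_rec_y using v(2)[OF that(2)] by simp
  qed
  define R where "R = {\<theta>. Re \<theta> > - u} \<inter> {\<theta>. Re \<theta> < u} \<inter> {\<theta>. 0 < Im \<theta>} \<inter> {\<theta>. Im \<theta> < v}"
  have R: "open R" "convex R" unfolding R_def
    by (intro open_Int open_halfspace_Re_gt open_halfspace_Re_lt open_halfspace_Im_gt open_halfspace_Im_lt)
      (intro convex_Int convex_halfspace_Re_gt convex_halfspace_Re_lt convex_halfspace_Im_gt convex_halfspace_Im_lt)
  have nf: "nf A \<theta> = k * rec A \<theta>" if "\<bar>Re \<theta>\<bar> < u" "\<bar>Im \<theta>\<bar> < v" "Im \<theta> > 0" for \<theta>
  proof (rule analytic_continuation_open[where f = "nf A" and g = "\<lambda>\<theta>. k * rec A \<theta>" and z = \<theta> and s' = R and s = "R \<inter> ball 0 d"])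
    have "\<i> * of_real (min d v / 2) \<in> R \<inter> ball 0 d" using d v u by (auto simp: R_def norm_mult)
    thus "R \<inter> ball 0 d \<noteq> {}" by blast
    show "open (R \<inter> ball 0 d)" using R by auto
    show "connected R" using R by (simp add: convex_connected)
    show "nf A holomorphic_on R" unfolding holomorphic_on_open[OF R(1)]
      using nf_has_deriv(1)[OF A] by (auto simp: R_def)
    show "(\<lambda>\<theta>. k * rec A \<theta>) holomorphic_on R" unfolding holomorphic_on_open[OF R(1)]
    proof
      fix z assume "z \<in> R"
      hence "norm (rec_y z) < 1" by (intro y) (auto simp: R_def)
      from DERIV_cmult[OF rec_has_deriv(1)[OF this]] show "\<exists>f'. ((\<lambda>\<theta>. k * rec A \<theta>) has_field_derivative f') (at z)" by blast
    qed
    show "\<theta> \<in> R" using that by (auto simp: R_def)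
  qed (use k R in \<open>auto simp: R_def\<close>)
  show thesis by (rule that[OF v(1) y nf])
qed

text \<open>On the upper half of the strip \<open>nf\<close> agrees, up to a constant, with the solution vanishing to second order
  at \<open>\<theta> = 0\<close>, which is even; this continues it across the real axis.\<close>

definition qprop :: "complex \<Rightarrow> (complex \<Rightarrow> complex) \<Rightarrow> bool" where
  "qprop A q \<longleftrightarrow> q holomorphic_on {\<theta>. \<bar>Re \<theta>\<bar> < pi} \<and>
     (\<forall>\<theta>. \<bar>Re \<theta>\<bar> < pi \<longrightarrow> Im \<theta> \<ge> 0 \<longrightarrow> q \<theta> = nf A \<theta> \<and> q (- \<theta>) = nf A \<theta>)"

lemma open_strip: "open {\<theta>::complex. \<bar>Re \<theta>\<bar> < pi}"
  by (intro open_Collect_less continuous_intros)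

text \<open>Take \<open>nf A\<close> above the real axis and its reflection below; on the axis the
  two are joined by the multiple k of \<open>rec A\<close>, which is even and holomorphic across
  it.\<close>

lemma ex_qprop:
  assumes A: "adm A"
  shows "\<exists>q. qprop A q"
proof -
  obtain k d where d: "d > 0" and k: "\<And>\<theta>. Im \<theta> > 0 \<Longrightarrow> norm \<theta> < d \<Longrightarrow> nf A \<theta> = k * rec A \<theta>"
    using nf_eq_rec_near_0[OF A] by blast
  define q where "q = (\<lambda>\<theta>. if Im \<theta> > 0 then nf A \<theta> else if Im \<theta> < 0 then nf A (- \<theta>) else k * rec A \<theta>)"
  have loc: "\<exists>v>0. \<forall>z. \<bar>Re z\<bar> < u \<longrightarrow> \<bar>Im z\<bar> < v \<longrightarrow> norm (rec_y z) < 1 \<and> q z = k * rec A z"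
    if u: "0 < u" "u < pi" for u
  proof -
    obtain v where v: "v > 0" "\<And>\<theta>. \<bar>Re \<theta>\<bar> < u \<Longrightarrow> \<bar>Im \<theta>\<bar> < v \<Longrightarrow> norm (rec_y \<theta>) < 1"
      "\<And>\<theta>. \<bar>Re \<theta>\<bar> < u \<Longrightarrow> \<bar>Im \<theta>\<bar> < v \<Longrightarrow> Im \<theta> > 0 \<Longrightarrow> nf A \<theta> = k * rec A \<theta>"
      using nf_eq_rec_near_real_axis[OF A d k u] by blast
    have "q z = k * rec A z" if "\<bar>Re z\<bar> < u" "\<bar>Im z\<bar> < v" for z
      using v(3)[of z] v(3)[of "- z"] that by (auto simp: q_def rec_even)
    with v show ?thesis by blast
  qed
  have hol: "q holomorphic_on {\<theta>. \<bar>Re \<theta>\<bar> < pi}"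
    unfolding holomorphic_on_open[OF open_strip]
  proof
    fix z assume z: "z \<in> {\<theta>. \<bar>Re \<theta>\<bar> < pi}"
    consider "Im z > 0" | "Im z < 0" | "Im z = 0" by linarith
    thus "\<exists>f'. (q has_field_derivative f') (at z)"
    proof cases
      case 1
      have "(q has_field_derivative nf1 A z) (at z)"
        by (rule has_field_derivative_transform_within_open[OF nf_has_deriv(1)[OF A 1] open_halfspace_Im_gt[of 0]])
          (use 1 in \<open>auto simp: q_def\<close>)
      thus ?thesis by blast
    next
      case 2
      have "((\<lambda>z. nf A (- z)) has_field_derivative nf1 A (- z) * (- 1)) (at z)"
        by (rule DERIV_chain2[OF nf_has_deriv(1)[OF A]]) (use 2 in \<open>auto intro!: derivative_eq_intros\<close>)
      hence "(q has_field_derivative nf1 A (- z) * (- 1)) (at z)"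
        by (rule has_field_derivative_transform_within_open[OF _ open_halfspace_Im_lt[of 0]])
          (use 2 in \<open>auto simp: q_def\<close>)
      thus ?thesis by blast
    next
      case 3
      define u where "u = (\<bar>Re z\<bar> + pi) / 2"
      have u: "0 < u" "u < pi" "\<bar>Re z\<bar> < u" using z pi_gt_zero by (auto simp: u_def)
      obtain v where v: "v > 0" "\<And>z. \<bar>Re z\<bar> < u \<Longrightarrow> \<bar>Im z\<bar> < v \<Longrightarrow> norm (rec_y z) < 1 \<and> q z = k * rec A z"
        using loc[OF u(1,2)] by blast
      have op: "open {z. \<bar>Re z\<bar> < u \<and> \<bar>Im z\<bar> < v}"
        by (intro open_Collect_conj open_Collect_less continuous_intros)
      have "((\<lambda>z. k * rec A z) has_field_derivative k * rec1 A z) (at z)"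
        using v(2)[of z] u 3 v(1) by (intro DERIV_cmult rec_has_deriv(1)) auto
      hence "(q has_field_derivative k * rec1 A z) (at z)"
        by (rule has_field_derivative_transform_within_open[OF _ op]) (use u 3 v in auto)
      thus ?thesis by blast
    qed
  qed
  \<comment> \<open>On the axis \<open>q\<close> is defined by \<open>rec\<close>; its equality with
    \<open>nf\<close>, which there is a boundary value of the Jost series, follows by continuity
    from above.\<close>
  have q1: "q \<theta> = nf A \<theta>" if "\<bar>Re \<theta>\<bar> < pi" "Im \<theta> \<ge> 0" for \<theta>
  proof (cases "Im \<theta> > 0")
    case True
    thus ?thesis by (simp add: q_def)
  next
    case False
    define g where "g = (\<lambda>y. \<theta> + \<i> * complex_of_real y)"
    have g: "(g \<longlongrightarrow> \<theta>) (at_right 0)"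
    proof -
      have "(g \<longlongrightarrow> \<theta> + \<i> * complex_of_real 0) (at_right 0)"
        unfolding g_def by (intro tendsto_intros)
      thus ?thesis by simp
    qed
    have "isCont q \<theta>"
      using holomorphic_on_imp_continuous_on[OF hol] that(1) by (simp add: continuous_on_eq_continuous_at[OF open_strip])
    hence 1: "((\<lambda>y. q (g y)) \<longlongrightarrow> q \<theta>) (at_right 0)" using g by (rule isCont_tendsto_compose)
    have 2: "((\<lambda>y. nf A (g y)) \<longlongrightarrow> nf A \<theta>) (at_right 0)"
      by (rule continuous_on_tendsto_compose[OF nf_continuous[OF A] g])
        (use that in \<open>auto simp: g_def intro!: eventually_at_rightI[of 0 1]\<close>)
    have "\<forall>\<^sub>F y in at_right 0. nf A (g y) = q (g y)"
      by (rule eventually_at_rightI[of 0 1]) (use that in \<open>auto simp: g_def q_def\<close>)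
    from Lim_transform_eventually[OF 2 this] 1 show ?thesis
      using tendsto_unique trivial_limit_at_right_real by blast
  qed
  have q2: "q (- \<theta>) = q \<theta>" for \<theta>
    by (auto simp: q_def rec_even)
  show ?thesis unfolding qprop_def using hol q1 q2 by auto
qed

definition qf :: "complex \<Rightarrow> complex \<Rightarrow> complex" where "qf A = (SOME q. qprop A q)"

lemma qf_qprop: "adm A \<Longrightarrow> qprop A (qf A)"
  unfolding qf_def using ex_qprop by (rule someI_ex)

lemma qf_holomorphic: "adm A \<Longrightarrow> qf A holomorphic_on {\<theta>. \<bar>Re \<theta>\<bar> < pi}"
  using qf_qprop by (auto simp: qprop_def)

lemma qf_eq_nf:
  "adm A \<Longrightarrow> \<bar>Re \<theta>\<bar> < pi \<Longrightarrow> Im \<theta> \<ge> 0 \<Longrightarrow> qf A \<theta> = nf A \<theta>"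
  "adm A \<Longrightarrow> \<bar>Re \<theta>\<bar> < pi \<Longrightarrow> Im \<theta> \<le> 0 \<Longrightarrow> qf A \<theta> = nf A (- \<theta>)"
  using qf_qprop[of A] unfolding qprop_def
  by (blast, metis abs_minus_cancel minus_minus neg_0_le_iff_le uminus_complex.sel)

lemma qf_has_deriv:
  "adm A \<Longrightarrow> \<bar>Re \<theta>\<bar> < pi \<Longrightarrow> (qf A has_field_derivative deriv (qf A) \<theta>) (at \<theta>)"
  by (rule holomorphic_derivI[OF qf_holomorphic open_strip]) auto

lemma deriv_qf:
  assumes A: "adm A" and re: "\<bar>Re \<theta>\<bar> < pi"
  shows "Im \<theta> > 0 \<Longrightarrow> deriv (qf A) \<theta> = nf1 A \<theta>" "Im \<theta> < 0 \<Longrightarrow> deriv (qf A) \<theta> = - nf1 A (- \<theta>)"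
proof -
  assume im: "Im \<theta> > 0"
  have op: "open {z. \<bar>Re z\<bar> < pi \<and> 0 < Im z}"
    by (intro open_Collect_conj open_Collect_less continuous_intros)
  have "(qf A has_field_derivative nf1 A \<theta>) (at \<theta>)"
    by (rule has_field_derivative_transform_within_open[OF nf_has_deriv(1)[OF A im] op])
      (use im re qf_eq_nf(1)[OF A] in auto)
  thus "deriv (qf A) \<theta> = nf1 A \<theta>" by (rule DERIV_imp_deriv)
next
  assume im: "Im \<theta> < 0"
  have op: "open {z. \<bar>Re z\<bar> < pi \<and> Im z < 0}"
    by (intro open_Collect_conj open_Collect_less continuous_intros)
  have "((\<lambda>z. nf A (- z)) has_field_derivative nf1 A (- \<theta>) * (- 1)) (at \<theta>)"
    by (rule DERIV_chain2[OF nf_has_deriv(1)[OF A]]) (use im in \<open>auto intro!: derivative_eq_intros\<close>)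
  hence "(qf A has_field_derivative nf1 A (- \<theta>) * (- 1)) (at \<theta>)"
    by (rule has_field_derivative_transform_within_open[OF _ op])
      (use im re qf_eq_nf(2)[OF A] in auto)
  thus "deriv (qf A) \<theta> = - nf1 A (- \<theta>)" using DERIV_imp_deriv by fastforce
qed

section \<open>The variable theta as a function of eta\<close>

text \<open>Off the cuts csqrt(1 - x^2) equals cos(Arcsin x) and has positive real part. This real
  part is cos(Re) cosh(Im), which confines Re(Arcsin x) to (-pi/2, pi/2); then Im x = cos(Re)
  sinh(Im) gives the signs.\<close>

lemma Arcsin_cut:
  assumes "1 - x^2 \<notin> \<real>\<^sub>\<le>\<^sub>0"
  shows "cos (Arcsin x) = csqrt (1 - x^2)" "\<bar>Re (Arcsin x)\<bar> < pi / 2"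
    "Im x > 0 \<Longrightarrow> Im (Arcsin x) > 0" "Im x < 0 \<Longrightarrow> Im (Arcsin x) < 0"
    "Im x = 0 \<Longrightarrow> Im (Arcsin x) = 0"
proof -
  define w where "w = \<i> * x + csqrt (1 - x^2)"
  have w: "w \<noteq> 0" unfolding w_def by (rule Arcsin_body_lemma)
  have e: "exp (\<i> * Arcsin x) = w" unfolding Arcsin_def w_def[symmetric] using w by (simp add: mult.assoc[symmetric])
  have "w * (csqrt (1 - x^2) - \<i> * x) = (csqrt (1 - x^2))^2 + x^2"
    unfolding w_def by (simp add: algebra_simps power2_eq_square del: power2_csqrt)
  hence "w * (csqrt (1 - x^2) - \<i> * x) = 1" by simp
  hence m: "csqrt (1 - x^2) - \<i> * x = exp (- (\<i> * Arcsin x))"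
    using w e by (simp add: exp_minus field_simps)
  show c: "cos (Arcsin x) = csqrt (1 - x^2)"
    unfolding cos_exp_eq e m[symmetric] by (simp add: w_def)
  have "Re (csqrt (1 - x^2)) > 0"
  proof -
    have "1 - (x^2) \<notin> \<real>\<^sub>\<le>\<^sub>0" using assms .
    hence "x^2 \<notin> complex_of_real ` {1..}" by (auto simp: complex_nonpos_Reals_iff)
    thus ?thesis by (rule cut_plane_csqrt(2))
  qed
  hence "cos (Re (Arcsin x)) * cosh (Im (Arcsin x)) > 0"
    unfolding c[symmetric] by (simp add: Re_cos cosh_def)
  moreover have "cosh (Im (Arcsin x)) > 0" by (rule cosh_real_pos)
  ultimately have cp: "cos (Re (Arcsin x)) > 0" using zero_less_mult_pos2 by blast
  show r: "\<bar>Re (Arcsin x)\<bar> < pi / 2"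
  proof (rule ccontr)
    assume "\<not> \<bar>Re (Arcsin x)\<bar> < pi / 2"
    moreover have "\<bar>Re (Arcsin x)\<bar> \<le> pi" by (rule Re_Arcsin_bound)
    ultimately have "cos \<bar>Re (Arcsin x)\<bar> \<le> cos (pi / 2)" by (intro cos_monotone_0_pi_le) auto
    with cp show False by simp
  qed
  have "Im x = Im (sin (Arcsin x))" by simp
  also have "\<dots> = cos (Re (Arcsin x)) * sinh (Im (Arcsin x))"
    by (simp only: Im_sin sinh_field_def)
  finally have i: "Im x = cos (Re (Arcsin x)) * sinh (Im (Arcsin x))" .
  show "Im x > 0 \<Longrightarrow> Im (Arcsin x) > 0" "Im x < 0 \<Longrightarrow> Im (Arcsin x) < 0" "Im x = 0 \<Longrightarrow> Im (Arcsin x) = 0"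
    using cp unfolding i by (simp_all add: zero_less_mult_iff mult_less_0_iff)
qed

lemma eta_domain_cut:
  assumes "\<eta> \<in> eta_domain"
  shows "1 - (2 * \<eta> - 1)^2 \<notin> \<real>\<^sub>\<le>\<^sub>0"
proof
  assume "1 - (2 * \<eta> - 1)^2 \<in> \<real>\<^sub>\<le>\<^sub>0"
  hence i: "Im ((2 * \<eta> - 1)^2) = 0" and r: "Re ((2 * \<eta> - 1)^2) \<ge> 1"
    by (auto simp: complex_nonpos_Reals_iff)
  from i have "Im \<eta> = 0 \<or> 2 * Re \<eta> - 1 = 0" by (simp add: power2_eq_square)
  moreover have "2 * Re \<eta> - 1 \<noteq> 0"
  proof
    assume "2 * Re \<eta> - 1 = 0"
    hence "Re ((2 * \<eta> - 1)^2) \<le> 0" by (simp add: power2_eq_square)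
    with r show False by simp
  qed
  ultimately have im: "Im \<eta> = 0" by simp
  hence "(2 * Re \<eta> - 1)^2 \<ge> 1" using r by (simp add: power2_eq_square)
  hence "\<bar>2 * Re \<eta> - 1\<bar> \<ge> 1" using abs_le_square_iff[of 1 "2 * Re \<eta> - 1"] by simp
  hence "Re \<eta> \<in> {..0} \<union> {1..}" by auto
  moreover have "\<eta> = of_real (Re \<eta>)" using im by (simp add: complex_eq_iff)
  ultimately have "\<eta> \<in> complex_of_real ` ({..0} \<union> {1..})" by (metis imageI)
  with assms show False by (simp add: eta_domain_def)
qed

lemma open_eta_domain: "open eta_domain"
  unfolding eta_domain_def image_Un by (intro open_Compl closed_Un closed_slot_left closed_slot_right)

lemma connected_eta_domain: "connected eta_domain"
proof (rule starlike_imp_connected)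
  show "starlike eta_domain"
    unfolding starlike_def
  proof (intro bexI[of _ "1 / 2"] ballI subsetI)
    show "1 / 2 \<in> eta_domain"
    proof -
      have "1 / 2 \<noteq> complex_of_real r" if "r \<le> 0 \<or> r \<ge> 1" for r using that by (auto simp: complex_eq_iff)
      thus ?thesis by (auto simp: eta_domain_def)
    qed
    fix x y assume x: "x \<in> eta_domain" and y: "y \<in> closed_segment (1 / 2) x"
    then obtain u where u: "0 \<le> u" "u \<le> 1" "y = (1 - of_real u) * (1 / 2) + of_real u * x"
      by (auto simp: in_segment scaleR_conv_of_real)
    show "y \<in> eta_domain"
    proof (rule ccontr)
      assume "y \<notin> eta_domain"
      then obtain r where r: "r \<le> 0 \<or> r \<ge> 1" "y = of_real r" by (auto simp: eta_domain_def)
      have re: "r = (1 - u) / 2 + u * Re x" and im: "u * Im x = 0" using u(3) r(2) by (auto simp: complex_eq_iff)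
      have u0: "u > 0" using re r u(1) by (cases "u = 0") auto
      have "Im x = 0" using im u0 by simp
      hence xr: "x = of_real (Re x)" by (simp add: complex_eq_iff)
      have "Re x \<le> 0 \<or> Re x \<ge> 1"
      proof (rule ccontr)
        assume "\<not> ?thesis"
        hence "u * Re x > 0" "u * Re x < u * 1" using u0 by (auto intro: mult_strict_left_mono)
        moreover have False if "0 < m" "m < v" "v \<le> 1" "(1 - v) / 2 + m \<le> 0 \<or> 1 \<le> (1 - v) / 2 + m" for m v :: real
          using that by (auto simp: field_simps)
        ultimately show False using r(1) u(2) unfolding re by simp
      qed
      hence "x \<notin> eta_domain" unfolding eta_domain_def by (subst xr) blast
      with x show False by simp
    qed
  qed
qed

text \<open>The arc cosine of 2 eta - 1 with values in the strip 0 < Re theta < pi on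
  \<open>eta_domain\<close>, so that eta = cos(theta/2)^2. The upper half-plane in eta corresponds
  to Im theta < 0.\<close>

definition theta_of :: "complex \<Rightarrow> complex" where "theta_of \<eta> = of_real (pi / 2) - Arcsin (2 * \<eta> - 1)"

lemma theta_of_props:
  assumes "\<eta> \<in> eta_domain"
  shows "0 < Re (theta_of \<eta>)" "Re (theta_of \<eta>) < pi" "cos (theta_of \<eta>) = 2 * \<eta> - 1" "Im \<eta> > 0 \<Longrightarrow> Im (theta_of \<eta>) < 0"
    "sin (theta_of \<eta>) \<noteq> 0"
    "(theta_of has_field_derivative - 2 / sin (theta_of \<eta>)) (at \<eta>)"
proof -
  note cut = eta_domain_cut[OF assms]
  show "0 < Re (theta_of \<eta>)" "Re (theta_of \<eta>) < pi" using Arcsin_cut(2)[OF cut] by (auto simp: theta_of_def)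
  show c: "cos (theta_of \<eta>) = 2 * \<eta> - 1"
    unfolding theta_of_def by (simp add: cos_diff)
  show "Im \<eta> > 0 \<Longrightarrow> Im (theta_of \<eta>) < 0" using Arcsin_cut(3)[OF cut] by (simp add: theta_of_def)
  have s: "sin (theta_of \<eta>) = cos (Arcsin (2 * \<eta> - 1))" unfolding theta_of_def by (simp add: sin_diff)
  have nz: "1 - (2 * \<eta> - 1)^2 \<noteq> 0" using cut by auto
  show sn: "sin (theta_of \<eta>) \<noteq> 0" unfolding s Arcsin_cut(1)[OF cut] using nz by simp
  have "(Arcsin has_field_derivative inverse (cos (Arcsin (2 * \<eta> - 1)))) (at (2 * \<eta> - 1))"
  proof (rule has_field_derivative_Arcsin)
    assume "Im (2 * \<eta> - 1) = 0"
    hence "2 * \<eta> - 1 = of_real (Re (2 * \<eta> - 1))" by (simp add: complex_eq_iff)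
    hence "1 - (2 * \<eta> - 1)^2 = of_real (1 - (Re (2 * \<eta> - 1))^2)" by (metis of_real_1 of_real_diff of_real_power)
    with cut have "\<not> (1 - (Re (2 * \<eta> - 1))^2 \<le> 0)" by (metis nonpos_Reals_of_real_iff)
    thus "\<bar>Re (2 * \<eta> - 1)\<bar> < 1" using abs_square_less_1[of "Re (2 * \<eta> - 1)"] by linarith
  qed
  moreover have "((\<lambda>\<eta>. 2 * \<eta> - 1) has_field_derivative 2) (at \<eta>)"
    by (auto intro!: derivative_eq_intros)
  ultimately have "((\<lambda>\<eta>. Arcsin (2 * \<eta> - 1)) has_field_derivative inverse (cos (Arcsin (2 * \<eta> - 1))) * 2) (at \<eta>)"
    by (rule DERIV_chain2)
  hence "(theta_of has_field_derivative 0 - inverse (cos (Arcsin (2 * \<eta> - 1))) * 2) (at \<eta>)"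
    unfolding theta_of_def[abs_def] by (intro DERIV_diff DERIV_const)
  thus "(theta_of has_field_derivative - 2 / sin (theta_of \<eta>)) (at \<eta>)"
    unfolding s by (simp add: inverse_eq_divide)
qed

subsection \<open>Reduction of the matrix to a scalar solution\<close>

text \<open>\<open>cfun\<close> and \<open>pfun\<close> are exchanged by eta |-> 1 - eta, that is
  theta |-> pi - theta; the first vanishes as eta tends to 1, the second as eta tends to 0.\<close>

definition cfun :: "complex \<Rightarrow> complex \<Rightarrow> complex" where "cfun A \<eta> = qf A (theta_of \<eta>)"
definition pfun :: "complex \<Rightarrow> complex \<Rightarrow> complex" where "pfun A \<eta> = qf A (of_real pi - theta_of \<eta>)"

lemma cfun_pfun_deriv:
  assumes A: "adm A" and \<eta>: "\<eta> \<in> eta_domain"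
  shows "(cfun A has_field_derivative - 2 * deriv (qf A) (theta_of \<eta>) / sin (theta_of \<eta>)) (at \<eta>)"
    "(pfun A has_field_derivative 2 * deriv (qf A) (of_real pi - theta_of \<eta>) / sin (theta_of \<eta>)) (at \<eta>)"
proof -
  note t = theta_of_props[OF \<eta>]
  have "(cfun A has_field_derivative deriv (qf A) (theta_of \<eta>) * (- 2 / sin (theta_of \<eta>))) (at \<eta>)"
    unfolding cfun_def[abs_def] by (rule DERIV_chain2[OF qf_has_deriv[OF A] t(6)]) (use t in auto)
  thus "(cfun A has_field_derivative - 2 * deriv (qf A) (theta_of \<eta>) / sin (theta_of \<eta>)) (at \<eta>)" by (simp add: mult_ac)
  have "((\<lambda>\<eta>. of_real pi - theta_of \<eta>) has_field_derivative 0 - (- 2 / sin (theta_of \<eta>))) (at \<eta>)"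
    by (rule DERIV_diff[OF DERIV_const t(6)])
  hence "(pfun A has_field_derivative deriv (qf A) (of_real pi - theta_of \<eta>) * (0 - (- 2 / sin (theta_of \<eta>)))) (at \<eta>)"
    unfolding pfun_def[abs_def] by (intro DERIV_chain2[OF qf_has_deriv[OF A]]) (use t in auto)
  thus "(pfun A has_field_derivative 2 * deriv (qf A) (of_real pi - theta_of \<eta>) / sin (theta_of \<eta>)) (at \<eta>)" by (simp add: mult_ac)
qed

lemma cfun_pfun_holomorphic: "adm A \<Longrightarrow> cfun A holomorphic_on eta_domain" "adm A \<Longrightarrow> pfun A holomorphic_on eta_domain"
  unfolding holomorphic_on_open[OF open_eta_domain] using cfun_pfun_deriv by blast+

lemma jost_shift: "jost B (\<theta> + of_real pi) = exp (\<i> * B * of_real pi) * jost B \<theta>"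
proof -
  have "exp (2 * \<i> * (\<theta> + of_real pi)) = exp (2 * \<i> * \<theta>)"
    by (simp add: distrib_left exp_add exp_two_pi_i' mult_ac) 
  moreover have "exp (\<i> * B * (\<theta> + of_real pi)) = exp (\<i> * B * of_real pi) * exp (\<i> * B * \<theta>)"
    by (simp add: distrib_left exp_add)
  ultimately show ?thesis unfolding jost_def by simp
qed

lemma exp_plus_inverse_nonzero:
  assumes "Im A \<noteq> 0"
  shows "exp (\<i> * A * of_real pi) + 1 / exp (\<i> * A * of_real pi) \<noteq> 0"
proof
  define e where "e = exp (\<i> * A * of_real pi)"
  have e0: "e \<noteq> 0" by (simp add: e_def)
  assume "exp (\<i> * A * of_real pi) + 1 / exp (\<i> * A * of_real pi) = 0"
  hence "e * (e + 1 / e) = 0" unfolding e_def[symmetric] by simp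
  hence "e * e + 1 = 0" using e0 by (simp add: distrib_left)
  hence "e * e = - 1" by (simp only: eq_neg_iff_add_eq_0)
  hence "norm e * norm e = 1" by (metis norm_mult norm_minus_cancel norm_one)
  hence "norm e ^ 2 = 1" by (simp add: power2_eq_square)
  hence "norm e = 1" using power2_eq_1_iff[of "norm e"] norm_ge_zero[of e] by auto
  hence "Im A * pi = 0" by (simp add: e_def)
  with assms show False by simp
qed

text \<open>For Im eta > 0 both -theta and pi - theta lie in the upper half-plane, so
  \<open>cfun\<close> and \<open>pfun\<close> are combinations of the two Jost solutions at -theta;
  the shift by pi multiplies these by e and -1/e. The linear system has determinant -(e + 1/e),
  nonzero because Im A \<noteq> 0.\<close>

lemma jost_eq_cfun_pfun:
  assumes A: "adm A" and im: "Im \<eta> > 0" and \<eta>: "\<eta> \<in> eta_domain"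
  defines "e \<equiv> exp (\<i> * A * of_real pi)"
  shows "jost A (- theta_of \<eta>) / GA A = - (pfun A \<eta> + cfun A \<eta> / e) / (e + 1 / e)"
    "jost (- A - 1) (- theta_of \<eta>) / GA (- A - 1) = (e * cfun A \<eta> - pfun A \<eta>) / (e + 1 / e)"
proof -
  note t = theta_of_props[OF \<eta>]
  define N N' where "N = jost A (- theta_of \<eta>) / GA A" and "N' = jost (- A - 1) (- theta_of \<eta>) / GA (- A - 1)"
  have c: "cfun A \<eta> = N' - N"
    unfolding cfun_def N_def N'_def using t(1,2) t(4)[OF im] by (subst qf_eq_nf(2)[OF A]) (auto simp: nf_def)
  have e': "exp (\<i> * (- A - 1) * of_real pi) = - (1 / e)"
  proof -
    have "\<i> * (- A - 1) * of_real pi = - (\<i> * A * of_real pi) - \<i> * of_real pi" by (simp add: algebra_simps)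
    thus ?thesis by (simp add: e_def exp_diff exp_minus field_simps)
  qed
  have e0: "e \<noteq> 0" by (simp add: e_def)
  have p: "pfun A \<eta> = - (1 / e) * N' - e * N"
  proof -
    have "pfun A \<eta> = nf A (- theta_of \<eta> + of_real pi)"
      unfolding pfun_def using t(1,2) t(4)[OF im] by (subst qf_eq_nf(1)[OF A]) auto
    thus ?thesis unfolding nf_def jost_shift e' e_def[symmetric] N_def N'_def by simp
  qed
  have nz: "e + 1 / e \<noteq> 0" unfolding e_def by (rule exp_plus_inverse_nonzero[OF admD(4)[OF A]])
  have "pfun A \<eta> + cfun A \<eta> / e = - (N * (e + 1 / e))" unfolding c p by (simp add: algebra_simps diff_divide_distrib)
  thus "jost A (- theta_of \<eta>) / GA A = - (pfun A \<eta> + cfun A \<eta> / e) / (e + 1 / e)"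
    unfolding N_def[symmetric] using nz by simp
  have "e * cfun A \<eta> - pfun A \<eta> = N' * (e + 1 / e)" unfolding c p by (simp add: algebra_simps)
  thus "jost (- A - 1) (- theta_of \<eta>) / GA (- A - 1) = (e * cfun A \<eta> - pfun A \<eta>) / (e + 1 / e)"
    unfolding N'_def[symmetric] using nz by simp
qed

lemma half_plane_Upper_subset: "half_plane Upper \<subseteq> eta_domain" "open (half_plane Upper)" "half_plane Upper \<noteq> {}"
  by (auto simp: eta_domain_def open_halfspace_Im_gt intro: exI[of _ \<i>])

lemma hyp2F1_theta_of:
  assumes A: "Im A \<noteq> 0" and im: "Im \<eta> > 0"
  shows "\<eta> powr (- A) * hyp2F1 A (A + 1) (2 * A + 2) (1 / \<eta>) = 4 powr A * jost A (- theta_of \<eta>)"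
proof -
  have \<eta>: "\<eta> \<in> eta_domain" using half_plane_Upper_subset(1) im by auto
  note t = theta_of_props[OF \<eta>]
  have "(1 + cos (theta_of \<eta>)) / 2 = \<eta>" unfolding t(3) by simp
  from hyp2F1_theta[OF A t(1,2) t(4)[OF im], unfolded this]
  show ?thesis unfolding jost_def by simp
qed

definition conn_e :: "complex \<Rightarrow> complex" where "conn_e A = exp (\<i> * A * of_real pi)"
definition conn_K :: "complex \<Rightarrow> complex" where "conn_K A = 4 powr A * GA A / (conn_e A + 1 / conn_e A)"
definition conn_L :: "complex \<Rightarrow> complex" where "conn_L A = 4 powr (- A - 1) * GA (- A - 1) / (conn_e A + 1 / conn_e A)"

text \<open>On the upper half-plane this is \<open>jost_eq_cfun_pfun\<close>. The right side is
  holomorphic on all of \<open>eta_domain\<close> and is therefore the continuation across (0, 1)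
  that the definition asks for.\<close>

lemma h_inf_eq:
  assumes A: "adm A" and \<eta>: "\<eta> \<in> eta_domain"
  shows "h_inf A \<eta> = - conn_K A * (conn_e A * pfun A \<eta> + cfun A \<eta>)"
  unfolding h_inf_def
proof (rule analytic_continuation_eqI[OF _ open_eta_domain connected_eta_domain half_plane_Upper_subset(2,3,1) _ \<eta>])
  show "(\<lambda>\<eta>. - conn_K A * (conn_e A * pfun A \<eta> + cfun A \<eta>)) holomorphic_on eta_domain"
    by (intro holomorphic_intros cfun_pfun_holomorphic A)
  fix \<eta> assume "\<eta> \<in> half_plane Upper"
  hence im: "Im \<eta> > 0" by simp
  hence \<eta>: "\<eta> \<in> eta_domain" using half_plane_Upper_subset(1) by auto
  have e0: "conn_e A \<noteq> 0" by (simp add: conn_e_def)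
  have ex: "exp (A * of_real pi * \<i>) = conn_e A" by (simp add: conn_e_def mult_ac)
  have "exp (A * of_real pi * \<i>) * \<eta> powr (- A) * hyp2F1 A (A + 1) (2 * A + 2) (1 / \<eta>)
      = conn_e A * 4 powr A * (GA A * (jost A (- theta_of \<eta>) / GA A))"
    unfolding ex unfolding mult.assoc hyp2F1_theta_of[OF admD(4)[OF A] im] using GA_nonzero[OF A] by simp
  also have "\<dots> = - conn_K A * (conn_e A * pfun A \<eta> + cfun A \<eta>)"
  proof -
    have "e * f * (g * (- (p + c / e) / k)) = - (f * g / k) * (e * p + c)" if "e \<noteq> 0" for e f g p c k :: complex
    proof -
      have "e * f * (g * (- x / k)) = - (f * g / k) * (e * x)" for x by (simp add: mult_ac)
      from this[of "p + c / e"] have "e * f * (g * (- (p + c / e) / k)) = - (f * g / k) * (e * (p + c / e))" .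
      moreover have "e * (p + c / e) = e * p + c" using that by (simp add: distrib_left)
      ultimately show ?thesis by simp
    qed
    from this[OF e0] show ?thesis
      unfolding jost_eq_cfun_pfun(1)[OF A im \<eta>] conn_e_def[symmetric] conn_K_def .
  qed
  finally show "- conn_K A * (conn_e A * pfun A \<eta> + cfun A \<eta>)
    = exp (A * of_real pi * \<i>) * \<eta> powr (- A) * hyp2F1 A (A + 1) (2 * A + 2) (1 / \<eta>)" by simp
qed

lemma s_inf_eq:
  assumes A: "adm A" and \<eta>: "\<eta> \<in> eta_domain"
  shows "s_inf A \<eta> = - conn_L A * (cfun A \<eta> - pfun A \<eta> / conn_e A)"
  unfolding s_inf_def
proof (rule analytic_continuation_eqI[OF _ open_eta_domain connected_eta_domain half_plane_Upper_subset(2,3,1) _ \<eta>])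
  have e0: "conn_e A \<noteq> 0" by (simp add: conn_e_def)
  show "(\<lambda>\<eta>. - conn_L A * (cfun A \<eta> - pfun A \<eta> / conn_e A)) holomorphic_on eta_domain"
    by (intro holomorphic_intros cfun_pfun_holomorphic A e0)
  fix \<eta> assume "\<eta> \<in> half_plane Upper"
  hence im: "Im \<eta> > 0" by simp
  hence \<eta>: "\<eta> \<in> eta_domain" using half_plane_Upper_subset(1) by auto
  define B where "B = - A - 1"
  have B: "adm B" unfolding B_def by (rule adm_reflect[OF A])
  have ex: "exp (- A * of_real pi * \<i>) = 1 / conn_e A" by (simp add: conn_e_def exp_minus field_simps)
  have par: "- B = A + 1" "B + 1 = - A" "2 * B + 2 = - 2 * A" by (simp_all add: B_def)
  note H = hyp2F1_theta_of[OF admD(4)[OF B] im, unfolded par]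
  have "- exp (- A * of_real pi * \<i>) * \<eta> powr (A + 1) * hyp2F1 (- A - 1) (- A) (- 2 * A) (1 / \<eta>)
      = - (1 / conn_e A) * (4 powr B * (GA B * (jost B (- theta_of \<eta>) / GA B)))"
    unfolding ex B_def[symmetric] unfolding mult.assoc H using GA_nonzero[OF B] by simp
  also have "\<dots> = - conn_L A * (cfun A \<eta> - pfun A \<eta> / conn_e A)"
  proof -
    have "- (1 / e) * (f * (g * ((e * c - p) / k))) = - (f * g / k) * (c - p / e)" if "e \<noteq> 0" for e f g p c k :: complex
      using that by (simp add: right_diff_distrib diff_divide_distrib mult_ac)
    from this[OF e0] show ?thesis
      unfolding jost_eq_cfun_pfun(2)[OF A im \<eta>, folded B_def] conn_e_def[symmetric] conn_L_def B_def[symmetric] .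
  qed
  finally show "- conn_L A * (cfun A \<eta> - pfun A \<eta> / conn_e A)
    = - exp (- A * of_real pi * \<i>) * \<eta> powr (A + 1) * hyp2F1 (- A - 1) (- A) (- 2 * A) (1 / \<eta>)" by simp
qed

section \<open>Two-by-two matrix algebra and the role of Q\<close>

lemma mat2_nth [simp]:
  "mat2 p q r s $ 1 $ 1 = p"
  "mat2 p q r s $ 1 $ 2 = q"
  "mat2 p q r s $ 2 $ 1 = r"
  "mat2 p q r s $ 2 $ 2 = s"
  by (simp_all add: mat2_def)

lemma mat2_eqI:
  fixes A :: "complex^2^2"
  assumes "A $ 1 $ 1 = p" "A $ 1 $ 2 = q" "A $ 2 $ 1 = r" "A $ 2 $ 2 = s"
  shows "A = mat2 p q r s"
  using assms by (simp add: vec_eq_iff forall_2)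

lemma mat2_mult: "mat2 p q r s ** mat2 p' q' r' s' = mat2 (p * p' + q * r') (p * q' + q * s') (r * p' + s * r') (r * q' + s * s')"
  by (rule mat2_eqI) (simp_all add: matrix_matrix_mult_def sum_2)

lemma mat2_one: "mat 1 = mat2 1 0 0 1"
  by (rule mat2_eqI) (simp_all add: mat_def)

lemma mat2_add: "mat2 p q r s + mat2 p' q' r' s' = mat2 (p + p') (q + q') (r + r') (s + s')"
  by (rule mat2_eqI) simp_all

lemma cscale_mat2: "cscale c (mat2 p q r s) = mat2 (c * p) (c * q) (c * r) (c * s)"
  by (rule mat2_eqI) (simp_all add: cscale_def)

lemma det_mat2: "det (mat2 p q r s) = p * s - q * r"
  by (simp add: det_2)

lemma matrix_inv_right:
  fixes A :: "complex^2^2"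
  assumes "invertible A"
  shows "A ** matrix_inv A = mat 1"
proof -
  have "A ** matrix_inv A = mat 1 \<and> matrix_inv A ** A = mat 1"
    unfolding matrix_inv_def by (rule someI_ex) (use assms in \<open>simp add: invertible_def\<close>)
  thus ?thesis ..
qed

lemma matrix_inv_eqI:
  fixes A B :: "complex^2^2"
  assumes "A ** B = mat 1"
  shows "matrix_inv A = B"
proof -
  have BA: "B ** A = mat 1" using assms by (simp add: matrix_left_right_inverse)
  hence "invertible A" using assms by (auto simp: invertible_def)
  hence "A ** matrix_inv A = mat 1" by (simp add: matrix_inv_right)
  hence "B ** (A ** matrix_inv A) = B" by simp
  thus ?thesis unfolding matrix_mul_assoc BA by simp
qed

lemma matrix_inv_mult:
  fixes A B :: "complex^2^2"
  assumes "det (A ** B) \<noteq> 0"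
  shows "matrix_inv B ** matrix_inv A = matrix_inv (A ** B)"
proof -
  have "det A \<noteq> 0" "det B \<noteq> 0" using assms by (auto simp: det_mul)
  hence "invertible A" "invertible B" by (auto simp: invertible_det_nz)
  hence a: "A ** matrix_inv A = mat 1" "B ** matrix_inv B = mat 1" by (auto simp: matrix_inv_right)
  have "A ** B ** (matrix_inv B ** matrix_inv A) = A ** (B ** matrix_inv B) ** matrix_inv A"
    by (simp add: matrix_mul_assoc)
  also have "\<dots> = mat 1" unfolding a(2) using a(1) by simp
  finally show ?thesis by (rule matrix_inv_eqI[symmetric])
qed

lemma matrix_inv_mat2:
  assumes "p * s - q * r \<noteq> 0"
  defines "d \<equiv> p * s - q * r"
  shows "matrix_inv (mat2 p q r s) = mat2 (s / d) (- q / d) (- r / d) (p / d)"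
proof (rule matrix_inv_eqI)
  have d: "d \<noteq> 0" using assms by simp
  have "p * (s / d) + q * (- r / d) = (p * s - q * r) / d" "r * (- q / d) + s * (p / d) = (p * s - q * r) / d"
    "p * (- q / d) + q * (p / d) = 0" "r * (s / d) + s * (- r / d) = 0"
    by (simp_all add: diff_divide_distrib mult_ac)
  thus "mat2 p q r s ** mat2 (s / d) (- q / d) (- r / d) (p / d) = mat 1"
    unfolding mat2_mult mat2_one d_def[symmetric] using d by simp
qed

text \<open>By \<open>GA_reflect\<close> the Gamma quotient in \<open>Q_mat\<close> exactly balances
  the connection constants of \<open>s_inf\<close> and \<open>h_inf\<close>; this lets one constant
  be factored out in \<open>Gamma_hat_Q\<close>.\<close>

lemma conn_relation:
  assumes A: "adm A"
  shows "4 powr (2 * A + 1) * conn_e A * (Gamma (A + 3/2) * Gamma (A + 1/2) / (Gamma A * Gamma (A + 2))) * conn_L A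
     = conn_e A * tan (A * of_real pi) * conn_K A"
proof -
  define R where "R = Gamma (A + 3/2) * Gamma (A + 1/2) / (Gamma A * Gamma (A + 2))"
  have 1: "R * GA (- A - 1) = tan (A * of_real pi) * GA A"
    unfolding R_def by (rule GA_reflect[OF A])
  have 2: "4 powr (2 * A + 1) * 4 powr (- A - 1) = (4 :: complex) powr A"
    by (simp add: powr_add[symmetric])
  have gen: "4 powr (2 * A + 1) * e * R * (4 powr (- A - 1) * GA (- A - 1) / k) = (4 powr (2 * A + 1) * 4 powr (- A - 1)) * e * (R * GA (- A - 1)) / k" for e k
    by (simp add: mult_ac)
  show ?thesis unfolding conn_L_def conn_K_def R_def[symmetric] gen 1 2
    by (simp only: mult_ac times_divide_eq_left times_divide_eq_right)
qed

lemma deriv_h_inf: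
  assumes A: "adm A" and \<eta>: "\<eta> \<in> eta_domain"
  shows "deriv (h_inf A) \<eta> = - conn_K A * (conn_e A * deriv (pfun A) \<eta> + deriv (cfun A) \<eta>)"
    "deriv (s_inf A) \<eta> = - conn_L A * (deriv (cfun A) \<eta> - deriv (pfun A) \<eta> / conn_e A)"
proof -
  note c = cfun_pfun_deriv(1)[OF A \<eta>] and p = cfun_pfun_deriv(2)[OF A \<eta>]
  note c' = c[folded DERIV_imp_deriv[OF c]] and p' = p[folded DERIV_imp_deriv[OF p]]
  have "((\<lambda>\<eta>. - conn_K A * (conn_e A * pfun A \<eta> + cfun A \<eta>)) has_field_derivative
      - conn_K A * (conn_e A * deriv (pfun A) \<eta> + deriv (cfun A) \<eta>)) (at \<eta>)"
    by (intro DERIV_cmult DERIV_add c' p')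
  hence "(h_inf A has_field_derivative - conn_K A * (conn_e A * deriv (pfun A) \<eta> + deriv (cfun A) \<eta>)) (at \<eta>)"
    by (rule has_field_derivative_transform_within_open[OF _ open_eta_domain \<eta>]) (use h_inf_eq[OF A] in auto)
  thus "deriv (h_inf A) \<eta> = - conn_K A * (conn_e A * deriv (pfun A) \<eta> + deriv (cfun A) \<eta>)" by (rule DERIV_imp_deriv)
  have "((\<lambda>\<eta>. - conn_L A * (cfun A \<eta> - pfun A \<eta> / conn_e A)) has_field_derivative
      - conn_L A * (deriv (cfun A) \<eta> - deriv (pfun A) \<eta> / conn_e A)) (at \<eta>)"
    by (intro DERIV_cmult DERIV_diff DERIV_cdivide c' p')
  hence "(s_inf A has_field_derivative - conn_L A * (deriv (cfun A) \<eta> - deriv (pfun A) \<eta> / conn_e A)) (at \<eta>)"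
    by (rule has_field_derivative_transform_within_open[OF _ open_eta_domain \<eta>]) (use s_inf_eq[OF A] in auto)
  thus "deriv (s_inf A) \<eta> = - conn_L A * (deriv (cfun A) \<eta> - deriv (pfun A) \<eta> / conn_e A)" by (rule DERIV_imp_deriv)
qed

definition conn_C :: "complex \<Rightarrow> complex" where
  "conn_C A = tan (A * of_real pi) * conn_K A * (conn_e A * conn_e A + 1)"

text \<open>\<open>Q_mat\<close> changes from the solutions normalised at eta = \<infinity> to those
  vanishing at eta = 1 and at eta = 0. The constant common to all entries cancels in
  \<open>Gamma_of_a\<close>.\<close>

lemma Gamma_hat_Q:
  assumes A: "adm A" and \<eta>: "\<eta> \<in> eta_domain"
  shows "Gamma_hat A \<eta> ** Q_mat A = mat2 (conn_C A * cfun A \<eta>) (conn_C A * pfun A \<eta>)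
     (conn_C A * deriv (cfun A) \<eta>) (conn_C A * deriv (pfun A) \<eta>)"
proof -
  define e T K L q where "e = conn_e A" and "T = tan (A * of_real pi)" and "K = conn_K A" and "L = conn_L A"
    and "q = 4 powr (2 * A + 1) * conn_e A * (Gamma (A + 3/2) * Gamma (A + 1/2) / (Gamma A * Gamma (A + 2)))"
  have rel: "q * L = e * T * K" unfolding q_def e_def T_def K_def L_def by (rule conn_relation[OF A])
  have e0: "e \<noteq> 0" by (simp add: e_def conn_e_def)
  have ex: "exp (A * of_real pi * \<i>) = e" by (simp add: e_def conn_e_def mult_ac)
  have Q: "Q_mat A = mat2 (- T) (- T * e) (- q * e) q"
    unfolding Q_mat_def ex mat2_mult T_def[symmetric] q_def e_def[symmetric] by (simp add: mult_ac)
  have 1: "- K * (e * p + c) * (- T) + - L * (c - p / e) * (- q * e) = T * K * (e * e + 1) * c" for p c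
  proof -
    have "- K * (e * p + c) * (- T) + - L * (c - p / e) * (- q * e) = T * K * (e * p + c) + (q * L) * (e * c - p)"
      using e0 by (simp add: algebra_simps)
    thus ?thesis unfolding rel by (simp add: algebra_simps)
  qed
  have 2: "- K * (e * p + c) * (- T * e) + - L * (c - p / e) * q = T * K * (e * e + 1) * p" for p c
  proof -
    have "- K * (e * p + c) * (- T * e) + - L * (c - p / e) * q = T * K * e * (e * p + c) - (q * L) * (c - p / e)"
      by (simp add: algebra_simps)
    thus ?thesis unfolding rel using e0 by (simp add: algebra_simps)
  qed
  show ?thesis
    unfolding Gamma_hat_def Q mat2_mult h_inf_eq[OF A \<eta>] s_inf_eq[OF A \<eta>] deriv_h_inf[OF A \<eta>]
      e_def[symmetric] K_def[symmetric] L_def[symmetric] 1 2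
    unfolding conn_C_def T_def e_def K_def ..
qed

lemma conn_C_nonzero:
  assumes A: "adm A"
  shows "conn_C A \<noteq> 0"
proof -
  have im: "Im (A * of_real pi) \<noteq> 0" using admD(4)[OF A] by simp
  have "sin (A * of_real pi) \<noteq> 0" "cos (A * of_real pi) \<noteq> 0"
    using im unfolding sin_eq_0 cos_eq_0 by (force dest: arg_cong[where f = Im])+
  hence 1: "tan (A * of_real pi) \<noteq> 0" by (simp add: tan_def)
  have 2: "conn_e A + 1 / conn_e A \<noteq> 0"
    unfolding conn_e_def by (rule exp_plus_inverse_nonzero[OF admD(4)[OF A]])
  have e0: "conn_e A \<noteq> 0" by (simp add: conn_e_def)
  hence "conn_e A * conn_e A + 1 = conn_e A * (conn_e A + 1 / conn_e A)" by (simp add: distrib_left)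
  hence 3: "conn_e A * conn_e A + 1 \<noteq> 0" using 2 e0 by simp
  have "conn_K A \<noteq> 0" unfolding conn_K_def using 2 GA_nonzero[OF A] by simp
  with 1 3 show ?thesis unfolding conn_C_def by simp
qed

section \<open>The matrix in terms of quotients at theta = pi/2\<close>

text \<open>These quotients are what remains after the common constant has cancelled. The cos phi in
  \<open>deriv_quot\<close> comes from d theta / d eta = -2 / sin theta at theta = pi/2 \<plusminus>
  phi, and the A + 1 in \<open>slope_quot\<close> from the shear matrix in
  \<open>Gamma_of_a\<close>.\<close>

definition value_quot :: "complex \<Rightarrow> complex \<Rightarrow> complex" where
  "value_quot A \<phi> = qf A (of_real (pi / 2) + \<phi>) / qf A (of_real (pi / 2))"
definition deriv_quot :: "complex \<Rightarrow> complex \<Rightarrow> complex" where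
  "deriv_quot A \<phi> = deriv (qf A) (of_real (pi / 2) + \<phi>) / (deriv (qf A) (of_real (pi / 2)) * cos \<phi>)"
definition slope_quot :: "complex \<Rightarrow> complex" where
  "slope_quot A = deriv (qf A) (of_real (pi / 2)) / (qf A (of_real (pi / 2)) * (A + 1))"
definition Gphi :: "complex \<Rightarrow> complex \<Rightarrow> complex^2^2" where
  "Gphi A \<phi> = mat2 ((value_quot A \<phi> - sin \<phi> * slope_quot A * deriv_quot A \<phi> + deriv_quot A \<phi>) / 2)
     ((- value_quot A (- \<phi>) - sin \<phi> * slope_quot A * deriv_quot A (- \<phi>) + deriv_quot A (- \<phi>)) / 2)
     ((- value_quot A \<phi> + sin \<phi> * slope_quot A * deriv_quot A \<phi> + deriv_quot A \<phi>) / 2)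
     ((value_quot A (- \<phi>) + sin \<phi> * slope_quot A * deriv_quot A (- \<phi>) + deriv_quot A (- \<phi>)) / 2)"

lemma sigma2_conj: "sigma2 ** mat2 p q r s ** sigma2 = mat2 s (- r) (- q) p"
proof -
  have "\<i> * x * \<i> = - x" for x
  proof -
    have "\<i> * x * \<i> = (\<i> * \<i>) * x" by (simp only: mult_ac)
    thus ?thesis by simp
  qed
  thus ?thesis unfolding sigma2_def mat2_mult by simp
qed

lemma outside_nonzero:
  assumes "z \<notin> complex_of_real ` {-1..1}"
  shows "z \<noteq> 0"
  using assms by (metis atLeastAtMost_iff imageI le_numeral_extra(1) neg_le_0_iff_le of_real_0 zero_le_one)

lemma inverse_eta_domain:
  assumes z: "z \<notin> complex_of_real ` {-1..1}"
  shows "(1 / z + 1) / 2 \<in> eta_domain"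
proof (rule ccontr)
  have z0: "z \<noteq> 0" by (rule outside_nonzero[OF z])
  assume "(1 / z + 1) / 2 \<notin> eta_domain"
  then obtain r where r: "r \<le> 0 \<or> r \<ge> 1" "(1 / z + 1) / 2 = of_real r" by (auto simp: eta_domain_def)
  have "1 / z = of_real (2 * r - 1)" using r(2) by (simp add: field_simps)
  hence zr: "z = of_real (1 / (2 * r - 1))" using z0 by (metis divide_divide_eq_right div_by_1 mult_1 of_real_1 of_real_divide)
  have "1 / (2 * r - 1) \<in> {-1..1}" using r(1) by (auto simp: divide_simps)
  with z zr show False by blast
qed

lemma Gamma_of_a_eq_Gphi:
  assumes A: "adm A" and z: "z \<notin> complex_of_real ` {-1..1}"
    and P: "qf A (of_real (pi / 2)) \<noteq> 0" "deriv (qf A) (of_real (pi / 2)) \<noteq> 0"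
  shows "Gamma_of_a A z = Gphi A (Arcsin (1 / z))"
proof -
  have z0: "z \<noteq> 0" by (rule outside_nonzero[OF z])
  define \<eta> where "\<eta> = (z + 1) / (2 * z)"
  define \<phi> where "\<phi> = Arcsin (1 / z)"
  have e1: "2 * \<eta> - 1 = 1 / z" using z0 by (simp add: \<eta>_def field_simps)
  have "\<eta> = (1 / z + 1) / 2" using z0 by (simp add: \<eta>_def field_simps)
  hence \<eta>: "\<eta> \<in> eta_domain" using inverse_eta_domain[OF z] by (simp only:)
  have t: "theta_of \<eta> = of_real (pi / 2) - \<phi>" unfolding theta_of_def e1 \<phi>_def ..
  have pt: "of_real pi - theta_of \<eta> = of_real (pi / 2) + \<phi>" unfolding t by (simp add: field_simps)
  have st: "sin (theta_of \<eta>) = cos \<phi>" unfolding t by (simp add: sin_diff)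
  have c0: "cos \<phi> \<noteq> 0" using theta_of_props(5)[OF \<eta>] st by simp
  have half: "1 / 2 \<in> eta_domain"
  proof -
    have "1 / 2 \<noteq> complex_of_real r" if "r \<le> 0 \<or> r \<ge> 1" for r using that by (auto simp: complex_eq_iff)
    thus ?thesis by (auto simp: eta_domain_def)
  qed
  have th2: "theta_of (1 / 2) = of_real (pi / 2)" by (simp add: theta_of_def)
  define p0 d0 where "p0 = qf A (of_real (pi / 2))" and "d0 = deriv (qf A) (of_real (pi / 2))"
  have pp: "of_real pi - of_real (pi / 2) = complex_of_real (pi / 2)" by (simp add: field_simps)
  have h: "cfun A (1 / 2) = p0" "pfun A (1 / 2) = p0" "deriv (cfun A) (1 / 2) = - 2 * d0" "deriv (pfun A) (1 / 2) = 2 * d0"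
    unfolding cfun_def pfun_def DERIV_imp_deriv[OF cfun_pfun_deriv(1)[OF A half]] DERIV_imp_deriv[OF cfun_pfun_deriv(2)[OF A half]] th2 pp p0_def d0_def
    by simp_all
  define C where "C = conn_C A"
  have C0: "C \<noteq> 0" unfolding C_def by (rule conn_C_nonzero[OF A])
  define c c1 p p1 where "c = cfun A \<eta>" and "c1 = deriv (cfun A) \<eta>" and "p = pfun A \<eta>" and "p1 = deriv (pfun A) \<eta>"
  have P0: "p0 \<noteq> 0" "d0 \<noteq> 0" using P by (simp_all add: p0_def d0_def)
  \<comment> \<open>The determinant at eta = 1/2. This point is fixed by eta |-> 1 - eta, so the two
    columns there agree in the first row and differ by sign in the second.\<close>
  define dd where "dd = 4 * C * C * p0 * d0"
  have dd0: "dd \<noteq> 0" using C0 P0 by (simp add: dd_def)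
  have W: "Gamma_hat A (1 / 2) ** Q_mat A = mat2 (C * p0) (C * p0) (C * (- 2 * d0)) (C * (2 * d0))"
    unfolding Gamma_hat_Q[OF A half] h C_def ..
  have dW: "(C * p0) * (C * (2 * d0)) - (C * p0) * (C * (- 2 * d0)) = dd"
    by (simp add: dd_def)
  define \<tau> where "\<tau> = 1 / (2 * z * (A + 1))"
  have inv: "matrix_inv (Q_mat A) ** matrix_inv (Gamma_hat A (1 / 2))
      = mat2 (C * (2 * d0) / dd) (- (C * p0) / dd) (- (C * (- 2 * d0)) / dd) (C * p0 / dd)"
    using matrix_inv_mult[of "Gamma_hat A (1 / 2)" "Q_mat A"] matrix_inv_mat2[of "C * p0" "C * (2 * d0)" "C * p0" "C * (- 2 * d0)"] dd0
    unfolding W det_mat2 dW by simp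
  have "Gamma_of_a A z = sigma2 ** (mat2 (C * (2 * d0) / dd) (- (C * p0) / dd) (- (C * (- 2 * d0)) / dd) (C * p0 / dd)
      ** mat2 1 (- \<tau>) 0 1 ** mat2 (C * c) (C * p) (C * c1) (C * p1)) ** sigma2"
  proof -
    have t: "- 1 / (2 * z * (A + 1)) = - \<tau>" by (simp add: \<tau>_def)
    have "Gamma_of_a A z = sigma2 ** ((matrix_inv (Q_mat A) ** matrix_inv (Gamma_hat A (1 / 2)))
        ** mat2 1 (- \<tau>) 0 1 ** (Gamma_hat A \<eta> ** Q_mat A)) ** sigma2"
      unfolding Gamma_of_a_def \<eta>_def[symmetric] t by (simp only: matrix_mul_assoc)
    thus ?thesis unfolding inv Gamma_hat_Q[OF A \<eta>] C_def c_def p_def c1_def p1_def .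
  qed
  also have "mat2 (C * (2 * d0) / dd) (- (C * p0) / dd) (- (C * (- 2 * d0)) / dd) (C * p0 / dd)
      ** mat2 1 (- \<tau>) 0 1 ** mat2 (C * c) (C * p) (C * c1) (C * p1)
     = mat2 ((c - \<tau> * c1) / (2 * p0) - c1 / (4 * d0)) ((p - \<tau> * p1) / (2 * p0) - p1 / (4 * d0))
        ((c - \<tau> * c1) / (2 * p0) + c1 / (4 * d0)) ((p - \<tau> * p1) / (2 * p0) + p1 / (4 * d0))"
  proof -
    have 1: "C * (2 * d0) / dd * (C * u) = u / (2 * p0)" "C * p0 / dd * (C * u) = u / (4 * d0)" for u
      using C0 P0 by (simp_all add: dd_def)
    have 2: "C * (2 * d0) / dd * (- \<tau>) * (C * u) = - (\<tau> * u / (2 * p0))" for u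
      using C0 P0 by (simp add: dd_def)
    have "(C * (2 * d0) / dd * 1 + - (C * p0) / dd * 0) * (C * u) + (C * (2 * d0) / dd * - \<tau> + - (C * p0) / dd * 1) * (C * v)
       = C * (2 * d0) / dd * (C * u) + C * (2 * d0) / dd * (- \<tau>) * (C * v) - C * p0 / dd * (C * v)" for u v
      by (simp add: algebra_simps)
    hence 3: "(C * (2 * d0) / dd * 1 + - (C * p0) / dd * 0) * (C * u) + (C * (2 * d0) / dd * - \<tau> + - (C * p0) / dd * 1) * (C * v)
       = (u - \<tau> * v) / (2 * p0) - v / (4 * d0)" for u v
      unfolding 1 2 by (simp add: diff_divide_distrib)
    have "(- (C * (- 2 * d0)) / dd * 1 + C * p0 / dd * 0) * (C * u) + (- (C * (- 2 * d0)) / dd * - \<tau> + C * p0 / dd * 1) * (C * v)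
       = C * (2 * d0) / dd * (C * u) + C * (2 * d0) / dd * (- \<tau>) * (C * v) + C * p0 / dd * (C * v)" for u v
      by (simp add: algebra_simps)
    hence 4: "(- (C * (- 2 * d0)) / dd * 1 + C * p0 / dd * 0) * (C * u) + (- (C * (- 2 * d0)) / dd * - \<tau> + C * p0 / dd * 1) * (C * v)
       = (u - \<tau> * v) / (2 * p0) + v / (4 * d0)" for u v
      unfolding 1 2 by (simp add: diff_divide_distrib)
    show ?thesis unfolding mat2_mult 3 4 ..
  qed
  also have "sigma2 ** \<dots> ** sigma2 = Gphi A \<phi>"
  proof -
    have A1: "A + 1 \<noteq> 0" using admD(4)[OF A] by (auto simp: complex_eq_iff)
    have s: "sin \<phi> = 1 / z" by (simp add: \<phi>_def)
    have c: "c = value_quot A (- \<phi>) * p0" "p = value_quot A \<phi> * p0"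
      using P0 unfolding c_def p_def cfun_def pfun_def pt t value_quot_def p0_def by simp_all
    have c1: "c1 = - 2 * deriv_quot A (- \<phi>) * d0" "p1 = 2 * deriv_quot A \<phi> * d0"
      using P0 c0 unfolding c1_def p1_def DERIV_imp_deriv[OF cfun_pfun_deriv(1)[OF A \<eta>]] DERIV_imp_deriv[OF cfun_pfun_deriv(2)[OF A \<eta>]] pt st
      unfolding t deriv_quot_def d0_def by simp_all
    have tm: "\<tau> * (2 * y * d0) / (2 * p0) = sin \<phi> * slope_quot A * y / 2" for y
    proof -
      have "1 / (2 * z * b) * (2 * y * d) / (2 * p) = 1 / z * (d / (p * b)) * y / 2" for b d p :: complex
        by (simp add: mult_ac)
      thus ?thesis unfolding s slope_quot_def \<tau>_def p0_def[symmetric] d0_def[symmetric] .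
    qed
    have tm': "\<tau> * (- 2 * y * d0) / (2 * p0) = - (sin \<phi> * slope_quot A * y / 2)" for y
      using tm[of y] by simp
    have x: "x * p0 / (2 * p0) = x / 2" "2 * x * d0 / (4 * d0) = x / 2" "- 2 * x * d0 / (4 * d0) = - (x / 2)" for x
      using P0 by simp_all
    show ?thesis
      unfolding sigma2_conj Gphi_def c c1 diff_divide_distrib tm tm' x
      by (simp add: diff_divide_distrib add_divide_distrib algebra_simps)
  qed
  finally show ?thesis unfolding \<phi>_def .
qed

subsection \<open>Asymptotics of the scalar solution\<close>

text \<open>The point theta = pi/2 is t = exp(2 i theta) = -1. \<open>wexp\<close> is the quotient
  of exp(i A theta) at -pi/2 and at pi/2; it is exponentially small for Im A \<rightarrow>
  -\<infinity>. \<open>Jr\<close> and \<open>Jr1\<close> are the Jost solution and its derivative at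
  pi/2 + xi, divided by the value at pi/2.\<close>

definition fm :: "complex \<Rightarrow> complex" where "fm A = FA A (- 1)"
definition wexp :: "complex \<Rightarrow> complex" where "wexp A = exp (- (\<i> * of_real pi * A))"

definition Jr :: "complex \<Rightarrow> complex \<Rightarrow> complex" where
  "Jr B \<xi> = exp (\<i> * B * \<xi>) * (FA B (- exp (2 * \<i> * \<xi>)) / fm B)"
definition Jr1 :: "complex \<Rightarrow> complex \<Rightarrow> complex" where
  "Jr1 B \<xi> = exp (\<i> * B * \<xi>) * ((\<i> * B * FA B (- exp (2 * \<i> * \<xi>)) + 2 * \<i> * (- exp (2 * \<i> * \<xi>) * FA1 B (- exp (2 * \<i> * \<xi>)))) / fm B)"

text \<open>The limit of \<open>FA_estimate\<close> along a radius: \<open>FA\<close> is continuous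
  on the closed disc, and for a point t \<noteq> 1 of it 1 - t avoids the cut of the square
  root.\<close>

lemma FA_estimate_closed:
  assumes A: "adm A" and t: "norm t \<le> 1" "t \<noteq> 1"
  shows "norm (FA A t - csqrt (1 - t)) * norm (1 - t) \<le> 15 / \<bar>Im A\<bar>"
proof -
  define g where "g = (\<lambda>s::real. of_real s * t)"
  have g: "(g \<longlongrightarrow> t) (at_left 1)"
  proof -
    have "(g \<longlongrightarrow> of_real 1 * t) (at_left 1)" unfolding g_def by (intro tendsto_intros)
    thus ?thesis by simp
  qed
  have gn: "norm (g s) < 1" if "s \<in> {0<..<1}" for s
  proof -
    have "norm (g s) = s * norm t" using that by (simp add: g_def norm_mult)
    also have "\<dots> \<le> s * 1" using that t by (intro mult_left_mono) auto
    finally show ?thesis using that by simp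
  qed
  have nn: "1 - t \<notin> \<real>\<^sub>\<le>\<^sub>0"
  proof
    assume "1 - t \<in> \<real>\<^sub>\<le>\<^sub>0"
    hence "Re t \<ge> 1" "Im t = 0" by (auto simp: complex_nonpos_Reals_iff)
    moreover have "Re t \<le> 1" using complex_Re_le_cmod[of t] t by simp
    ultimately have "t = 1" by (simp add: complex_eq_iff)
    with t show False by simp
  qed
  have 1: "((\<lambda>s. FA A (g s)) \<longlongrightarrow> FA A t) (at_left 1)"
    by (rule continuous_on_tendsto_compose[OF FA_continuous[OF A] g])
      (use t in simp, rule eventually_at_leftI[of 0 1], use less_imp_le[OF gn] in auto)
  have 2: "((\<lambda>s. csqrt (1 - g s)) \<longlongrightarrow> csqrt (1 - t)) (at_left 1)"
    by (rule isCont_tendsto_compose[OF isCont_csqrt']) (use nn in \<open>auto intro!: tendsto_intros g continuous_intros\<close>)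
  have "((\<lambda>s. norm (FA A (g s) - csqrt (1 - g s)) * norm (1 - g s)) \<longlongrightarrow> norm (FA A t - csqrt (1 - t)) * norm (1 - t)) (at_left 1)"
    by (intro tendsto_intros 1 2 g)
  thus ?thesis
    by (rule tendsto_upperbound[where F = "at_left 1"])
      (auto intro!: eventually_at_leftI[of 0 1] FA_estimate[OF A] gn)
qed

lemma csqrt_2: "csqrt 2 = of_real (sqrt 2)"
  using csqrt_of_real_nonneg[of "2"] by simp

lemma fm_estimate:
  assumes A: "adm A"
  shows "norm (fm A - of_real (sqrt 2)) \<le> 15 / \<bar>Im A\<bar>"
proof -
  have "norm (FA A (- 1) - csqrt (1 - (- 1))) * norm (1 - (- 1 :: complex)) \<le> 15 / \<bar>Im A\<bar>"
    by (rule FA_estimate_closed[OF A]) auto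
  hence "norm (fm A - of_real (sqrt 2)) * 2 \<le> 15 / \<bar>Im A\<bar>" by (simp add: fm_def csqrt_2)
  thus ?thesis using norm_ge_zero[of "fm A - of_real (sqrt 2)"] by linarith
qed

text \<open>The threshold 50 makes the error at most 15/50 = 0.3, and sqrt 2 \<ge> 1.3 leaves
  1.\<close>

lemma fm_ge:
  assumes A: "adm A" and im: "\<bar>Im A\<bar> \<ge> 50"
  shows "norm (fm A) \<ge> 1"
proof -
  have "15 / \<bar>Im A\<bar> \<le> 15 / 50" using im by (intro divide_left_mono) auto
  hence 1: "norm (fm A - of_real (sqrt 2)) \<le> 3 / 10" using fm_estimate[OF A] by simp
  have "sqrt (1.3 ^ 2) \<le> sqrt (2::real)" by (intro real_sqrt_le_mono) (simp add: power2_eq_square)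
  hence 2: "sqrt 2 \<ge> (13 / 10 :: real)" by (simp add: real_sqrt_abs)
  have "norm (complex_of_real (sqrt 2)) \<le> norm (fm A) + norm (of_real (sqrt 2) - fm A)"
    by (rule norm_triangle_sub)
  thus ?thesis using 1 2 by (simp add: norm_minus_commute)
qed

lemma exp_two_i_shift: "exp (2 * \<i> * (of_real (pi / 2) + \<psi>)) = - exp (2 * \<i> * \<psi>)"
  "exp (2 * \<i> * (of_real (- pi / 2) - \<psi>)) = - exp (2 * \<i> * (- \<psi>))"
proof -
  have "2 * \<i> * (of_real (pi / 2) + \<psi>) = \<i> * of_real pi + 2 * \<i> * \<psi>" by (simp add: algebra_simps)
  thus "exp (2 * \<i> * (of_real (pi / 2) + \<psi>)) = - exp (2 * \<i> * \<psi>)" by (simp add: exp_add)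
  have "2 * \<i> * (of_real (- pi / 2) - \<psi>) = - (\<i> * of_real pi) + 2 * \<i> * (- \<psi>)" by (simp add: algebra_simps)
  thus "exp (2 * \<i> * (of_real (- pi / 2) - \<psi>)) = - exp (2 * \<i> * (- \<psi>))"
    by (simp only: exp_add exp_minus[of "\<i> * of_real pi"] exp_pi_i) simp
qed

definition Gc :: "complex \<Rightarrow> complex" where "Gc B = exp (\<i> * B * of_real (pi / 2)) * fm B / GA B"

lemma jost_Jr:
  assumes "fm B \<noteq> 0"
  shows "jost B (of_real (pi / 2) + \<psi>) / GA B = Gc B * Jr B \<psi>"
    "jost1 B (of_real (pi / 2) + \<psi>) / GA B = Gc B * Jr1 B \<psi>"
    "jost B (of_real (- pi / 2) - \<psi>) / GA B = Gc B * wexp B * Jr B (- \<psi>)"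
    "jost1 B (of_real (- pi / 2) - \<psi>) / GA B = Gc B * wexp B * Jr1 B (- \<psi>)"
proof -
  have 1: "exp (\<i> * B * (of_real (pi / 2) + \<psi>)) = exp (\<i> * B * of_real (pi / 2)) * exp (\<i> * B * \<psi>)"
    by (simp only: distrib_left exp_add)
  have 2: "exp (\<i> * B * (of_real (- pi / 2) - \<psi>)) = exp (\<i> * B * of_real (pi / 2)) * wexp B * exp (\<i> * B * (- \<psi>))"
  proof -
    have "\<i> * B * (of_real (- pi / 2) - \<psi>) = \<i> * B * of_real (pi / 2) + - (\<i> * of_real pi * B) + \<i> * B * (- \<psi>)"
      by (simp add: algebra_simps)
    thus ?thesis unfolding wexp_def by (simp only: exp_add)
  qed
  have g: "e * v * x / g = e * f / g * (v * (x / f))" "e * w * v * x / g = e * f / g * w * (v * (x / f))"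
    if "f \<noteq> 0" for e v x f g w :: complex
    using that by simp_all
  show "jost B (of_real (pi / 2) + \<psi>) / GA B = Gc B * Jr B \<psi>"
    unfolding jost_def Gc_def Jr_def exp_two_i_shift 1 by (rule g(1)[OF assms])
  show "jost1 B (of_real (pi / 2) + \<psi>) / GA B = Gc B * Jr1 B \<psi>"
    unfolding jost1_def Gc_def Jr1_def exp_two_i_shift 1 by (rule g(1)[OF assms])
  show "jost B (of_real (- pi / 2) - \<psi>) / GA B = Gc B * wexp B * Jr B (- \<psi>)"
    unfolding jost_def Gc_def Jr_def exp_two_i_shift 2 by (rule g(2)[OF assms])
  show "jost1 B (of_real (- pi / 2) - \<psi>) / GA B = Gc B * wexp B * Jr1 B (- \<psi>)"
    unfolding jost1_def Gc_def Jr1_def exp_two_i_shift 2 by (rule g(2)[OF assms])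
qed

lemma wexp_reflect: "wexp (- A - 1) = - (1 / wexp A)"
proof -
  have "- (\<i> * of_real pi * (- A - 1)) = \<i> * of_real pi + - (- (\<i> * of_real pi * A))" by (simp add: algebra_simps)
  hence "wexp (- A - 1) = exp (\<i> * of_real pi) * exp (- (- (\<i> * of_real pi * A)))"
    unfolding wexp_def by (simp only: exp_add)
  thus ?thesis unfolding wexp_def exp_minus[of "- (\<i> * of_real pi * A)"] by (simp add: inverse_eq_divide)
qed

text \<open>Up to factors \<open>wexp A\<close> and signs these are the coefficients of the two Jost
  solutions when the solution is normalised to 1 at pi/2. Both tend to 1 as \<open>wexp A\<close>
  tends to 0.\<close>

definition mu1 :: "complex \<Rightarrow> complex" where "mu1 A = (1 + wexp A) / (1 + wexp A * wexp A)"
definition mu2 :: "complex \<Rightarrow> complex" where "mu2 A = (1 - wexp A) / (1 + wexp A * wexp A)"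
definition mid_value :: "complex \<Rightarrow> complex" where "mid_value A = qf A (of_real (pi / 2))"

lemma norm_wexp: "norm (wexp A) = exp (pi * Im A)"
  by (simp add: wexp_def)

definition adm_low :: "complex \<Rightarrow> bool" where "adm_low A \<longleftrightarrow> adm A \<and> Im A \<le> - 50"

lemma wexp_bound:
  assumes "Im A \<le> - 50"
  shows "norm (wexp A) \<le> 1 / \<bar>Im A\<bar>" "norm (wexp A) \<le> 1 / 50" "wexp A \<noteq> 0"
    "1 + wexp A * wexp A \<noteq> 0" "1 + wexp A \<noteq> 0" "1 / 2 \<le> norm (1 + wexp A * wexp A)"
proof -
  define \<tau> where "\<tau> = - Im A"
  have \<tau>: "\<tau> \<ge> 50" using assms by (simp add: \<tau>_def)
  have "norm (wexp A) = 1 / exp (pi * \<tau>)" by (simp add: norm_wexp \<tau>_def exp_minus field_simps)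
  also have "\<dots> \<le> 1 / \<tau>"
  proof (intro divide_left_mono)
    have "1 * \<tau> \<le> pi * \<tau>" using \<tau> pi_gt3 by (intro mult_right_mono) auto
    thus "\<tau> \<le> exp (pi * \<tau>)" using exp_ge_add_one_self[of "pi * \<tau>"] by linarith
  qed (use \<tau> in auto)
  finally show 1: "norm (wexp A) \<le> 1 / \<bar>Im A\<bar>" using assms by (simp add: \<tau>_def)
  have "1 / \<bar>Im A\<bar> \<le> 1 / 50" using assms by (intro divide_left_mono) auto
  with 1 show 2: "norm (wexp A) \<le> 1 / 50" by linarith
  show "wexp A \<noteq> 0" by (simp add: wexp_def)
  have "norm (wexp A * wexp A) \<le> (1 / 50) * (1 / 50)" unfolding norm_mult using 2 by (intro mult_mono) auto
  moreover have "norm (1::complex) \<le> norm (1 + wexp A * wexp A) + norm (- (wexp A * wexp A))"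
    using norm_triangle_ineq[of "1 + wexp A * wexp A" "- (wexp A * wexp A)"] by simp
  ultimately show 3: "1 / 2 \<le> norm (1 + wexp A * wexp A)" by simp
  thus "1 + wexp A * wexp A \<noteq> 0" by auto
  show "1 + wexp A \<noteq> 0"
  proof
    assume "1 + wexp A = 0"
    hence "wexp A = - 1" by (simp add: eq_neg_iff_add_eq_0 add.commute)
    with 2 show False by simp
  qed
qed

text \<open>The value at pi/2 is obtained twice, from \<open>nf\<close> at pi/2 and, by evenness,
  from \<open>nf\<close> at -pi/2. The two expressions form a linear system for \<open>Gc A\<close>
  and \<open>Gc (- A - 1)\<close>, which determines both exactly in terms of \<open>wexp A\<close>
  and that value.\<close>

lemma Gc_relation:
  assumes A: "adm_low A"
  shows "Gc (- A - 1) = - (wexp A * mu2 A) * mid_value A" "Gc A = - mu1 A * mid_value A" "mid_value A \<noteq> 0"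
proof -
  have a: "adm A" and im: "Im A \<le> - 50" using A by (auto simp: adm_low_def)
  define B where "B = - A - 1"
  have b: "adm B" unfolding B_def by (rule adm_reflect[OF a])
  have f: "fm A \<noteq> 0" "fm B \<noteq> 0"
    using fm_ge[OF a] fm_ge[OF b] im by (auto simp: B_def)
  have Jr0: "Jr C 0 = 1" if "fm C \<noteq> 0" for C using that by (simp add: Jr_def fm_def)
  have re: "\<bar>Re (complex_of_real (pi / 2))\<bar> < pi" using pi_gt_zero by simp
  define w G H where "w = wexp A" and "G = Gc A" and "H = Gc B"
  note wb = wexp_bound[OF im, folded w_def]
  have 1: "mid_value A = H - G"
  proof -
    have "mid_value A = nf A (of_real (pi / 2) + 0)" unfolding mid_value_def using qf_eq_nf(1)[OF a re] by simp
    thus ?thesis unfolding nf_def B_def[symmetric] jost_Jr(1)[OF f(1)] jost_Jr(1)[OF f(2)] Jr0[OF f(1)] Jr0[OF f(2)]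
      by (simp add: H_def G_def)
  qed
  have 2: "mid_value A = - (H / w) - G * w"
  proof -
    have "mid_value A = nf A (of_real (- pi / 2) - 0)" unfolding mid_value_def using qf_eq_nf(2)[OF a re] by simp
    also have "\<dots> = H * wexp B - G * w"
      unfolding nf_def B_def[symmetric] jost_Jr(3)[OF f(1)] jost_Jr(3)[OF f(2)] minus_zero Jr0[OF f(1)] Jr0[OF f(2)]
      by (simp add: H_def G_def w_def)
    also have "wexp B = - (1 / w)" unfolding B_def w_def by (rule wexp_reflect)
    finally show ?thesis by simp
  qed
  have "H - G = - (H / w) - G * w" using 1 2 by simp
  hence "w * (H - G) = w * (- (H / w) - G * w)" by simp
  hence "w * H - w * G = - H - G * w * w" using wb(3) by (simp add: right_diff_distrib mult_ac)
  hence 3: "H * (1 + w) = w * (1 - w) * G" by (simp add: algebra_simps)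
  have "mid_value A * (1 + w) = - G * (1 + w * w)" unfolding 1 using 3 by (simp add: algebra_simps)
  hence G: "G = - mu1 A * mid_value A" unfolding mu1_def w_def[symmetric] 
  proof -
    have "G = - (x / d) * p" if "p * x = - G * d" "d \<noteq> 0" for p d x
    proof -
      have "x / d * p = (p * x) / d" by simp
      thus ?thesis using that by simp
    qed
    from this[OF \<open>mid_value A * (1 + w) = - G * (1 + w * w)\<close> wb(4)] show "G = - ((1 + w) / (1 + w * w)) * mid_value A" by simp
  qed
  thus "Gc A = - mu1 A * mid_value A" by (simp add: G_def)
  have "H * (1 + w) = - (w * mu2 A) * mid_value A * (1 + w)"
    unfolding 3 G mu1_def mu2_def w_def[symmetric] by (simp add: mult_ac)
  hence "H = - (w * mu2 A) * mid_value A" using wb(5) mult_right_cancel by blast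
  thus "Gc (- A - 1) = - (wexp A * mu2 A) * mid_value A" by (simp add: H_def B_def w_def)
  have "G \<noteq> 0" unfolding G_def Gc_def using f GA_nonzero[OF a] by simp
  thus "mid_value A \<noteq> 0" using G by auto
qed

lemma nf_exact:
  assumes A: "adm_low A"
  shows "nf A (of_real (pi / 2) + \<psi>) / mid_value A = mu1 A * Jr A \<psi> - wexp A * mu2 A * Jr (- A - 1) \<psi>"
    "nf1 A (of_real (pi / 2) + \<psi>) / mid_value A = mu1 A * Jr1 A \<psi> - wexp A * mu2 A * Jr1 (- A - 1) \<psi>"
    "nf A (of_real (- pi / 2) - \<psi>) / mid_value A = mu2 A * Jr (- A - 1) (- \<psi>) + wexp A * mu1 A * Jr A (- \<psi>)"
    "nf1 A (of_real (- pi / 2) - \<psi>) / mid_value A = mu2 A * Jr1 (- A - 1) (- \<psi>) + wexp A * mu1 A * Jr1 A (- \<psi>)"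
proof -
  have a: "adm A" and im: "Im A \<le> - 50" using A by (auto simp: adm_low_def)
  define B where "B = - A - 1"
  have b: "adm B" unfolding B_def by (rule adm_reflect[OF a])
  have f: "fm A \<noteq> 0" "fm B \<noteq> 0"
    using fm_ge[OF a] fm_ge[OF b] im by (auto simp: B_def)
  note R = Gc_relation[OF A, folded B_def]
  have w: "wexp B = - (1 / wexp A)" unfolding B_def by (rule wexp_reflect)
  have g: "(- (v * m) * P * x - - l * P * y) / P = l * y - v * m * x"
    "(- (v * m) * P * - (1 / v) * x - - l * P * v * y) / P = m * x + v * l * y"
    if "P \<noteq> 0" "v \<noteq> 0" for v m P x l y :: complex
    using that by (simp_all add: field_simps)
  note g' = g[OF R(3) wexp_bound(3)[OF im]]
  show "nf A (of_real (pi / 2) + \<psi>) / mid_value A = mu1 A * Jr A \<psi> - wexp A * mu2 A * Jr (- A - 1) \<psi>"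
    unfolding nf_def B_def[symmetric] jost_Jr[OF f(1)] jost_Jr[OF f(2)] R(1,2) by (rule g'(1))
  show "nf1 A (of_real (pi / 2) + \<psi>) / mid_value A = mu1 A * Jr1 A \<psi> - wexp A * mu2 A * Jr1 (- A - 1) \<psi>"
    unfolding nf1_def B_def[symmetric] jost_Jr[OF f(1)] jost_Jr[OF f(2)] R(1,2) by (rule g'(1))
  show "nf A (of_real (- pi / 2) - \<psi>) / mid_value A = mu2 A * Jr (- A - 1) (- \<psi>) + wexp A * mu1 A * Jr A (- \<psi>)"
    unfolding nf_def B_def[symmetric] jost_Jr[OF f(1)] jost_Jr[OF f(2)] R(1,2) w by (rule g'(2))
  show "nf1 A (of_real (- pi / 2) - \<psi>) / mid_value A = mu2 A * Jr1 (- A - 1) (- \<psi>) + wexp A * mu1 A * Jr1 A (- \<psi>)"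
    unfolding nf1_def B_def[symmetric] jost_Jr[OF f(1)] jost_Jr[OF f(2)] R(1,2) w by (rule g'(2))
qed

section \<open>Asymptotics of the normalised solution\<close>

abbreviation ccos :: "complex \<Rightarrow> complex" where "ccos \<psi> \<equiv> csqrt (cos \<psi>)"

text \<open>The bound on cos psi keeps t = -exp(2 i psi) away from 1, where
  \<open>FA_estimate\<close> degenerates, since 1 - t = 2 exp(i psi) cos psi.\<close>

definition region :: "real \<Rightarrow> real \<Rightarrow> complex \<Rightarrow> bool" where
  "region \<delta> Y \<psi> \<longleftrightarrow> \<bar>Re \<psi>\<bar> \<le> pi / 2 \<and> \<bar>Im \<psi>\<bar> \<le> Y \<and> \<delta> \<le> norm (cos \<psi>)"

lemma region_minus: "region \<delta> Y (- \<psi>) \<longleftrightarrow> region \<delta> Y \<psi>"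
  by (simp add: region_def)

lemma one_plus_exp_cos: "1 + exp (2 * \<i> * \<psi>) = 2 * exp (\<i> * \<psi>) * cos (\<psi> :: complex)"
proof -
  have "exp (2 * \<i> * \<psi>) = exp (\<i> * \<psi>) * exp (\<i> * \<psi>)" by (simp add: exp_add[symmetric] mult.assoc)
  moreover have "exp (\<i> * \<psi>) * exp (- (\<i> * \<psi>)) = 1" by (simp add: exp_add[symmetric])
  ultimately show ?thesis unfolding cos_exp_eq by (simp add: algebra_simps)
qed

text \<open>The number 1 + exp(2 i psi) is nonzero and lies in the closed disc of radius 1 about 1,
  so its argument is below pi/2 in modulus. Removing i psi with |Re psi| \<le> pi/2 stays in the
  principal strip, and the square roots factor without a sign.\<close>

lemma csqrt_one_plus_exp:
  assumes re: "\<bar>Re \<psi>\<bar> \<le> pi / 2" and im: "Im \<psi> \<ge> 0" and c: "cos \<psi> \<noteq> 0"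
  shows "csqrt (1 + exp (2 * \<i> * \<psi>)) = of_real (sqrt 2) * exp (\<i> * \<psi> / 2) * ccos \<psi>"
proof -
  define u where "u = 1 + exp (2 * \<i> * \<psi>)"
  have u: "u = 2 * exp (\<i> * \<psi>) * cos \<psi>" unfolding u_def by (rule one_plus_exp_cos)
  have u0: "u \<noteq> 0" using c by (simp add: u)
  have n: "norm (exp (2 * \<i> * \<psi>)) \<le> 1" using im by simp
  have "Re u > 0"
  proof (rule ccontr)
    assume "\<not> Re u > 0"
    moreover have "- Re (exp (2 * \<i> * \<psi>)) \<le> 1" using abs_Re_le_cmod[of "exp (2 * \<i> * \<psi>)"] n by linarith
    ultimately have r: "Re (exp (2 * \<i> * \<psi>)) = - 1" by (simp add: u_def)
    hence "(- 1)\<^sup>2 + (Im (exp (2 * \<i> * \<psi>)))\<^sup>2 = (norm (exp (2 * \<i> * \<psi>)))\<^sup>2" by (simp only: cmod_power2)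
    also have "\<dots> \<le> 1\<^sup>2" using n by (intro power_mono) auto
    finally have "Im (exp (2 * \<i> * \<psi>)) = 0" by simp
    hence "u = 0" using r by (simp add: u_def complex_eq_iff)
    with u0 show False ..
  qed
  hence L: "\<bar>Im (Ln u)\<bar> < pi / 2" using Re_Ln_pos_lt[OF u0] by simp
  have i2: "Im (Ln 2) = 0" by (metis Im_complex_of_real Ln_of_real of_real_numeral zero_less_numeral)
  have "Ln (cos \<psi>) = Ln u - \<i> * \<psi> - Ln 2"
  proof (rule Ln_unique)
    have "exp (Ln u - \<i> * \<psi> - Ln 2) = u / exp (\<i> * \<psi>) / 2"
      using u0 by (simp add: exp_diff)
    thus "exp (Ln u - \<i> * \<psi> - Ln 2) = cos \<psi>" unfolding u by simp
    show "- pi < Im (Ln u - \<i> * \<psi> - Ln 2)" "Im (Ln u - \<i> * \<psi> - Ln 2) \<le> pi"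
      using L re i2 by auto
  qed
  hence Lu: "Ln u / 2 = Ln 2 / 2 + \<i> * \<psi> / 2 + Ln (cos \<psi>) / 2" by (simp add: field_simps)
  have e2: "csqrt 2 = exp (Ln 2 / 2)" by (rule csqrt_exp_Ln) simp
  have "csqrt u = exp (Ln u / 2)" using u0 by (rule csqrt_exp_Ln)
  also have "\<dots> = csqrt 2 * exp (\<i> * \<psi> / 2) * ccos \<psi>"
    unfolding Lu exp_add csqrt_exp_Ln[OF c] e2 ..
  finally show ?thesis unfolding u_def csqrt_2 .
qed

lemma norm_csqrt_eq: "norm (csqrt z) = sqrt (norm z)"
proof -
  have "norm (csqrt z) ^ 2 = norm z" by (metis norm_power power2_csqrt)
  thus ?thesis by (metis norm_ge_zero real_sqrt_unique)
qed

lemma region_bounds: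
  assumes "region \<delta> Y \<psi>"
  shows "norm (ccos \<psi>) \<le> exp Y" "norm (exp (- (\<i> * \<psi>) / 2)) \<le> exp Y" "norm (exp (\<i> * \<psi>)) \<le> exp Y"
    "norm (exp (- (\<i> * \<psi>))) \<le> exp Y" "0 \<le> Y" "norm (sin \<psi>) \<le> exp Y" "norm (cos \<psi>) \<le> exp Y"
    "exp (- Y) \<le> norm (exp (\<i> * \<psi>))"
proof -
  have Y: "\<bar>Im \<psi>\<bar> \<le> Y" using assms by (simp add: region_def)
  show Y0: "0 \<le> Y" using Y by linarith
  show 1: "norm (exp (\<i> * \<psi>)) \<le> exp Y" "norm (exp (- (\<i> * \<psi>))) \<le> exp Y" "norm (exp (- (\<i> * \<psi>) / 2)) \<le> exp Y"
    "exp (- Y) \<le> norm (exp (\<i> * \<psi>))"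
    using Y by auto
  have "norm (exp (\<i> * \<psi>) + exp (- (\<i> * \<psi>))) \<le> exp Y + exp Y" "norm (exp (\<i> * \<psi>) - exp (- (\<i> * \<psi>))) \<le> exp Y + exp Y"
    using norm_triangle_mono[OF 1(1,2)] norm_triangle_ineq4[of "exp (\<i> * \<psi>)" "exp (- (\<i> * \<psi>))"] 1(1,2) by linarith+
  thus c: "norm (cos \<psi>) \<le> exp Y" and "norm (sin \<psi>) \<le> exp Y"
    unfolding cos_exp_eq sin_exp_eq by (auto simp: norm_divide norm_mult)
  have "norm (ccos \<psi>) = sqrt (norm (cos \<psi>))" by (rule norm_csqrt_eq)
  also have "\<dots> \<le> sqrt (exp Y * exp Y)"
  proof (rule real_sqrt_le_mono)
    have "exp Y * 1 \<le> exp Y * exp Y" using Y0 by (intro mult_left_mono) auto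
    thus "norm (cos \<psi>) \<le> exp Y * exp Y" using c by linarith
  qed
  finally show "norm (ccos \<psi>) \<le> exp Y" by simp
qed

text \<open>The terms bound, in this order, the error of \<open>FA\<close>, the error of
  \<open>fm\<close> and the \<open>FA1\<close> term of the derivative;
  \<open>2 * \<delta> * exp (- Y)\<close> is the lower bound for |1 - t|.\<close>

definition jost_const :: "real \<Rightarrow> real \<Rightarrow> real" where
  "jost_const \<delta> Y = 15 * exp Y / (2 * \<delta> * exp (- Y)) + 15 * exp Y + 16 * exp Y / (2 * \<delta> * exp (- Y))"

lemma jost_const_pos: "\<delta> > 0 \<Longrightarrow> jost_const \<delta> Y > 0"
  unfolding jost_const_def by (intro add_pos_pos divide_pos_pos mult_pos_pos) auto

text \<open>Numerator and denominator of \<open>Jr\<close> are asymptotic to square roots with the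
  common factor sqrt 2, and \<open>csqrt_one_plus_exp\<close> contributes exp(i psi/2): this is
  where A + 1/2 comes from. In \<open>Jr1\<close> the \<open>FA1\<close> term is bounded, hence
  O(1/|Im C|) after the factor i C has been taken out.\<close>

lemma Jr_estimate:
  assumes C: "adm C" "\<bar>Im C\<bar> \<ge> 50" and \<psi>: "region \<delta> Y \<psi>" "Im \<psi> \<ge> 0" and \<delta>: "\<delta> > 0"
  shows "\<exists>R. norm R \<le> jost_const \<delta> Y / \<bar>Im C\<bar> \<and> Jr C \<psi> = exp (\<i> * (C + 1 / 2) * \<psi>) * (ccos \<psi> + R)"
    "Im \<psi> > 0 \<Longrightarrow> \<exists>R. norm R \<le> jost_const \<delta> Y / \<bar>Im C\<bar> \<and> Jr1 C \<psi> = \<i> * C * exp (\<i> * (C + 1 / 2) * \<psi>) * (ccos \<psi> + R)"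
proof -
  define \<tau> where "\<tau> = \<bar>Im C\<bar>"
  have \<tau>: "\<tau> \<ge> 50" using C by (simp add: \<tau>_def)
  define t where "t = - exp (2 * \<i> * \<psi>)"
  define x where "x = exp (- (\<i> * \<psi>) / 2)"
  define F f B where "F = FA C t" and "f = fm C" and "B = ccos \<psi>"
  define k where "k = 2 * \<delta> * exp (- Y)"
  have k0: "k > 0" using \<delta> by (simp add: k_def)
  note rb = region_bounds[OF \<psi>(1)]
  have c0: "cos \<psi> \<noteq> 0" using \<psi>(1) \<delta> by (auto simp: region_def)
  have t1: "1 - t = 2 * exp (\<i> * \<psi>) * cos \<psi>" unfolding t_def using one_plus_exp_cos[of \<psi>] by simp
  have kt: "k \<le> norm (1 - t)"
  proof -
    have "exp (- Y) * \<delta> \<le> norm (exp (\<i> * \<psi>)) * norm (cos \<psi>)"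
      using rb(8) \<psi>(1) \<delta> by (intro mult_mono) (auto simp: region_def)
    thus ?thesis unfolding t1 k_def norm_mult by (simp add: mult.commute)
  qed
  have tn: "norm t \<le> 1" using \<psi>(2) by (simp add: t_def)
  have tne: "t \<noteq> 1" using kt k0 by auto
  have f1: "norm f \<ge> 1" unfolding f_def by (rule fm_ge[OF C])
  hence f0: "f \<noteq> 0" by auto
  have cs: "csqrt (1 - t) * x = of_real (sqrt 2) * B"
  proof -
    have "csqrt (1 - t) = of_real (sqrt 2) * exp (\<i> * \<psi> / 2) * B"
      using csqrt_one_plus_exp[of \<psi>] \<psi> c0 by (simp add: t_def B_def region_def)
    moreover have "exp (\<i> * \<psi> / 2) * x = 1" by (simp add: x_def exp_add[symmetric] add_divide_distrib[symmetric])
    ultimately show ?thesis by (simp add: mult_ac)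
  qed
  define R where "R = F / f * x - B"
  have Fe: "norm (F - csqrt (1 - t)) \<le> 15 / \<tau> / k"
  proof -
    have "norm (F - csqrt (1 - t)) * k \<le> norm (F - csqrt (1 - t)) * norm (1 - t)"
      using kt by (rule mult_left_mono) simp
    also have "\<dots> \<le> 15 / \<tau>" unfolding F_def \<tau>_def by (rule FA_estimate_closed[OF C(1) tn tne])
    finally show ?thesis by (simp only: pos_le_divide_eq[OF k0])
  qed
  have Re: "R = ((F - csqrt (1 - t)) * x - (f - of_real (sqrt 2)) * B) / f"
    unfolding R_def using f0 cs by (simp add: field_simps)
  have Rb: "norm R \<le> (15 * exp Y / k + 15 * exp Y) / \<tau>"
  proof -
    have "norm ((F - csqrt (1 - t)) * x - (f - of_real (sqrt 2)) * B) \<le> norm (F - csqrt (1 - t)) * norm x + norm (f - of_real (sqrt 2)) * norm B"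
      by (rule order_trans[OF norm_triangle_ineq4]) (simp add: norm_mult)
    also have "\<dots> \<le> 15 / \<tau> / k * exp Y + 15 / \<tau> * exp Y"
      using Fe fm_estimate[OF C(1)] rb \<tau> k0 unfolding x_def B_def f_def \<tau>_def by (intro add_mono mult_mono) auto
    also have "\<dots> = (15 * exp Y / k + 15 * exp Y) / \<tau>" by (simp add: add_divide_distrib)
    finally have 1: "norm ((F - csqrt (1 - t)) * x - (f - of_real (sqrt 2)) * B) \<le> (15 * exp Y / k + 15 * exp Y) / \<tau>" .
    have "norm R = norm ((F - csqrt (1 - t)) * x - (f - of_real (sqrt 2)) * B) / norm f"
      unfolding Re by (rule norm_divide)
    also have "\<dots> \<le> norm ((F - csqrt (1 - t)) * x - (f - of_real (sqrt 2)) * B) / 1"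
      using f1 by (intro divide_left_mono) auto
    finally show ?thesis using 1 by simp
  qed
  have ex: "exp (\<i> * C * \<psi>) = exp (\<i> * (C + 1 / 2) * \<psi>) * x"
    unfolding x_def exp_add[symmetric] by (rule arg_cong[where f = exp]) (simp add: algebra_simps)
  have jost_const: "(15 * exp Y / k + 15 * exp Y) / \<tau> + 16 * exp Y / k / \<tau> = jost_const \<delta> Y / \<tau>"
    by (simp add: jost_const_def k_def add_divide_distrib)
  have pos: "0 \<le> 16 * exp Y / k / \<tau>" using k0 \<tau> by simp
  have "norm R \<le> jost_const \<delta> Y / \<tau>" using Rb jost_const pos by linarith
  moreover have "Jr C \<psi> = exp (\<i> * (C + 1 / 2) * \<psi>) * (ccos \<psi> + R)"
    unfolding Jr_def ex t_def[symmetric] R_def F_def f_def B_def by (simp add: mult_ac)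
  ultimately show "\<exists>R. norm R \<le> jost_const \<delta> Y / \<bar>Im C\<bar> \<and> Jr C \<psi> = exp (\<i> * (C + 1 / 2) * \<psi>) * (ccos \<psi> + R)"
    unfolding \<tau>_def by blast
  assume im: "Im \<psi> > 0"
  have C0: "norm C \<ge> \<tau>" unfolding \<tau>_def by (rule abs_Im_le_cmod)
  hence Cnz: "C \<noteq> 0" using \<tau> by auto
  define R2 where "R2 = 2 * (t * FA1 C t) / (C * f) * x"
  have R2b: "norm R2 \<le> 16 * exp Y / k / \<tau>"
  proof -
    have "norm t < 1" using im by (simp add: t_def)
    from FA1_estimate[OF C(1) this] have "norm (t * FA1 C t) * norm (1 - t) \<le> 8" .
    hence "norm (t * FA1 C t) * k \<le> 8" using mult_left_mono[OF kt norm_ge_zero[of "t * FA1 C t"]] by linarith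
    hence 1: "norm (t * FA1 C t) \<le> 8 / k" using k0 by (simp add: pos_le_divide_eq)
    have "\<tau> * 1 \<le> norm C * norm f" using C0 f1 \<tau> by (intro mult_mono) auto
    hence 2: "\<tau> \<le> norm (C * f)" by (simp add: norm_mult)
    have "norm R2 = 2 * norm (t * FA1 C t) / norm (C * f) * norm x"
      unfolding R2_def by (simp add: norm_mult norm_divide)
    also have "\<dots> \<le> 2 * (8 / k) / \<tau> * exp Y"
      using 1 2 \<tau> k0 rb(2) unfolding x_def by (intro mult_mono frac_le) auto
    finally show ?thesis by simp
  qed
  have "norm (R + R2) \<le> jost_const \<delta> Y / \<tau>" using norm_triangle_ineq[of R R2] Rb R2b jost_const by linarith
  moreover have "Jr1 C \<psi> = \<i> * C * exp (\<i> * (C + 1 / 2) * \<psi>) * (ccos \<psi> + (R + R2))"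
  proof -
    have "(\<i> * C * F + 2 * \<i> * (t * g)) / f * x = \<i> * C * (F / f * x + 2 * (t * g) / (C * f) * x)" for g
      using Cnz f0 by (simp add: field_simps)
    from this[of "FA1 C t"] have "(\<i> * C * F + 2 * \<i> * (t * FA1 C t)) / f * x = \<i> * C * (ccos \<psi> + (R + R2))"
      unfolding R_def R2_def B_def by simp
    thus ?thesis unfolding Jr1_def ex t_def[symmetric] F_def f_def by (metis mult.assoc mult.commute)
  qed
  ultimately show "\<exists>R. norm R \<le> jost_const \<delta> Y / \<bar>Im C\<bar> \<and> Jr1 C \<psi> = \<i> * C * exp (\<i> * (C + 1 / 2) * \<psi>) * (ccos \<psi> + R)"
    unfolding \<tau>_def by blast
qed

lemma mu_bounds:
  assumes "Im A \<le> - 50"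
  shows "norm (mu1 A - 1) \<le> 4 / \<bar>Im A\<bar>" "norm (mu2 A - 1) \<le> 4 / \<bar>Im A\<bar>" "norm (mu1 A) \<le> 2" "norm (mu2 A) \<le> 2"
proof -
  define w where "w = wexp A"
  note wb = wexp_bound[OF assms, folded w_def]
  have ww: "norm (w * w) \<le> norm w"
    using mult_left_mono[of "norm w" 1 "norm w"] wb(2) by (simp add: norm_mult)
  have 1: "mu1 A - 1 = (w - w * w) / (1 + w * w)" "mu2 A - 1 = (- w - w * w) / (1 + w * w)"
    unfolding mu1_def mu2_def w_def[symmetric] using wb(4) by (simp_all add: field_simps)
  have 2: "norm (v / (1 + w * w)) \<le> 4 / \<bar>Im A\<bar>" if "norm v \<le> 2 * norm w" for v
  proof -
    have "norm (v / (1 + w * w)) \<le> (2 * norm w) / (1 / 2)"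
      unfolding norm_divide using that wb(6) by (intro frac_le) auto
    thus ?thesis using wb(1) by simp
  qed
  have "norm (w - w * w) \<le> 2 * norm w" using norm_triangle_ineq4[of w "w * w"] ww by linarith
  thus a: "norm (mu1 A - 1) \<le> 4 / \<bar>Im A\<bar>" unfolding 1 by (rule 2)
  have "norm (- w - w * w) \<le> 2 * norm w" using norm_triangle_ineq4[of "- w" "w * w"] ww by simp
  thus b: "norm (mu2 A - 1) \<le> 4 / \<bar>Im A\<bar>" unfolding 1 by (rule 2)
  have "4 / \<bar>Im A\<bar> \<le> 4 / 50" using assms by (intro divide_left_mono) auto
  hence s: "4 / \<bar>Im A\<bar> \<le> 1" by simp
  show "norm (mu1 A) \<le> 2" "norm (mu2 A) \<le> 2"
    using norm_triangle_ineq[of "mu1 A - 1" 1] norm_triangle_ineq[of "mu2 A - 1" 1] a b s by auto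
qed

text \<open>Two ways to write the even solution at pi/2 + psi with an argument in the closed upper
  half-plane: directly for Im psi \<ge> 0, through -(pi/2 + psi) for Im psi \<le> 0. The derivative
  of an even function is odd, hence the sign in \<open>nf1s\<close>.\<close>

definition nfs :: "side \<Rightarrow> complex \<Rightarrow> complex \<Rightarrow> complex" where
  "nfs t A \<psi> = (case t of Upper \<Rightarrow> nf A (of_real (pi / 2) + \<psi>) | Lower \<Rightarrow> nf A (of_real (- pi / 2) - \<psi>))"
definition nf1s :: "side \<Rightarrow> complex \<Rightarrow> complex \<Rightarrow> complex" where
  "nf1s t A \<psi> = (case t of Upper \<Rightarrow> nf1 A (of_real (pi / 2) + \<psi>) | Lower \<Rightarrow> - nf1 A (of_real (- pi / 2) - \<psi>))"

definition two_term_const :: "real \<Rightarrow> real \<Rightarrow> real" where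
  "two_term_const \<delta> Y = 4 * exp Y + 2 * (jost_const \<delta> Y + (exp Y + jost_const \<delta> Y))"

lemma two_term_const_pos: "\<delta> > 0 \<Longrightarrow> two_term_const \<delta> Y > 0"
  unfolding two_term_const_def using jost_const_pos[of \<delta> Y] by (intro add_pos_pos mult_pos_pos) auto

lemma mult_near_one:
  fixes m B R :: complex
  assumes m: "norm (m - 1) \<le> 4 / \<tau>" "norm m \<le> 2" and R: "norm R \<le> K / \<tau>" and B: "norm B \<le> b" and \<tau>: "\<tau> > 0" and K: "0 \<le> K"
  shows "norm (m * (B + R) - B) \<le> (4 * b + 2 * K) / \<tau>"
proof -
  have b: "b \<ge> 0" using B norm_ge_zero order_trans by blast
  have "m * (B + R) - B = (m - 1) * B + m * R" by (simp add: ring_distribs)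
  hence "norm (m * (B + R) - B) \<le> norm (m - 1) * norm B + norm m * norm R"
    by (metis norm_mult norm_triangle_ineq)
  also have "\<dots> \<le> 4 / \<tau> * b + 2 * (K / \<tau>)" using assms b by (intro add_mono mult_mono) auto
  finally show ?thesis by (simp add: add_divide_distrib)
qed

text \<open>Passing to the reflected argument exchanges the roles of A and -A - 1, hence of
  \<open>mu1\<close> and \<open>mu2\<close>, and by \<open>wexp_reflect\<close> reverses the sign of
  the small term. This is the origin of \<open>side_sign t\<close>.\<close>

lemma nfs_estimate:
  assumes A: "adm_low A" and \<psi>: "region \<delta> Y \<psi>" and \<delta>: "\<delta> > 0"
    and sgn: "case t of Upper \<Rightarrow> Im \<psi> \<ge> 0 | Lower \<Rightarrow> Im \<psi> \<le> 0"
  shows "\<exists>E1 E2. norm E1 \<le> two_term_const \<delta> Y / \<bar>Im A\<bar> \<and> norm E2 \<le> two_term_const \<delta> Y / \<bar>Im A\<bar> \<and>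
     nfs t A \<psi> / mid_value A = exp (\<i> * (A + 1 / 2) * \<psi>) * (ccos \<psi> + E1)
        - side_sign t * wexp A * exp (- (\<i> * (A + 1 / 2) * \<psi>)) * (ccos \<psi> + E2)" (is ?thesis1)
    "Im \<psi> \<noteq> 0 \<Longrightarrow> \<exists>E1 E2. norm E1 \<le> two_term_const \<delta> Y / \<bar>Im A\<bar> \<and> norm E2 \<le> two_term_const \<delta> Y / \<bar>Im A\<bar> \<and>
     nf1s t A \<psi> / (\<i> * A * mid_value A) = exp (\<i> * (A + 1 / 2) * \<psi>) * (ccos \<psi> + E1)
        + side_sign t * wexp A * exp (- (\<i> * (A + 1 / 2) * \<psi>)) * (ccos \<psi> + E2)" (is "_ \<Longrightarrow> ?thesis2")
proof -
  have a: "adm A" and im: "Im A \<le> - 50" using A by (auto simp: adm_low_def)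
  define \<tau> where "\<tau> = \<bar>Im A\<bar>"
  have \<tau>: "\<tau> \<ge> 50" using im by (simp add: \<tau>_def)
  have b: "adm (- A - 1)" by (rule adm_reflect[OF a])
  have imB: "\<bar>Im (- A - 1)\<bar> = \<tau>" by (simp add: \<tau>_def)
  have imA: "\<bar>Im A\<bar> = \<tau>" by (simp add: \<tau>_def)
  define \<xi> where "\<xi> = (case t of Upper \<Rightarrow> \<psi> | Lower \<Rightarrow> - \<psi>)"
  have \<xi>: "region \<delta> Y \<xi>" "Im \<xi> \<ge> 0" using \<psi> sgn by (auto simp: \<xi>_def region_minus split: side.splits)
  have Bx: "ccos \<xi> = ccos \<psi>" by (auto simp: \<xi>_def split: side.splits)
  define e where "e = exp (\<i> * (A + 1 / 2) * \<psi>)"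
  define e' where "e' = exp (- (\<i> * (A + 1 / 2) * \<psi>))"
  define w where "w = wexp A"
  have nb: "norm (ccos \<psi>) \<le> exp Y" by (rule region_bounds(1)[OF \<psi>])
  have KJ0: "0 \<le> jost_const \<delta> Y" using jost_const_pos[OF \<delta>] less_imp_le by blast
  have KXle: "(4 * exp Y + 2 * jost_const \<delta> Y) / \<tau> \<le> two_term_const \<delta> Y / \<tau>"
    unfolding two_term_const_def using \<tau> KJ0 by (intro divide_right_mono) (auto simp: add_nonneg_nonneg)
  note mb = mu_bounds[OF im, unfolded imA]
  have np: "- A - 1 + 1 / 2 = - (A + 1 / 2)" by simp
  have exs: "exp (\<i> * (- (A + 1 / 2)) * \<psi>) = e'" "exp (\<i> * (A + 1 / 2) * (- \<psi>)) = e'" "exp (\<i> * (- (A + 1 / 2)) * (- \<psi>)) = e"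
    unfolding e_def e'_def by (simp_all add: algebra_simps)
  obtain R1 where R1: "norm R1 \<le> jost_const \<delta> Y / \<tau>" "Jr A \<xi> = exp (\<i> * (A + 1 / 2) * \<xi>) * (ccos \<psi> + R1)"
    using Jr_estimate(1)[OF a _ \<xi> \<delta>] \<tau> unfolding imA Bx by blast
  obtain R2 where R2: "norm R2 \<le> jost_const \<delta> Y / \<tau>" "Jr (- A - 1) \<xi> = exp (\<i> * (- (A + 1 / 2)) * \<xi>) * (ccos \<psi> + R2)"
    using Jr_estimate(1)[OF b _ \<xi> \<delta>] \<tau> unfolding imB Bx np by blast
  define E1 E2 where "E1 = mu1 A * (ccos \<psi> + R1) - ccos \<psi>" and "E2 = mu2 A * (ccos \<psi> + R2) - ccos \<psi>"
  have E: "norm E1 \<le> two_term_const \<delta> Y / \<tau>" "norm E2 \<le> two_term_const \<delta> Y / \<tau>"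
    unfolding E1_def E2_def
    using mult_near_one[OF mb(1,3) R1(1) nb _ KJ0] mult_near_one[OF mb(2,4) R2(1) nb _ KJ0] KXle \<tau> by (meson order_trans less_le_trans zero_less_numeral)+
  have g: "m * (v * (B + R)) = v * (B + (m * (B + R) - B))" "w * m * (v * (B + R)) = w * v * (B + (m * (B + R) - B))" for m v B R w :: complex
    by (simp_all add: algebra_simps)
  show ?thesis1
  proof (cases t)
    case Upper
    have "nfs t A \<psi> / mid_value A = e * (ccos \<psi> + E1) - side_sign t * w * e' * (ccos \<psi> + E2)"
      unfolding nfs_def Upper side.case nf_exact(1)[OF A] E1_def E2_def
      using R1(2) R2(2) unfolding \<xi>_def Upper side.case exs e_def[symmetric] w_def by (simp add: algebra_simps)
    thus ?thesis using E unfolding e_def e'_def w_def \<tau>_def by blast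
  next
    case Lower
    have "nfs t A \<psi> / mid_value A = e * (ccos \<psi> + E2) - side_sign t * w * e' * (ccos \<psi> + E1)"
      unfolding nfs_def Lower side.case nf_exact(3)[OF A] E1_def E2_def
      using R1(2) R2(2) unfolding \<xi>_def Lower side.case exs e_def[symmetric] w_def by (simp add: algebra_simps)
    thus ?thesis using E unfolding e_def e'_def w_def \<tau>_def by blast
  qed
  assume "Im \<psi> \<noteq> 0"
  hence \<xi>p: "Im \<xi> > 0" using sgn by (auto simp: \<xi>_def split: side.splits)
  obtain S1 where S1: "norm S1 \<le> jost_const \<delta> Y / \<tau>" "Jr1 A \<xi> = \<i> * A * exp (\<i> * (A + 1 / 2) * \<xi>) * (ccos \<psi> + S1)"
    using Jr_estimate(2)[OF a _ \<xi> \<delta> \<xi>p] \<tau> unfolding imA Bx by blast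
  obtain S2 where S2: "norm S2 \<le> jost_const \<delta> Y / \<tau>" "Jr1 (- A - 1) \<xi> = \<i> * (- A - 1) * exp (\<i> * (- (A + 1 / 2)) * \<xi>) * (ccos \<psi> + S2)"
    using Jr_estimate(2)[OF b _ \<xi> \<delta> \<xi>p] \<tau> unfolding imB Bx np by blast
  have An: "\<tau> \<le> norm A" unfolding \<tau>_def by (rule abs_Im_le_cmod)
  hence A0: "A \<noteq> 0" using \<tau> by auto
  \<comment> \<open>The derivative of the Jost solution for -A - 1 carries the factor -A - 1 instead
    of -A; the quotient 1 + 1/A is absorbed into the error.\<close>
  define r where "r = S2 + (ccos \<psi> + S2) / A"
  have S2': "Jr1 (- A - 1) \<xi> = - (\<i> * A * exp (\<i> * (- (A + 1 / 2)) * \<xi>) * (ccos \<psi> + r))"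
  proof -
    have "\<i> * (- A - 1) * v * (B + S) = - (\<i> * A * v * (B + (S + (B + S) / A)))" for v B S
      using A0 by (simp add: field_simps)
    thus ?thesis unfolding S2(2) r_def by blast
  qed
  have rb: "norm r \<le> (jost_const \<delta> Y + (exp Y + jost_const \<delta> Y)) / \<tau>"
  proof -
    have "norm (ccos \<psi> + S2) \<le> exp Y + jost_const \<delta> Y"
    proof -
      have "jost_const \<delta> Y / \<tau> \<le> jost_const \<delta> Y / 1" using \<tau> KJ0 by (intro divide_left_mono) auto
      thus ?thesis using norm_triangle_ineq[of "ccos \<psi>" S2] nb S2(1) by simp
    qed
    hence "norm ((ccos \<psi> + S2) / A) \<le> (exp Y + jost_const \<delta> Y) / \<tau>"
      unfolding norm_divide using An \<tau> KJ0 by (intro frac_le add_nonneg_nonneg) auto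
    thus ?thesis unfolding r_def using norm_triangle_ineq[of S2 "(ccos \<psi> + S2) / A"] S2(1) by (simp add: add_divide_distrib)
  qed
  define D1 D2 where "D1 = mu1 A * (ccos \<psi> + S1) - ccos \<psi>" and "D2 = mu2 A * (ccos \<psi> + r) - ccos \<psi>"
  have KX2: "two_term_const \<delta> Y = 4 * exp Y + 2 * (jost_const \<delta> Y + (exp Y + jost_const \<delta> Y))" by (rule two_term_const_def)
  have D: "norm D1 \<le> two_term_const \<delta> Y / \<tau>" "norm D2 \<le> two_term_const \<delta> Y / \<tau>"
  proof -
    have "norm D1 \<le> (4 * exp Y + 2 * jost_const \<delta> Y) / \<tau>" unfolding D1_def
      by (rule mult_near_one[OF mb(1,3) S1(1) nb _ KJ0]) (use \<tau> in auto)
    thus "norm D1 \<le> two_term_const \<delta> Y / \<tau>" using KXle by linarith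
    have "0 \<le> jost_const \<delta> Y + (exp Y + jost_const \<delta> Y)" using KJ0 by (simp add: add_nonneg_nonneg)
    thus "norm D2 \<le> two_term_const \<delta> Y / \<tau>" unfolding D2_def KX2
      by (intro mult_near_one[OF mb(2,4) rb nb]) (use \<tau> in auto)
  qed
  have P0: "mid_value A \<noteq> 0" by (rule Gc_relation(3)[OF A])
  have dv: "x / (\<i> * A * mid_value A) = (x / mid_value A) / (\<i> * A)" for x by (simp add: mult_ac)
  have iA: "\<i> * A \<noteq> 0" using A0 by simp
  show ?thesis2
  proof (cases t)
    case Upper
    have "nf1s t A \<psi> / (\<i> * A * mid_value A) = e * (ccos \<psi> + D1) + side_sign t * w * e' * (ccos \<psi> + D2)"
    proof -
      have "nf1s t A \<psi> / mid_value A = (\<i> * A) * (e * (ccos \<psi> + D1) + w * e' * (ccos \<psi> + D2))"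
      proof -
        have j: "Jr1 A \<psi> = \<i> * A * e * (ccos \<psi> + S1)" "Jr1 (- A - 1) \<psi> = - (\<i> * A * e' * (ccos \<psi> + r))"
          using S1(2) S2' unfolding \<xi>_def Upper side.case exs e_def[symmetric] .
        show ?thesis unfolding nf1s_def Upper side.case nf_exact(2)[OF A] D1_def D2_def j w_def
          by (simp add: algebra_simps)
      qed
      thus ?thesis unfolding dv using iA Upper by simp
    qed
    thus ?thesis using D unfolding e_def e'_def w_def \<tau>_def by blast
  next
    case Lower
    have "nf1s t A \<psi> / (\<i> * A * mid_value A) = e * (ccos \<psi> + D2) + side_sign t * w * e' * (ccos \<psi> + D1)"
    proof -
      have "- nf1 A (of_real (- pi / 2) - \<psi>) / mid_value A = - (nf1 A (of_real (- pi / 2) - \<psi>) / mid_value A)" by simp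
      also have "\<dots> = (\<i> * A) * (e * (ccos \<psi> + D2) - w * e' * (ccos \<psi> + D1))"
      proof -
        have j: "Jr1 A (- \<psi>) = \<i> * A * e' * (ccos \<psi> + S1)" "Jr1 (- A - 1) (- \<psi>) = - (\<i> * A * e * (ccos \<psi> + r))"
          using S1(2) S2' unfolding \<xi>_def Lower side.case exs e_def[symmetric] .
        show ?thesis unfolding nf_exact(4)[OF A] D1_def D2_def j w_def
          by (simp add: algebra_simps)
      qed
      finally have "nf1s t A \<psi> / mid_value A = (\<i> * A) * (e * (ccos \<psi> + D2) - w * e' * (ccos \<psi> + D1))"
        unfolding nf1s_def Lower side.case .
      thus ?thesis unfolding dv using iA Lower by simp
    qed
    thus ?thesis using D unfolding e_def e'_def w_def \<tau>_def by blast
  qed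
qed

section \<open>One dominant exponential inside the strip\<close>

definition deriv_ratio :: "complex \<Rightarrow> complex" where
  "deriv_ratio A = deriv (qf A) (of_real (pi / 2)) / (\<i> * A * mid_value A)"

text \<open>The ratio of the two exponentials: small inside the strip, of order one on the left edge \<open>Re \<psi> = - \<pi> / 2\<close>.\<close>

definition rho2 :: "complex \<Rightarrow> complex \<Rightarrow> complex" where
  "rho2 A \<psi> = wexp A * exp (- (2 * (\<i> * (A + 1 / 2) * \<psi>)))"

lemma two_term_const_nonneg: "\<delta> > 0 \<Longrightarrow> 0 \<le> two_term_const \<delta> Y"
  using two_term_const_pos less_imp_le by blast

text \<open>By \<open>adm\<close>, |Re A + 1/2| \<le> 1, so Im psi contributes at most the factor
  exp(2Y), while Re psi contributes the decay, which is lost on the left edge.\<close>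

lemma rho2_bound:
  assumes A: "adm_low A" and \<psi>: "region \<delta> Y \<psi>"
  shows "norm (rho2 A \<psi>) \<le> exp (2 * Y) * exp (- (2 * \<bar>Im A\<bar> * (pi / 2 + Re \<psi>)))"
    "norm (rho2 A \<psi>) \<le> exp (2 * Y)"
proof -
  have a: "adm A" and im: "Im A \<le> - 50" using A by (auto simp: adm_low_def)
  have "Re (- (2 * (\<i> * (A + 1 / 2) * \<psi>))) = 2 * (Im A * Re \<psi> + (Re A + 1 / 2) * Im \<psi>)"
    by (simp add: algebra_simps)
  hence n: "norm (rho2 A \<psi>) = exp (pi * Im A + 2 * (Im A * Re \<psi> + (Re A + 1 / 2) * Im \<psi>))"
    unfolding rho2_def norm_mult norm_wexp norm_exp_eq_Re by (simp add: exp_add)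
  have "(Re A + 1 / 2) * Im \<psi> \<le> \<bar>Re A + 1 / 2\<bar> * \<bar>Im \<psi>\<bar>" by (metis abs_ge_self abs_mult)
  also have "\<dots> \<le> 1 * Y" using admD[OF a] \<psi> by (intro mult_mono) (auto simp: region_def)
  finally have 1: "(Re A + 1 / 2) * Im \<psi> \<le> Y" by simp
  have 2: "pi * Im A + 2 * (Im A * Re \<psi>) = - (2 * \<bar>Im A\<bar> * (pi / 2 + Re \<psi>))"
    using im by (simp add: algebra_simps)
  have "pi * Im A + 2 * (Im A * Re \<psi> + (Re A + 1 / 2) * Im \<psi>) \<le> 2 * Y + - (2 * \<bar>Im A\<bar> * (pi / 2 + Re \<psi>))"
    using 1 2 by (simp add: distrib_left)
  thus b: "norm (rho2 A \<psi>) \<le> exp (2 * Y) * exp (- (2 * \<bar>Im A\<bar> * (pi / 2 + Re \<psi>)))"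
    unfolding n exp_add[symmetric] by simp
  have "0 \<le> 2 * \<bar>Im A\<bar> * (pi / 2 + Re \<psi>)" using \<psi> by (intro mult_nonneg_nonneg) (auto simp: region_def)
  hence "exp (2 * Y) * exp (- (2 * \<bar>Im A\<bar> * (pi / 2 + Re \<psi>))) \<le> exp (2 * Y) * 1" by (intro mult_left_mono) auto
  with b show "norm (rho2 A \<psi>) \<le> exp (2 * Y)" by linarith
qed

text \<open>The exponential decay is weakened by x \<le> exp x to the scale 1/|Im A| of the other
  errors.\<close>

lemma rho2_small:
  assumes A: "adm_low A" and \<psi>: "region \<delta> Y \<psi>" and d: "d > 0" "d \<le> pi / 2 + Re \<psi>"
  shows "norm (rho2 A \<psi>) \<le> exp (2 * Y) / (2 * d) / \<bar>Im A\<bar>"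
proof -
  have im: "\<bar>Im A\<bar> \<ge> 50" using A by (auto simp: adm_low_def)
  define x where "x = 2 * \<bar>Im A\<bar> * d"
  have x: "x > 0" using im d by (simp add: x_def)
  have "exp (- (2 * \<bar>Im A\<bar> * (pi / 2 + Re \<psi>))) \<le> exp (- x)"
    unfolding x_def using d im by (simp add: mult_left_mono)
  also have "\<dots> \<le> 1 / x"
  proof -
    have "x \<le> exp x" using exp_ge_add_one_self[of x] by linarith
    thus ?thesis using x by (simp add: exp_minus divide_simps)
  qed
  finally have "exp (2 * Y) * exp (- (2 * \<bar>Im A\<bar> * (pi / 2 + Re \<psi>))) \<le> exp (2 * Y) * (1 / x)"
    by (intro mult_left_mono) auto
  with rho2_bound(1)[OF A \<psi>] show ?thesis by (simp add: x_def mult_ac)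
qed

lemma exp_split: "exp (- (\<i> * v * \<psi>)) = exp (\<i> * v * \<psi>) * exp (- (2 * (\<i> * v * (\<psi>::complex))))"
  by (simp add: exp_add[symmetric] mult_ac)

lemma nfs_two_term:
  assumes A: "adm_low A" and \<psi>: "region \<delta> Y \<psi>" and \<delta>: "\<delta> > 0"
    and sgn: "case t of Upper \<Rightarrow> Im \<psi> \<ge> 0 | Lower \<Rightarrow> Im \<psi> \<le> 0"
  shows "\<exists>E1 E2. norm E1 \<le> two_term_const \<delta> Y / \<bar>Im A\<bar> \<and> norm E2 \<le> two_term_const \<delta> Y / \<bar>Im A\<bar> \<and>
     nfs t A \<psi> / mid_value A = exp (\<i> * (A + 1 / 2) * \<psi>) * ((ccos \<psi> + E1) - side_sign t * rho2 A \<psi> * (ccos \<psi> + E2))"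
    "Im \<psi> \<noteq> 0 \<Longrightarrow> \<exists>E1 E2. norm E1 \<le> two_term_const \<delta> Y / \<bar>Im A\<bar> \<and> norm E2 \<le> two_term_const \<delta> Y / \<bar>Im A\<bar> \<and>
     nf1s t A \<psi> / (\<i> * A * mid_value A) = exp (\<i> * (A + 1 / 2) * \<psi>) * ((ccos \<psi> + E1) + side_sign t * rho2 A \<psi> * (ccos \<psi> + E2))"
proof -
  have g: "e * x - s * w * (e * v) * y = e * (x - s * (w * v) * y)" "e * x + s * w * (e * v) * y = e * (x + s * (w * v) * y)"
    for e x s w v y :: complex by (simp_all add: algebra_simps)
  show "\<exists>E1 E2. norm E1 \<le> two_term_const \<delta> Y / \<bar>Im A\<bar> \<and> norm E2 \<le> two_term_const \<delta> Y / \<bar>Im A\<bar> \<and>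
     nfs t A \<psi> / mid_value A = exp (\<i> * (A + 1 / 2) * \<psi>) * ((ccos \<psi> + E1) - side_sign t * rho2 A \<psi> * (ccos \<psi> + E2))"
    using nfs_estimate(1)[OF assms] unfolding exp_split[of "A + 1/2" \<psi>] g rho2_def .
  show "\<exists>E1 E2. norm E1 \<le> two_term_const \<delta> Y / \<bar>Im A\<bar> \<and> norm E2 \<le> two_term_const \<delta> Y / \<bar>Im A\<bar> \<and>
     nf1s t A \<psi> / (\<i> * A * mid_value A) = exp (\<i> * (A + 1 / 2) * \<psi>) * ((ccos \<psi> + E1) + side_sign t * rho2 A \<psi> * (ccos \<psi> + E2))"
    if "Im \<psi> \<noteq> 0"
    using nfs_estimate(2)[OF assms that] unfolding exp_split[of "A + 1/2" \<psi>] g rho2_def .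
qed

lemma qf_eq_nfs:
  assumes A: "adm A" and re: "\<bar>Re \<psi>\<bar> < pi / 2"
  shows "(case t of Upper \<Rightarrow> Im \<psi> \<ge> 0 | Lower \<Rightarrow> Im \<psi> \<le> 0) \<Longrightarrow> qf A (of_real (pi / 2) + \<psi>) = nfs t A \<psi>"
    "(case t of Upper \<Rightarrow> Im \<psi> > 0 | Lower \<Rightarrow> Im \<psi> < 0) \<Longrightarrow> deriv (qf A) (of_real (pi / 2) + \<psi>) = nf1s t A \<psi>"
proof -
  have re': "\<bar>Re (of_real (pi / 2) + \<psi>)\<bar> < pi" using re by auto
  have m: "- (of_real (pi / 2) + \<psi>) = of_real (- pi / 2) - \<psi>" by simp
  show "(case t of Upper \<Rightarrow> Im \<psi> \<ge> 0 | Lower \<Rightarrow> Im \<psi> \<le> 0) \<Longrightarrow> qf A (of_real (pi / 2) + \<psi>) = nfs t A \<psi>"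
    using qf_eq_nf[OF A re'] unfolding m nfs_def by (auto split: side.splits)
  show "(case t of Upper \<Rightarrow> Im \<psi> > 0 | Lower \<Rightarrow> Im \<psi> < 0) \<Longrightarrow> deriv (qf A) (of_real (pi / 2) + \<psi>) = nf1s t A \<psi>"
    using deriv_qf[OF A re'] unfolding m nf1s_def by (auto split: side.splits)
qed

definition one_term_const :: "real \<Rightarrow> real \<Rightarrow> real \<Rightarrow> real" where
  "one_term_const \<delta> Y d = two_term_const \<delta> Y + exp (2 * Y) / (2 * d) * (exp Y + two_term_const \<delta> Y)"

lemma one_term_algebra:
  fixes E1 E2 r B s :: complex
  assumes "norm E1 \<le> K / \<tau>" "norm E2 \<le> K / \<tau>" "norm r \<le> c / \<tau>" "norm B \<le> b" "\<tau> \<ge> 1" "0 \<le> K" "0 \<le> c" "norm s = 1"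
  shows "norm ((B + E1) + s * r * (B + E2) - B) \<le> (K + c * (b + K)) / (\<tau>::real)"
proof -
  have "K / \<tau> \<le> K / 1" using assms by (intro divide_left_mono) auto
  hence "norm (B + E2) \<le> b + K" using norm_triangle_ineq[of B E2] assms by simp
  hence "norm (r * (B + E2)) \<le> c / \<tau> * (b + K)" unfolding norm_mult using assms by (intro mult_mono) auto
  moreover have "norm ((B + E1) + s * r * (B + E2) - B) \<le> norm E1 + norm (r * (B + E2))"
    using norm_triangle_ineq[of E1 "s * (r * (B + E2))"] assms(8) by (simp add: norm_mult mult.assoc)
  ultimately show ?thesis using assms(1) by (simp add: add_divide_distrib)
qed

lemma norm_side_sign: "norm (side_sign t) = 1" "norm (- side_sign t) = 1"
  by (cases t; simp)+

lemma one_term_nfs: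
  assumes A: "adm_low A" and \<psi>: "region \<delta> Y \<psi>" and \<delta>: "\<delta> > 0" and d: "d > 0" "d \<le> pi / 2 + Re \<psi>"
    and sgn: "case t of Upper \<Rightarrow> Im \<psi> \<ge> 0 | Lower \<Rightarrow> Im \<psi> \<le> 0"
  shows "norm (nfs t A \<psi> / mid_value A * exp (- (\<i> * (A + 1 / 2) * \<psi>)) - ccos \<psi>) \<le> one_term_const \<delta> Y d / \<bar>Im A\<bar>"
    "Im \<psi> \<noteq> 0 \<Longrightarrow> norm (nf1s t A \<psi> / (\<i> * A * mid_value A) * exp (- (\<i> * (A + 1 / 2) * \<psi>)) - ccos \<psi>) \<le> one_term_const \<delta> Y d / \<bar>Im A\<bar>"
proof -
  have im: "\<bar>Im A\<bar> \<ge> 1" using A by (auto simp: adm_low_def)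
  have c: "exp (\<i> * v * \<psi>) * x * exp (- (\<i> * v * \<psi>)) = x" for v x
    by (simp add: exp_minus)
  note b = region_bounds(1)[OF \<psi>]
  have c0: "0 \<le> exp (2 * Y) / (2 * d)" using d by simp
  obtain E1 E2 where E: "norm E1 \<le> two_term_const \<delta> Y / \<bar>Im A\<bar>" "norm E2 \<le> two_term_const \<delta> Y / \<bar>Im A\<bar>"
     "nfs t A \<psi> / mid_value A = exp (\<i> * (A + 1 / 2) * \<psi>) * ((ccos \<psi> + E1) - side_sign t * rho2 A \<psi> * (ccos \<psi> + E2))"
    using nfs_two_term(1)[OF A \<psi> \<delta> sgn] by blast
  show "norm (nfs t A \<psi> / mid_value A * exp (- (\<i> * (A + 1 / 2) * \<psi>)) - ccos \<psi>) \<le> one_term_const \<delta> Y d / \<bar>Im A\<bar>"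
    using one_term_algebra[OF E(1,2) rho2_small[OF A \<psi> d] b im two_term_const_nonneg[OF \<delta>] c0 norm_side_sign(2)[of t]]
    unfolding E(3) c one_term_const_def by simp
  assume "Im \<psi> \<noteq> 0"
  then obtain E1 E2 where E: "norm E1 \<le> two_term_const \<delta> Y / \<bar>Im A\<bar>" "norm E2 \<le> two_term_const \<delta> Y / \<bar>Im A\<bar>"
     "nf1s t A \<psi> / (\<i> * A * mid_value A) = exp (\<i> * (A + 1 / 2) * \<psi>) * ((ccos \<psi> + E1) + side_sign t * rho2 A \<psi> * (ccos \<psi> + E2))"
    using nfs_two_term(2)[OF A \<psi> \<delta> sgn] by blast
  show "norm (nf1s t A \<psi> / (\<i> * A * mid_value A) * exp (- (\<i> * (A + 1 / 2) * \<psi>)) - ccos \<psi>) \<le> one_term_const \<delta> Y d / \<bar>Im A\<bar>"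
    using one_term_algebra[OF E(1,2) rho2_small[OF A \<psi> d] b im two_term_const_nonneg[OF \<delta>] c0 norm_side_sign(1)[of t]]
    unfolding E(3) c one_term_const_def by simp
qed

lemma isCont_ccos:
  assumes "\<bar>Re \<psi>\<bar> < pi / 2"
  shows "isCont (\<lambda>\<psi>. ccos \<psi>) \<psi>"
proof -
  have "cos (Re \<psi>) > 0" using assms by (intro cos_gt_zero_pi) auto
  hence "Re (cos \<psi>) > 0" by (simp add: Re_cos zero_less_mult_iff add_pos_pos)
  hence "cos \<psi> \<notin> \<real>\<^sub>\<le>\<^sub>0" by (rule pos_Re_not_nonpos)
  thus ?thesis by (intro isCont_csqrt' continuous_intros)
qed

text \<open>For real \<open>\<psi>\<close> the estimate is a limit of \<open>one_term_nfs\<close>.\<close>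

lemma one_term_qf:
  assumes A: "adm_low A" and \<psi>: "region \<delta> Y \<psi>" and re: "\<bar>Re \<psi>\<bar> < pi / 2" and \<delta>: "\<delta> > 0" and d: "d > 0" "d \<le> pi / 2 + Re \<psi>"
  shows "norm (qf A (of_real (pi / 2) + \<psi>) / mid_value A * exp (- (\<i> * (A + 1 / 2) * \<psi>)) - ccos \<psi>) \<le> one_term_const \<delta> (Y + 1) d / \<bar>Im A\<bar>"
    "norm (deriv (qf A) (of_real (pi / 2) + \<psi>) / (\<i> * A * mid_value A) * exp (- (\<i> * (A + 1 / 2) * \<psi>)) - ccos \<psi>) \<le> one_term_const \<delta> (Y + 1) d / \<bar>Im A\<bar>"
proof -
  have a: "adm A" using A by (auto simp: adm_low_def)
  \<comment> \<open>The extra 1 in Y leaves room for approaching a real psi through psi + i y with 0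
    < y < 1.\<close>
  have \<psi>1: "region \<delta> (Y + 1) \<psi>" using \<psi> by (auto simp: region_def)
  define t where "t = (if Im \<psi> \<ge> 0 then Upper else Lower)"
  have t: "case t of Upper \<Rightarrow> Im \<psi> \<ge> 0 | Lower \<Rightarrow> Im \<psi> \<le> 0" by (auto simp: t_def)
  show "norm (qf A (of_real (pi / 2) + \<psi>) / mid_value A * exp (- (\<i> * (A + 1 / 2) * \<psi>)) - ccos \<psi>) \<le> one_term_const \<delta> (Y + 1) d / \<bar>Im A\<bar>"
    unfolding qf_eq_nfs(1)[OF a re t] by (rule one_term_nfs(1)[OF A \<psi>1 \<delta> d t])
  have nz: "norm (deriv (qf A) (of_real (pi / 2) + z) / (\<i> * A * mid_value A) * exp (- (\<i> * (A + 1 / 2) * z)) - ccos z) \<le> one_term_const \<delta> (Y + 1) d / \<bar>Im A\<bar>"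
    if z: "region \<delta> (Y + 1) z" "\<bar>Re z\<bar> < pi / 2" "d \<le> pi / 2 + Re z" "Im z \<noteq> 0" for z
  proof -
    define t where "t = (if Im z \<ge> 0 then Upper else Lower)"
    have t: "case t of Upper \<Rightarrow> Im z \<ge> 0 | Lower \<Rightarrow> Im z \<le> 0" "case t of Upper \<Rightarrow> Im z > 0 | Lower \<Rightarrow> Im z < 0"
      using z(4) by (auto simp: t_def)
    show ?thesis unfolding qf_eq_nfs(2)[OF a z(2) t(2)] by (rule one_term_nfs(2)[OF A z(1) \<delta> d(1) z(3) t(1) z(4)])
  qed
  show "norm (deriv (qf A) (of_real (pi / 2) + \<psi>) / (\<i> * A * mid_value A) * exp (- (\<i> * (A + 1 / 2) * \<psi>)) - ccos \<psi>) \<le> one_term_const \<delta> (Y + 1) d / \<bar>Im A\<bar>"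
  proof (cases "Im \<psi> = 0")
    case False
    show ?thesis by (rule nz[OF \<psi>1 re d(2) False])
  next
    case True
    define g where "g = (\<lambda>y. \<psi> + \<i> * complex_of_real y)"
    have g: "(g \<longlongrightarrow> \<psi>) (at_right 0)"
    proof -
      have "(g \<longlongrightarrow> \<psi> + \<i> * complex_of_real 0) (at_right 0)" unfolding g_def by (intro tendsto_intros)
      thus ?thesis by simp
    qed
    have "continuous_on {\<theta>. \<bar>Re \<theta>\<bar> < pi} (deriv (qf A))"
      by (intro holomorphic_on_imp_continuous_on holomorphic_deriv[OF qf_holomorphic[OF a] open_strip])
    moreover have "of_real (pi / 2) + \<psi> \<in> {\<theta>. \<bar>Re \<theta>\<bar> < pi}" using re by auto
    ultimately have "isCont (deriv (qf A)) (of_real (pi / 2) + \<psi>)"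
      using continuous_on_eq_continuous_at[OF open_strip] by blast
    hence 1: "((\<lambda>y. deriv (qf A) (of_real (pi / 2) + g y)) \<longlongrightarrow> deriv (qf A) (of_real (pi / 2) + \<psi>)) (at_right 0)"
      by (rule isCont_tendsto_compose) (intro tendsto_intros g)
    have 2: "((\<lambda>y. ccos (g y)) \<longlongrightarrow> ccos \<psi>) (at_right 0)"
      by (rule isCont_tendsto_compose[OF isCont_ccos[OF re] g])
    have nz0: "\<i> * A * mid_value A \<noteq> 0"
    proof -
      have "A \<noteq> 0" using admD(4)[OF a] by auto
      thus ?thesis using Gc_relation(3)[OF A] by simp
    qed
    have "((\<lambda>y. norm (deriv (qf A) (of_real (pi / 2) + g y) / (\<i> * A * mid_value A) * exp (- (\<i> * (A + 1 / 2) * g y)) - ccos (g y))) \<longlongrightarrow>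
       norm (deriv (qf A) (of_real (pi / 2) + \<psi>) / (\<i> * A * mid_value A) * exp (- (\<i> * (A + 1 / 2) * \<psi>)) - ccos \<psi>)) (at_right 0)"
      by (intro tendsto_intros 1 2 g nz0)
    thus ?thesis
    proof (rule tendsto_upperbound)
      show "\<forall>\<^sub>F y in at_right 0. norm (deriv (qf A) (of_real (pi / 2) + g y) / (\<i> * A * mid_value A) * exp (- (\<i> * (A + 1 / 2) * g y)) - ccos (g y)) \<le> one_term_const \<delta> (Y + 1) d / \<bar>Im A\<bar>"
      proof (rule eventually_at_rightI[of 0 1])
        fix y :: real assume y: "y \<in> {0<..<1}"
        \<comment> \<open>For real psi the modulus of cos(psi + i y) is smallest at y = 0, so the
          lower bound \<delta> persists along the approach.\<close>
        have "E + inverse E \<ge> 2" if "E > 0" for E :: real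
        proof -
          have "0 \<le> (E - 1)^2 / E" using that by simp
          also have "\<dots> = E + inverse E - 2" using that by (simp add: divide_simps) (simp add: power2_eq_square algebra_simps)
          finally show ?thesis by simp
        qed
        from this[of "exp (2 * y)"] have "norm (cos \<psi>) ^ 2 \<le> norm (cos (g y)) ^ 2"
          unfolding norm_cos_squared using True by (simp add: g_def)
        hence "norm (cos \<psi>) \<le> norm (cos (g y))" by (rule power2_le_imp_le) simp
        hence "region \<delta> (Y + 1) (g y)" using \<psi> True y region_bounds(5)[OF \<psi>] by (auto simp: region_def g_def)
        thus "norm (deriv (qf A) (of_real (pi / 2) + g y) / (\<i> * A * mid_value A) * exp (- (\<i> * (A + 1 / 2) * g y)) - ccos (g y)) \<le> one_term_const \<delta> (Y + 1) d / \<bar>Im A\<bar>"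
          by (rule nz) (use re d True y in \<open>auto simp: g_def\<close>)
      qed simp
    qed simp
  qed
qed

text \<open>The case psi = 0 of \<open>one_term_qf\<close>: cos 0 = 1 gives \<delta> = 1, Y = 0 is
  raised to 1, and d = 1 is below pi/2.\<close>

definition ratio_const :: real where "ratio_const = one_term_const 1 1 1"

lemma deriv_ratio_estimate:
  assumes A: "adm_low A"
  shows "norm (deriv_ratio A - 1) \<le> ratio_const / \<bar>Im A\<bar>"
proof -
  have "region 1 0 0" by (simp add: region_def)
  from one_term_qf(2)[OF A this, of 1] show ?thesis
    using pi_gt3 by (simp add: deriv_ratio_def ratio_const_def)
qed

subsection \<open>The spectral parameter near zero\<close>

lemma Arcsin_minus:
  assumes "1 - x^2 \<notin> \<real>\<^sub>\<le>\<^sub>0"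
  shows "Arcsin (- x) = - Arcsin x"
  by (rule Arcsin_unique) (use Arcsin_cut(2)[OF assms] in simp_all)

text \<open>With x = 1/(2 lambda) the logarithm in \<open>a_fun\<close> has the argument i x +
  csqrt(1 - x^2), the same as in Arcsin x = -i Ln(i x + csqrt(1 - x^2)).\<close>

lemma a_fun_eq_Arcsin:
  assumes "l \<noteq> 0"
  shows "a_fun l = Arcsin (1 / (2 * l)) / of_real pi"
proof -
  have "csqrt (1 - 1 / (4 * l^2)) = csqrt (1 - (1 / (2 * l))^2)"
    by (simp add: power_divide power_mult_distrib)
  hence "(\<i> + sqrt_lam l) / (2 * l) = \<i> * (1 / (2 * l)) + csqrt (1 - (1 / (2 * l))^2)"
    using assms by (simp add: sqrt_lam_def add_divide_distrib)
  moreover have "1 / (\<i> * of_real pi) * x = - \<i> * x / of_real pi" for x by (simp add: divide_simps)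
  ultimately show ?thesis unfolding a_fun_def Arcsin_def by simp
qed

lemma inverse_cut:
  assumes z: "z \<notin> complex_of_real ` {-1..1}"
  shows "1 - (1 / z)^2 \<notin> \<real>\<^sub>\<le>\<^sub>0"
proof -
  have "2 * (x / 2) - 1 = x - 1" for x :: complex by simp
  hence "2 * ((1 / z + 1) / 2) - 1 = 1 / z" by (metis add_diff_cancel_right')
  from eta_domain_cut[OF inverse_eta_domain[OF z], unfolded this] show ?thesis .
qed

text \<open>Thus g = -phi/pi with the phi that parametrises 1/z, so exp(-kappa g) = exp(kappa
  phi/pi), which is the large part of the Jost exponential.\<close>

lemma g_fun_eq_Arcsin:
  assumes z: "z \<notin> complex_of_real ` {-1..1}"
  shows "g_fun z = - Arcsin (1 / z) / of_real pi"
proof -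
  have z0: "z \<noteq> 0" by (rule outside_nonzero[OF z])
  have "1 / (2 * (- z / 2)) = - (1 / z)" by simp
  thus ?thesis unfolding g_fun_def using a_fun_eq_Arcsin[of "- z / 2"] z0 Arcsin_minus[OF inverse_cut[OF z]] by simp
qed

text \<open>The part of \<open>a\<close> that is not linear in \<open>\<kappa>\<close>.\<close>

definition a_correction :: "complex \<Rightarrow> complex" where "a_correction l = Ln ((1 + csqrt (1 - 4 * l^2)) / 2)"

lemma small_cut:
  assumes "norm l < 1 / 2 \<or> Im l \<noteq> 0" "l \<noteq> 0"
  shows "1 - 4 * l^2 \<notin> \<real>\<^sub>\<le>\<^sub>0"
proof
  assume "1 - 4 * l^2 \<in> \<real>\<^sub>\<le>\<^sub>0"
  hence i: "Im (l^2) = 0" and r: "Re (l^2) \<ge> 1 / 4" by (auto simp: complex_nonpos_Reals_iff)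
  from i have "Re l = 0 \<or> Im l = 0" by (auto simp: power2_eq_square)
  moreover have "Re l \<noteq> 0"
  proof
    assume "Re l = 0"
    hence "Re (l^2) \<le> 0" by (simp add: power2_eq_square)
    with r show False by simp
  qed
  ultimately have im: "Im l = 0" by simp
  hence "norm l < 1 / 2" using assms by simp
  hence "norm l ^ 2 < (1 / 2)^2" by (intro power_strict_mono) auto
  moreover have "norm l ^ 2 = (Re l)^2" "Re (l^2) = (Re l)^2"
    using im by (simp_all only: cmod_power2) (simp_all add: power2_eq_square)
  ultimately show False using r by (simp add: power2_eq_square)
qed

lemma csqrt_Re_pos:
  assumes "u \<notin> \<real>\<^sub>\<le>\<^sub>0"
  shows "Re (csqrt u) > 0"
proof -
  have "1 - u \<notin> complex_of_real ` {1..}" using assms by (force simp: complex_nonpos_Reals_iff complex_eq_iff)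
  from cut_plane_csqrt(2)[OF this] show ?thesis by simp
qed

lemma a_correction_facts:
  assumes l: "norm l < 1 / 2 \<or> Im l \<noteq> 0" "l \<noteq> 0"
  shows "exp (a_correction l) = (1 + csqrt (1 - 4 * l^2)) / 2" "\<bar>Im (a_correction l)\<bar> < pi / 2" "isCont a_correction l"
    "Im l = 0 \<Longrightarrow> Im (a_correction l) = 0"
proof -
  define r where "r = csqrt (1 - 4 * l^2)"
  have r: "Re r > 0" unfolding r_def by (rule csqrt_Re_pos[OF small_cut[OF l]])
  have p: "Re ((1 + r) / 2) > 0" using r by simp
  hence nz: "(1 + r) / 2 \<noteq> 0" by (metis less_irrefl zero_complex.sel(1))
  show "exp (a_correction l) = (1 + csqrt (1 - 4 * l^2)) / 2" unfolding a_correction_def r_def[symmetric] using nz by (rule exp_Ln)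
  show "\<bar>Im (a_correction l)\<bar> < pi / 2" unfolding a_correction_def r_def[symmetric] using Re_Ln_pos_lt[OF nz] p by simp
  show "isCont a_correction l" unfolding a_correction_def[abs_def]
    by (intro continuous_intros isCont_Ln' isCont_csqrt' small_cut[OF l] pos_Re_not_nonpos[OF p, unfolded r_def]) auto
  assume im: "Im l = 0"
  hence n: "norm l < 1 / 2" using l by simp
  have lr: "l = of_real (Re l)" using im by (simp add: complex_eq_iff)
  define x where "x = 1 - 4 * (Re l)^2"
  have "1 - 4 * l^2 = of_real x" by (subst lr) (simp add: x_def)
  moreover have "x \<ge> 0"
  proof -
    have "\<bar>Re l\<bar> \<le> 1 / 2" using abs_Re_le_cmod[of l] n by linarith
    hence "\<bar>Re l\<bar> ^ 2 \<le> (1 / 2)^2" by (intro power_mono) auto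
    thus ?thesis by (simp add: x_def power2_eq_square)
  qed
  ultimately have "a_correction l = Ln (of_real ((1 + sqrt x) / 2))" by (simp add: a_correction_def csqrt_of_real_nonneg)
  also have "\<dots> = of_real (ln ((1 + sqrt x) / 2))"
    using \<open>x \<ge> 0\<close> real_sqrt_ge_zero[of x] by (intro Ln_of_real) (simp add: add_pos_nonneg)
  finally show "Im (a_correction l) = 0" by (simp only: Im_complex_of_real)
qed

text \<open>The formula for a in the upper half-plane, written with Ln(-i lambda), whose cut is the
  negative imaginary axis; near 0 it therefore remains continuous up to the real shore.\<close>

definition aU :: "complex \<Rightarrow> complex" where "aU l = (a_correction l - Ln (- (\<i> * l))) / (\<i> * of_real pi)"

lemma a_fun_upper:
  assumes im: "Im l > 0"
  shows "a_fun l = aU l"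
proof -
  have l: "norm l < 1 / 2 \<or> Im l \<noteq> 0" "l \<noteq> 0" using im by auto
  define r where "r = csqrt (1 - 4 * l^2)"
  have r: "Re r > 0" unfolding r_def by (rule csqrt_Re_pos[OF small_cut[OF l]])
  have r2: "r^2 = 1 - 4 * l^2" by (simp add: r_def)
  have cs: "csqrt (1 - 1 / (4 * l^2)) = \<i> * r / (2 * l)"
  proof (rule csqrt_unique)
    show "(\<i> * r / (2 * l))^2 = 1 - 1 / (4 * l^2)"
      using l(2) by (simp add: power_divide power_mult_distrib r2 diff_divide_distrib)
    have i: "2 * Re r * Im r = - 8 * Re l * Im l"
      using arg_cong[OF r2, of Im] by (simp add: power2_eq_square)
    hence i: "Re r * Im r = - 4 * Re l * Im l" by (simp add: mult_ac)
    \<comment> \<open>The sign of the root is decided by Re(i r / (2 l)), which has the sign of Re r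
      Im l - Im r Re l. Multiplying by Re r brings in Re r Im r, known from r^2 = 1 - 4 l^2.\<close>
    have "Re r * (Re r * Im l - Im r * Re l) = Re r ^ 2 * Im l - (Re r * Im r) * Re l"
      by (simp add: power2_eq_square algebra_simps)
    also have "\<dots> = Re r ^ 2 * Im l + 4 * Re l ^ 2 * Im l"
      unfolding i by (simp add: power2_eq_square algebra_simps)
    also have "\<dots> > 0" using r im by (intro add_pos_nonneg) auto
    finally have "Re r * Im l - Im r * Re l > 0" using r by (simp add: zero_less_mult_iff)
    hence "Re (\<i> * r * cnj (2 * l)) > 0" by (simp add: algebra_simps)
    hence "Re (\<i> * r / (2 * l)) > 0" unfolding Re_complex_div_gt_0 .
    thus "0 < Re (\<i> * r / (2 * l)) \<or> Re (\<i> * r / (2 * l)) = 0 \<and> 0 \<le> Im (\<i> * r / (2 * l))" ..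
  qed
  have "(\<i> + sqrt_lam l) / (2 * l) = \<i> * (1 + r) / (2 * l)"
    unfolding sqrt_lam_def cs using l(2) by (simp add: distrib_left)
  moreover have "Ln (\<i> * (1 + r) / (2 * l)) = a_correction l - Ln (- (\<i> * l))"
  proof (rule Ln_unique)
    have il: "- (\<i> * l) \<noteq> 0" using l(2) by simp
    have "exp (a_correction l - Ln (- (\<i> * l))) = ((1 + r) / 2) / (- (\<i> * l))"
      unfolding exp_diff a_correction_facts(1)[OF l] r_def exp_Ln[OF il] ..
    also have "\<dots> = \<i> * (1 + r) / (2 * l)"
      using l(2) by (simp add: divide_simps)
    finally show "exp (a_correction l - Ln (- (\<i> * l))) = \<i> * (1 + r) / (2 * l)" .
    have "\<bar>Im (Ln (- (\<i> * l)))\<bar> \<le> pi / 2" using Re_Ln_pos_le[OF il] im by simp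
    thus "- pi < Im (a_correction l - Ln (- (\<i> * l)))" "Im (a_correction l - Ln (- (\<i> * l))) \<le> pi"
      using a_correction_facts(2)[OF l] by auto
  qed
  ultimately show ?thesis unfolding a_fun_def aU_def by (simp only:) simp
qed

lemma a_fun_lower:
  assumes im: "Im l < 0"
  shows "a_fun l = - aU (- l)"
proof -
  have l0: "l \<noteq> 0" using im by auto
  have c: "1 - (1 / (2 * l))^2 \<notin> \<real>\<^sub>\<le>\<^sub>0" by (rule inverse_cut) (use im in \<open>auto dest: arg_cong[where f = Im]\<close>)
  have "a_fun (- l) = - a_fun l"
    using a_fun_eq_Arcsin[of "- l"] a_fun_eq_Arcsin[OF l0] Arcsin_minus[OF c] l0 by simp
  thus ?thesis using a_fun_upper[of "- l"] im by simp
qed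

lemma aU_isCont:
  assumes "Im l \<ge> 0" "norm l < 1 / 2" "l \<noteq> 0"
  shows "isCont aU l"
proof -
  have "- (\<i> * l) \<notin> \<real>\<^sub>\<le>\<^sub>0" using assms by (auto simp: complex_nonpos_Reals_iff complex_eq_iff)
  thus ?thesis unfolding aU_def[abs_def] using a_correction_facts(3)[of l] assms
    by (intro continuous_intros isCont_Ln') auto
qed

lemma shore_eqI:
  fixes f :: "complex \<Rightarrow> 'a::t2_space"
  assumes "(f \<longlongrightarrow> L) (at z within half_plane s)" and im: "Im z = 0"
  shows "shore s f z = L"
proof -
  have "at z within half_plane s \<noteq> bot"
  proof -
    have "z islimpt half_plane s"
    proof (cases s)
      case Upper
      show ?thesis unfolding Upper islimpt_approachable
      proof (intro allI impI)
        fix e :: real assume e: "e > 0"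
        show "\<exists>x'\<in>half_plane Upper. x' \<noteq> z \<and> dist x' z < e"
          by (rule bexI[of _ "z + \<i> * of_real (e / 2)"]) (use e im in \<open>auto simp: dist_norm norm_mult\<close>)
      qed
    next
      case Lower
      show ?thesis unfolding Lower islimpt_approachable
      proof (intro allI impI)
        fix e :: real assume e: "e > 0"
        show "\<exists>x'\<in>half_plane Lower. x' \<noteq> z \<and> dist x' z < e"
          by (rule bexI[of _ "z - \<i> * of_real (e / 2)"]) (use e im in \<open>auto simp: dist_norm norm_mult\<close>)
      qed
    qed
    thus ?thesis by (simp add: trivial_limit_within)
  qed
  thus ?thesis unfolding shore_def using assms(1) by (rule tendsto_Lim)
qed

lemma real_segment:
  assumes "norm l < 1 / 2"
  shows "l \<in> closed_segment (- 1 / 2) (1 / 2) \<longleftrightarrow> Im l = 0"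
proof
  assume "l \<in> closed_segment (- 1 / 2) (1 / 2)"
  thus "Im l = 0" by (auto simp: in_segment scaleR_conv_of_real)
next
  assume im: "Im l = 0"
  have "\<bar>Re l\<bar> \<le> 1 / 2" using abs_Re_le_cmod[of l] assms by linarith
  hence "l = (1 - (Re l + 1 / 2)) *\<^sub>R (- 1 / 2) + (Re l + 1 / 2) *\<^sub>R (1 / 2)" "0 \<le> Re l + 1 / 2" "Re l + 1 / 2 \<le> 1"
    using im by (auto simp: complex_eq_iff field_simps)
  thus "l \<in> closed_segment (- 1 / 2) (1 / 2)" unfolding in_segment by blast
qed

text \<open>On the cut the shore limit exists because \<open>aU\<close> is continuous there and
  agrees with \<open>a_fun\<close> in the open half-plane; the lower half-plane follows from
  oddness.\<close>

lemma a_val_eq: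
  assumes l: "l \<in> closed_half_plane s" "norm l < 1 / 2" "l \<noteq> 0"
  shows "a_val s l = side_sign s * aU (side_sign s * l)"
proof (cases "Im l = 0")
  case False
  hence "a_val s l = a_fun l" unfolding a_val_def using real_segment[OF l(2)] by simp
  thus ?thesis using a_fun_upper[of l] a_fun_lower[of l] l False by (cases s) auto
next
  case True
  have "(a_fun \<longlongrightarrow> side_sign s * aU (side_sign s * l)) (at l within half_plane s)"
  proof (rule Lim_transform_eventually)
    have "isCont (\<lambda>l. side_sign s * aU (side_sign s * l)) l"
    proof (cases s)
      case Upper
      thus ?thesis using aU_isCont[of l] l by simp
    next
      case Lower
      have "isCont (\<lambda>l. aU (- l)) l"
        by (rule isCont_o2[where f = uminus and g = aU]) (use aU_isCont[of "- l"] l Lower in \<open>auto intro!: continuous_intros\<close>)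
      thus ?thesis using Lower by simp
    qed
    thus "((\<lambda>l. side_sign s * aU (side_sign s * l)) \<longlongrightarrow> side_sign s * aU (side_sign s * l)) (at l within half_plane s)"
      using continuous_within continuous_at_imp_continuous_at_within by blast
    show "\<forall>\<^sub>F x in at l within half_plane s. side_sign s * aU (side_sign s * x) = a_fun x"
      by (rule eventually_at_topological[THEN iffD2])
        (rule exI[of _ UNIV], use a_fun_upper a_fun_lower in \<open>cases s; auto\<close>)
  qed
  hence "shore s a_fun l = side_sign s * aU (side_sign s * l)" using True by (rule shore_eqI)
  thus ?thesis unfolding a_val_def using real_segment[OF l(2)] True by simp
qed

lemma Ln_eq_rotate:
  assumes "Im l \<ge> 0" "l \<noteq> 0"
  shows "Ln l = \<i> * of_real (pi / 2) + Ln (- (\<i> * l))"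
proof (rule Ln_unique)
  have il: "- (\<i> * l) \<noteq> 0" using assms by simp
  have "exp (\<i> * of_real (pi / 2)) = \<i>" by (simp only: cis_conv_exp[symmetric] cis_pi_half)
  thus "exp (\<i> * of_real (pi / 2) + Ln (- (\<i> * l))) = l"
    unfolding exp_add exp_Ln[OF il] by simp
  have "\<bar>Im (Ln (- (\<i> * l)))\<bar> \<le> pi / 2" using Re_Ln_pos_le[OF il] assms by simp
  moreover have "Im (\<i> * of_real (pi / 2) + Ln (- (\<i> * l))) = pi / 2 + Im (Ln (- (\<i> * l)))" by simp
  ultimately show "- pi < Im (\<i> * of_real (pi / 2) + Ln (- (\<i> * l)))" "Im (\<i> * of_real (pi / 2) + Ln (- (\<i> * l))) \<le> pi"
    using pi_gt_zero by linarith+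
qed

lemma kappa_eq:
  assumes l: "l \<in> closed_half_plane s" "l \<noteq> 0"
  shows "kappa s l = - (side_sign s * \<i> * of_real (pi / 2)) - Ln (- (\<i> * (side_sign s * l)))"
proof (cases s)
  case Upper
  thus ?thesis using Ln_eq_rotate[of l] l by simp
next
  case Lower
  have "Im (cnj l) \<ge> 0" "cnj l \<noteq> 0" using l Lower by auto
  note R = Ln_eq_rotate[OF this]
  have "- (\<i> * cnj l) \<notin> \<real>\<^sub>\<le>\<^sub>0" using l Lower by (auto simp: complex_nonpos_Reals_iff complex_eq_iff)
  from cnj_Ln[OF this] have "cnj (Ln (- (\<i> * cnj l))) = Ln (\<i> * l)" by simp
  thus ?thesis using Lower unfolding R by (simp add: R)
qed

text \<open>The choice between \<open>a\<close> and \<open>- a - 1\<close> makes the imaginary part tend to \<open>-\<infinity>\<close> in both half-planes.\<close>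

definition A_param :: "side \<Rightarrow> complex \<Rightarrow> complex" where
  "A_param s l = (case s of Upper \<Rightarrow> a_val s l | Lower \<Rightarrow> - a_val s l - 1)"

text \<open>Both a and kappa involve the same Ln(-i sigma lambda), sigma being
  \<open>side_sign s\<close>; eliminating it leaves A affine in kappa up to the correction. The
  constant sigma later produces exp(sigma i phi), which distinguishes the two forms of
  \<open>Psi0\<close>.\<close>

lemma A_param_eq:
  assumes l: "l \<in> closed_half_plane s" "norm l < 1 / 2" "l \<noteq> 0"
  shows "A_param s l + 1 / 2 = side_sign s - \<i> * kappa s l / of_real pi + a_correction l / (\<i> * of_real pi)"
proof -
  have "a_correction (- l) = a_correction l" by (simp add: a_correction_def)
  hence e: "a_correction (side_sign s * l) = a_correction l" by (cases s) auto
  define L where "L = Ln (- (\<i> * (side_sign s * l)))"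
  have aU: "aU (side_sign s * l) = (a_correction l - L) / (\<i> * of_real pi)" unfolding aU_def e L_def ..
  have k: "kappa s l = - (side_sign s * \<i> * of_real (pi / 2)) - L" unfolding L_def by (rule kappa_eq[OF l(1,3)])
  have p: "complex_of_real pi \<noteq> 0" by simp
  have i: "x / (\<i> * of_real pi) = - \<i> * x / of_real pi" for x by (simp add: divide_simps)
  show ?thesis unfolding A_param_def a_val_eq[OF l] aU k i
    using p by (cases s; simp add: field_simps)
qed

lemma a_correction_small:
  assumes l: "norm l < 1 / 2" "l \<noteq> 0"
  shows "norm (a_correction l) \<le> 4 * norm l ^ 2"
proof -
  define r where "r = csqrt (1 - 4 * l^2)"
  have r: "Re r > 0" unfolding r_def by (rule csqrt_Re_pos[OF small_cut]) (use l in auto)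
  have "(r - 1) * (r + 1) = - 4 * l^2" unfolding r_def by (simp add: algebra_simps power2_eq_square[symmetric])
  hence "norm (r - 1) * norm (r + 1) = 4 * norm l ^ 2" by (metis norm_minus_cancel norm_mult norm_numeral norm_power mult_minus_left)
  moreover have "norm (r + 1) \<ge> 1" using complex_Re_le_cmod[of "r + 1"] r by simp
  ultimately have r1: "norm (r - 1) \<le> 4 * norm l ^ 2"
    using mult_left_mono[of 1 "norm (r + 1)" "norm (r - 1)"] by simp
  define u where "u = (r - 1) / 2"
  have u: "norm u \<le> 2 * norm l ^ 2" using r1 by (simp add: u_def norm_divide)
  have "norm l ^ 2 < (1 / 2)^2" using l by (intro power_strict_mono) auto
  hence u2: "norm u < 1 / 2" using u by (simp add: power2_eq_square)
  have "a_correction l = Ln (1 + u)" unfolding a_correction_def r_def[symmetric] u_def by (simp add: add_divide_distrib diff_divide_distrib)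
  thus ?thesis using norm_Ln_le[OF u2] u by simp
qed

lemma kappa_facts:
  assumes l: "l \<in> closed_half_plane s" "l \<noteq> 0"
  shows "Re (kappa s l) = - ln (norm l)" "\<bar>Im (kappa s l)\<bar> \<le> pi"
proof -
  define y where "y = side_sign s * l"
  have n: "norm y = norm l" by (simp add: y_def norm_mult norm_side_sign)
  have y: "- (\<i> * y) \<noteq> 0" "Im y \<ge> 0" using l by (cases s; auto simp: y_def)+
  have k: "kappa s l = - (side_sign s * \<i> * of_real (pi / 2)) - Ln (- (\<i> * y))" unfolding y_def by (rule kappa_eq[OF l])
  have "Re (Ln (- (\<i> * y))) = ln (norm l)" using Re_Ln[OF y(1)] n by (simp add: norm_mult)
  thus "Re (kappa s l) = - ln (norm l)" unfolding k by (cases s) auto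
  have "\<bar>Im (Ln (- (\<i> * y)))\<bar> \<le> pi / 2" using Re_Ln_pos_le[OF y(1)] y(2) by simp
  thus "\<bar>Im (kappa s l)\<bar> \<le> pi" unfolding k by (cases s) auto
qed

text \<open>On the cut the real part comes from Im Ln(-i sigma lambda), off the cut from the strip
  |Re Arcsin| < pi/2. The bound puts both a and -a - 1 into the strip of \<open>adm\<close>.\<close>

lemma Re_a_val_bound:
  assumes l: "l \<in> closed_half_plane s" "norm l < 1 / 2" "l \<noteq> 0"
  shows "\<bar>Re (a_val s l)\<bar> \<le> 1 / 2"
proof -
  define y where "y = side_sign s * l"
  have n: "norm y < 1 / 2" "y \<noteq> 0" "Im y \<ge> 0" using l by (cases s; auto simp: y_def)+
  have "\<bar>Re (aU y)\<bar> \<le> 1 / 2"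
  proof (cases "Im y = 0")
    case True
    have il: "- (\<i> * y) \<noteq> 0" using n by simp
    have "\<bar>Im (Ln (- (\<i> * y)))\<bar> \<le> pi / 2" using Re_Ln_pos_le[OF il] n(3) by simp
    moreover have "Re (aU y) = (Im (a_correction y) - Im (Ln (- (\<i> * y)))) / pi"
    proof -
      have "x / (\<i> * of_real pi) = - \<i> * x / of_real pi" for x by (simp add: divide_simps)
      thus ?thesis unfolding aU_def by (simp add: diff_divide_distrib)
    qed
    moreover have "Im (a_correction y) = 0" using a_correction_facts(4)[of y] n True by auto
    moreover have "\<bar>(0 - b) / pi\<bar> \<le> 1 / 2" if "\<bar>b\<bar> \<le> pi / 2" for b
      using that by (simp add: abs_divide divide_simps mult.commute)
    ultimately show ?thesis by metis
  next
    case False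
    hence im: "Im y > 0" using n by simp
    have "1 - (1 / (2 * y))^2 \<notin> \<real>\<^sub>\<le>\<^sub>0" by (rule inverse_cut) (use im in \<open>auto dest: arg_cong[where f = Im]\<close>)
    from Arcsin_cut(2)[OF this] have "\<bar>Re (a_fun y)\<bar> < 1 / 2"
      unfolding a_fun_eq_Arcsin[OF n(2)] by (simp add: divide_simps)
    thus ?thesis using a_fun_upper[OF im] by simp
  qed
  thus ?thesis unfolding a_val_eq[OF l] y_def by (cases s) auto
qed

text \<open>Below exp(-300) the real part -ln|lambda| of kappa exceeds 300, so |Im A| \<ge> (300 -
  1)/4 passes the threshold 50 of \<open>adm_low\<close>; here pi < 4 is used.\<close>

definition lam_bound :: real where "lam_bound = exp (- 300)"

lemma lam_bound_less: "lam_bound < 1 / 2"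
proof -
  have "exp (- 300 :: real) \<le> 1 / 301" using exp_ge_add_one_self[of "300::real"] by (simp add: exp_minus divide_simps)
  thus ?thesis by (simp add: lam_bound_def)
qed

lemma A_param_facts:
  assumes l: "l \<in> closed_half_plane s" "norm l < lam_bound" "l \<noteq> 0"
  shows "adm_low (A_param s l)" "1 / \<bar>Im (A_param s l)\<bar> \<le> 5 / norm (kappa s l)" "norm (kappa s l) \<ge> 100"
    "norm (a_correction l) \<le> 100 / norm (kappa s l)"
proof -
  have h: "norm l < 1 / 2" using l(2) lam_bound_less by linarith
  define L where "L = - ln (norm l)"
  have "ln (norm l) < ln (exp (- 300))" using l by (subst ln_less_cancel_iff) (auto simp: lam_bound_def)
  hence L: "L > 300" by (simp add: L_def)
  note k = kappa_facts[OF l(1,3), folded L_def]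
  have k1: "norm (kappa s l) \<le> L + pi" using cmod_le[of "kappa s l"] k L by linarith
  have k2: "L \<le> norm (kappa s l)" using complex_Re_le_cmod[of "kappa s l"] k by simp
  thus "norm (kappa s l) \<ge> 100" using L by simp
  have kp: "norm (kappa s l) > 0" using k2 L by linarith
  have e: "norm (a_correction l) \<le> 4 * norm l ^ 2" by (rule a_correction_small[OF h l(3)])
  have n1: "norm l * (L + pi) \<le> 10"
  proof -
    have "norm l = exp (- L)" using l(3) by (simp add: L_def)
    moreover have "exp (- L) * (L + pi) \<le> 10"
    proof -
      have "L + 1 \<le> exp L" using exp_ge_add_one_self[of L] by linarith
      moreover have "exp L \<ge> 1" using L by simp
      ultimately have "L + pi \<le> 10 * exp L" using pi_less_4 by linarith
      thus ?thesis by (simp add: exp_minus divide_simps)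
    qed
    ultimately show ?thesis by simp
  qed
  have "norm (a_correction l) * norm (kappa s l) \<le> 4 * norm l ^ 2 * (L + pi)" using e k1 L by (intro mult_mono) auto
  also have "\<dots> = 4 * norm l * (norm l * (L + pi))" by (simp add: power2_eq_square)
  also have "\<dots> \<le> 4 * 1 * 10" using h n1 L by (intro mult_mono) auto
  finally show "norm (a_correction l) \<le> 100 / norm (kappa s l)" using kp by (simp add: pos_le_divide_eq)
  have "norm l ^ 2 \<le> (1 / 2)^2" using h by (intro power_mono) auto
  hence e1: "norm (a_correction l) \<le> 1" using e by (simp add: power2_eq_square)
  have "Im (A_param s l) = Im (A_param s l + 1 / 2)" by simp
  also have "\<dots> = - (L + Re (a_correction l)) / pi"
  proof -
    have "Im (\<i> * kappa s l / of_real pi) = L / pi" using k(1) by simp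
    moreover have "Im (a_correction l / (\<i> * of_real pi)) = - Re (a_correction l) / pi"
    proof -
      have "x / (\<i> * of_real pi) = - \<i> * x / of_real pi" for x by (simp add: divide_simps)
      thus ?thesis by simp
    qed
    moreover have "Im (side_sign s) = 0" by (cases s) auto
    ultimately show ?thesis unfolding A_param_eq[OF l(1) h l(3)] by (simp add: diff_divide_distrib add_divide_distrib)
  qed
  finally have im: "Im (A_param s l) = - (L + Re (a_correction l)) / pi" .
  have "\<bar>Re (a_correction l)\<bar> \<le> 1" using abs_Re_le_cmod[of "a_correction l"] e1 by linarith
  hence Le: "L + Re (a_correction l) \<ge> L - 1" by linarith
  have i1: "\<bar>Im (A_param s l)\<bar> = (L + Re (a_correction l)) / pi" using Le L unfolding im by (simp add: abs_if field_simps)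
  have i2: "\<bar>Im (A_param s l)\<bar> \<ge> (L - 1) / 4"
    unfolding i1 using Le L pi_less_4 by (intro frac_le) auto
  hence i50: "\<bar>Im (A_param s l)\<bar> \<ge> 49" using L by simp
  show "1 / \<bar>Im (A_param s l)\<bar> \<le> 5 / norm (kappa s l)"
  proof -
    \<comment> \<open>|kappa| \<le> L + 4 and |Im A| \<ge> (L - 1)/4, and 4 (L + 4) \<le> 5 (L - 1)
      for L > 300.\<close>
    have "k \<le> 5 * X" if "k \<le> L + pi" "(L - 1) / 4 \<le> X" for k X
    proof -
      have "k \<le> L + 4" "L - 1 \<le> 4 * X" using that pi_less_4 by (linarith, simp add: divide_simps)
      thus ?thesis using L by linarith
    qed
    from this[OF k1 i2] have "norm (kappa s l) \<le> 5 * \<bar>Im (A_param s l)\<bar>" .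
    thus ?thesis using kp i50 by (simp add: divide_simps)
  qed
  have "Im (A_param s l) \<le> - 50"
  proof -
    have "50 * pi \<le> L + Re (a_correction l)" using Le L pi_less_4 by linarith
    thus ?thesis unfolding im by (simp add: divide_simps)
  qed
  moreover have "adm (A_param s l)"
  proof -
    have "- 3 / 2 \<le> Re (A_param s l) \<and> Re (A_param s l) \<le> 1 / 2"
      using Re_a_val_bound[OF l(1) h l(3)] unfolding A_param_def by (cases s) auto
    thus ?thesis using i50 by (simp add: adm_def)
  qed
  ultimately show "adm_low (A_param s l)" by (simp add: adm_low_def)
qed

text \<open>\<open>nf\<close> changes sign under A |-> -A - 1, and the matrix contains quotients of
  it. So the parameter with Im A \<rightarrow> -\<infinity> serves both half-planes of lambda,
  except that \<open>slope_quot\<close> contains A + 1 explicitly.\<close>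

lemma qf_reflect:
  assumes A: "adm A" and re: "\<bar>Re \<theta>\<bar> < pi"
  shows "qf (- A - 1) \<theta> = - qf A \<theta>" "deriv (qf (- A - 1)) \<theta> = - deriv (qf A) \<theta>"
proof -
  have n: "nf (- A - 1) \<theta> = - nf A \<theta>" for \<theta> by (simp add: nf_def)
  have e: "qf (- A - 1) \<theta> = - qf A \<theta>" if "\<bar>Re \<theta>\<bar> < pi" for \<theta>
    using qf_eq_nf[OF A that] qf_eq_nf[OF adm_reflect[OF A] that] n by (cases "Im \<theta> \<ge> 0") auto
  show "qf (- A - 1) \<theta> = - qf A \<theta>" by (rule e[OF re])
  have "((\<lambda>\<theta>. - qf A \<theta>) has_field_derivative - deriv (qf A) \<theta>) (at \<theta>)"
    by (rule DERIV_minus[OF qf_has_deriv[OF A re]])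
  hence "(qf (- A - 1) has_field_derivative - deriv (qf A) \<theta>) (at \<theta>)"
    by (rule has_field_derivative_transform_within_open[OF _ open_strip]) (use re e in auto)
  thus "deriv (qf (- A - 1)) \<theta> = - deriv (qf A) \<theta>" by (rule DERIV_imp_deriv)
qed

subsection \<open>Matrix estimates\<close>

definition entries_le :: "real \<Rightarrow> complex^2^2 \<Rightarrow> bool" where
  "entries_le b A \<longleftrightarrow> (\<forall>i j. norm (A $ i $ j) \<le> b)"

lemma entries_le_mat2: "entries_le b (mat2 p q r s) \<longleftrightarrow> norm p \<le> b \<and> norm q \<le> b \<and> norm r \<le> b \<and> norm s \<le> b"
  by (auto simp: entries_le_def forall_2)

lemma entries_le_mult:
  assumes "entries_le a A" "entries_le b B" "0 \<le> a"
  shows "entries_le (2 * a * b) (A ** B)"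
  unfolding entries_le_def
proof (intro allI)
  fix i j
  have "norm (A $ i $ k * B $ k $ j) \<le> a * b" for k
    unfolding norm_mult using assms by (intro mult_mono) (auto simp: entries_le_def)
  from add_mono[OF this[of 1] this[of 2]] show "norm ((A ** B) $ i $ j) \<le> 2 * a * b"
    using norm_triangle_ineq[of "A $ i $ 1 * B $ 1 $ j" "A $ i $ 2 * B $ 2 $ j"]
    by (simp add: matrix_matrix_mult_def sum_2)
qed

lemma norm_le_entries:
  assumes "entries_le b A"
  shows "norm A \<le> 4 * b"
proof -
  have r: "norm (A $ i) \<le> 2 * b" for i
  proof -
    have "norm (A $ i) \<le> (\<Sum>j\<in>UNIV. norm (A $ i $ j))" unfolding norm_vec_def by (intro L2_set_le_sum) auto
    also have "\<dots> \<le> 2 * b" using assms by (simp add: sum_2 entries_le_def) (metis add_mono mult_2)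
    finally show ?thesis .
  qed
  have "norm A \<le> (\<Sum>i\<in>UNIV. norm (A $ i))" unfolding norm_vec_def[of A] by (intro L2_set_le_sum) auto
  also have "\<dots> \<le> 4 * b" using add_mono[OF r[of 1] r[of 2]] by (simp add: sum_2)
  finally show ?thesis .
qed

text \<open>The first factor has determinant 1, and r1 r2 = 0 makes the factor with entries r1, r2
  unipotent triangular, so both inverses are explicit: adjugate and change of sign. E is the
  entrywise error multiplied by these inverses. The 16 collects 2 from each of the two products and
  4 from \<open>norm_le_entries\<close>.\<close>

lemma triangular_factor_estimate:
  fixes g11 g12 g21 g22 p11 p12 p21 p22 r1 r2 c :: complex
  assumes d: "p11 * p22 - p12 * p21 = 1" and r: "r1 * r2 = 0"
    and b: "1 \<le> b" "norm r1 \<le> b" "norm r2 \<le> b" "entries_le b (mat2 p11 p12 p21 p22)"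
    and k: "norm (g11 * exp c - (p11 + r1 * p12)) \<le> k" "norm (g12 * exp (- c) - (p12 + r2 * p11)) \<le> k"
      "norm (g21 * exp c - (p21 + r1 * p22)) \<le> k" "norm (g22 * exp (- c) - (p22 + r2 * p21)) \<le> k"
  shows "\<exists>E. norm E \<le> 16 * b^2 * k \<and>
     mat2 g11 g12 g21 g22 = mat2 p11 p12 p21 p22 ** (mat 1 + E) ** mat2 1 r2 r1 1 ** exp_sigma3 (- c)"
proof -
  define P where "P = mat2 p11 p12 p21 p22"
  define P' where "P' = mat2 p22 (- p12) (- p21) p11"
  define T where "T = mat2 1 r2 r1 1"
  define T' where "T' = mat2 1 (- r2) (- r1) 1"
  define D where "D = mat2 (g11 * exp c - (p11 + r1 * p12)) (g12 * exp (- c) - (p12 + r2 * p11))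
     (g21 * exp c - (p21 + r1 * p22)) (g22 * exp (- c) - (p22 + r2 * p21))"
  define E where "E = P' ** D ** T'"
  have r': "r2 * r1 = 0" using r by (simp add: mult.commute)
  have mid_value: "P ** P' = mat 1"
    unfolding P_def P'_def mat2_mult mat2_one using d by (simp add: mult.commute)
  have TT: "T' ** T = mat 1"
    unfolding T_def T'_def mat2_mult mat2_one using r r' by (simp only: mult_1 mult_1_right mult_zero_left mult_zero_right add_0_left add_0_right mult_minus_left minus_zero) simp
  have "entries_le b P'" "entries_le k D" "entries_le b T'" using b k by (auto simp: P'_def D_def T'_def entries_le_mat2)
  hence "entries_le (2 * (2 * b * k) * b) E"
    unfolding E_def using b order_trans[OF norm_ge_zero k(1)] by (intro entries_le_mult) auto
  hence nE: "norm E \<le> 16 * b^2 * k" using norm_le_entries by (force simp: power2_eq_square mult_ac)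
  have D: "(A + B) ** C = A ** C + B ** C" for A B C :: "complex^2^2"
    by (simp add: matrix_matrix_mult_def vec_eq_iff distrib_right sum.distrib)
  have "P ** (mat 1 + E) ** T = P ** T + (P ** P') ** D ** (T' ** T)"
    unfolding E_def by (simp add: matrix_add_ldistrib D matrix_mul_assoc)
  also have "\<dots> = P ** T + D" unfolding mid_value TT by simp
  also have "P ** T = mat2 (p11 + r1 * p12) (p12 + r2 * p11) (p21 + r1 * p22) (p22 + r2 * p21)"
    unfolding P_def T_def mat2_mult by (simp add: algebra_simps)
  also have "\<dots> + D = mat2 (g11 * exp c) (g12 * exp (- c)) (g21 * exp c) (g22 * exp (- c))"
    unfolding D_def mat2_add by simp
  finally have PT: "P ** (mat 1 + E) ** T = mat2 (g11 * exp c) (g12 * exp (- c)) (g21 * exp c) (g22 * exp (- c))" .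
  have "P ** (mat 1 + E) ** T ** exp_sigma3 (- c) = mat2 g11 g12 g21 g22"
    unfolding PT exp_sigma3_def mat2_mult by (simp add: mult.assoc exp_add[symmetric])
  thus ?thesis using nE unfolding P_def T_def by metis
qed

text \<open>One matrix entry. X and Z/(u B^2) are close to (1 - rho) B and (1 + rho)/B; the part
  without rho gives an entry of the outer parametrix, the part with rho gives r times the other
  entry of the same row. \<open>S1\<close> collects the errors of X, Z, u and m, \<open>S2\<close>
  that of the phase p, \<open>S3\<close> that of the second exponential.\<close>

lemma entry_estimate:
  fixes X Z p q \<rho> r B x m u \<eta> \<mu> :: complex
  assumes \<epsilon>: "\<epsilon> \<le> 1 / 2" and R: "R \<ge> 1" and \<eta>: "norm \<eta> = 1" and \<mu>: "norm \<mu> = 1" and B0: "B \<noteq> 0" and q0: "q \<noteq> 0"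
    and X: "norm (X - (1 - \<rho>) * B) \<le> \<epsilon>" and Z: "norm (Z - (1 + \<rho>) * B) \<le> \<epsilon>"
    and u: "norm (u - 1) \<le> \<epsilon>" and m: "norm (m - \<mu>) \<le> \<epsilon>" and p: "norm (p - q) \<le> \<epsilon>" and r: "norm (p * \<rho> - r / q) \<le> \<epsilon>"
    and b: "norm B \<le> R" "norm (1 / B) \<le> R" "norm x \<le> R" "norm q \<le> R" "norm \<rho> \<le> R"
  shows "norm (p * ((\<eta> * X + (1 - x * m) * (Z / (u * B^2))) / 2)
     - ((\<eta> * B + (1 - \<mu> * x) / B) / 2 * q + r * ((- \<eta> * B + (1 - \<mu> * x) / B) / 2 / q))) \<le> 24 * R^4 * \<epsilon>"
proof -
  define Y where "Y = Z / (u * B^2)"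
  define a where "a = 1 - x * m"
  define a0 where "a0 = 1 - \<mu> * x"
  have e0: "0 \<le> \<epsilon>" using order_trans[OF norm_ge_zero X] .
  have R2: "R \<le> R^2" "1 \<le> R^2" "R^2 \<le> R^3" "R^3 \<le> R^4" "R^2 \<le> R^4" "1 \<le> R^4" "R \<le> R^4" "1 \<le> R^3"
    using R power_increasing[of 1 2 R] power_increasing[of 0 2 R] power_increasing[of 2 3 R] power_increasing[of 3 4 R] power_increasing[of 2 4 R]
      power_increasing[of 0 4 R] power_increasing[of 1 4 R] power_increasing[of 0 3 R] by simp_all
  have nu: "norm u \<ge> 1 / 2" using u \<epsilon> norm_triangle_ineq2[of 1 "1 - u"] by (simp add: norm_minus_commute)
  have u0: "u \<noteq> 0" using nu by auto
  have iu: "norm (1 / u) \<le> 2" using nu u0 by (simp add: norm_divide divide_simps)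
  have r1: "norm (1 + \<rho>) \<le> 2 * R" using norm_triangle_ineq[of 1 \<rho>] b R by simp
  have rB: "norm ((1 + \<rho>) / B) \<le> 2 * R^2"
  proof -
    have "norm ((1 + \<rho>) * (1 / B)) \<le> 2 * R * R" unfolding norm_mult using r1 b R by (intro mult_mono) auto
    thus ?thesis by (simp add: power2_eq_square)
  qed
  have Yd: "norm (Y - (1 + \<rho>) / B) \<le> 6 * R^2 * \<epsilon>"
  proof -
    have "Y - (1 + \<rho>) / B = (Z - (1 + \<rho>) * B) * (1 / u * (1 / B * (1 / B))) + (1 + \<rho>) / B * (1 / u * (1 - u))"
      unfolding Y_def using u0 B0 by (simp add: divide_simps power2_eq_square) (simp add: algebra_simps)
    moreover have "norm ((Z - (1 + \<rho>) * B) * (1 / u * (1 / B * (1 / B)))) \<le> \<epsilon> * (2 * (R * R))"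
      unfolding norm_mult using Z iu b R e0 by (intro mult_mono) auto
    moreover have "norm ((1 + \<rho>) / B * (1 / u * (1 - u))) \<le> 2 * R^2 * (2 * \<epsilon>)"
      unfolding norm_mult using rB iu u by (intro mult_mono) (auto simp: norm_minus_commute)
    moreover have "\<epsilon> * (2 * (R * R)) + 2 * R^2 * (2 * \<epsilon>) = 6 * R^2 * \<epsilon>" by (simp add: power2_eq_square)
    ultimately show ?thesis
      using norm_triangle_ineq[of "(Z - (1 + \<rho>) * B) * (1 / u * (1 / B * (1 / B)))" "(1 + \<rho>) / B * (1 / u * (1 - u))"]
      by (simp only:)
  qed
  have nm: "norm m \<le> 3 / 2" using m \<epsilon> \<mu> norm_triangle_ineq[of "m - \<mu>" \<mu>] by simp
  have na: "norm a \<le> 3 * R"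
  proof -
    have "norm (x * m) \<le> R * (3 / 2)" unfolding norm_mult using b nm R by (intro mult_mono) auto
    thus ?thesis unfolding a_def using norm_triangle_ineq4[of 1 "x * m"] R by simp
  qed
  have na0: "norm a0 \<le> 2 * R" unfolding a0_def using norm_triangle_ineq4[of 1 "\<mu> * x"] b \<mu> R by (simp add: norm_mult)
  have naa: "norm (a - a0) \<le> R * \<epsilon>"
  proof -
    have "a - a0 = x * (\<mu> - m)" by (simp add: a_def a0_def algebra_simps)
    thus ?thesis using mult_mono[OF b(3) m] R by (simp add: norm_mult norm_minus_commute)
  qed
  have aY: "norm (a * Y - a0 * ((1 + \<rho>) / B)) \<le> 20 * R^3 * \<epsilon>"
  proof -
    have D: "a * Y - a0 * c = a * (Y - c) + (a - a0) * c" for c by (simp add: algebra_simps)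
    have "a * Y - a0 * ((1 + \<rho>) / B) = a * (Y - (1 + \<rho>) / B) + (a - a0) * ((1 + \<rho>) / B)"
      using D[of "(1 + \<rho>) / B"] .
    moreover have "norm (a * (Y - (1 + \<rho>) / B)) \<le> 3 * R * (6 * R^2 * \<epsilon>)"
      unfolding norm_mult using na Yd R by (intro mult_mono) auto
    moreover have "norm ((a - a0) * ((1 + \<rho>) / B)) \<le> R * \<epsilon> * (2 * R^2)"
      unfolding norm_mult[of "a - a0"] using naa rB R e0 by (intro mult_mono) auto
    ultimately show ?thesis
      using norm_triangle_ineq[of "a * (Y - (1 + \<rho>) / B)" "(a - a0) * ((1 + \<rho>) / B)"]
      by (simp add: power2_eq_square power3_eq_cube mult_ac)
  qed
  have np: "norm p \<le> 2 * R" using p \<epsilon> b R norm_triangle_ineq[of "p - q" q] by simp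
  have nB: "norm (s * B + a0 / B) \<le> 3 * R^2" if "norm s = 1" for s
  proof -
    have "norm (a0 * (1 / B)) \<le> 2 * R * R" unfolding norm_mult using na0 b R by (intro mult_mono) auto
    moreover have "norm (s * B) \<le> R" using that b by (simp add: norm_mult)
    ultimately show ?thesis using norm_triangle_ineq[of "s * B" "a0 / B"] R2 by (simp add: power2_eq_square)
  qed
  define S1 where "S1 = p * (\<eta> * (X - (1 - \<rho>) * B) + (a * Y - a0 * ((1 + \<rho>) / B)))"
  define S2 where "S2 = (p - q) * (\<eta> * B + a0 / B)"
  define S3 where "S3 = (p * \<rho> - r / q) * (- \<eta> * B + a0 / B)"
  have S1: "norm S1 \<le> 2 * R * (\<epsilon> + 20 * R^3 * \<epsilon>)"
    unfolding S1_def norm_mult[of p]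
  proof (rule mult_mono[OF np])
    have "norm (\<eta> * (X - (1 - \<rho>) * B)) \<le> \<epsilon>" using X \<eta> by (simp add: norm_mult)
    thus "norm (\<eta> * (X - (1 - \<rho>) * B) + (a * Y - a0 * ((1 + \<rho>) / B))) \<le> \<epsilon> + 20 * R^3 * \<epsilon>"
      using aY norm_triangle_mono by blast
  qed (use R in auto)
  have S2: "norm S2 \<le> \<epsilon> * (3 * R^2)" unfolding S2_def norm_mult[of "p - q"] using p nB[OF \<eta>] e0 by (intro mult_mono) auto
  have S3: "norm S3 \<le> \<epsilon> * (3 * R^2)" unfolding S3_def norm_mult[of "p * \<rho> - r / q"]
    using r nB[of "- \<eta>"] \<eta> e0 by (intro mult_mono) auto
  have n: "\<epsilon> * R \<le> \<epsilon> * R^4" "\<epsilon> * R^2 \<le> \<epsilon> * R^4" using R2 e0 by (intro mult_left_mono; simp)+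
  have "norm (S1 + S2 + S3) \<le> 48 * R^4 * \<epsilon>"
    using norm_triangle_ineq[of S1 S2] norm_triangle_ineq[of "S1 + S2" S3] S1 S2 S3 n
    by (simp add: algebra_simps power3_eq_cube power4_eq_xxxx)
  moreover have "p * ((\<eta> * X + a * Y) / 2) - ((\<eta> * B + a0 / B) / 2 * q + r * ((- \<eta> * B + a0 / B) / 2 / q)) = (S1 + S2 + S3) / 2"
    unfolding S1_def S2_def S3_def using B0 q0 by (simp add: algebra_simps add_divide_distrib diff_divide_distrib)
  ultimately show ?thesis unfolding Y_def[symmetric] a_def[symmetric] a0_def[symmetric] by (simp only: norm_divide) simp
qed

text \<open>The outer parametrix in the variables \<open>x = sin \<phi>\<close>, \<open>B = \<beta>\<close>, \<open>q = exp (\<plusminus> \<i> \<phi>)\<close>, in which it is the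
  leading term of the one-term expansion; \<open>Psi0_eq\<close> shows that this is \<open>\<Psi>\<^sub>0\<close>.\<close>

definition Psi_form :: "complex \<Rightarrow> complex \<Rightarrow> complex \<Rightarrow> complex \<Rightarrow> complex^2^2" where
  "Psi_form \<mu> B x q = mat2 ((B + (1 - \<mu> * x) / B) / 2 * q) ((- B + (1 - \<mu> * x) / B) / 2 / q)
     ((- B + (1 + \<mu> * x) / B) / 2 * q) ((B + (1 + \<mu> * x) / B) / 2 / q)"

text \<open>The shape of \<open>Gphi\<close>: u is the normalised slope at pi/2, c = cos phi, x =
  sin phi, m the factor \<open>slope_quot\<close>, and X, Z are the normalised value and derivative
  at phi (index 1) and at -phi (index 2).\<close>

definition Gamma_form :: "complex \<Rightarrow> complex \<Rightarrow> complex \<Rightarrow> complex \<Rightarrow> complex \<Rightarrow> complex \<Rightarrow> complex \<Rightarrow> complex \<Rightarrow> complex^2^2" where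
  "Gamma_form u c x m X1 Z1 X2 Z2 = mat2 ((X1 + (1 - x * m) * (Z1 / (u * c))) / 2) ((- X2 + (1 - x * m) * (Z2 / (u * c))) / 2)
     ((- X1 + (1 + x * m) * (Z1 / (u * c))) / 2) ((X2 + (1 + x * m) * (Z2 / (u * c))) / 2)"

text \<open>Rows differ by the signs of B and x, columns by the sign of B and by inverting q and the
  phase, so one entry estimate serves all four entries. 1536 R^10 is 16 (2 R^3)^2 times 24 R^4,
  where 2 R^3 bounds the entries of \<open>Psi_form\<close>.\<close>

lemma Gamma_form_estimate:
  fixes B q r1 r2 c e :: complex
  assumes \<epsilon>: "\<epsilon> \<le> 1 / 2" and R: "R \<ge> 1" and \<mu>: "norm \<mu> = 1" and nz: "B \<noteq> 0" "q \<noteq> 0" "e \<noteq> 0"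
    and X1: "norm (X1 / e - (1 - \<rho>1) * B) \<le> \<epsilon>" and Z1: "norm (Z1 / e - (1 + \<rho>1) * B) \<le> \<epsilon>"
    and X2: "norm (X2 * e - (1 - \<rho>2) * B) \<le> \<epsilon>" and Z2: "norm (Z2 * e - (1 + \<rho>2) * B) \<le> \<epsilon>"
    and u: "norm (u - 1) \<le> \<epsilon>" and m: "norm (m - \<mu>) \<le> \<epsilon>"
    and p1: "norm (e * exp c - q) \<le> \<epsilon>" and r1: "norm (e * exp c * \<rho>1 - r1 / q) \<le> \<epsilon>"
    and p2: "norm (1 / (e * exp c) - 1 / q) \<le> \<epsilon>" and r2: "norm (1 / (e * exp c) * \<rho>2 - r2 * q) \<le> \<epsilon>"
    and deriv_ratio: "r1 * r2 = 0"
    and b: "norm B \<le> R" "norm (1 / B) \<le> R" "norm x \<le> R" "norm q \<le> R" "norm (1 / q) \<le> R" "norm \<rho>1 \<le> R" "norm \<rho>2 \<le> R"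
      "norm r1 \<le> R" "norm r2 \<le> R"
  shows "\<exists>E. norm E \<le> 1536 * R^10 * \<epsilon> \<and> Gamma_form u (B^2) x m X1 Z1 X2 Z2 = Psi_form \<mu> B x q ** (mat 1 + E) ** mat2 1 r2 r1 1 ** exp_sigma3 (- c)"
proof -
  let ?k = "24 * R^4 * \<epsilon>"
  have sc: "e * w * ((s * (X / e) + a * (Z / e / v)) / 2) = ((s * X + a * (Z / v)) / 2) * w"
    "1 / (e * w) * ((s * (X * e) + a * (Z * e / v)) / 2) = ((s * X + a * (Z / v)) / 2) * (1 / w)" if "w \<noteq> 0"
    for s X Z a v w :: complex using nz that by (simp_all add: divide_simps) (simp_all add: algebra_simps)
  have d: "((B + (1 - \<mu> * x) / B) / 2 * q) * ((B + (1 + \<mu> * x) / B) / 2 / q)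
     - ((- B + (1 - \<mu> * x) / B) / 2 / q) * ((- B + (1 + \<mu> * x) / B) / 2 * q) = 1"
    using nz by (simp add: divide_simps) (simp add: algebra_simps)
  have b3: "norm ((s * B + (1 + v * x) / B) / 2) \<le> 2 * R^2" if "norm s = 1" "norm v = 1" for s v
  proof -
    have "norm (1 + v * x) \<le> 2 * R" using norm_triangle_ineq[of 1 "v * x"] b R that by (simp add: norm_mult)
    hence "norm ((1 + v * x) * (1 / B)) \<le> 2 * R * R" unfolding norm_mult[of "1 + v * x"] using b R by (intro mult_mono) auto
    moreover have "norm (s * B) \<le> R" using that b by (simp add: norm_mult)
    moreover have "R * 1 \<le> R * R" using R by (intro mult_left_mono) auto
    moreover have "(1 + v * x) / B = (1 + v * x) * (1 / B)" by simp
    ultimately have "norm (s * B + (1 + v * x) / B) \<le> 4 * (R * R)"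
      using norm_triangle_ineq[of "s * B" "(1 + v * x) * (1 / B)"] R by (simp only: mult.assoc mult_1_right)
    thus ?thesis by (simp add: norm_divide power2_eq_square)
  qed
  have b4: "norm (y * q) \<le> 2 * R^3" "norm (y / q) \<le> 2 * R^3" if "norm y \<le> 2 * R^2" for y
  proof -
    have "norm (y * q) \<le> 2 * R^2 * R" unfolding norm_mult using that b R by (intro mult_mono) auto
    thus "norm (y * q) \<le> 2 * R^3" by (simp add: power2_eq_square power3_eq_cube mult_ac)
    have "norm (y * (1 / q)) \<le> 2 * R^2 * R" unfolding norm_mult using that b R by (intro mult_mono) auto
    thus "norm (y / q) \<le> 2 * R^3" by (simp add: power2_eq_square power3_eq_cube mult_ac)
  qed
  have R3: "1 \<le> 2 * R^3" "R \<le> 2 * R^3" using R power_increasing[of 1 3 R] by simp_all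
  have B: "entries_le (2 * R^3) (Psi_form \<mu> B x q)"
    unfolding Psi_form_def entries_le_mat2 using b3[of 1 \<mu>] b3[of 1 "- \<mu>"] b3[of "-1" \<mu>] b3[of "-1" "- \<mu>"] \<mu>
    by (intro conjI b4) simp_all
  have nx: "norm (- x) \<le> R" and q': "1 / q \<noteq> 0" and iq: "norm (1 / (1 / q)) \<le> R" using b nz by auto
  have p2': "norm (1 / (e * exp c) - (1 / q)) \<le> \<epsilon>" and r2': "norm (1 / (e * exp c) * \<rho>2 - r2 / (1 / q)) \<le> \<epsilon>"
    using p2 r2 by simp_all
  have one: "norm (1::complex) = 1" "norm (- 1 :: complex) = 1" by simp_all
  note E1 = entry_estimate[OF \<epsilon> R one(1) \<mu> nz(1,2) X1 Z1 u m p1 r1 b(1,2,3,4,6)]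
  note E3 = entry_estimate[OF \<epsilon> R one(2) \<mu> nz(1,2) X1 Z1 u m p1 r1 b(1,2) nx b(4,6)]
  note E2 = entry_estimate[OF \<epsilon> R one(2) \<mu> nz(1) q' X2 Z2 u m p2' r2' b(1,2,3,5,7)]
  note E4 = entry_estimate[OF \<epsilon> R one(1) \<mu> nz(1) q' X2 Z2 u m p2' r2' b(1,2) nx b(5,7)]
  have ex: "1 / exp c = exp (- c)" by (simp add: exp_minus inverse_eq_divide)
  have "\<exists>E. norm E \<le> 16 * (2 * R^3)^2 * ?k \<and> Gamma_form u (B^2) x m X1 Z1 X2 Z2 = Psi_form \<mu> B x q ** (mat 1 + E) ** mat2 1 r2 r1 1 ** exp_sigma3 (- c)"
    unfolding Gamma_form_def Psi_form_def
  proof (rule triangular_factor_estimate[OF d deriv_ratio])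
    show "norm ((X1 + (1 - x * m) * (Z1 / (u * B^2))) / 2 * exp c - ((B + (1 - \<mu> * x) / B) / 2 * q + r1 * ((- B + (1 - \<mu> * x) / B) / 2 / q))) \<le> ?k"
      using E1 unfolding sc[OF exp_not_eq_zero] by simp
    show "norm ((- X1 + (1 + x * m) * (Z1 / (u * B^2))) / 2 * exp c - ((- B + (1 + \<mu> * x) / B) / 2 * q + r1 * ((B + (1 + \<mu> * x) / B) / 2 / q))) \<le> ?k"
      using E3 unfolding sc[OF exp_not_eq_zero] by simp
    show "norm ((- X2 + (1 - x * m) * (Z2 / (u * B^2))) / 2 * exp (- c) - ((- B + (1 - \<mu> * x) / B) / 2 / q + r2 * ((B + (1 - \<mu> * x) / B) / 2 * q))) \<le> ?k"
      using E2 unfolding sc[OF exp_not_eq_zero] ex by simp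
    show "norm ((X2 + (1 + x * m) * (Z2 / (u * B^2))) / 2 * exp (- c) - ((B + (1 + \<mu> * x) / B) / 2 / q + r2 * ((- B + (1 + \<mu> * x) / B) / 2 * q))) \<le> ?k"
      using E4 unfolding sc[OF exp_not_eq_zero] ex by simp
  qed (use B[unfolded Psi_form_def] R3 b in auto)
  moreover have "16 * (2 * R^3)^2 * ?k = 1536 * R^10 * \<epsilon>"
    by (simp add: power_mult_distrib power_mult[symmetric] power_add[symmetric])
  ultimately show ?thesis by (simp only:)
qed

section \<open>The outer parametrix in the variable phi\<close>

text \<open>With B^2 = cos phi and y = \<plusminus>i sin phi, q = B^2 + y is Euler's formula for
  exp(\<plusminus>i phi); then 1/q = B^2 - y and all products become linear in y.\<close>

lemma Psi_form_entries:
  fixes B y q b :: complex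
  assumes "B * b = 1" "y^2 = B^4 - 1" "q = B^2 + y"
  shows "(B + (1 - y) * b) * q = B + b + y * b" "(- B + (1 - y) * b) * (B^2 - y) = B - b - y * b"
    "(- B + (1 + y) * b) * q = B - b + y * b" "(B + (1 + y) * b) * (B^2 - y) = B + b - y * b"
    "(B^2 - y) * q = 1"
  using assms by algebra+

text \<open>Two nested principal square roots form the principal fourth root, since halving a
  principal logarithm leaves it principal; the inner root is cos(Arcsin(1/z)).\<close>

lemma beta_eq:
  assumes z: "z \<notin> complex_of_real ` {-1..1}"
  shows "beta z = ccos (Arcsin (1 / z))"
proof -
  have z0: "z \<noteq> 0" by (rule outside_nonzero[OF z])
  define u where "u = 1 - (1 / z)^2"
  have u: "u \<notin> \<real>\<^sub>\<le>\<^sub>0" unfolding u_def by (rule inverse_cut[OF z])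
  hence u0: "u \<noteq> 0" by auto
  have e: "(z^2 - 1) / z^2 = u" using z0 by (simp add: u_def power_divide diff_divide_distrib)
  have "csqrt u = exp (Ln u / 2)" using csqrt_exp_Ln[OF u0] .
  hence "Ln (csqrt u) = Ln u / 2" using mpi_less_Im_Ln[OF u0] Im_Ln_le_pi[OF u0] by simp
  hence "Ln (csqrt u) / 2 = Ln u / 4" by (simp only:) simp
  hence "csqrt (csqrt u) = exp (Ln u / 4)" using csqrt_exp_Ln[of "csqrt u"] u0 by (simp only: csqrt_eq_0 not_False_eq_True simp_thms)
  moreover have "cos (Arcsin (1 / z)) = csqrt u" using Arcsin_cut(1)[OF inverse_cut[OF z]] by (simp add: u_def)
  ultimately show ?thesis unfolding beta_def e using u0 by (simp add: powr_def)
qed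

lemma cos_Arcsin_nonzero:
  assumes z: "z \<notin> complex_of_real ` {-1..1}"
  shows "cos (Arcsin (1 / z)) \<noteq> 0"
  using Arcsin_cut(1)[OF inverse_cut[OF z]] inverse_cut[OF z] by auto

text \<open>Conjugation by \<open>sigma1\<close> changes the sign of y = i sin phi, which is what
  replacing i phi by -i phi does in \<open>Psi_form\<close>.\<close>

lemma Psi0_eq:
  assumes z: "z \<notin> complex_of_real ` {-1..1}"
  defines "\<phi> \<equiv> Arcsin (1 / z)"
  shows "Psi0 s z = Psi_form (side_sign s * \<i>) (ccos \<phi>) (sin \<phi>) (exp (side_sign s * \<i> * \<phi>))"
proof -
  define B where "B = ccos \<phi>"
  define b where "b = 1 / B"
  define x where "x = sin \<phi>"
  define y where "y = side_sign s * \<i> * x"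
  define q where "q = exp (side_sign s * \<i> * \<phi>)"
  have B0: "B \<noteq> 0" using cos_Arcsin_nonzero[OF z] by (simp add: B_def \<phi>_def)
  hence Bb: "B * b = 1" by (simp add: b_def)
  have B2: "B^2 = cos \<phi>" by (simp add: B_def)
  have y2: "y^2 = B^4 - 1"
  proof -
    have "B^4 = (cos \<phi>)^2" unfolding B2[symmetric] by (simp add: power_mult[symmetric])
    moreover have "y^2 = - (x^2)" unfolding y_def by (cases s) (simp_all add: power_mult_distrib)
    ultimately show ?thesis using sin_cos_squared_add[of \<phi>] unfolding x_def by (simp add: algebra_simps)
  qed
  have q: "q = B^2 + y"
    unfolding q_def B2 y_def x_def using exp_Euler[of \<phi>] exp_minus_Euler[of \<phi>] by (cases s) auto
  note P = Psi_form_entries[OF Bb y2 q]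
  have iq: "1 / q = B^2 - y" using P(5) by (metis mult_zero_right nonzero_eq_divide_eq zero_neq_one)
  have h: "w / 2 * q = w * q / 2" "w / 2 / q = w * (B^2 - y) / 2" "w / B = w * b" for w
    unfolding iq[symmetric] b_def by simp_all
  have F: "Psi_form (side_sign s * \<i>) B x q = mat2 ((B + b + y * b) / 2) ((B - b - y * b) / 2) ((B - b + y * b) / 2) ((B + b - y * b) / 2)"
    unfolding Psi_form_def y_def[symmetric] h P ..
  have xz: "\<i> / (2 * z) = \<i> * x / 2" by (simp add: x_def \<phi>_def)
  have bz: "beta z / 2 = B / 2" "1 / (2 * beta z) = b / 2" using beta_eq[OF z] by (simp_all add: B_def b_def \<phi>_def)
  have Ph: "Phi z = mat2 ((B + b + \<i> * x * b) / 2) ((B - b - \<i> * x * b) / 2) ((B - b + \<i> * x * b) / 2) ((B + b - \<i> * x * b) / 2)"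
    unfolding Phi_def beta_sigma1_def xz bz mat2_one cscale_mat2 mat2_add mat2_mult
    by (simp add: algebra_simps add_divide_distrib diff_divide_distrib)
  have "Psi0 s z = Psi_form (side_sign s * \<i>) B x q"
    unfolding F using Ph by (cases s) (simp_all add: y_def sigma1_def mat2_mult)
  thus ?thesis unfolding B_def x_def q_def .
qed

text \<open>In \<open>slope_quot\<close> the denominator a + 1 is A + 1 for a = A and -A for a = -A
  - 1; the two cases tend to i and to -i.\<close>

definition slope_limit :: "side \<Rightarrow> complex \<Rightarrow> complex" where
  "slope_limit s A = (case s of Upper \<Rightarrow> \<i> * A * deriv_ratio A / (A + 1) | Lower \<Rightarrow> - \<i> * deriv_ratio A)"

lemma slope_limit_estimate:
  assumes A: "adm_low A"
  shows "norm (slope_limit s A - side_sign s * \<i>) \<le> (2 * ratio_const + 1) / \<bar>Im A\<bar>"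
proof -
  have im: "\<bar>Im A\<bar> \<ge> 50" using A by (auto simp: adm_low_def)
  have A1: "norm (A + 1) \<ge> \<bar>Im A\<bar>" using abs_Im_le_cmod[of "A + 1"] by simp
  hence nz: "A + 1 \<noteq> 0" using im by auto
  note r = deriv_ratio_estimate[OF A]
  have K0: "0 \<le> ratio_const / \<bar>Im A\<bar>" using r norm_ge_zero order_trans by blast
  show ?thesis
  proof (cases s)
    case Upper
    have i: "norm (1 / (A + 1)) \<le> 1 / \<bar>Im A\<bar>" using A1 im by (simp add: norm_divide frac_le)
    also have "\<dots> \<le> 1 / 50" using im by (intro frac_le) auto
    finally have i50: "norm (1 / (A + 1)) \<le> 1" by simp
    have t: "norm (1 - 1 / (A + 1)) \<le> 2" using norm_triangle_ineq4[of 1 "1 / (A + 1)"] i50 by simp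
    have "\<i> * A * deriv_ratio A / (A + 1) - \<i> = \<i> * ((1 - 1 / (A + 1)) * (deriv_ratio A - 1) - 1 / (A + 1))"
    proof -
      have "A / (A + 1) = 1 - 1 / (A + 1)" using nz by (simp add: field_simps)
      moreover have "\<i> * A * deriv_ratio A / (A + 1) = \<i> * deriv_ratio A * (A / (A + 1))" by simp
      moreover have "\<i> * v * (1 - w) - \<i> = \<i> * ((1 - w) * (v - 1) - w)" for v w by (simp add: algebra_simps)
      ultimately show ?thesis by (simp only:)
    qed
    hence "norm (\<i> * A * deriv_ratio A / (A + 1) - \<i>) = norm ((1 - 1 / (A + 1)) * (deriv_ratio A - 1) - 1 / (A + 1))"
      by (simp only: norm_mult norm_ii mult_1_left)
    also have "\<dots> \<le> norm (1 - 1 / (A + 1)) * norm (deriv_ratio A - 1) + norm (1 / (A + 1))"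
      by (metis norm_mult norm_triangle_ineq4)
    also have "\<dots> \<le> 2 * (ratio_const / \<bar>Im A\<bar>) + 1 / \<bar>Im A\<bar>" using t r i by (intro add_mono mult_mono) auto
    finally show ?thesis using Upper by (simp add: slope_limit_def add_divide_distrib)
  next
    case Lower
    have "slope_limit s A - side_sign s * \<i> = - \<i> * (deriv_ratio A - 1)" using Lower by (simp add: slope_limit_def algebra_simps)
    hence "norm (slope_limit s A - side_sign s * \<i>) = norm (deriv_ratio A - 1)" by (simp only: norm_mult norm_minus_cancel norm_ii mult_1_left)
    moreover have "1 / \<bar>Im A\<bar> \<ge> 0" by simp
    moreover have "(2 * ratio_const + 1) / \<bar>Im A\<bar> = 2 * (ratio_const / \<bar>Im A\<bar>) + 1 / \<bar>Im A\<bar>" by (simp add: add_divide_distrib)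
    ultimately show ?thesis using r K0 by linarith
  qed
qed

lemma Gamma_mat_eq_form:
  assumes A: "adm_low (A_param s l)" and z: "z \<notin> complex_of_real ` {-1..1}" and r: "deriv_ratio (A_param s l) \<noteq> 0"
  defines "\<phi> \<equiv> Arcsin (1 / z)" and "B \<equiv> A_param s l"
  shows "Gamma_mat s z l = Gamma_form (deriv_ratio B) (cos \<phi>) (sin \<phi>) (slope_limit s B)
     (qf B (of_real (pi / 2) + \<phi>) / mid_value B) (deriv (qf B) (of_real (pi / 2) + \<phi>) / (\<i> * B * mid_value B))
     (qf B (of_real (pi / 2) + - \<phi>) / mid_value B) (deriv (qf B) (of_real (pi / 2) + - \<phi>) / (\<i> * B * mid_value B))"
proof -
  have a: "adm B" using A by (simp add: B_def adm_low_def)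
  have P0: "mid_value B \<noteq> 0" using Gc_relation(3)[OF A] by (simp add: B_def)
  have B0: "B \<noteq> 0" using A by (auto simp: B_def adm_low_def)
  have c0: "cos \<phi> \<noteq> 0" unfolding \<phi>_def by (rule cos_Arcsin_nonzero[OF z])
  have d: "deriv (qf B) (of_real (pi / 2)) = deriv_ratio B * (\<i> * B * mid_value B)" using P0 B0 by (simp add: deriv_ratio_def)
  have re: "\<bar>Re \<phi>\<bar> < pi / 2" unfolding \<phi>_def by (rule Arcsin_cut(2)[OF inverse_cut[OF z]])
  have re': "\<bar>Re (of_real (pi / 2) + \<phi>)\<bar> < pi" "\<bar>Re (of_real (pi / 2) + - \<phi>)\<bar> < pi" "\<bar>Re (of_real (pi / 2))\<bar> < pi"
    using re by auto
  have v: "a_val s l = (case s of Upper \<Rightarrow> B | Lower \<Rightarrow> - B - 1)" by (cases s) (simp_all add: B_def A_param_def)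
  have av: "adm (a_val s l)" unfolding v using a adm_reflect[OF a] by (cases s) auto
  have p: "qf (a_val s l) \<theta> = side_sign s * qf B \<theta>" "deriv (qf (a_val s l)) \<theta> = side_sign s * deriv (qf B) \<theta>"
    if "\<bar>Re \<theta>\<bar> < pi" for \<theta>
    unfolding v using qf_reflect[OF a that] by (cases s; simp)+
  have s0: "side_sign s \<noteq> 0" by (cases s) auto
  have r': "deriv_ratio B \<noteq> 0" using r by (simp add: B_def)
  have pP: "qf (a_val s l) (of_real (pi / 2)) = side_sign s * mid_value B"
    unfolding mid_value_def by (rule p(1)[OF re'(3)])
  have X: "value_quot (a_val s l) \<phi> = qf B (of_real (pi / 2) + \<phi>) / mid_value B" "value_quot (a_val s l) (- \<phi>) = qf B (of_real (pi / 2) + - \<phi>) / mid_value B"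
    unfolding value_quot_def pP p[OF re'(1)] p[OF re'(2)] using s0 by simp_all
  have rc: "e / (deriv_ratio B * (\<i> * B * mid_value B) * c) = e / (\<i> * B * mid_value B) / (deriv_ratio B * c)" for e c by (simp add: mult_ac)
  have Y: "deriv_quot (a_val s l) \<phi> = deriv (qf B) (of_real (pi / 2) + \<phi>) / (\<i> * B * mid_value B) / (deriv_ratio B * cos \<phi>)"
    "deriv_quot (a_val s l) (- \<phi>) = deriv (qf B) (of_real (pi / 2) + - \<phi>) / (\<i> * B * mid_value B) / (deriv_ratio B * cos \<phi>)"
    unfolding deriv_quot_def p(2)[OF re'(1)] p(2)[OF re'(2)] p(2)[OF re'(3)] d rc[symmetric] using s0 by simp_all
  have "B + 1 \<noteq> 0" using admD(4)[OF a] by (auto simp: complex_eq_iff)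
  hence m: "slope_quot (a_val s l) = slope_limit s B"
    unfolding slope_quot_def pP p(2)[OF re'(3)] d slope_limit_def using P0 B0 s0 v by (cases s) (simp_all add: mult_ac)
  have q0: "qf (a_val s l) (of_real (pi / 2)) \<noteq> 0" "deriv (qf (a_val s l)) (of_real (pi / 2)) \<noteq> 0"
    unfolding pP p(2)[OF re'(3)] d using P0 B0 s0 r' by auto
  have g: "(X - x * m * Y + Y) / 2 = (X + (1 - x * m) * Y) / 2" "(X + x * m * Y + Y) / 2 = (X + (1 + x * m) * Y) / 2"
    for X x m Y :: complex by (simp_all add: algebra_simps)
  show ?thesis
    unfolding Gamma_mat_def Gamma_of_a_eq_Gphi[OF av z q0] \<phi>_def[symmetric] Gphi_def Gamma_form_def X Y m g ..
qed

section \<open>Collecting the errors\<close>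

text \<open>A sum over all sources of error, so that each is dominated by the same \<epsilon>. The
  factors 5 convert 1/|Im A| into 1/|kappa| by \<open>A_param_facts\<close>; the first term belongs
  to the phases.\<close>

definition error_const :: "real \<Rightarrow> real \<Rightarrow> real \<Rightarrow> real" where
  "error_const \<delta> Y d = 150 * (2 + Y) * exp (3 * Y) + (10 * ratio_const + 5) + 5 * ((1 + exp (2 * Y)) * two_term_const \<delta> Y) + 5 * one_term_const \<delta> (Y + 1) d + 5 * one_term_const \<delta> Y d"

lemma one_term_const_nonneg:
  assumes "\<delta> > 0" "d > 0"
  shows "0 \<le> one_term_const \<delta> Y d"
  unfolding one_term_const_def using two_term_const_nonneg[OF assms(1)] assms(2) by (intro add_nonneg_nonneg mult_nonneg_nonneg) auto

lemma error_const_ge: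
  assumes "\<delta> > 0" "d > 0" "Y \<ge> 0"
  shows "150 * (2 + Y) * exp (3 * Y) \<le> error_const \<delta> Y d" "10 * ratio_const + 5 \<le> error_const \<delta> Y d" "5 * ((1 + exp (2 * Y)) * two_term_const \<delta> Y) \<le> error_const \<delta> Y d"
    "5 * one_term_const \<delta> (Y + 1) d \<le> error_const \<delta> Y d" "5 * one_term_const \<delta> Y d \<le> error_const \<delta> Y d" "error_const \<delta> Y d > 0" "0 \<le> ratio_const"
proof -
  have K: "0 \<le> ratio_const" unfolding ratio_const_def by (rule one_term_const_nonneg) auto
  have "0 < 150 * (2 + Y) * exp (3 * Y)" using assms by simp
  moreover have "0 \<le> 5 * ((1 + exp (2 * Y)) * two_term_const \<delta> Y)"
    using two_term_const_nonneg[OF assms(1)] by (intro mult_nonneg_nonneg) (auto intro!: add_nonneg_nonneg)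
  moreover note one_term_const_nonneg[OF assms(1,2), of Y] one_term_const_nonneg[OF assms(1,2), of "Y + 1"] K
  moreover have "x \<le> x + (10 * k + 5) + y + 5 * z + 5 * w \<and> (10 * k + 5) \<le> x + (10 * k + 5) + y + 5 * z + 5 * w \<and>
      y \<le> x + (10 * k + 5) + y + 5 * z + 5 * w \<and> 5 * z \<le> x + (10 * k + 5) + y + 5 * z + 5 * w \<and>
      5 * w \<le> x + (10 * k + 5) + y + 5 * z + 5 * w \<and> 0 < x + (10 * k + 5) + y + 5 * z + 5 * w \<and> 0 \<le> k"
    if "0 < x" "0 \<le> y" "0 \<le> w" "0 \<le> z" "0 \<le> k" for x y z w k :: real by (intro conjI) (use that in linarith)+
  ultimately show "150 * (2 + Y) * exp (3 * Y) \<le> error_const \<delta> Y d" "10 * ratio_const + 5 \<le> error_const \<delta> Y d" "5 * ((1 + exp (2 * Y)) * two_term_const \<delta> Y) \<le> error_const \<delta> Y d"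
    "5 * one_term_const \<delta> (Y + 1) d \<le> error_const \<delta> Y d" "5 * one_term_const \<delta> Y d \<le> error_const \<delta> Y d" "error_const \<delta> Y d > 0" "0 \<le> ratio_const"
    unfolding error_const_def by blast+
qed

lemma norm_exp_minus_one:
  fixes u :: complex
  assumes "norm u \<le> 1 / 2"
  shows "norm (exp u - 1) \<le> 3 / 2 * norm u"
  by (rule norm_exp_bounds(2)[OF assms])

lemma side_exp_bound:
  assumes "region \<delta> Y \<psi>"
  shows "norm (exp (side_sign s * \<i> * \<psi>)) \<le> exp Y" "norm (1 / exp (side_sign s * \<i> * \<psi>)) \<le> exp Y"
proof -
  have i: "1 / exp w = exp (- w)" for w :: complex by (simp add: exp_minus inverse_eq_divide)
  have "\<bar>Im \<psi>\<bar> \<le> Y" using assms by (simp add: region_def)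
  thus "norm (exp (side_sign s * \<i> * \<psi>)) \<le> exp Y" "norm (1 / exp (side_sign s * \<i> * \<psi>)) \<le> exp Y"
    unfolding i norm_exp_eq_Re by (cases s; simp)+
qed

text \<open>By \<open>A_param_eq\<close> the Jost phase is exp(sigma i psi) exp(kappa psi/pi)
  exp(u), where u = O(1/kappa) stems from \<open>a_correction\<close>; the factor exp(-kappa psi/pi)
  removes the large part. Similarly \<open>wexp A\<close> is -i exp(-kappa - L), and this -i is the
  source of the factor i in the triangular matrices.\<close>

lemma phase_estimates:
  assumes l: "l \<in> closed_half_plane s" "norm l < lam_bound" "l \<noteq> 0" and reg: "region \<delta> Y \<psi>" and \<delta>: "\<delta> > 0" and d: "d > 0"
  defines "A \<equiv> A_param s l" and "\<kappa> \<equiv> kappa s l" and "\<sigma> \<equiv> side_sign s"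
  assumes \<epsilon>: "error_const \<delta> Y d / norm \<kappa> \<le> 1 / 2"
  shows "norm (exp (\<i> * (A + 1 / 2) * \<psi>) * exp (- (\<kappa> * \<psi> / of_real pi)) - exp (\<sigma> * \<i> * \<psi>)) \<le> error_const \<delta> Y d / norm \<kappa>"
    "norm (exp (- (\<kappa> * (1 + 2 * \<psi> / of_real pi)))) \<le> exp (2 * Y) \<Longrightarrow>
     norm (exp (\<i> * (A + 1 / 2) * \<psi>) * exp (- (\<kappa> * \<psi> / of_real pi)) * rho2 A \<psi>
       - - \<i> * exp (- (\<kappa> * (1 + 2 * \<psi> / of_real pi))) / exp (\<sigma> * \<i> * \<psi>)) \<le> error_const \<delta> Y d / norm \<kappa>"
proof -
  define L where "L = a_correction l"
  define u where "u = L * \<psi> / of_real pi"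
  note f = A_param_facts[OF l, folded A_def \<kappa>_def L_def]
  have k: "norm \<kappa> > 0" using f(3) by linarith
  note rb = region_bounds[OF reg]
  have Y: "Y \<ge> 0" using rb by blast
  have h: "norm l < 1 / 2" using l(2) lam_bound_less by linarith
  have nu: "A + 1 / 2 = \<sigma> - \<i> * \<kappa> / of_real pi + L / (\<i> * of_real pi)"
    unfolding A_def \<kappa>_def \<sigma>_def L_def by (rule A_param_eq[OF l(1) h l(3)])
  have p0: "complex_of_real pi \<noteq> 0" by simp
  have inu: "\<i> * (A + 1 / 2) * \<psi> = \<sigma> * \<i> * \<psi> + \<kappa> * \<psi> / of_real pi + u"
    unfolding nu u_def using p0 by (simp add: field_simps)
  have psi: "norm \<psi> / pi \<le> 1 + Y"
  proof -
    have "norm \<psi> \<le> pi / 2 + Y" using cmod_le[of \<psi>] reg by (simp add: region_def)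
    also have "\<dots> \<le> pi * (1 + Y)"
    proof -
      have "1 * Y \<le> pi * Y" using Y pi_gt3 by (intro mult_right_mono) auto
      thus ?thesis unfolding distrib_left mult_1_right using pi_gt_zero by linarith
    qed
    finally show ?thesis by (simp add: divide_simps mult.commute)
  qed
  have nu': "norm u \<le> 100 * (1 + Y) / norm \<kappa>"
  proof -
    have "norm u = norm L * (norm \<psi> / pi)" by (simp add: u_def norm_mult norm_divide)
    also have "\<dots> \<le> 100 / norm \<kappa> * (1 + Y)" using f(4) psi Y k by (intro mult_mono) auto
    finally show ?thesis by simp
  qed
  have nuL: "norm (- u - L) \<le> 100 * (2 + Y) / norm \<kappa>"
  proof -
    have "norm (- u - L) \<le> norm u + norm L" using norm_triangle_ineq4[of "- u" L] by simp
    also have "\<dots> \<le> 100 * (1 + Y) / norm \<kappa> + 100 / norm \<kappa>" using nu' f(4) by (rule add_mono)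
    finally show ?thesis by (simp add: add_divide_distrib[symmetric] algebra_simps)
  qed
  have e1: "1 \<le> exp (3 * Y)" "exp Y \<le> exp (3 * Y)" using Y by auto
  \<comment> \<open>Exponents of modulus at most 1/2 allow |exp v - 1| \<le> (3/2) |v|, which turns
    the 100 of \<open>A_param_facts\<close> into the 150 of \<open>error_const\<close>.\<close>
  have small: "100 * (2 + Y) / norm \<kappa> \<le> 1 / 2"
  proof -
    have "100 * (2 + Y) \<le> 150 * (2 + Y) * 1" using Y by simp
    also have "\<dots> \<le> 150 * (2 + Y) * exp (3 * Y)" using Y e1 by (intro mult_left_mono) auto
    also have "\<dots> \<le> error_const \<delta> Y d" by (rule error_const_ge(1)[OF \<delta> d Y])
    finally have "100 * (2 + Y) / norm \<kappa> \<le> error_const \<delta> Y d / norm \<kappa>" by (intro divide_right_mono) auto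
    with \<epsilon> show ?thesis by linarith
  qed
  have nu1: "norm u \<le> 100 * (2 + Y) / norm \<kappa>"
  proof -
    have "100 * (1 + Y) / norm \<kappa> \<le> 100 * (2 + Y) / norm \<kappa>" by (intro divide_right_mono) auto
    with nu' show ?thesis by linarith
  qed
  have eu: "norm (exp v - 1) \<le> 150 * (2 + Y) / norm \<kappa>" if "norm v \<le> 100 * (2 + Y) / norm \<kappa>" for v :: complex
  proof -
    have "150 * t / n = 3 / 2 * (100 * t / n)" for t n :: real by simp
    hence "150 * (2 + Y) / norm \<kappa> = 3 / 2 * (100 * (2 + Y) / norm \<kappa>)" .
    moreover have "norm v \<le> 1 / 2" using that small by linarith
    ultimately show ?thesis using norm_exp_minus_one[of v] that by linarith
  qed
  have q: "norm (exp (\<sigma> * \<i> * \<psi>)) \<le> exp Y" "norm (1 / exp (\<sigma> * \<i> * \<psi>)) \<le> exp Y"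
    unfolding \<sigma>_def by (rule side_exp_bound[OF reg])+
  have fin: "150 * (2 + Y) / norm \<kappa> * exp (3 * Y) \<le> error_const \<delta> Y d / norm \<kappa>"
    using divide_right_mono[OF error_const_ge(1)[OF \<delta> d Y], of "norm \<kappa>"] by simp
  have p: "exp (\<i> * (A + 1 / 2) * \<psi>) * exp (- (\<kappa> * \<psi> / of_real pi)) = exp (\<sigma> * \<i> * \<psi>) * exp u"
    unfolding inu exp_add[symmetric] by simp
  have "norm (exp (\<sigma> * \<i> * \<psi>) * exp u - exp (\<sigma> * \<i> * \<psi>)) = norm (exp u - 1) * norm (exp (\<sigma> * \<i> * \<psi>))"
    unfolding norm_mult[symmetric] by (simp only: left_diff_distrib mult_1_left mult.commute)
  also have "\<dots> \<le> 150 * (2 + Y) / norm \<kappa> * exp (3 * Y)"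
    using eu[OF nu1] order_trans[OF q(1) e1(2)] Y by (intro mult_mono) auto
  finally show "norm (exp (\<i> * (A + 1 / 2) * \<psi>) * exp (- (\<kappa> * \<psi> / of_real pi)) - exp (\<sigma> * \<i> * \<psi>)) \<le> error_const \<delta> Y d / norm \<kappa>"
    unfolding p using fin by linarith
  assume br: "norm (exp (- (\<kappa> * (1 + 2 * \<psi> / of_real pi)))) \<le> exp (2 * Y)"
  define E where "E = exp (- (\<kappa> * (1 + 2 * \<psi> / of_real pi)))"
  have wx: "wexp A = - \<i> * exp (- \<kappa> - L)"
  proof -
    have "- (\<i> * of_real pi * A) = - (\<sigma> * \<i> * of_real pi) + \<i> * of_real (pi / 2) + (- \<kappa> - L)"
    proof -
      have "\<i> * of_real pi * (A + 1 / 2) = \<i> * of_real pi * \<sigma> + \<kappa> + L"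
        unfolding nu using p0 by (simp add: field_simps)
      moreover have "- (\<i> * of_real pi * A) = - (\<i> * of_real pi * (A + 1 / 2)) + \<i> * of_real (pi / 2)"
        by (simp add: algebra_simps)
      ultimately show ?thesis by (simp only: minus_add_distrib) (simp add: algebra_simps)
    qed
    hence "wexp A = exp (- (\<sigma> * \<i> * of_real pi) + \<i> * of_real (pi / 2) + (- \<kappa> - L))"
      unfolding wexp_def by (rule arg_cong)
    hence "wexp A = exp (- (\<sigma> * \<i> * of_real pi)) * exp (\<i> * of_real (pi / 2)) * exp (- \<kappa> - L)"
      unfolding exp_add .
    moreover have "exp (\<i> * of_real (pi / 2)) = \<i>" by (simp only: cis_conv_exp[symmetric] cis_pi_half)
    moreover have "exp (- (\<sigma> * \<i> * of_real pi)) = - 1"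
      by (cases s) (simp_all add: \<sigma>_def exp_minus)
    ultimately show ?thesis by simp
  qed
  have rh: "exp (\<sigma> * \<i> * \<psi>) * exp u * rho2 A \<psi> = - \<i> * E / exp (\<sigma> * \<i> * \<psi>) * exp (- u - L)"
  proof -
    have "\<sigma> * \<i> * \<psi> + u + (- \<kappa> - L) + - (2 * (\<i> * (A + 1 / 2) * \<psi>)) = - (\<kappa> * (1 + 2 * \<psi> / of_real pi)) + - (\<sigma> * \<i> * \<psi>) + (- u - L)"
      unfolding inu using p0 by (simp add: field_simps)
    hence "exp (\<sigma> * \<i> * \<psi> + u + (- \<kappa> - L) + - (2 * (\<i> * (A + 1 / 2) * \<psi>))) = exp (- (\<kappa> * (1 + 2 * \<psi> / of_real pi)) + - (\<sigma> * \<i> * \<psi>) + (- u - L))"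
      by (rule arg_cong)
    hence "exp (\<sigma> * \<i> * \<psi>) * exp u * exp (- \<kappa> - L) * exp (- (2 * (\<i> * (A + 1 / 2) * \<psi>))) = E * exp (- (\<sigma> * \<i> * \<psi>)) * exp (- u - L)"
      unfolding E_def exp_add .
    hence "- \<i> * (exp (\<sigma> * \<i> * \<psi>) * exp u * exp (- \<kappa> - L) * exp (- (2 * (\<i> * (A + 1 / 2) * \<psi>)))) = - \<i> * (E * exp (- (\<sigma> * \<i> * \<psi>)) * exp (- u - L))"
      by (rule arg_cong)
    thus ?thesis unfolding rho2_def wx exp_minus[of "\<sigma> * \<i> * \<psi>"] by (simp only: divide_inverse mult_ac)
  qed
  have "norm (exp (\<sigma> * \<i> * \<psi>) * exp u * rho2 A \<psi> - - \<i> * E / exp (\<sigma> * \<i> * \<psi>))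
      = norm (exp (- u - L) - 1) * (norm (- \<i> * E) * norm (1 / exp (\<sigma> * \<i> * \<psi>)))"
  proof -
    have "w / e * x - w / e = (x - 1) * (w * (1 / e))" for w e x :: complex by (simp add: algebra_simps diff_divide_distrib)
    thus ?thesis unfolding rh norm_mult[symmetric] by (rule arg_cong)
  qed
  also have "\<dots> \<le> 150 * (2 + Y) / norm \<kappa> * (exp (2 * Y) * exp Y)"
    using eu[OF nuL] q(2) br Y by (intro mult_mono) (auto simp: E_def[symmetric] norm_mult)
  also have "exp (2 * Y) * exp Y = exp (3 * Y)" by (simp add: exp_add[symmetric])
  finally show "norm (exp (\<i> * (A + 1 / 2) * \<psi>) * exp (- (\<kappa> * \<psi> / of_real pi)) * rho2 A \<psi>
       - - \<i> * exp (- (\<kappa> * (1 + 2 * \<psi> / of_real pi))) / exp (\<sigma> * \<i> * \<psi>)) \<le> error_const \<delta> Y d / norm \<kappa>"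
    unfolding p E_def[symmetric] using fin by linarith
qed

lemma im_bound:
  assumes l: "l \<in> closed_half_plane s" "norm l < lam_bound" "l \<noteq> 0" and y: "5 * y \<le> C" "0 \<le> y"
  shows "y / \<bar>Im (A_param s l)\<bar> \<le> C / norm (kappa s l)"
proof -
  have "y * (1 / \<bar>Im (A_param s l)\<bar>) \<le> y * (5 / norm (kappa s l))" using A_param_facts(2)[OF l] y by (intro mult_left_mono) auto
  also have "\<dots> \<le> C / norm (kappa s l)" using divide_right_mono[OF y(1), of "norm (kappa s l)"] by (simp add: mult_ac)
  finally show ?thesis by simp
qed

text \<open>The number exp(2Y) + 1/sqrt \<delta> serves as R for everything at once: exp(2Y) bounds
  the exponentials, sines and square roots on the region, and 1/sqrt \<delta> bounds 1/B because
  |cos phi| \<ge> \<delta>.\<close>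

lemma final_estimate:
  assumes l: "l \<in> closed_half_plane s" "norm l < lam_bound" "l \<noteq> 0" and reg: "region \<delta> Y \<phi>" and \<delta>: "\<delta> > 0" and d: "d > 0"
  defines "A \<equiv> A_param s l" and "\<kappa> \<equiv> kappa s l" and "\<sigma> \<equiv> side_sign s"
  defines "\<epsilon> \<equiv> error_const \<delta> Y d / norm \<kappa>"
  assumes \<epsilon>: "\<epsilon> \<le> 1 / 2"
    and X1: "norm (X1 * exp (- (\<i> * (A + 1 / 2) * \<phi>)) - (1 - \<rho>1) * ccos \<phi>) \<le> \<epsilon>"
    and Z1: "norm (Z1 * exp (- (\<i> * (A + 1 / 2) * \<phi>)) - (1 + \<rho>1) * ccos \<phi>) \<le> \<epsilon>"
    and X2: "norm (X2 * exp (- (\<i> * (A + 1 / 2) * (- \<phi>))) - (1 - \<rho>2) * ccos \<phi>) \<le> \<epsilon>"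
    and Z2: "norm (Z2 * exp (- (\<i> * (A + 1 / 2) * (- \<phi>))) - (1 + \<rho>2) * ccos \<phi>) \<le> \<epsilon>"
    and r1: "norm (exp (\<i> * (A + 1 / 2) * \<phi>) * exp (- (\<kappa> * \<phi> / of_real pi)) * \<rho>1 - r1 / exp (\<sigma> * \<i> * \<phi>)) \<le> \<epsilon>"
    and r2: "norm (exp (\<i> * (A + 1 / 2) * (- \<phi>)) * exp (- (\<kappa> * (- \<phi>) / of_real pi)) * \<rho>2 - r2 / exp (\<sigma> * \<i> * (- \<phi>))) \<le> \<epsilon>"
    and rr0: "r1 * r2 = 0" and b: "norm \<rho>1 \<le> exp (2 * Y)" "norm \<rho>2 \<le> exp (2 * Y)" "norm r1 \<le> exp (2 * Y)" "norm r2 \<le> exp (2 * Y)"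
  shows "\<exists>E. norm E \<le> 1536 * (exp (2 * Y) + 1 / sqrt \<delta>)^10 * \<epsilon> \<and>
    Gamma_form (deriv_ratio A) (cos \<phi>) (sin \<phi>) (slope_limit s A) X1 Z1 X2 Z2 =
      Psi_form (\<sigma> * \<i>) (ccos \<phi>) (sin \<phi>) (exp (\<sigma> * \<i> * \<phi>)) ** (mat 1 + E) ** mat2 1 r2 r1 1 ** exp_sigma3 (- \<kappa> * (- \<phi> / of_real pi))"
proof -
  define R where "R = exp (2 * Y) + 1 / sqrt \<delta>"
  define e where "e = exp (\<i> * (A + 1 / 2) * \<phi>)"
  define c where "c = - (\<kappa> * \<phi> / of_real pi)"
  define q where "q = exp (\<sigma> * \<i> * \<phi>)"
  note f = A_param_facts[OF l, folded A_def \<kappa>_def]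
  note rb = region_bounds[OF reg]
  have k: "norm \<kappa> > 0" using f(3) by linarith
  have Y: "Y \<ge> 0" using rb by blast
  have s\<delta>: "1 / sqrt \<delta> > 0" using \<delta> by simp
  have eY: "1 \<le> exp Y" "exp Y \<le> exp (2 * Y)" using Y by auto
  have R: "R \<ge> 1" "exp Y \<le> R" "exp (2 * Y) \<le> R" "1 / sqrt \<delta> \<le> R" unfolding R_def using s\<delta> eY by linarith+
  have c0: "cos \<phi> \<noteq> 0" "norm (cos \<phi>) \<ge> \<delta>" using reg \<delta> by (auto simp: region_def)
  have B: "norm (1 / ccos \<phi>) \<le> 1 / sqrt \<delta>"
    using c0 \<delta> by (simp add: norm_divide norm_csqrt_eq frac_le)
  note imb = im_bound[OF l, folded A_def \<kappa>_def, of _ "error_const \<delta> Y d", folded \<epsilon>_def]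
  have K: "0 \<le> ratio_const" by (rule error_const_ge(7)[OF \<delta> d Y])
  have u: "norm (deriv_ratio A - 1) \<le> \<epsilon>"
  proof (rule order_trans[OF deriv_ratio_estimate[OF f(1)] imb])
    show "5 * ratio_const \<le> error_const \<delta> Y d" using error_const_ge(2)[OF \<delta> d Y] K by linarith
  qed (rule K)
  have m: "norm (slope_limit s A - \<sigma> * \<i>) \<le> \<epsilon>"
    by (rule order_trans[OF slope_limit_estimate[OF f(1), of s, folded \<sigma>_def] imb]) (use error_const_ge(2)[OF \<delta> d Y] K in simp_all)
  have \<epsilon>': "error_const \<delta> Y d / norm (kappa s l) \<le> 1 / 2" using \<epsilon> unfolding \<epsilon>_def \<kappa>_def .
  have reg': "region \<delta> Y (- \<phi>)" using reg by (simp add: region_minus)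
  note p1 = phase_estimates(1)[OF l reg \<delta> d \<epsilon>', folded A_def \<kappa>_def \<sigma>_def, folded \<epsilon>_def]
  note p2 = phase_estimates(1)[OF l reg' \<delta> d \<epsilon>', folded A_def \<kappa>_def \<sigma>_def, folded \<epsilon>_def]
  have me: "exp (- (\<i> * (A + 1 / 2) * \<phi>)) = 1 / e" "exp (- (\<i> * (A + 1 / 2) * (- \<phi>))) = e" "exp (\<i> * (A + 1 / 2) * (- \<phi>)) = 1 / e"
    "exp (- (\<kappa> * (- \<phi>) / of_real pi)) = 1 / exp c" "exp (- (\<kappa> * \<phi> / of_real pi)) = exp c" "exp (\<sigma> * \<i> * (- \<phi>)) = 1 / q"
    by (simp_all add: e_def c_def q_def exp_minus inverse_eq_divide)
  have mu: "norm (\<sigma> * \<i>) = 1" by (simp add: \<sigma>_def norm_mult norm_side_sign)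
  have nz: "ccos \<phi> \<noteq> 0" "q \<noteq> 0" "e \<noteq> 0" using c0 by (auto simp: q_def e_def)
  have q: "norm q \<le> exp Y" "norm (1 / q) \<le> exp Y"
    unfolding q_def \<sigma>_def by (rule side_exp_bound[OF reg])+
  have x: "norm (sin \<phi>) \<le> exp Y" "norm (ccos \<phi>) \<le> exp Y" using rb by blast+
  have B2: "cos \<phi> = (ccos \<phi>)^2" by simp
  have cc: "- \<kappa> * (- \<phi> / of_real pi) = - c" by (simp add: c_def)
  have "\<exists>E. norm E \<le> 1536 * R^10 * \<epsilon> \<and>
    Gamma_form (deriv_ratio A) ((ccos \<phi>)^2) (sin \<phi>) (slope_limit s A) X1 Z1 X2 Z2 =
      Psi_form (\<sigma> * \<i>) (ccos \<phi>) (sin \<phi>) q ** (mat 1 + E) ** mat2 1 r2 r1 1 ** exp_sigma3 (- c)"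
  proof (rule Gamma_form_estimate[OF \<epsilon> R(1) mu nz _ _ _ _ u m _ _ _ _ rr0])
    show "norm (X1 / e - (1 - \<rho>1) * ccos \<phi>) \<le> \<epsilon>" "norm (Z1 / e - (1 + \<rho>1) * ccos \<phi>) \<le> \<epsilon>"
      using X1 Z1 unfolding me by (simp_all only: times_divide_eq_right mult_1_right)
    show "norm (X2 * e - (1 - \<rho>2) * ccos \<phi>) \<le> \<epsilon>" "norm (Z2 * e - (1 + \<rho>2) * ccos \<phi>) \<le> \<epsilon>"
      using X2 Z2 unfolding me .
    show "norm (e * exp c - q) \<le> \<epsilon>" using p1 unfolding me e_def[symmetric] q_def[symmetric] .
    show "norm (e * exp c * \<rho>1 - r1 / q) \<le> \<epsilon>" using r1 unfolding me e_def[symmetric] q_def[symmetric] .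
    show "norm (1 / (e * exp c) - 1 / q) \<le> \<epsilon>" using p2 unfolding me times_divide_times_eq mult_1_left .
    have "r2 / (1 / q) = r2 * q" by simp
    thus "norm (1 / (e * exp c) * \<rho>2 - r2 * q) \<le> \<epsilon>" using r2 unfolding me times_divide_times_eq mult_1_left by (simp only:)
    show "norm (ccos \<phi>) \<le> R" "norm (1 / ccos \<phi>) \<le> R" "norm (sin \<phi>) \<le> R" "norm q \<le> R" "norm (1 / q) \<le> R"
      "norm \<rho>1 \<le> R" "norm \<rho>2 \<le> R" "norm r1 \<le> R" "norm r2 \<le> R"
      using b x q B R(2,3,4) by linarith+
  qed
  thus ?thesis unfolding cc B2[symmetric] R_def q_def .
qed

lemma deriv_ratio_nonzero:
  assumes l: "l \<in> closed_half_plane s" "norm l < lam_bound" "l \<noteq> 0" and \<delta>: "\<delta> > 0" "d > 0" "Y \<ge> 0"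
    and \<epsilon>: "error_const \<delta> Y d / norm (kappa s l) \<le> 1 / 2"
  shows "deriv_ratio (A_param s l) \<noteq> 0"
proof
  assume "deriv_ratio (A_param s l) = 0"
  hence "1 \<le> ratio_const / \<bar>Im (A_param s l)\<bar>" using deriv_ratio_estimate[OF A_param_facts(1)[OF l]] by simp
  moreover have "ratio_const / \<bar>Im (A_param s l)\<bar> \<le> error_const \<delta> Y d / norm (kappa s l)"
    by (rule im_bound[OF l]) (use error_const_ge(2)[OF \<delta>] error_const_ge(7)[OF \<delta>] in simp_all)
  ultimately show False using \<epsilon> by simp
qed

text \<open>|Re phi| stays away from pi/2, so at phi and at -phi the second exponential is
  negligible. The general estimate is used with rho = r = 0, and the triangular factor is the
  identity.\<close>

lemma outside_estimate:
  assumes l: "l \<in> closed_half_plane s" "norm l < lam_bound" "l \<noteq> 0" and z: "z \<notin> complex_of_real ` {-1..1}"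
    and reg: "region \<delta> Y (Arcsin (1 / z))" and \<delta>: "\<delta> > 0" and d: "d > 0" "\<bar>Re (Arcsin (1 / z))\<bar> \<le> pi / 2 - d"
    and \<epsilon>: "error_const \<delta> Y d / norm (kappa s l) \<le> 1 / 2"
  shows "\<exists>E. norm E \<le> 1536 * (exp (2 * Y) + 1 / sqrt \<delta>)^10 * (error_const \<delta> Y d / norm (kappa s l)) \<and>
     Gamma_mat s z l = Psi0 s z ** (mat 1 + E) ** exp_sigma3 (- kappa s l * g_fun z)"
proof -
  define \<phi> where "\<phi> = Arcsin (1 / z)"
  define A where "A = A_param s l"
  have A: "adm_low A" unfolding A_def by (rule A_param_facts(1)[OF l])
  have reg1: "region \<delta> Y \<phi>" "region \<delta> Y (- \<phi>)" using reg by (simp_all add: \<phi>_def region_minus)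
  have Y: "Y \<ge> 0" using region_bounds(5)[OF reg] .
  have re: "\<bar>Re \<phi>\<bar> < pi / 2" "\<bar>Re (- \<phi>)\<bar> < pi / 2" "d \<le> pi / 2 + Re \<phi>" "d \<le> pi / 2 + Re (- \<phi>)"
    using d by (auto simp: \<phi>_def)
  have kb: "one_term_const \<delta> (Y + 1) d / \<bar>Im A\<bar> \<le> error_const \<delta> Y d / norm (kappa s l)"
    unfolding A_def by (rule im_bound[OF l error_const_ge(4)[OF \<delta> d(1) Y] one_term_const_nonneg[OF \<delta> d(1)]])
  note o1 = one_term_qf[OF A reg1(1) re(1) \<delta> d(1) re(3)]
  note o2 = one_term_qf[OF A reg1(2) re(2) \<delta> d(1) re(4)]
  have R: "deriv_ratio (A_param s l) \<noteq> 0" by (rule deriv_ratio_nonzero[OF l \<delta> d(1) Y \<epsilon>])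
  have "\<exists>E. norm E \<le> 1536 * (exp (2 * Y) + 1 / sqrt \<delta>)^10 * (error_const \<delta> Y d / norm (kappa s l)) \<and>
    Gamma_form (deriv_ratio (A_param s l)) (cos \<phi>) (sin \<phi>) (slope_limit s (A_param s l))
     (qf A (of_real (pi / 2) + \<phi>) / mid_value A) (deriv (qf A) (of_real (pi / 2) + \<phi>) / (\<i> * A * mid_value A))
     (qf A (of_real (pi / 2) + - \<phi>) / mid_value A) (deriv (qf A) (of_real (pi / 2) + - \<phi>) / (\<i> * A * mid_value A)) =
      Psi_form (side_sign s * \<i>) (ccos \<phi>) (sin \<phi>) (exp (side_sign s * \<i> * \<phi>)) ** (mat 1 + E) ** mat2 1 0 0 1 ** exp_sigma3 (- kappa s l * (- \<phi> / of_real pi))"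
    by (rule final_estimate[OF l reg1(1) \<delta> d(1) \<epsilon>, where ?\<rho>1.0 = 0 and ?\<rho>2.0 = 0])
      (use order_trans[OF o1(1) kb] order_trans[OF o1(2) kb] order_trans[OF o2(1) kb] order_trans[OF o2(2) kb] error_const_ge(6)[OF \<delta> d(1) Y]
        in \<open>simp_all add: A_def[symmetric] del: of_real_divide\<close>)
  thus ?thesis
    unfolding Gamma_mat_eq_form[OF A[unfolded A_def] z R] Psi0_eq[OF z] g_fun_eq_Arcsin[OF z] \<phi>_def A_def
    by (simp only: mat2_one[symmetric] matrix_mul_rid)
qed

section \<open>Uniformity on compact sets off the cut\<close>

lemma small_epsilon:
  assumes l: "l \<in> closed_half_plane s" "l \<noteq> 0" "norm l < exp (- (2 * C))" and C: "C > 0"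
  shows "C / norm (kappa s l) \<le> 1 / 2"
proof -
  have "ln (norm l) < ln (exp (- (2 * C)))" using l by (subst ln_less_cancel_iff) auto
  hence "2 * C \<le> norm (kappa s l)" using kappa_facts(1)[OF l(1,2)] complex_Re_le_cmod[of "kappa s l"] by simp
  thus ?thesis using C by (simp add: divide_simps)
qed

text \<open>Arcsin(1/z) is continuous off the cut, so on a compact set the strict inequalities |Re|
  < pi/2 and |cos| > 0 hold with a margin.\<close>

lemma compact_outside:
  assumes K: "compact K" "K \<inter> complex_of_real ` {-1..1} = {}"
  shows "\<exists>\<delta> Y d. \<delta> > 0 \<and> Y \<ge> 0 \<and> d > 0 \<and> (\<forall>z\<in>K. region \<delta> Y (Arcsin (1 / z)) \<and> \<bar>Re (Arcsin (1 / z))\<bar> \<le> pi / 2 - d)"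
proof (cases "K = {}")
  case True
  thus ?thesis by (intro exI[of _ 1]) auto
next
  case False
  have nz: "z \<notin> complex_of_real ` {-1..1}" if "z \<in> K" for z using K(2) that by blast
  have c: "continuous_on K (\<lambda>z. Arcsin (1 / z))"
  proof (rule continuous_at_imp_continuous_on, rule ballI)
    fix z assume z: "z \<in> K"
    have z0: "z \<noteq> 0" by (rule outside_nonzero[OF nz[OF z]])
    have "isCont Arcsin (1 / z)"
    proof (rule isCont_Arcsin)
      assume im: "Im (1 / z) = 0"
      show "\<bar>Re (1 / z)\<bar> < 1"
      proof (rule ccontr)
        assume "\<not> \<bar>Re (1 / z)\<bar> < 1"
        hence "1^2 \<le> \<bar>Re (1 / z)\<bar>^2" by (intro power_mono) auto
        moreover have "1 - (1 / z)^2 = of_real (1 - (Re (1 / z))^2)"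
        proof -
          have "1 / z = of_real (Re (1 / z))" using im complex_is_Real_iff by (simp only: complex_eq_iff Re_complex_of_real Im_complex_of_real simp_thms)
          thus ?thesis by (metis of_real_1 of_real_diff of_real_power)
        qed
        ultimately have "1 - (1 / z)^2 \<in> \<real>\<^sub>\<le>\<^sub>0" by (simp only: complex_nonpos_Reals_iff Re_complex_of_real Im_complex_of_real) simp
        with inverse_cut[OF nz[OF z]] show False ..
      qed
    qed
    thus "isCont (\<lambda>z. Arcsin (1 / z)) z"
      by (intro isCont_o2[where g = Arcsin and f = "\<lambda>z. 1 / z"]) (use z0 in \<open>auto intro!: continuous_intros\<close>)
  qed
  have "bounded ((\<lambda>z. Arcsin (1 / z)) ` K)" by (rule compact_imp_bounded[OF compact_continuous_image[OF c K(1)]])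
  then obtain Y where Y: "\<And>z. z \<in> K \<Longrightarrow> norm (Arcsin (1 / z)) \<le> Y" by (auto simp: bounded_iff)
  have "continuous_on K (\<lambda>z. \<bar>Re (Arcsin (1 / z))\<bar>)" "continuous_on K (\<lambda>z. norm (cos (Arcsin (1 / z))))"
    by (intro continuous_intros c)+
  from continuous_attains_sup[OF K(1) False this(1)] continuous_attains_inf[OF K(1) False this(2)]
  obtain z1 z2 where z1: "z1 \<in> K" "\<And>z. z \<in> K \<Longrightarrow> \<bar>Re (Arcsin (1 / z))\<bar> \<le> \<bar>Re (Arcsin (1 / z1))\<bar>"
    and z2: "z2 \<in> K" "\<And>z. z \<in> K \<Longrightarrow> norm (cos (Arcsin (1 / z2))) \<le> norm (cos (Arcsin (1 / z)))" by blast
  have d: "pi / 2 - \<bar>Re (Arcsin (1 / z1))\<bar> > 0" using Arcsin_cut(2)[OF inverse_cut[OF nz[OF z1(1)]]] by simp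
  have \<delta>: "norm (cos (Arcsin (1 / z2))) > 0" using cos_Arcsin_nonzero[OF nz[OF z2(1)]] by simp
  have "0 \<le> Y" using Y[OF z1(1)] norm_ge_zero order_trans by blast
  moreover have "region (norm (cos (Arcsin (1 / z2)))) Y (Arcsin (1 / z))" if "z \<in> K" for z
    unfolding region_def using Y[OF that] z2(2)[OF that] abs_Im_le_cmod[of "Arcsin (1 / z)"] Arcsin_cut(2)[OF inverse_cut[OF nz[OF that]]] by linarith
  moreover have "\<bar>Re (Arcsin (1 / z))\<bar> \<le> pi / 2 - (pi / 2 - \<bar>Re (Arcsin (1 / z1))\<bar>)" if "z \<in> K" for z using z1(2)[OF that] by simp
  ultimately show ?thesis using d \<delta> by blast
qed

subsection \<open>Boundary values on the cut\<close>

definition side_real :: "side \<Rightarrow> real" where "side_real t = (case t of Upper \<Rightarrow> 1 | Lower \<Rightarrow> -1)"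

text \<open>The boundary value of \<open>Arcsin (1 / w)\<close> as \<open>w\<close> tends to \<open>x\<close> from the half-plane \<open>t\<close>.\<close>

definition phi0 :: "side \<Rightarrow> real \<Rightarrow> complex" where
  "phi0 t x = Complex (sgn x * pi / 2) (- (side_real t * ln (1 / \<bar>x\<bar> + sqrt (1 / x^2 - 1))))"

text \<open>The two numbers 1/|x| \<plusminus> sqrt(1/x^2 - 1) are reciprocal to each other, so
  exp(i phi0) and its inverse are both explicit; sin phi0 = 1/x is their half-difference divided by
  i, and |cos phi0| follows from the squares.\<close>

lemma phi0_facts:
  assumes x: "x \<noteq> 0" "\<bar>x\<bar> < 1"
  shows "exp (\<i> * phi0 t x) = \<i> * of_real (sgn x * (1 / \<bar>x\<bar> + side_real t * sqrt (1 / x^2 - 1)))"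
    "sin (phi0 t x) = of_real (1 / x)" "Re (phi0 t x) = sgn x * pi / 2"
    "(case t of Upper \<Rightarrow> Im (phi0 t x) < 0 | Lower \<Rightarrow> Im (phi0 t x) > 0)" "\<bar>Im (phi0 t x)\<bar> \<le> 2 / \<bar>x\<bar>"
    "norm (cos (phi0 t x)) = sqrt (1 / x^2 - 1)"
proof -
  define a where "a = 1 / \<bar>x\<bar>"
  define S where "S = sqrt (1 / x^2 - 1)"
  have a1: "a > 1" using x by (simp add: a_def)
  have a2: "a^2 = 1 / x^2" by (simp add: a_def power_divide)
  have "1^2 < a^2" using a1 by (intro power_strict_mono) auto
  hence p: "1 / x^2 - 1 > 0" by (simp add: a2)
  have S: "S > 0" "S^2 = a^2 - 1" using p by (simp_all add: S_def a2)
  have Sa: "S \<le> a"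
  proof (rule power2_le_imp_le)
    show "S^2 \<le> a^2" using S by simp
  qed (use a1 in simp)
  have W: "(a + S) * (a - S) = 1" using S(2) by (simp add: power2_eq_square algebra_simps)
  have W1: "a + S > 1" using a1 S by simp
  have am: "a - S = 1 / (a + S)" using W W1 by (simp add: field_simps)
  have eW: "exp (side_real t * ln (a + S)) = a + side_real t * S"
    using W1 am by (cases t) (simp_all add: side_real_def exp_minus inverse_eq_divide)
  have ph: "phi0 t x = Complex (sgn x * pi / 2) (- (side_real t * ln (a + S)))" by (simp add: phi0_def a_def S_def)
  have "\<i> * phi0 t x = of_real (side_real t * ln (a + S)) + \<i> * of_real (sgn x * pi / 2)" unfolding ph by (simp add: complex_eq_iff)
  hence "exp (\<i> * phi0 t x) = of_real (a + side_real t * S) * exp (\<i> * of_real (sgn x * pi / 2))"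
    by (simp only: exp_add exp_of_real eW)
  also have "exp (\<i> * of_real (sgn x * pi / 2)) = \<i> * of_real (sgn x)"
  proof -
    have "cis (sgn x * pi / 2) = \<i> * of_real (sgn x)" using x by (cases "x > 0") (auto simp: complex_eq_iff sgn_if)
    thus ?thesis by (simp only: cis_conv_exp)
  qed
  finally have e: "exp (\<i> * phi0 t x) = \<i> * of_real (sgn x * (a + side_real t * S))" by simp
  thus "exp (\<i> * phi0 t x) = \<i> * of_real (sgn x * (1 / \<bar>x\<bar> + side_real t * sqrt (1 / x^2 - 1)))" by (simp add: a_def S_def)
  have sx: "sgn x * sgn x = 1" using x by (simp add: sgn_if)
  have st: "side_real t * side_real t = 1" by (cases t) (simp_all add: side_real_def)
  have inv: "(sgn x * (a + side_real t * S)) * (sgn x * (a - side_real t * S)) = 1"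
  proof -
    have "(sgn x * (a + side_real t * S)) * (sgn x * (a - side_real t * S)) = (sgn x * sgn x) * (a^2 - (side_real t * side_real t) * S^2)"
      by (simp add: power2_eq_square algebra_simps)
    thus ?thesis unfolding sx st S(2) by simp
  qed
  have e': "exp (- (\<i> * phi0 t x)) = - \<i> * of_real (sgn x * (a - side_real t * S))"
  proof -
    have "exp (\<i> * phi0 t x) * (- \<i> * of_real (sgn x * (a - side_real t * S))) = of_real ((sgn x * (a + side_real t * S)) * (sgn x * (a - side_real t * S)))"
    proof -
      have "(\<i> * of_real u) * (- \<i> * of_real v) = of_real (u * v)" for u v by (simp add: complex_eq_iff)
      thus ?thesis unfolding e .
    qed
    also have "\<dots> = 1" unfolding inv by simp
    finally show ?thesis by (metis exp_minus_inverse exp_not_eq_zero mult_left_cancel)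
  qed
  have sa: "sgn x * a = 1 / x" using x by (simp add: a_def sgn_if)
  have "sin (phi0 t x) = of_real (sgn x * a)" unfolding sin_exp_eq e e' by (simp add: algebra_simps)
  thus s: "sin (phi0 t x) = of_real (1 / x)" unfolding sa .
  show "Re (phi0 t x) = sgn x * pi / 2" by (simp add: ph)
  have im: "Im (phi0 t x) = - (side_real t * ln (a + S))" by (simp add: ph)
  have lw: "ln (a + S) > 0" using W1 by simp
  thus "(case t of Upper \<Rightarrow> Im (phi0 t x) < 0 | Lower \<Rightarrow> Im (phi0 t x) > 0)" unfolding im by (cases t) (simp_all add: side_real_def)
  have "ln (a + S) \<le> a + S - 1" using W1 by (intro ln_le_minus_one) simp
  hence "ln (a + S) \<le> 2 * a" using Sa by linarith
  moreover have "\<bar>Im (phi0 t x)\<bar> = ln (a + S)" unfolding im using lw by (cases t) (simp_all add: side_real_def)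
  ultimately show "\<bar>Im (phi0 t x)\<bar> \<le> 2 / \<bar>x\<bar>" by (simp add: a_def)
  have "(cos (phi0 t x))^2 = of_real (1 - 1 / x^2)"
    using sin_cos_squared_add[of "phi0 t x"] unfolding s by (simp add: algebra_simps power_divide)
  hence "norm (cos (phi0 t x)) ^ 2 = \<bar>1 - 1 / x^2\<bar>" by (metis norm_of_real norm_power)
  also have "\<dots> = S^2" using p S(2) a2 by simp
  finally show "norm (cos (phi0 t x)) = sqrt (1 / x^2 - 1)" unfolding S_def[symmetric] using S(1) by (simp add: power2_eq_iff_nonneg)
qed

text \<open>For real y with |y| > 1 the root of 1 - y^2 sits on its cut, whereas that of y^2 - 1 is
  continuous there; the sign relating them is decided by the quadrant of y.\<close>

lemma csqrt_shore:
  fixes k :: real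
  assumes k: "k * k = 1" and y: "k * (Re y * Im y) < 0"
  shows "csqrt (1 - y^2) = \<i> * of_real k * csqrt (y^2 - 1)"
proof (rule csqrt_unique)
  define c where "c = csqrt (y^2 - 1)"
  have c2: "c^2 = y^2 - 1" by (simp add: c_def)
  have k2: "(of_real k :: complex)^2 = 1" using k by (simp add: power2_eq_square of_real_mult[symmetric] del: of_real_mult)
  show "(\<i> * of_real k * csqrt (y^2 - 1))^2 = 1 - y^2" unfolding c_def[symmetric] power_mult_distrib k2 c2 by simp
  have "Re c * Im c = Re y * Im y" using arg_cong[OF c2, of Im] by (simp add: power2_eq_square mult_ac)
  hence n: "Re c * (k * Im c) < 0" using y by (simp add: mult_ac)
  moreover have "Re c \<ge> 0" unfolding c_def by (rule csqrt_principal[THEN disjE, of "y^2 - 1"]) auto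
  ultimately have "k * Im c < 0" by (simp add: mult_less_0_iff)
  thus "0 < Re (\<i> * of_real k * csqrt (y^2 - 1)) \<or> Re (\<i> * of_real k * csqrt (y^2 - 1)) = 0 \<and> 0 \<le> Im (\<i> * of_real k * csqrt (y^2 - 1))"
    unfolding c_def[symmetric] by simp
qed

text \<open>On the side t of x the branch is fixed by k = sgn x times the sign of t; by
  \<open>csqrt_shore\<close>, Arcsin(1/w) is there a function F that is continuous at x
  itself.\<close>

lemma Arcsin_shore:
  assumes x: "x \<noteq> 0" "\<bar>x\<bar> < 1"
  shows "((\<lambda>w. Arcsin (1 / w)) \<longlongrightarrow> phi0 t x) (at (of_real x) within half_plane t)"
proof (rule Lim_transform_eventually)
  define k where "k = sgn x * side_real t"
  have st: "side_real t * side_real t = 1" by (cases t) (simp_all add: side_real_def)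
  have k: "k * k = 1" using x st by (simp add: k_def sgn_if)
  define F where "F = (\<lambda>w. - \<i> * Ln (\<i> * (1 / w) + \<i> * of_real k * csqrt ((1 / w)^2 - 1)))"
  have "x^2 < 1" using x by (simp add: abs_square_less_1)
  hence p: "1 / x^2 - 1 > 0" using x by simp
  have arg: "(1 / complex_of_real x)^2 - 1 = of_real (1 / x^2 - 1)" by (simp add: power_divide)
  have cx: "csqrt ((1 / complex_of_real x)^2 - 1) = of_real (sqrt (1 / x^2 - 1))"
    unfolding arg using p csqrt_of_real_nonneg[of "of_real (1 / x^2 - 1)"] by (simp only: Im_complex_of_real Re_complex_of_real)
  have sx: "1 / x = sgn x * (1 / \<bar>x\<bar>)" using x by (simp add: sgn_if)
  have L: "\<i> * (1 / complex_of_real x) + \<i> * of_real k * csqrt ((1 / complex_of_real x)^2 - 1) = exp (\<i> * phi0 t x)"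
  proof -
    have "1 / complex_of_real x = of_real (sgn x * (1 / \<bar>x\<bar>))" using sx by (metis of_real_1 of_real_divide)
    thus ?thesis unfolding cx phi0_facts(1)[OF x] k_def by (simp add: algebra_simps)
  qed
  have Re0: "Re (phi0 t x) = sgn x * pi / 2" by (rule phi0_facts(3)[OF x])
  have "Re (phi0 t x) = pi / 2 \<or> Re (phi0 t x) = - (pi / 2)" using x unfolding Re0 by (simp add: sgn_if)
  hence "- pi < Re (phi0 t x)" "Re (phi0 t x) \<le> pi" using pi_gt_zero by linarith+
  hence "Ln (exp (\<i> * phi0 t x)) = \<i> * phi0 t x" by (intro Ln_exp) simp_all
  hence Fx: "F (of_real x) = phi0 t x" unfolding F_def L by (simp add: mult.assoc[symmetric])
  have ex: "exp (\<i> * phi0 t x) \<notin> \<real>\<^sub>\<le>\<^sub>0"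
  proof
    assume "exp (\<i> * phi0 t x) \<in> \<real>\<^sub>\<le>\<^sub>0"
    hence "Im (exp (\<i> * phi0 t x)) = 0" by (simp add: complex_nonpos_Reals_iff)
    moreover have "Re (exp (\<i> * phi0 t x)) = 0" unfolding phi0_facts(1)[OF x] by simp
    ultimately show False using exp_not_eq_zero[of "\<i> * phi0 t x"] by (simp add: complex_eq_iff)
  qed
  have cn: "(1 / complex_of_real x)^2 - 1 \<notin> \<real>\<^sub>\<le>\<^sub>0" unfolding arg using p by (simp add: complex_nonpos_Reals_iff)
  have "isCont F (of_real x)" unfolding F_def
    by (intro continuous_intros isCont_Ln' isCont_csqrt') (use x cn ex L in \<open>auto\<close>)
  thus "(F \<longlongrightarrow> phi0 t x) (at (of_real x) within half_plane t)"
    using Fx continuous_within continuous_at_imp_continuous_at_within by metis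
  have "F w = Arcsin (1 / w)" if w: "x * Re w > 0" "w \<in> half_plane t" for w
  proof -
    have w0: "w \<noteq> 0" using w by auto
    define n where "n = (Re w)^2 + (Im w)^2"
    have n: "n > 0" using w0 by (simp add: n_def complex_neq_0)
    have ri: "Re (1 / w) = Re w / n" "Im (1 / w) = - Im w / n" by (simp_all add: Re_divide Im_divide n_def)
    have "sgn x * Re w > 0" using w(1) by (auto simp: sgn_if zero_less_mult_iff)
    moreover have "side_real t * Im w > 0" using w(2) by (cases t) (simp_all add: side_real_def)
    ultimately have "(sgn x * Re w) * (side_real t * Im w) / (n * n) > 0" using n by simp
    moreover have "k * (Re (1 / w) * Im (1 / w)) = - ((sgn x * Re w) * (side_real t * Im w) / (n * n))"
      unfolding ri k_def by (simp add: mult_ac)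
    ultimately have "k * (Re (1 / w) * Im (1 / w)) < 0" by simp
    from csqrt_shore[OF k this] show ?thesis unfolding F_def Arcsin_def by simp
  qed
  moreover have "open {w. x * Re w > 0}" by (intro open_Collect_less continuous_intros)
  moreover have "of_real x \<in> {w. x * Re w > 0}" using x by (simp add: zero_less_mult_iff) linarith
  ultimately show "\<forall>\<^sub>F w in at (of_real x) within half_plane t. F w = Arcsin (1 / w)"
    unfolding eventually_at_topological by blast
qed

lemma isCont_mat2:
  fixes p q r s :: "'a::t2_space \<Rightarrow> complex"
  assumes "isCont p x" "isCont q x" "isCont r x" "isCont s x"
  shows "isCont (\<lambda>x. mat2 (p x) (q x) (r x) (s x)) x"
  unfolding isCont_def
proof (intro vec_tendstoI)
  fix i j :: 2
  show "((\<lambda>y. vec_nth (vec_nth (mat2 (p y) (q y) (r y) (s y)) i) j) \<longlongrightarrow> vec_nth (vec_nth (mat2 (p x) (q x) (r x) (s x)) i) j) (at x)"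
    using assms exhaust_2[of i] exhaust_2[of j] by (auto simp: isCont_def)
qed

lemma isCont_nfs:
  assumes A: "adm A" and t: "case t of Upper \<Rightarrow> Im \<psi> > 0 | Lower \<Rightarrow> Im \<psi> < 0"
  shows "isCont (nfs t A) \<psi>" "isCont (nf1s t A) \<psi>"
proof -
  have n: "isCont (nf A) \<theta>" "isCont (nf1 A) \<theta>" if "Im \<theta> > 0" for \<theta>
    using nf_has_deriv[OF A that] DERIV_isCont by blast+
  have "isCont (nfs t A) \<psi> \<and> isCont (nf1s t A) \<psi>"
  proof (cases t)
    case Upper
    have "isCont (\<lambda>\<psi>. nf A (of_real (pi / 2) + \<psi>)) \<psi>" "isCont (\<lambda>\<psi>. nf1 A (of_real (pi / 2) + \<psi>)) \<psi>"
      by (rule isCont_o2[where f = "\<lambda>\<psi>. of_real (pi / 2) + \<psi>"]; use t Upper n in \<open>force intro!: continuous_intros\<close>)+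
    thus ?thesis using Upper by (simp add: nfs_def[abs_def] nf1s_def[abs_def])
  next
    case Lower
    have "isCont (\<lambda>\<psi>. nf A (of_real (- pi / 2) - \<psi>)) \<psi>" "isCont (\<lambda>\<psi>. nf1 A (of_real (- pi / 2) - \<psi>)) \<psi>"
      by (rule isCont_o2[where f = "\<lambda>\<psi>. of_real (- pi / 2) - \<psi>"]; use t Lower n in \<open>force intro!: continuous_intros\<close>)+
    thus ?thesis using Lower by (simp add: nfs_def[abs_def] nf1s_def[abs_def] continuous_intros)
  qed
  thus "isCont (nfs t A) \<psi>" "isCont (nf1s t A) \<psi>" by blast+
qed

text \<open>w |-> 1/w exchanges the half-planes, so phi = Arcsin(1/w) lies opposite to w and -phi on
  the side of w.\<close>

fun other :: "side \<Rightarrow> side" where "other Upper = Lower" | "other Lower = Upper"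

definition shore_form :: "side \<Rightarrow> side \<Rightarrow> complex \<Rightarrow> complex \<Rightarrow> complex^2^2" where
  "shore_form t s A \<phi> = Gamma_form (deriv_ratio A) (cos \<phi>) (sin \<phi>) (slope_limit s A) (nfs (other t) A \<phi> / mid_value A) (nf1s (other t) A \<phi> / (\<i> * A * mid_value A))
     (nfs t A (- \<phi>) / mid_value A) (nf1s t A (- \<phi>) / (\<i> * A * mid_value A))"

lemma half_plane_cut: "w \<in> half_plane t \<Longrightarrow> w \<notin> complex_of_real ` {-1..1}"
  by (cases t) auto

text \<open>In the limit one of pi/2 \<plusminus> phi reaches the edge of the strip on which
  \<open>qf\<close> is defined. Its imaginary part stays nonzero, so the Jost form
  \<open>nfs\<close> is continuous there and supplies the boundary value.\<close>

lemma shore_Gamma: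
  assumes l: "l \<in> closed_half_plane s" "norm l < lam_bound" "l \<noteq> 0" and x: "x \<noteq> 0" "\<bar>x\<bar> < 1" and R: "deriv_ratio (A_param s l) \<noteq> 0"
  shows "shore t (\<lambda>w. Gamma_mat s w l) (of_real x) = shore_form t s (A_param s l) (phi0 t x)"
proof (rule shore_eqI)
  define A where "A = A_param s l"
  define p where "p = phi0 t x"
  have A: "adm_low A" unfolding A_def by (rule A_param_facts(1)[OF l])
  hence a: "adm A" by (simp add: adm_low_def)
  have P0: "mid_value A \<noteq> 0" by (rule Gc_relation(3)[OF A])
  have A0: "A \<noteq> 0" using A by (auto simp: adm_low_def)
  have "sqrt (1 / x^2 - 1) \<noteq> 0"
  proof -
    have "x^2 < 1" using x by (simp add: abs_square_less_1)
    thus ?thesis using x by simp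
  qed
  hence c0: "cos p \<noteq> 0" using phi0_facts(6)[OF x, of t] unfolding p_def by auto
  have sg: "case other t of Upper \<Rightarrow> Im p > 0 | Lower \<Rightarrow> Im p < 0" "case t of Upper \<Rightarrow> Im (- p) > 0 | Lower \<Rightarrow> Im (- p) < 0"
    using phi0_facts(4)[OF x, of t] unfolding p_def by (cases t; simp)+
  have m: "isCont (\<lambda>\<phi>. nfs t A (- \<phi>)) p" "isCont (\<lambda>\<phi>. nf1s t A (- \<phi>)) p"
    by (rule isCont_o2[where f = uminus], auto intro!: continuous_intros isCont_nfs[OF a sg(2)])+
  have "isCont (shore_form t s A) p"
    unfolding shore_form_def[abs_def] Gamma_form_def using c0 R P0 A0
    by (intro isCont_mat2 continuous_intros m isCont_nfs[OF a sg(1)]) (auto simp: A_def)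
  hence T: "((\<lambda>w. shore_form t s A (Arcsin (1 / w))) \<longlongrightarrow> shore_form t s A p) (at (of_real x) within half_plane t)"
    unfolding p_def by (rule isCont_tendsto_compose[OF _ Arcsin_shore[OF x]])
  have eq: "shore_form t s A (Arcsin (1 / w)) = Gamma_mat s w l" if w: "w \<in> half_plane t" for w
  proof -
    note wn = half_plane_cut[OF w]
    note c = inverse_cut[OF wn]
    have iw: "case other t of Upper \<Rightarrow> Im (1 / w) > 0 | Lower \<Rightarrow> Im (1 / w) < 0"
      using w by (cases t) (auto simp: Im_divide divide_simps sum_power2_gt_zero_iff)
    define \<phi> where "\<phi> = Arcsin (1 / w)"
    have re: "\<bar>Re \<phi>\<bar> < pi / 2" "\<bar>Re (- \<phi>)\<bar> < pi / 2" using Arcsin_cut(2)[OF c] by (simp_all add: \<phi>_def)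
    have s1: "case other t of Upper \<Rightarrow> Im \<phi> > 0 | Lower \<Rightarrow> Im \<phi> < 0"
      using iw Arcsin_cut(3,4)[OF c] by (cases t) (auto simp: \<phi>_def)
    hence s2: "case t of Upper \<Rightarrow> Im (- \<phi>) > 0 | Lower \<Rightarrow> Im (- \<phi>) < 0" by (cases t) auto
    have s1': "case other t of Upper \<Rightarrow> Im \<phi> \<ge> 0 | Lower \<Rightarrow> Im \<phi> \<le> 0" "case t of Upper \<Rightarrow> Im (- \<phi>) \<ge> 0 | Lower \<Rightarrow> Im (- \<phi>) \<le> 0"
      using s1 by (cases t; simp)+
    show ?thesis
      unfolding Gamma_mat_eq_form[OF A[unfolded A_def] wn R] \<phi>_def[symmetric] A_def[symmetric] shore_form_def
        qf_eq_nfs(1)[OF a re(1) s1'(1)] qf_eq_nfs(2)[OF a re(1) s1] qf_eq_nfs(1)[OF a re(2) s1'(2)] qf_eq_nfs(2)[OF a re(2) s2] ..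
  qed
  show "((\<lambda>w. Gamma_mat s w l) \<longlongrightarrow> shore_form t s (A_param s l) (phi0 t x)) (at (of_real x) within half_plane t)"
    by (rule Lim_transform_eventually[OF T[unfolded A_def p_def] eventually_at_topological[THEN iffD2, OF exI[of _ UNIV]]])
      (use eq in \<open>auto simp: A_def\<close>)
  show "Im (complex_of_real x) = 0" by simp
qed

lemma shore_Psi0:
  fixes t :: side
  assumes x: "x \<noteq> 0" "\<bar>x\<bar> < 1"
  defines "p \<equiv> phi0 t x"
  shows "shore t (Psi0 s) (of_real x) = Psi_form (side_sign s * \<i>) (ccos p) (sin p) (exp (side_sign s * \<i> * p))"
proof (rule shore_eqI)
  have "sqrt (1 / x^2 - 1) \<noteq> 0"
  proof -
    have "x^2 < 1" using x by (simp add: abs_square_less_1)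
    thus ?thesis using x by simp
  qed
  hence c0: "cos p \<noteq> 0" using phi0_facts(6)[OF x, of t] unfolding p_def by auto
  \<comment> \<open>cos phi0 is purely imaginary and nonzero, hence off the cut of
    \<open>csqrt\<close>.\<close>
  have "cos (Re p) = 0" using x unfolding p_def phi0_facts(3)[OF x] by (simp add: sgn_if)
  hence "Re (cos p) = 0" by (simp add: Re_cos)
  hence "cos p \<notin> \<real>\<^sub>\<le>\<^sub>0" using c0 by (auto simp: complex_nonpos_Reals_iff complex_eq_iff)
  hence "isCont (\<lambda>\<phi>. Psi_form (side_sign s * \<i>) (ccos \<phi>) (sin \<phi>) (exp (side_sign s * \<i> * \<phi>))) p"
    unfolding Psi_form_def using c0 by (intro isCont_mat2 continuous_intros isCont_csqrt') auto
  hence "((\<lambda>w. Psi_form (side_sign s * \<i>) (ccos (Arcsin (1 / w))) (sin (Arcsin (1 / w))) (exp (side_sign s * \<i> * Arcsin (1 / w))))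
      \<longlongrightarrow> Psi_form (side_sign s * \<i>) (ccos p) (sin p) (exp (side_sign s * \<i> * p))) (at (of_real x) within half_plane t)"
    unfolding p_def by (rule isCont_tendsto_compose[OF _ Arcsin_shore[OF x]])
  thus "(Psi0 s \<longlongrightarrow> Psi_form (side_sign s * \<i>) (ccos p) (sin p) (exp (side_sign s * \<i> * p))) (at (of_real x) within half_plane t)"
    by (rule Lim_transform_eventually[OF _ eventually_at_topological[THEN iffD2, OF exI[of _ UNIV]]])
      (use Psi0_eq[OF half_plane_cut] in auto)
  show "Im (complex_of_real x) = 0" by simp
qed

lemma shore_g:
  assumes x: "x \<noteq> 0" "\<bar>x\<bar> < 1"
  shows "shore t g_fun (of_real x) = - phi0 t x / of_real pi"
proof (rule shore_eqI)
  have "((\<lambda>w. - Arcsin (1 / w) / of_real pi) \<longlongrightarrow> - phi0 t x / of_real pi) (at (of_real x) within half_plane t)"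
    by (intro tendsto_intros Arcsin_shore[OF x]) auto
  thus "(g_fun \<longlongrightarrow> - phi0 t x / of_real pi) (at (of_real x) within half_plane t)"
    by (rule Lim_transform_eventually[OF _ eventually_at_topological[THEN iffD2, OF exI[of _ UNIV]]])
      (use g_fun_eq_Arcsin[OF half_plane_cut] in auto)
  show "Im (complex_of_real x) = 0" by simp
qed

section \<open>The estimate on the shores\<close>

text \<open>At Re psi = pi/2 the distance to the left edge is pi, so the second exponential is
  negligible in this column.\<close>

lemma one_term_column:
  assumes l: "l \<in> closed_half_plane s" "norm l < lam_bound" "l \<noteq> 0" and reg: "region \<delta> Y \<psi>" and \<delta>: "\<delta> > 0" and re: "Re \<psi> = pi / 2"
    and t: "case t of Upper \<Rightarrow> Im \<psi> > 0 | Lower \<Rightarrow> Im \<psi> < 0"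
  defines "A \<equiv> A_param s l" and "\<epsilon> \<equiv> error_const \<delta> Y (pi / 2) / norm (kappa s l)"
  shows "norm (nfs t A \<psi> / mid_value A * exp (- (\<i> * (A + 1 / 2) * \<psi>)) - (1 - 0) * ccos \<psi>) \<le> \<epsilon>"
    "norm (nf1s t A \<psi> / (\<i> * A * mid_value A) * exp (- (\<i> * (A + 1 / 2) * \<psi>)) - (1 + 0) * ccos \<psi>) \<le> \<epsilon>"
proof -
  have Y: "Y \<ge> 0" by (rule region_bounds(5)[OF reg])
  have d: "pi / 2 > 0" "pi / 2 \<le> pi / 2 + Re \<psi>" using re pi_gt_zero by linarith+
  have t': "case t of Upper \<Rightarrow> Im \<psi> \<ge> 0 | Lower \<Rightarrow> Im \<psi> \<le> 0" "Im \<psi> \<noteq> 0" using t by (cases t; simp)+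
  have kb: "one_term_const \<delta> Y (pi / 2) / \<bar>Im A\<bar> \<le> \<epsilon>"
    unfolding A_def \<epsilon>_def by (rule im_bound[OF l error_const_ge(5)[OF \<delta> d(1) Y] one_term_const_nonneg[OF \<delta> d(1)]])
  note o = one_term_nfs[OF A_param_facts(1)[OF l] reg \<delta> d t'(1), folded A_def]
  show "norm (nfs t A \<psi> / mid_value A * exp (- (\<i> * (A + 1 / 2) * \<psi>)) - (1 - 0) * ccos \<psi>) \<le> \<epsilon>"
    using order_trans[OF o(1) kb] by (simp only: diff_zero mult_1_left)
  show "norm (nf1s t A \<psi> / (\<i> * A * mid_value A) * exp (- (\<i> * (A + 1 / 2) * \<psi>)) - (1 + 0) * ccos \<psi>) \<le> \<epsilon>"
    using order_trans[OF o(2)[OF t'(2)] kb] by (simp only: add_0_right mult_1_left)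
qed

text \<open>At Re psi = -pi/2 the second exponential has order one and is kept as \<rho>. Its
  leading part r, with the phase adjusted, becomes the off-diagonal entry of the triangular
  factor.\<close>

lemma two_term_column:
  assumes l: "l \<in> closed_half_plane s" "norm l < lam_bound" "l \<noteq> 0" and reg: "region \<delta> Y \<psi>" and \<delta>: "\<delta> > 0" and re: "Re \<psi> = - pi / 2"
    and t: "case t of Upper \<Rightarrow> Im \<psi> > 0 | Lower \<Rightarrow> Im \<psi> < 0"
  defines "A \<equiv> A_param s l" and "\<kappa> \<equiv> kappa s l" and "\<epsilon> \<equiv> error_const \<delta> Y (pi / 2) / norm (kappa s l)"
  defines "\<rho> \<equiv> side_sign t * rho2 A \<psi>" and "r \<equiv> side_sign t * (- \<i> * exp (- (\<kappa> * (1 + 2 * \<psi> / of_real pi))))"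
  assumes \<epsilon>: "\<epsilon> \<le> 1 / 2"
  shows "norm (nfs t A \<psi> / mid_value A * exp (- (\<i> * (A + 1 / 2) * \<psi>)) - (1 - \<rho>) * ccos \<psi>) \<le> \<epsilon>"
    "norm (nf1s t A \<psi> / (\<i> * A * mid_value A) * exp (- (\<i> * (A + 1 / 2) * \<psi>)) - (1 + \<rho>) * ccos \<psi>) \<le> \<epsilon>"
    "norm (exp (\<i> * (A + 1 / 2) * \<psi>) * exp (- (\<kappa> * \<psi> / of_real pi)) * \<rho> - r / exp (side_sign s * \<i> * \<psi>)) \<le> \<epsilon>"
    "norm \<rho> \<le> exp (2 * Y)" "norm r \<le> exp (2 * Y)"
proof -
  have Y: "Y \<ge> 0" by (rule region_bounds(5)[OF reg])
  have d: "pi / 2 > 0" by simp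
  have t': "case t of Upper \<Rightarrow> Im \<psi> \<ge> 0 | Lower \<Rightarrow> Im \<psi> \<le> 0" "Im \<psi> \<noteq> 0" using t by (cases t; simp)+
  have A: "adm_low A" unfolding A_def by (rule A_param_facts(1)[OF l])
  show \<rho>: "norm \<rho> \<le> exp (2 * Y)" unfolding \<rho>_def norm_mult norm_side_sign using rho2_bound(2)[OF A reg] by simp
  have kb: "((1 + exp (2 * Y)) * two_term_const \<delta> Y) / \<bar>Im A\<bar> \<le> \<epsilon>"
    unfolding A_def \<epsilon>_def
    by (rule im_bound[OF l error_const_ge(3)[OF \<delta> d Y]]) (intro mult_nonneg_nonneg two_term_const_nonneg \<delta> add_nonneg_nonneg; simp)
  have c: "norm (w * (B + E1 - side_sign t * rho2 A \<psi> * (B + E2)) * v - (1 - \<rho>) * B) \<le> \<epsilon>"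
    "norm (w * (B + E1 + side_sign t * rho2 A \<psi> * (B + E2)) * v - (1 + \<rho>) * B) \<le> \<epsilon>"
    if "norm E1 \<le> two_term_const \<delta> Y / \<bar>Im A\<bar>" "norm E2 \<le> two_term_const \<delta> Y / \<bar>Im A\<bar>" "w * v = 1" for w v B E1 E2
  proof -
    have "norm (\<rho> * E2) \<le> exp (2 * Y) * (two_term_const \<delta> Y / \<bar>Im A\<bar>)" unfolding norm_mult using \<rho> that by (intro mult_mono) auto
    hence b: "norm E1 + norm (\<rho> * E2) \<le> \<epsilon>" using that(1) kb by (simp add: add_divide_distrib distrib_right)
    have wv: "w * z * v = z" for z using that(3) by (metis mult.commute mult.assoc mult_1_right)
    have "w * (B + E1 - side_sign t * rho2 A \<psi> * (B + E2)) * v - (1 - \<rho>) * B = E1 - \<rho> * E2"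
      unfolding wv \<rho>_def[symmetric] by (simp add: algebra_simps)
    thus "norm (w * (B + E1 - side_sign t * rho2 A \<psi> * (B + E2)) * v - (1 - \<rho>) * B) \<le> \<epsilon>"
      using norm_triangle_ineq4[of E1 "\<rho> * E2"] b by (simp only:)
    have "w * (B + E1 + side_sign t * rho2 A \<psi> * (B + E2)) * v - (1 + \<rho>) * B = E1 + \<rho> * E2"
      unfolding wv \<rho>_def[symmetric] by (simp add: algebra_simps)
    thus "norm (w * (B + E1 + side_sign t * rho2 A \<psi> * (B + E2)) * v - (1 + \<rho>) * B) \<le> \<epsilon>"
      using norm_triangle_ineq[of E1 "\<rho> * E2"] b by (simp only:)
  qed
  have ex: "exp (\<i> * (A + 1 / 2) * \<psi>) * exp (- (\<i> * (A + 1 / 2) * \<psi>)) = 1" by (simp add: exp_minus_inverse)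
  show "norm (nfs t A \<psi> / mid_value A * exp (- (\<i> * (A + 1 / 2) * \<psi>)) - (1 - \<rho>) * ccos \<psi>) \<le> \<epsilon>"
    using nfs_two_term(1)[OF A reg \<delta> t'(1)] c(1)[OF _ _ ex] by force
  show "norm (nf1s t A \<psi> / (\<i> * A * mid_value A) * exp (- (\<i> * (A + 1 / 2) * \<psi>)) - (1 + \<rho>) * ccos \<psi>) \<le> \<epsilon>"
    using nfs_two_term(2)[OF A reg \<delta> t'] c(2)[OF _ _ ex] by force
  have eb: "norm (exp (- (\<kappa> * (1 + 2 * \<psi> / of_real pi)))) \<le> exp (2 * Y)"
  proof -
    \<comment> \<open>On this edge 1 + 2 psi/pi is purely imaginary, so the modulus involves only Im
      kappa, which is bounded by pi.\<close>
    have "1 + 2 * \<psi> / of_real pi = \<i> * of_real (2 * Im \<psi> / pi)" using re by (simp add: complex_eq_iff)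
    hence "Re (- (\<kappa> * (1 + 2 * \<psi> / of_real pi))) = Im \<kappa> * (2 * Im \<psi> / pi)" by (simp only:) simp
    also have "\<dots> \<le> \<bar>Im \<kappa>\<bar> * \<bar>2 * Im \<psi> / pi\<bar>" by (metis abs_ge_self abs_mult)
    also have "\<dots> \<le> pi * (2 * Y / pi)"
      using kappa_facts(2)[OF l(1,3)] reg pi_gt_zero by (intro mult_mono) (auto simp: \<kappa>_def region_def abs_mult divide_right_mono)
    finally show ?thesis by simp
  qed
  show "norm r \<le> exp (2 * Y)" unfolding r_def norm_mult norm_side_sign using eb by simp
  have p: "e * (side_sign t * \<rho>') - side_sign t * r' / q = side_sign t * (e * \<rho>' - r' / q)" for e \<rho>' r' q
    by (simp add: algebra_simps)
  show "norm (exp (\<i> * (A + 1 / 2) * \<psi>) * exp (- (\<kappa> * \<psi> / of_real pi)) * \<rho> - r / exp (side_sign s * \<i> * \<psi>)) \<le> \<epsilon>"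
    unfolding \<rho>_def r_def p norm_mult[of "side_sign t"] norm_side_sign mult_1_left
    using phase_estimates(2)[OF l reg \<delta> d \<epsilon>[unfolded \<epsilon>_def] eb[unfolded \<kappa>_def]] unfolding A_def \<kappa>_def \<epsilon>_def .
qed

text \<open>For x < 0 the point phi0 has real part -pi/2 and the first column has two terms; for x >
  0 this happens at -phi0, in the second column. This decides between the lower and the upper
  triangular factor.\<close>

lemma shore_estimate:
  assumes l: "l \<in> closed_half_plane s" "norm l < lam_bound" "l \<noteq> 0" and x: "x \<noteq> 0" "\<bar>x\<bar> < 1"
    and reg: "region \<delta> Y (phi0 t x)" and \<delta>: "\<delta> > 0"
    and \<epsilon>: "error_const \<delta> Y (pi / 2) / norm (kappa s l) \<le> 1 / 2"
  shows "\<exists>E. norm E \<le> 1536 * (exp (2 * Y) + 1 / sqrt \<delta>)^10 * (error_const \<delta> Y (pi / 2) / norm (kappa s l)) \<and>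
     (let z = complex_of_real x; \<kappa> = kappa s l; g = shore t g_fun z;
        T = (if x < 0 then mat2 1 0 (side_sign t * \<i> * exp (\<kappa> * (2 * g - 1))) 1
             else mat2 1 (- side_sign t * \<i> * exp (- \<kappa> * (2 * g + 1))) 0 1)
      in shore t (\<lambda>w. Gamma_mat s w l) z = shore t (Psi0 s) z ** (mat 1 + E) ** T ** exp_sigma3 (- \<kappa> * g))"
proof -
  define p where "p = phi0 t x"
  define A where "A = A_param s l"
  define \<kappa> where "\<kappa> = kappa s l"
  have reg1: "region \<delta> Y p" "region \<delta> Y (- p)" using reg by (simp_all add: p_def region_minus)
  have Y: "Y \<ge> 0" by (rule region_bounds(5)[OF reg])
  have d: "pi / 2 > 0" by simp
  have R: "deriv_ratio (A_param s l) \<noteq> 0" by (rule deriv_ratio_nonzero[OF l \<delta> d Y \<epsilon>])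
  have sg: "case other t of Upper \<Rightarrow> Im p > 0 | Lower \<Rightarrow> Im p < 0" "case t of Upper \<Rightarrow> Im (- p) > 0 | Lower \<Rightarrow> Im (- p) < 0"
    using phi0_facts(4)[OF x, of t] unfolding p_def by (cases t; simp)+
  have Rp: "Re p = sgn x * pi / 2" unfolding p_def by (rule phi0_facts(3)[OF x])
  have C: "0 \<le> error_const \<delta> Y (pi / 2) / norm (kappa s l)" using error_const_ge(6)[OF \<delta> d Y] by simp
  have cm: "ccos (- p) = ccos p" by simp
  note F = final_estimate[OF l reg1(1) \<delta> d \<epsilon>, folded A_def \<kappa>_def]
  show ?thesis
  proof (cases "x < 0")
    case True
    have re: "Re p = - pi / 2" "Re (- p) = pi / 2" using Rp True by simp_all
    note o = one_term_column[OF l reg1(2) \<delta> re(2) sg(2), unfolded cm, folded A_def \<kappa>_def]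
    note w = two_term_column[OF l reg1(1) \<delta> re(1) sg(1) \<epsilon>, folded A_def \<kappa>_def]
    have r: "side_sign (other t) * (- \<i> * exp (- (\<kappa> * (1 + 2 * p / of_real pi)))) = side_sign t * \<i> * exp (\<kappa> * (2 * (- p / of_real pi) - 1))"
    proof -
      have "- (\<kappa> * (1 + 2 * p / of_real pi)) = \<kappa> * (2 * (- p / of_real pi) - 1)" by (simp add: algebra_simps)
      moreover have "side_sign (other t) = - side_sign t" by (cases t) auto
      ultimately show ?thesis by (simp only:) simp
    qed
    have "\<exists>E. norm E \<le> 1536 * (exp (2 * Y) + 1 / sqrt \<delta>)^10 * (error_const \<delta> Y (pi / 2) / norm \<kappa>) \<and>
      shore_form t s A p = Psi_form (side_sign s * \<i>) (ccos p) (sin p) (exp (side_sign s * \<i> * p)) ** (mat 1 + E)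
        ** mat2 1 0 (side_sign t * \<i> * exp (\<kappa> * (2 * (- p / of_real pi) - 1))) 1 ** exp_sigma3 (- \<kappa> * (- p / of_real pi))"
      unfolding shore_form_def r[symmetric]
      by (rule F[OF w(1,2) o w(3) _ _ w(4) _ w(5)]) (use C in \<open>simp_all add: \<kappa>_def\<close>)
    thus ?thesis
      unfolding Let_def shore_Gamma[OF l x R] shore_Psi0[OF x] shore_g[OF x] p_def A_def \<kappa>_def using True by (simp only: if_True)
  next
    case False
    have re: "Re p = pi / 2" "Re (- p) = - pi / 2" using Rp False x by simp_all
    note o = one_term_column[OF l reg1(1) \<delta> re(1) sg(1), folded A_def \<kappa>_def]
    note w = two_term_column[OF l reg1(2) \<delta> re(2) sg(2) \<epsilon>, unfolded cm, folded A_def \<kappa>_def]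
    have r: "side_sign t * (- \<i> * exp (- (\<kappa> * (1 + 2 * (- p) / of_real pi)))) = - side_sign t * \<i> * exp (- \<kappa> * (2 * (- p / of_real pi) + 1))"
    proof -
      have "- (\<kappa> * (1 + 2 * (- p) / of_real pi)) = - \<kappa> * (2 * (- p / of_real pi) + 1)" by (simp add: algebra_simps)
      thus ?thesis by (simp only:) simp
    qed
    have "\<exists>E. norm E \<le> 1536 * (exp (2 * Y) + 1 / sqrt \<delta>)^10 * (error_const \<delta> Y (pi / 2) / norm \<kappa>) \<and>
      shore_form t s A p = Psi_form (side_sign s * \<i>) (ccos p) (sin p) (exp (side_sign s * \<i> * p)) ** (mat 1 + E)
        ** mat2 1 (- side_sign t * \<i> * exp (- \<kappa> * (2 * (- p / of_real pi) + 1))) 0 1 ** exp_sigma3 (- \<kappa> * (- p / of_real pi))"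
      unfolding shore_form_def r[symmetric]
      by (rule F[OF o w(1,2) _ w(3) _ _ w(4) _ w(5)]) (use C in \<open>simp_all add: \<kappa>_def\<close>)
    thus ?thesis
      unfolding Let_def shore_Gamma[OF l x R] shore_Psi0[OF x] shore_g[OF x] p_def A_def \<kappa>_def using False by (simp only: if_False)
  qed
qed

lemma compact_cut:
  assumes K: "compact K" "K \<subseteq> {-1<..<0} \<union> {0<..<1::real}"
  shows "\<exists>\<delta> Y. \<delta> > 0 \<and> Y \<ge> 0 \<and> (\<forall>x\<in>K. \<forall>t. x \<noteq> 0 \<and> \<bar>x\<bar> < 1 \<and> region \<delta> Y (phi0 t x))"
proof (cases "K = {}")
  case True
  thus ?thesis by (intro exI[of _ 1]) auto
next
  case False
  have k: "x \<noteq> 0 \<and> \<bar>x\<bar> < 1" if "x \<in> K" for x using K(2) that by auto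
  have c: "continuous_on K (\<lambda>x. \<bar>x\<bar>)" by (intro continuous_intros)
  from continuous_attains_sup[OF K(1) False c] continuous_attains_inf[OF K(1) False c]
  obtain u v where u: "u \<in> K" "\<And>x. x \<in> K \<Longrightarrow> \<bar>x\<bar> \<le> \<bar>u\<bar>" and v: "v \<in> K" "\<And>x. x \<in> K \<Longrightarrow> \<bar>v\<bar> \<le> \<bar>x\<bar>" by blast
  have "u^2 < 1" using k[OF u(1)] by (simp add: abs_square_less_1)
  hence \<delta>: "sqrt (1 / u^2 - 1) > 0" using k[OF u(1)] by simp
  have reg: "region (sqrt (1 / u^2 - 1)) (2 / \<bar>v\<bar>) (phi0 t x)" if x: "x \<in> K" for x t
  proof -
    note f = phi0_facts[OF conjunct1[OF k[OF x]] conjunct2[OF k[OF x]], of t]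
    have "x^2 \<le> u^2" using u(2)[OF x] by (simp add: abs_le_square_iff)
    hence "1 / u^2 \<le> 1 / x^2" using k[OF x] by (intro divide_left_mono) (auto simp: zero_less_mult_iff k[OF u(1)])
    hence "sqrt (1 / u^2 - 1) \<le> norm (cos (phi0 t x))" unfolding f(6) by simp
    moreover have "\<bar>Re (phi0 t x)\<bar> \<le> pi / 2" unfolding f(3) using k[OF x] by (simp add: sgn_if)
    moreover have "2 / \<bar>x\<bar> \<le> 2 / \<bar>v\<bar>" using v(2)[OF x] k[OF v(1)] by (intro divide_left_mono) auto
    ultimately show ?thesis unfolding region_def using f(5) by linarith
  qed
  have "0 \<le> 2 / \<bar>v\<bar>" by simp
  thus ?thesis using \<delta> reg k by blast
qed

text \<open>The estimates give O(1/kappa) with a constant that depends only on the compact set; for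
  M \<ge> 1 this is contained in O(M^2/kappa).\<close>

lemma scale_bound:
  fixes n c M k :: real
  assumes "n \<le> c * (C / k)" "M \<ge> 1" "0 \<le> c" "0 \<le> C" "0 \<le> k"
  shows "n \<le> c * C * (M^2 / k)"
proof -
  have "1 \<le> M^2" using assms(2) by simp
  hence "c * C / k * 1 \<le> c * C / k * M^2" using assms by (intro mult_left_mono) auto
  thus ?thesis using assms(1) by simp
qed

theorem theorem5p23:
  shows "\<exists>M0::real. M0 > 0 \<and>
    (\<forall>K :: complex set. compact K \<and> K \<inter> complex_of_real ` {-1..1} = {} \<longrightarrow>
      (\<exists>C::real. C > 0 \<and> (\<forall>M\<ge>M0. \<exists>\<delta>::real. \<delta> > 0 \<and>
        (\<forall>s. \<forall>l \<in> closed_half_plane s. 0 < norm l \<and> norm l < \<delta> \<longrightarrow>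
          (\<forall>z\<in>K. \<exists>E :: complex^2^2.
             norm E \<le> C * (M^2 / norm (kappa s l)) \<and>
             Gamma_mat s z l =
               Psi0 s z ** (mat 1 + E) ** exp_sigma3 (- kappa s l * g_fun z)))))) \<and>
    (\<forall>K :: real set. compact K \<and> K \<subseteq> {-1<..<0} \<union> {0<..<1} \<longrightarrow>
      (\<exists>C::real. C > 0 \<and> (\<forall>M\<ge>M0. \<exists>\<delta>::real. \<delta> > 0 \<and>
        (\<forall>s. \<forall>l \<in> closed_half_plane s. 0 < norm l \<and> norm l < \<delta> \<longrightarrow>
          (\<forall>x\<in>K. \<forall>t. \<exists>E :: complex^2^2.
             norm E \<le> C * (M^2 / norm (kappa s l)) \<and>
             (let z = complex_of_real x;
                  \<kappa> = kappa s l;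
                  g = shore t g_fun z;
                  T = (if x < 0
                       then mat2 1 0 (side_sign t * \<i> * exp (\<kappa> * (2 * g - 1))) 1
                       else mat2 1 (- side_sign t * \<i> * exp (- \<kappa> * (2 * g + 1))) 0 1)
              in shore t (\<lambda>w. Gamma_mat s w l) z =
                   shore t (Psi0 s) z ** (mat 1 + E) ** T ** exp_sigma3 (- \<kappa> * g)))))))"
\<comment> \<open>M0 = 1: the constants below are chosen before M, and \<open>scale_bound\<close>
  inserts M^2.\<close>
proof (rule exI[of _ 1], intro conjI allI impI; (elim conjE)?)
  show "(0::real) < 1" by simp
next
  fix K :: "complex set"
  assume K: "compact K" "K \<inter> complex_of_real ` {-1..1} = {}"
  obtain \<delta> Y d where k: "\<delta> > 0" "Y \<ge> 0" "d > 0"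
    and r: "\<And>z. z \<in> K \<Longrightarrow> region \<delta> Y (Arcsin (1 / z)) \<and> \<bar>Re (Arcsin (1 / z))\<bar> \<le> pi / 2 - d"
    using compact_outside[OF K] by blast
  define c where "c = 1536 * (exp (2 * Y) + 1 / sqrt \<delta>)^10"
  have c: "c > 0" unfolding c_def using k by (intro mult_pos_pos zero_less_power add_pos_pos) auto
  have C: "error_const \<delta> Y d > 0" by (rule error_const_ge(6)[OF k(1,3,2)])
  show "\<exists>C::real. C > 0 \<and> (\<forall>M\<ge>1. \<exists>\<delta>::real. \<delta> > 0 \<and>
        (\<forall>s. \<forall>l \<in> closed_half_plane s. 0 < norm l \<and> norm l < \<delta> \<longrightarrow>
          (\<forall>z\<in>K. \<exists>E :: complex^2^2. norm E \<le> C * (M^2 / norm (kappa s l)) \<and>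
             Gamma_mat s z l = Psi0 s z ** (mat 1 + E) ** exp_sigma3 (- kappa s l * g_fun z))))"
  \<comment> \<open>Of the two bounds on |lambda| the first makes A admissible, the second gives
    \<epsilon> \<le> 1/2 through \<open>small_epsilon\<close>.\<close>
  proof (rule exI[of _ "c * error_const \<delta> Y d"], intro conjI allI impI exI[of _ "min lam_bound (exp (- (2 * error_const \<delta> Y d)))"] ballI)
    show "c * error_const \<delta> Y d > 0" using c C by simp
    show "0 < min lam_bound (exp (- (2 * error_const \<delta> Y d)))" by (simp add: lam_bound_def)
  next
    fix M :: real and s l z
    assume M: "1 \<le> M" and l: "l \<in> closed_half_plane s" "0 < norm l \<and> norm l < min lam_bound (exp (- (2 * error_const \<delta> Y d)))" and z: "z \<in> K"
    have l': "norm l < lam_bound" "l \<noteq> 0" "norm l < exp (- (2 * error_const \<delta> Y d))" using l(2) by auto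
    have zn: "z \<notin> complex_of_real ` {-1..1}" using K(2) z by blast
    obtain E where E: "norm E \<le> c * (error_const \<delta> Y d / norm (kappa s l))"
      "Gamma_mat s z l = Psi0 s z ** (mat 1 + E) ** exp_sigma3 (- kappa s l * g_fun z)"
      unfolding c_def using outside_estimate[OF l(1) l'(1,2) zn conjunct1[OF r[OF z]] k(1,3) conjunct2[OF r[OF z]] small_epsilon[OF l(1) l'(2,3) C]]
      by blast
    from scale_bound[OF E(1) M] c C E(2)
    show "\<exists>E :: complex^2^2. norm E \<le> c * error_const \<delta> Y d * (M^2 / norm (kappa s l)) \<and>
             Gamma_mat s z l = Psi0 s z ** (mat 1 + E) ** exp_sigma3 (- kappa s l * g_fun z)"
      by (intro exI[of _ E]) (auto simp only: less_imp_le norm_ge_zero)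
  qed
next
  fix K :: "real set"
  assume K: "compact K" "K \<subseteq> {-1<..<0} \<union> {0<..<1}"
  obtain \<delta> Y where k: "\<delta> > 0" "Y \<ge> 0" and r: "\<And>x t. x \<in> K \<Longrightarrow> x \<noteq> 0 \<and> \<bar>x\<bar> < 1 \<and> region \<delta> Y (phi0 t x)"
    using compact_cut[OF K] by blast
  define c where "c = 1536 * (exp (2 * Y) + 1 / sqrt \<delta>)^10"
  have c: "c > 0" unfolding c_def using k by (intro mult_pos_pos zero_less_power add_pos_pos) auto
  have C: "error_const \<delta> Y (pi / 2) > 0" by (rule error_const_ge(6)[OF k(1) _ k(2)]) simp
  show "\<exists>C::real. C > 0 \<and> (\<forall>M\<ge>1. \<exists>\<delta>::real. \<delta> > 0 \<and>
        (\<forall>s. \<forall>l \<in> closed_half_plane s. 0 < norm l \<and> norm l < \<delta> \<longrightarrow>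
          (\<forall>x\<in>K. \<forall>t. \<exists>E :: complex^2^2.
             norm E \<le> C * (M^2 / norm (kappa s l)) \<and>
             (let z = complex_of_real x;
                  \<kappa> = kappa s l;
                  g = shore t g_fun z;
                  T = (if x < 0
                       then mat2 1 0 (side_sign t * \<i> * exp (\<kappa> * (2 * g - 1))) 1
                       else mat2 1 (- side_sign t * \<i> * exp (- \<kappa> * (2 * g + 1))) 0 1)
              in shore t (\<lambda>w. Gamma_mat s w l) z =
                   shore t (Psi0 s) z ** (mat 1 + E) ** T ** exp_sigma3 (- \<kappa> * g)))))"
  proof (rule exI[of _ "c * error_const \<delta> Y (pi / 2)"], rule conjI, use c C in simp, intro allI impI,
      rule exI[of _ "min lam_bound (exp (- (2 * error_const \<delta> Y (pi / 2))))"], rule conjI, simp add: lam_bound_def, intro allI ballI impI)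
    fix M :: real and s l x t
    assume M: "1 \<le> M" and l: "l \<in> closed_half_plane s" "0 < norm l \<and> norm l < min lam_bound (exp (- (2 * error_const \<delta> Y (pi / 2))))" and x: "x \<in> K"
    have l': "norm l < lam_bound" "l \<noteq> 0" "norm l < exp (- (2 * error_const \<delta> Y (pi / 2)))" using l(2) by auto
    note rx = r[OF x, of t]
    note S = shore_estimate[OF l(1) l'(1,2) conjunct1[OF rx] conjunct1[OF conjunct2[OF rx]] conjunct2[OF conjunct2[OF rx]] k(1)
        small_epsilon[OF l(1) l'(2,3) C], folded c_def]
    have b: "norm (E :: complex^2^2) \<le> c * error_const \<delta> Y (pi / 2) * (M^2 / norm (kappa s l))"
      if "norm E \<le> c * (error_const \<delta> Y (pi / 2) / norm (kappa s l))" for E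
      by (rule scale_bound[OF that M]) (use c C in auto)
    show "\<exists>E :: complex^2^2.
             norm E \<le> c * error_const \<delta> Y (pi / 2) * (M^2 / norm (kappa s l)) \<and>
             (let z = complex_of_real x;
                  \<kappa> = kappa s l;
                  g = shore t g_fun z;
                  T = (if x < 0
                       then mat2 1 0 (side_sign t * \<i> * exp (\<kappa> * (2 * g - 1))) 1
                       else mat2 1 (- side_sign t * \<i> * exp (- \<kappa> * (2 * g + 1))) 0 1)
              in shore t (\<lambda>w. Gamma_mat s w l) z =
                   shore t (Psi0 s) z ** (mat 1 + E) ** T ** exp_sigma3 (- \<kappa> * g))"
      by (rule ex_forward[OF S], erule conjE, rule conjI, erule b, assumption)
  qed
qed

end
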